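(* Let $\Bbbk$ be a field, let $H$ be a cocommutative Hopf algebra over $\Bbbk$, and let $M$ be a left $H$-module coalgebra with its augmentation filtration. If $M$ is amenable, then its associated graded $\operatorname{gr}M$ is an amenable $\operatorname{gr}H$-module coalgebra.
   Context: A left $H$-module coalgebra is a coalgebra $M$ endowed with a left $H$-module structure such that the action map $H\otimes M\to M$ is a (counital) coalgebra map. For subspaces $F\le H$, $E\le M$, $FE$ denotes the linear span of $\{fe\}$. $M$ is amenable (over $H$) if for every finite-dimensional subspace $F\le H$ and every $\epsilon>0$ there exists a finite-dimensional subcoalgebra $E\le M$ with $\dim\frac{E+FE}{E}<\epsilon\dim E$. Let $\varpi=\ker(\varepsilon\colon H\to\Bbbk)$ be the augmentation ideal and $H_n=\varpi^n$ for $n\ge 0$ ($H_0=H$). One has $H_iH_j\subseteq H_{i+j}$, $\Delta(H_n)\subseteq\sum_{i+j=n}H_i\otimes H_j$ and $S(H_n)\subseteq H_n$, so $\operatorname{gr}H=\bigoplus_{n\ge0}H_n/H_{n+1}$ is naturally a graded (cocommutative) Hopf algebra. The augmentation filtration of $M$ is $M_n=H_nM$; one has $\Delta(M_n)\subseteq\sum_{i+j=n}M_i\otimes M_j$, so $\operatorname{gr}M=\bigoplus_{n\ge0}M_n/M_{n+1}$ is naturally a (graded) $\operatorname{gr}H$-module coalgebra, with the operations induced from those of $H$ and $M$. *)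

theory Defs
  imports Complex_Main "HOL-Algebra.AbelCoset" "Jordan_Normal_Form.Missing_VectorSpace"
begin

section \<open>Quotients, free spaces and tensor products\<close>

text \<open>
  A vector space over the field \<open>K\<close> is a module record \<open>V\<close> with \<open>vectorspace K V\<close>; a subspace
  \<open>W\<close> of \<open>V\<close>, regarded as a space of its own, is \<open>V\<lparr>carrier := W\<rparr>\<close>. The fields \<open>mult\<close> and \<open>one\<close>
  that module records inherit from rings have no meaning for mere vector spaces and coalgebras.
\<close>

definition quotient_space :: "('k, 'v, 'z) module_scheme \<Rightarrow> 'v set \<Rightarrow> ('k, 'v set) module" where
  "quotient_space V W =
    \<lparr>carrier = a_rcosets\<^bsub>V\<^esub> W,
     mult = (\<lambda>_ _. W), one = W, zero = W,
     add = (\<lambda>X Y. X <+>\<^bsub>V\<^esub> Y),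
     smult = (\<lambda>c X. \<Union>x\<in>X. W +>\<^bsub>V\<^esub> (c \<odot>\<^bsub>V\<^esub> x))\<rparr>"

definition ground_space :: "('k, 'y) ring_scheme \<Rightarrow> ('k, 'k) module" where
  "ground_space K =
    \<lparr>carrier = carrier K,
     mult = mult K, one = one K, zero = zero K,
     add = add K,
     smult = mult K\<rparr>"

definition free_space :: "('k, 'y) ring_scheme \<Rightarrow> 'p set \<Rightarrow> ('k, 'p \<Rightarrow> 'k) module" where
  "free_space K S =
    \<lparr>carrier = {f. (\<forall>p. f p \<in> carrier K) \<and> finite {p. f p \<noteq> \<zero>\<^bsub>K\<^esub>} \<and> {p. f p \<noteq> \<zero>\<^bsub>K\<^esub>} \<subseteq> S},
     mult = (\<lambda>_ _ _. \<zero>\<^bsub>K\<^esub>), one = (\<lambda>_. \<zero>\<^bsub>K\<^esub>), zero = (\<lambda>_. \<zero>\<^bsub>K\<^esub>),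
     add = (\<lambda>f g p. f p \<oplus>\<^bsub>K\<^esub> g p),
     smult = (\<lambda>c f p. c \<otimes>\<^bsub>K\<^esub> f p)\<rparr>"

definition free_gen :: "('k, 'y) ring_scheme \<Rightarrow> 'p \<Rightarrow> 'p \<Rightarrow> 'k" where
  "free_gen K p = (\<lambda>q. if q = p then \<one>\<^bsub>K\<^esub> else \<zero>\<^bsub>K\<^esub>)"

type_synonym ('k, 'v, 'w) tens = "('v \<times> 'w \<Rightarrow> 'k) set"

definition tensor_relators ::
  "('k, 'y) ring_scheme \<Rightarrow> ('k, 'v, 'z1) module_scheme \<Rightarrow> ('k, 'w, 'z2) module_scheme \<Rightarrow> ('v \<times> 'w \<Rightarrow> 'k) set"
where
  "tensor_relators K V W =
    (let F = free_space K (carrier V \<times> carrier W); g = (\<lambda>v w. free_gen K (v, w)) in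
      {g (v \<oplus>\<^bsub>V\<^esub> v') w \<ominus>\<^bsub>F\<^esub> (g v w \<oplus>\<^bsub>F\<^esub> g v' w) | v v' w.
         v \<in> carrier V \<and> v' \<in> carrier V \<and> w \<in> carrier W} \<union>
      {g v (w \<oplus>\<^bsub>W\<^esub> w') \<ominus>\<^bsub>F\<^esub> (g v w \<oplus>\<^bsub>F\<^esub> g v w') | v w w'.
         v \<in> carrier V \<and> w \<in> carrier W \<and> w' \<in> carrier W} \<union>
      {g (c \<odot>\<^bsub>V\<^esub> v) w \<ominus>\<^bsub>F\<^esub> (c \<odot>\<^bsub>F\<^esub> g v w) | c v w.
         c \<in> carrier K \<and> v \<in> carrier V \<and> w \<in> carrier W} \<union>
      {g v (c \<odot>\<^bsub>W\<^esub> w) \<ominus>\<^bsub>F\<^esub> (c \<odot>\<^bsub>F\<^esub> g v w) | c v w.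
         c \<in> carrier K \<and> v \<in> carrier V \<and> w \<in> carrier W})"

definition tensor_null ::
  "('k, 'y) ring_scheme \<Rightarrow> ('k, 'v, 'z1) module_scheme \<Rightarrow> ('k, 'w, 'z2) module_scheme \<Rightarrow> ('v \<times> 'w \<Rightarrow> 'k) set"
where
  "tensor_null K V W =
    module.span K (free_space K (carrier V \<times> carrier W)) (tensor_relators K V W)"

definition tensor ::
  "('k, 'y) ring_scheme \<Rightarrow> ('k, 'v, 'z1) module_scheme \<Rightarrow> ('k, 'w, 'z2) module_scheme \<Rightarrow>
    ('k, ('k, 'v, 'w) tens) module"
where
  "tensor K V W = quotient_space (free_space K (carrier V \<times> carrier W)) (tensor_null K V W)"

definition pure_tensor ::
  "('k, 'y) ring_scheme \<Rightarrow> ('k, 'v, 'z1) module_scheme \<Rightarrow> ('k, 'w, 'z2) module_scheme \<Rightarrow>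
    'v \<Rightarrow> 'w \<Rightarrow> ('k, 'v, 'w) tens"
where
  "pure_tensor K V W v w =
    tensor_null K V W +>\<^bsub>free_space K (carrier V \<times> carrier W)\<^esub> free_gen K (v, w)"

text \<open>
  For a bilinear map \<open>\<beta>\<close> from \<open>V\<close> and \<open>W\<close> to \<open>U\<close>, the linear map \<open>V \<otimes> W \<rightarrow> U\<close> sending
  \<open>v \<otimes> w\<close> to \<open>\<beta> v w\<close>. Bilinearity makes the result independent of the chosen representative of
  the coset \<open>t\<close>.
\<close>

definition tensor_lift ::
  "('k, 'y) ring_scheme \<Rightarrow> ('k, 'u, 'z) module_scheme \<Rightarrow> ('v \<Rightarrow> 'w \<Rightarrow> 'u) \<Rightarrow> ('k, 'v, 'w) tens \<Rightarrow> 'u"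
where
  "tensor_lift K U \<beta> t =
    (let f = (SOME f. f \<in> t) in
      \<Oplus>\<^bsub>U\<^esub> p \<in> {p. f p \<noteq> \<zero>\<^bsub>K\<^esub>}. f p \<odot>\<^bsub>U\<^esub> \<beta> (fst p) (snd p))"

text \<open>\<open>tensor_map K V W f g\<close> is \<open>f \<otimes> g\<close>, where \<open>V\<close> and \<open>W\<close> are the codomains of \<open>f\<close> and \<open>g\<close>.\<close>

definition tensor_map ::
  "('k, 'y) ring_scheme \<Rightarrow> ('k, 'v, 'z1) module_scheme \<Rightarrow> ('k, 'w, 'z2) module_scheme \<Rightarrow>
    ('a \<Rightarrow> 'v) \<Rightarrow> ('b \<Rightarrow> 'w) \<Rightarrow> ('k, 'a, 'b) tens \<Rightarrow> ('k, 'v, 'w) tens"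
where
  "tensor_map K V W f g = tensor_lift K (tensor K V W) (\<lambda>a b. pure_tensor K V W (f a) (g b))"

definition tensor_swap ::
  "('k, 'y) ring_scheme \<Rightarrow> ('k, 'v, 'z1) module_scheme \<Rightarrow> ('k, 'w, 'z2) module_scheme \<Rightarrow>
    ('k, 'v, 'w) tens \<Rightarrow> ('k, 'w, 'v) tens"
where
  "tensor_swap K V W = tensor_lift K (tensor K W V) (\<lambda>v w. pure_tensor K W V w v)"

text \<open>The isomorphism \<open>(U \<otimes> V) \<otimes> W \<rightarrow> U \<otimes> (V \<otimes> W)\<close>.\<close>

definition tensor_assoc ::
  "('k, 'y) ring_scheme \<Rightarrow> ('k, 'u, 'z1) module_scheme \<Rightarrow> ('k, 'v, 'z2) module_scheme \<Rightarrow>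
    ('k, 'w, 'z3) module_scheme \<Rightarrow>
    ('k, ('k, 'u, 'v) tens, 'w) tens \<Rightarrow> ('k, 'u, ('k, 'v, 'w) tens) tens"
where
  "tensor_assoc K U V W =
    (let VW = tensor K V W; T = tensor K U VW in
      tensor_lift K T (\<lambda>s w.
        tensor_lift K T (\<lambda>u v. pure_tensor K U VW u (pure_tensor K V W v w)) s))"

text \<open>The isomorphism \<open>(A \<otimes> B) \<otimes> (C \<otimes> D) \<rightarrow> (A \<otimes> C) \<otimes> (B \<otimes> D)\<close>.\<close>

definition tensor_middle_swap ::
  "('k, 'y) ring_scheme \<Rightarrow> ('k, 'a, 'z1) module_scheme \<Rightarrow> ('k, 'b, 'z2) module_scheme \<Rightarrow>
    ('k, 'c, 'z3) module_scheme \<Rightarrow> ('k, 'd, 'z4) module_scheme \<Rightarrow>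
    ('k, ('k, 'a, 'b) tens, ('k, 'c, 'd) tens) tens \<Rightarrow>
    ('k, ('k, 'a, 'c) tens, ('k, 'b, 'd) tens) tens"
where
  "tensor_middle_swap K A B C D =
    (let AC = tensor K A C; BD = tensor K B D; T = tensor K AC BD in
      tensor_lift K T (\<lambda>s t.
        tensor_lift K T (\<lambda>a b.
          tensor_lift K T (\<lambda>c d.
            pure_tensor K AC BD (pure_tensor K A C a c) (pure_tensor K B D b d)) t) s))"


section \<open>Hopf algebras and module coalgebras\<close>

record ('k, 'v) coalg = "('k, 'v) module" +
  comult :: "'v \<Rightarrow> ('v \<times> 'v \<Rightarrow> 'k) set"
  counit :: "'v \<Rightarrow> 'k"

record ('k, 'v) hopf = "('k, 'v) coalg" +
  antipode :: "'v \<Rightarrow> 'v"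

record ('k, 'h, 'v) modcoalg = "('k, 'v) coalg" +
  act :: "'h \<Rightarrow> 'v \<Rightarrow> 'v"

locale coalgebra = vectorspace K C
  for K :: "('k, 'y) ring_scheme" and C :: "('k, 'v, 'z) coalg_scheme" +
  assumes comult_linear: "comult C \<in> module_hom K C (tensor K C C)"
    and counit_linear: "counit C \<in> module_hom K C (ground_space K)"
    and coassoc: "x \<in> carrier C \<Longrightarrow>
      tensor_assoc K C C C (tensor_map K (tensor K C C) C (comult C) (\<lambda>b. b) (comult C x)) =
      tensor_map K C (tensor K C C) (\<lambda>a. a) (comult C) (comult C x)"
    and counit_left: "x \<in> carrier C \<Longrightarrow>
      tensor_lift K C (\<lambda>a b. counit C a \<odot>\<^bsub>C\<^esub> b) (comult C x) = x"
    and counit_right: "x \<in> carrier C \<Longrightarrow>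
      tensor_lift K C (\<lambda>a b. counit C b \<odot>\<^bsub>C\<^esub> a) (comult C x) = x"

definition coalgebra_hom ::
  "('k, 'y) ring_scheme \<Rightarrow> ('k, 'v, 'z1) coalg_scheme \<Rightarrow> ('k, 'w, 'z2) coalg_scheme \<Rightarrow> ('v \<Rightarrow> 'w) \<Rightarrow> bool"
where
  "coalgebra_hom K C D f \<longleftrightarrow>
    f \<in> module_hom K C D \<and>
    (\<forall>x\<in>carrier C. comult D (f x) = tensor_map K D D f f (comult C x)) \<and>
    (\<forall>x\<in>carrier C. counit D (f x) = counit C x)"

definition tensor_coalgebra ::
  "('k, 'y) ring_scheme \<Rightarrow> ('k, 'v, 'z1) coalg_scheme \<Rightarrow> ('k, 'w, 'z2) coalg_scheme \<Rightarrow>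
    ('k, ('k, 'v, 'w) tens) coalg"
where
  "tensor_coalgebra K C D =
    \<lparr>carrier = carrier (tensor K C D),
     mult = mult (tensor K C D), one = one (tensor K C D), zero = zero (tensor K C D),
     add = add (tensor K C D),
     smult = smult (tensor K C D),
     comult = (\<lambda>t. tensor_middle_swap K C C D D
       (tensor_map K (tensor K C C) (tensor K D D) (comult C) (comult D) t)),
     counit = tensor_lift K (ground_space K) (\<lambda>c d. counit C c \<otimes>\<^bsub>K\<^esub> counit D d)\<rparr>"

text \<open>The library locale \<open>algebra\<close> is restricted to commutative algebras.\<close>

locale assoc_algebra = vectorspace K A + ring A
  for K :: "('k, 'y) ring_scheme" and A :: "('k, 'v, 'z) module_scheme" +
  assumes smult_mult_left: "\<lbrakk>c \<in> carrier K; x \<in> carrier A; y \<in> carrier A\<rbrakk> \<Longrightarrow>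
      (c \<odot>\<^bsub>A\<^esub> x) \<otimes>\<^bsub>A\<^esub> y = c \<odot>\<^bsub>A\<^esub> (x \<otimes>\<^bsub>A\<^esub> y)"
    and smult_mult_right: "\<lbrakk>c \<in> carrier K; x \<in> carrier A; y \<in> carrier A\<rbrakk> \<Longrightarrow>
      x \<otimes>\<^bsub>A\<^esub> (c \<odot>\<^bsub>A\<^esub> y) = c \<odot>\<^bsub>A\<^esub> (x \<otimes>\<^bsub>A\<^esub> y)"

text \<open>A bialgebra is an algebra and coalgebra whose multiplication and unit are coalgebra maps.\<close>

locale hopf_algebra = assoc_algebra K H + coalgebra K H
  for K :: "('k, 'y) ring_scheme" and H :: "('k, 'h, 'z) hopf_scheme" +
  assumes mult_coalgebra_hom: "coalgebra_hom K (tensor_coalgebra K H H) H (tensor_lift K H (mult H))"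
    and comult_one: "comult H \<one>\<^bsub>H\<^esub> = pure_tensor K H H \<one>\<^bsub>H\<^esub> \<one>\<^bsub>H\<^esub>"
    and counit_one: "counit H \<one>\<^bsub>H\<^esub> = \<one>\<^bsub>K\<^esub>"
    and antipode_linear: "antipode H \<in> module_hom K H H"
    and antipode_left: "x \<in> carrier H \<Longrightarrow>
      tensor_lift K H (\<lambda>a b. antipode H a \<otimes>\<^bsub>H\<^esub> b) (comult H x) = counit H x \<odot>\<^bsub>H\<^esub> \<one>\<^bsub>H\<^esub>"
    and antipode_right: "x \<in> carrier H \<Longrightarrow>
      tensor_lift K H (\<lambda>a b. a \<otimes>\<^bsub>H\<^esub> antipode H b) (comult H x) = counit H x \<odot>\<^bsub>H\<^esub> \<one>\<^bsub>H\<^esub>"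

definition cocommutative :: "('k, 'y) ring_scheme \<Rightarrow> ('k, 'v, 'z) coalg_scheme \<Rightarrow> bool" where
  "cocommutative K C \<longleftrightarrow> (\<forall>x\<in>carrier C. tensor_swap K C C (comult C x) = comult C x)"

locale module_coalgebra = H: hopf_algebra K H + M: coalgebra K M
  for K :: "('k, 'y) ring_scheme" and H :: "('k, 'h, 'z1) hopf_scheme"
    and M :: "('k, 'h, 'm, 'z2) modcoalg_scheme" +
  assumes act_closed: "\<lbrakk>h \<in> carrier H; m \<in> carrier M\<rbrakk> \<Longrightarrow> act M h m \<in> carrier M"
    and act_add_left: "\<lbrakk>h \<in> carrier H; h' \<in> carrier H; m \<in> carrier M\<rbrakk> \<Longrightarrow>
      act M (h \<oplus>\<^bsub>H\<^esub> h') m = act M h m \<oplus>\<^bsub>M\<^esub> act M h' m"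
    and act_add_right: "\<lbrakk>h \<in> carrier H; m \<in> carrier M; m' \<in> carrier M\<rbrakk> \<Longrightarrow>
      act M h (m \<oplus>\<^bsub>M\<^esub> m') = act M h m \<oplus>\<^bsub>M\<^esub> act M h m'"
    and act_smult_left: "\<lbrakk>c \<in> carrier K; h \<in> carrier H; m \<in> carrier M\<rbrakk> \<Longrightarrow>
      act M (c \<odot>\<^bsub>H\<^esub> h) m = c \<odot>\<^bsub>M\<^esub> act M h m"
    and act_smult_right: "\<lbrakk>c \<in> carrier K; h \<in> carrier H; m \<in> carrier M\<rbrakk> \<Longrightarrow>
      act M h (c \<odot>\<^bsub>M\<^esub> m) = c \<odot>\<^bsub>M\<^esub> act M h m"
    and act_mult: "\<lbrakk>h \<in> carrier H; h' \<in> carrier H; m \<in> carrier M\<rbrakk> \<Longrightarrow>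
      act M (h \<otimes>\<^bsub>H\<^esub> h') m = act M h (act M h' m)"
    and act_one: "m \<in> carrier M \<Longrightarrow> act M \<one>\<^bsub>H\<^esub> m = m"
    and act_coalgebra_hom: "coalgebra_hom K (tensor_coalgebra K H M) M (tensor_lift K M (act M))"


section \<open>Amenability\<close>

definition subcoalgebra :: "('k, 'y) ring_scheme \<Rightarrow> 'v set \<Rightarrow> ('k, 'v, 'z) coalg_scheme \<Rightarrow> bool" where
  "subcoalgebra K E C \<longleftrightarrow>
    VectorSpace.subspace K E C \<and>
    comult C ` E \<subseteq> module.span K (tensor K C C) {pure_tensor K C C a b | a b. a \<in> E \<and> b \<in> E}"

definition span_act ::
  "('k, 'y) ring_scheme \<Rightarrow> ('k, 'h, 'm, 'z) modcoalg_scheme \<Rightarrow> 'h set \<Rightarrow> 'm set \<Rightarrow> 'm set"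
where
  "span_act K M F E = module.span K M {act M f e | f e. f \<in> F \<and> e \<in> E}"

definition amenable ::
  "('k, 'y) ring_scheme \<Rightarrow> ('k, 'h, 'z1) hopf_scheme \<Rightarrow> ('k, 'h, 'm, 'z2) modcoalg_scheme \<Rightarrow> bool"
where
  "amenable K H M \<longleftrightarrow>
    (\<forall>F (\<epsilon>::real). VectorSpace.subspace K F H \<and> vectorspace.fin_dim K (H\<lparr>carrier := F\<rparr>) \<and> \<epsilon> > 0 \<longrightarrow>
      (\<exists>E. subcoalgebra K E M \<and> vectorspace.fin_dim K (M\<lparr>carrier := E\<rparr>) \<and>
        real (vectorspace.dim K (quotient_space (M\<lparr>carrier := E <+>\<^bsub>M\<^esub> span_act K M F E\<rparr>) E))
          < \<epsilon> * real (vectorspace.dim K (M\<lparr>carrier := E\<rparr>))))"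


section \<open>Augmentation filtrations\<close>

definition aug_ideal :: "('k, 'y) ring_scheme \<Rightarrow> ('k, 'h, 'z) hopf_scheme \<Rightarrow> 'h set" where
  "aug_ideal K H = {x \<in> carrier H. counit H x = \<zero>\<^bsub>K\<^esub>}"

primrec aug_power :: "('k, 'y) ring_scheme \<Rightarrow> ('k, 'h, 'z) hopf_scheme \<Rightarrow> nat \<Rightarrow> 'h set" where
  "aug_power K H 0 = carrier H"
| "aug_power K H (Suc n) =
    module.span K H {x \<otimes>\<^bsub>H\<^esub> y | x y. x \<in> aug_ideal K H \<and> y \<in> aug_power K H n}"

definition aug_filtration ::
  "('k, 'y) ring_scheme \<Rightarrow> ('k, 'h, 'z1) hopf_scheme \<Rightarrow> ('k, 'h, 'm, 'z2) modcoalg_scheme \<Rightarrow> nat \<Rightarrow> 'm set"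
where
  "aug_filtration K H M n = span_act K M (aug_power K H n) (carrier M)"


section \<open>Associated graded spaces\<close>

text \<open>
  Let \<open>V\<close> be a space with a descending filtration \<open>P\<close>, where \<open>P 0 = V\<close>. An element of
  \<open>gr V = (\<Oplus>n. P n / P (n + 1))\<close> is a finitely supported family \<open>\<xi>\<close> whose \<open>n\<close>-th
  entry is a coset of \<open>P (n + 1)\<close> in \<open>P n\<close>.
\<close>

definition gr_component ::
  "('k, 'v, 'z) module_scheme \<Rightarrow> (nat \<Rightarrow> 'v set) \<Rightarrow> nat \<Rightarrow> ('k, 'v set) module"
where
  "gr_component V P n = quotient_space (V\<lparr>carrier := P n\<rparr>) (P (Suc n))"

definition gr_support :: "(nat \<Rightarrow> 'v set) \<Rightarrow> (nat \<Rightarrow> 'v set) \<Rightarrow> nat set" where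
  "gr_support P \<xi> = {n. \<xi> n \<noteq> P (Suc n)}"

definition gr_space ::
  "('k, 'v, 'z) module_scheme \<Rightarrow> (nat \<Rightarrow> 'v set) \<Rightarrow> ('k, nat \<Rightarrow> 'v set) module"
where
  "gr_space V P =
    \<lparr>carrier = {\<xi>. (\<forall>n. \<xi> n \<in> carrier (gr_component V P n)) \<and> finite (gr_support P \<xi>)},
     mult = (\<lambda>_ _ n. P (Suc n)), one = (\<lambda>n. P (Suc n)), zero = (\<lambda>n. P (Suc n)),
     add = (\<lambda>\<xi> \<eta> n. \<xi> n \<oplus>\<^bsub>gr_component V P n\<^esub> \<eta> n),
     smult = (\<lambda>c \<xi> n. c \<odot>\<^bsub>gr_component V P n\<^esub> \<xi> n)\<rparr>"

text \<open>The class of \<open>x \<in> P n\<close> in degree \<open>n\<close>.\<close>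

definition gr_class ::
  "('k, 'v, 'z) module_scheme \<Rightarrow> (nat \<Rightarrow> 'v set) \<Rightarrow> nat \<Rightarrow> 'v \<Rightarrow> nat \<Rightarrow> 'v set"
where
  "gr_class V P n x = (\<lambda>i. if i = n then P (Suc n) +>\<^bsub>V\<^esub> x else P (Suc i))"

text \<open>
  Induced bilinear operations: a map \<open>\<beta>\<close> sending \<open>P i\<close> and \<open>Q j\<close> into \<open>Q (i + j)\<close> induces
  maps from \<open>P i / P (i + 1)\<close> and \<open>Q j / Q (j + 1)\<close> to \<open>Q (i + j) / Q (i + j + 1)\<close>. Induced
  linear operations: similarly for a map sending each \<open>P n\<close> into itself.
\<close>

definition gr_bilinear ::
  "('k, 'v, 'z) module_scheme \<Rightarrow> (nat \<Rightarrow> 'v set) \<Rightarrow> ('h \<Rightarrow> 'v \<Rightarrow> 'v) \<Rightarrow>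
    (nat \<Rightarrow> 'h set) \<Rightarrow> (nat \<Rightarrow> 'v set) \<Rightarrow> nat \<Rightarrow> 'v set"
where
  "gr_bilinear V Q \<beta> \<xi> \<eta> n =
    (\<Oplus>\<^bsub>gr_component V Q n\<^esub> i \<in> {..n}. \<Union>x\<in>\<xi> i. \<Union>y\<in>\<eta> (n - i). Q (Suc n) +>\<^bsub>V\<^esub> \<beta> x y)"

definition gr_linear ::
  "('k, 'v, 'z) module_scheme \<Rightarrow> (nat \<Rightarrow> 'v set) \<Rightarrow> ('v \<Rightarrow> 'v) \<Rightarrow> (nat \<Rightarrow> 'v set) \<Rightarrow> nat \<Rightarrow> 'v set"
where
  "gr_linear V P f \<xi> n = (\<Union>x\<in>\<xi> n. P (Suc n) +>\<^bsub>V\<^esub> f x)"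

text \<open>
  The induced comultiplication. For \<open>x \<in> P n\<close>, write \<open>comult x = (\<Sum>i\<le>n. t i)\<close> with
  \<open>t i \<in> P i \<otimes> P (n - i)\<close>; the class of \<open>x\<close> is sent to the sum of the images of the \<open>t i\<close> under
  \<open>P i \<otimes> P (n - i) \<rightarrow> P i / P (i + 1) \<otimes> P (n - i) / P (n - i + 1)\<close>. If
  \<open>comult (P n) \<subseteq> (\<Sum>i\<le>n. P i \<otimes> P (n - i))\<close> for all \<open>n\<close>, then such \<open>t\<close> exist and the result
  depends neither on \<open>t\<close> nor on the representative \<open>x\<close> modulo \<open>P (n + 1)\<close>.
\<close>

definition gr_decomposition ::
  "('k, 'y) ring_scheme \<Rightarrow> ('k, 'v, 'z) coalg_scheme \<Rightarrow> (nat \<Rightarrow> 'v set) \<Rightarrow> nat \<Rightarrow> 'v \<Rightarrow>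
    (nat \<Rightarrow> ('k, 'v, 'v) tens) \<Rightarrow> bool"
where
  "gr_decomposition K C P n x t \<longleftrightarrow>
    (\<forall>i\<le>n. t i \<in> carrier (tensor K (C\<lparr>carrier := P i\<rparr>) (C\<lparr>carrier := P (n - i)\<rparr>))) \<and>
    comult C x = (\<Oplus>\<^bsub>tensor K C C\<^esub> i \<in> {..n}. tensor_map K C C (\<lambda>a. a) (\<lambda>b. b) (t i))"

definition gr_comult ::
  "('k, 'y) ring_scheme \<Rightarrow> ('k, 'v, 'z) coalg_scheme \<Rightarrow> (nat \<Rightarrow> 'v set) \<Rightarrow>
    (nat \<Rightarrow> 'v set) \<Rightarrow> ('k, nat \<Rightarrow> 'v set, nat \<Rightarrow> 'v set) tens"
where
  "gr_comult K C P \<xi> =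
    (let G = gr_space C P in
      \<Oplus>\<^bsub>tensor K G G\<^esub> n \<in> gr_support P \<xi>.
        let x = (SOME x. x \<in> \<xi> n); t = (SOME t. gr_decomposition K C P n x t) in
          \<Oplus>\<^bsub>tensor K G G\<^esub> i \<in> {..n}. tensor_map K G G (gr_class C P i) (gr_class C P (n - i)) (t i))"

text \<open>The counit vanishes on \<open>P 1\<close>, and is induced from degree \<open>0\<close>.\<close>

definition gr_counit :: "('k, 'v, 'z) coalg_scheme \<Rightarrow> (nat \<Rightarrow> 'v set) \<Rightarrow> 'k" where
  "gr_counit C \<xi> = counit C (SOME x. x \<in> \<xi> 0)"

definition gr_hopf ::
  "('k, 'y) ring_scheme \<Rightarrow> ('k, 'h, 'z) hopf_scheme \<Rightarrow> ('k, nat \<Rightarrow> 'h set) hopf"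
where
  "gr_hopf K H =
    (let P = aug_power K H; G = gr_space H P in
      \<lparr>carrier = carrier G,
       mult = gr_bilinear H P (mult H), one = gr_class H P 0 \<one>\<^bsub>H\<^esub>, zero = zero G,
       add = add G,
       smult = smult G,
       comult = gr_comult K H P,
       counit = gr_counit H,
       antipode = gr_linear H P (antipode H)\<rparr>)"

definition gr_modcoalg ::
  "('k, 'y) ring_scheme \<Rightarrow> ('k, 'h, 'z1) hopf_scheme \<Rightarrow> ('k, 'h, 'm, 'z2) modcoalg_scheme \<Rightarrow>
    ('k, nat \<Rightarrow> 'h set, nat \<Rightarrow> 'm set) modcoalg"
where
  "gr_modcoalg K H M =
    (let P = aug_filtration K H M; G = gr_space M P in
      \<lparr>carrier = carrier G,
       mult = mult G, one = one G, zero = zero G,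
       add = add G,
       smult = smult G,
       comult = gr_comult K M P,
       counit = gr_counit M,
       act = gr_bilinear M P (act M)\<rparr>)"

end

theory Submission
  imports Defs
begin

text \<open>
  Identities between elements of tensor powers are tested against functionals, so that coalgebra
  axioms become identities for the convolution of functionals; on the associated graded spaces the
  homogeneous functionals suffice.

  For amenability, let \<open>E\<close> be a subcoalgebra of \<open>M\<close> with \<open>E' = E + TE\<close> little larger than \<open>E\<close>, where
  \<open>T\<close> is spanned by the coefficients of a comatrix. Let \<open>C\<close> range over the subspaces above
  \<open>\<Omega> = \<Inter> M\<^sub>n\<close> that are stable under both coefficient actions of \<open>M\<^sup>*\<close>, and let \<open>E\<^sub>C\<close> be the elements of
  \<open>E\<close> all of whose coefficients lie in \<open>C\<close>. If \<open>C\<^sub>j\<close> maximises \<open>m dim E\<^sub>C - j dim C/\<Omega>\<close> and \<open>C'\<^sub>j\<close> is the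
  largest maximiser for \<open>E'\<close>, then \<open>T C\<^sub>j \<subseteq> C'\<^sub>j\<close>: one applies the comatrix to tuples, and the antipode
  and cocommutativity make the subspaces that arise stable. Telescoping the maximal values over \<open>j\<close>
  shows that \<open>dim C'\<^sub>j/\<Omega>\<close> is close to \<open>dim C\<^sub>j/\<Omega>\<close> for some \<open>j\<close>, and \<open>gr C\<^sub>j\<close> is the required
  subcoalgebra of \<open>gr M\<close>.
\<close>

section \<open>Linear maps, subspaces and quotients\<close>

text \<open>If \<Omega> were zero, the associated graded space of \<open>E\<close> itself would do:
  it would have the dimension of \<open>E\<close>, and symbols of elements of \<open>F\<close> would
  send it into that of \<open>E + FE\<close>. In general its dimension is only that of E/(E \<inter>
  \<Omega>), and almost all of \<open>E\<close> may lie in \<Omega>. What helps is that the counit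
  vanishes on \<Omega>: an element with all coefficients in \<Omega> is zero, so the coefficients of
  \<open>E\<close> must leave \<Omega>. A subspace \<open>C\<close> is rewarded for the part of
  \<open>E\<close> whose coefficients it contains and pays \<open>j\<close> for each dimension over
  \<Omega>. At price 1 all of \<open>E\<close> can be afforded, beyond \<open>m dim E\<close>
  nothing can, and the prices in between are averaged.

  Stability of \<open>C\<close> is required only for functionals killing some
  \<open>M\<^sub>n\<close>: others need not preserve \<Omega>, and these suffice to induce the
  homogeneous functionals on \<open>gr M\<close>. The definition of \<open>E\<^sub>C\<close> tests
  all functionals, since elements of \<Omega> would otherwise pass. Tuples enter because a single
  entry of a comatrix does not in general intertwine the coefficient actions; the whole matrix does,
  up to changing the functional.\<close>

lemma homI:
  assumes "\<And>x. x \<in> carrier V \<Longrightarrow> f x \<in> carrier W"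
    and "\<And>x y. \<lbrakk>x \<in> carrier V; y \<in> carrier V\<rbrakk> \<Longrightarrow> f (x \<oplus>\<^bsub>V\<^esub> y) = f x \<oplus>\<^bsub>W\<^esub> f y"
    and "\<And>c x. \<lbrakk>c \<in> carrier K; x \<in> carrier V\<rbrakk> \<Longrightarrow> f (c \<odot>\<^bsub>V\<^esub> x) = c \<odot>\<^bsub>W\<^esub> f x"
  shows "f \<in> module_hom K V W"
  using assms unfolding module_hom_def by auto

lemma hom_closed: "\<lbrakk>f \<in> module_hom K V W; x \<in> carrier V\<rbrakk> \<Longrightarrow> f x \<in> carrier W"
  unfolding module_hom_def by auto

lemmas hom_add = module_hom_add
lemmas hom_smult = module_hom_smult

lemma hom_cong:
  assumes "f \<in> module_hom K V W" "vectorspace K V" "\<And>x. x \<in> carrier V \<Longrightarrow> f x = g x"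
  shows "g \<in> module_hom K V W"
proof -
  interpret V: vectorspace K V by fact
  show ?thesis
    using assms(1,3) by (intro homI) (auto simp: hom_closed hom_add hom_smult simp flip: assms(3))
qed

lemma hom_comp: "\<lbrakk>g \<in> module_hom K V W; f \<in> module_hom K W U\<rbrakk> \<Longrightarrow> (\<lambda>x. f (g x)) \<in> module_hom K V U"
  by (intro homI) (simp_all add: hom_closed hom_add hom_smult)

lemma hom_id: "(\<lambda>x. x) \<in> module_hom K V V"
  unfolding module_hom_def by auto

lemma hom_0:
  assumes "f \<in> module_hom K V W" "vectorspace K V" "vectorspace K W"
  shows "f \<zero>\<^bsub>V\<^esub> = \<zero>\<^bsub>W\<^esub>"
proof -
  interpret mod_hom K V W f
    using assms by (simp add: mod_hom_def mod_hom_axioms_def vectorspace_def)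
  show ?thesis by simp
qed

lemma hom_minus:
  assumes "f \<in> module_hom K V W" "vectorspace K V" "vectorspace K W" "x \<in> carrier V" "y \<in> carrier V"
  shows "f (x \<ominus>\<^bsub>V\<^esub> y) = f x \<ominus>\<^bsub>W\<^esub> f y"
proof -
  interpret mod_hom K V W f
    using assms by (simp add: mod_hom_def mod_hom_axioms_def vectorspace_def)
  show ?thesis using assms by simp
qed

lemma hom_finsum:
  assumes "f \<in> module_hom K V W" "vectorspace K V" "vectorspace K W" "\<And>i. i \<in> A \<Longrightarrow> g i \<in> carrier V"
  shows "f (\<Oplus>\<^bsub>V\<^esub>i\<in>A. g i) = (\<Oplus>\<^bsub>W\<^esub>i\<in>A. f (g i))"
proof -
  interpret V: vectorspace K V by fact
  interpret W: vectorspace K W by fact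
  show ?thesis
    using assms(4)
  proof (induct A rule: infinite_finite_induct)
    case (insert a A)
    then have "f (\<Oplus>\<^bsub>V\<^esub>i\<in>insert a A. g i) = f (g a \<oplus>\<^bsub>V\<^esub> (\<Oplus>\<^bsub>V\<^esub>i\<in>A. g i))"
      by (subst V.finsum_insert) auto
    also have "\<dots> = f (g a) \<oplus>\<^bsub>W\<^esub> (\<Oplus>\<^bsub>W\<^esub>i\<in>A. f (g i))"
      using insert by (subst hom_add[OF assms(1)]) auto
    also have "\<dots> = (\<Oplus>\<^bsub>W\<^esub>i\<in>insert a A. f (g i))"
      using insert by (subst W.finsum_insert) (auto intro: hom_closed[OF assms(1)])
    finally show ?case .
  qed (auto simp: hom_0[OF assms(1-3)])
qed

section \<open>Calculus of subspaces: closure, sums, spans\<close>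

context vectorspace
begin

lemma vs_self: "vectorspace K V" ..

lemma hom_zero_map: "(\<lambda>x. \<zero>\<^bsub>V\<^esub>) \<in> module_hom K U V"
  by (intro homI) auto

lemma hom_add_map:
  "\<lbrakk>f \<in> module_hom K U V; g \<in> module_hom K U V\<rbrakk> \<Longrightarrow> (\<lambda>x. f x \<oplus>\<^bsub>V\<^esub> g x) \<in> module_hom K U V"
  by (intro homI) (auto simp: hom_closed hom_add hom_smult smult_r_distr M.a_ac)

lemma hom_smult_map:
  "\<lbrakk>f \<in> module_hom K U V; c \<in> carrier K\<rbrakk> \<Longrightarrow> (\<lambda>x. c \<odot>\<^bsub>V\<^esub> f x) \<in> module_hom K U V"
  by (intro homI) (auto simp: hom_closed hom_add hom_smult smult_r_distr R.m_comm simp flip: smult_assoc1)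

lemma hom_finsum_map:
  assumes "\<And>i. i \<in> A \<Longrightarrow> f i \<in> module_hom K U V"
  shows "(\<lambda>x. \<Oplus>\<^bsub>V\<^esub>i\<in>A. f i x) \<in> module_hom K U V"
proof (rule homI)
  note c = hom_closed[OF assms]
  show "(\<Oplus>\<^bsub>V\<^esub>i\<in>A. f i x) \<in> carrier V" if "x \<in> carrier U" for x
    using that c by (intro M.finsum_closed) auto
  show "(\<Oplus>\<^bsub>V\<^esub>i\<in>A. f i (x \<oplus>\<^bsub>U\<^esub> y)) = (\<Oplus>\<^bsub>V\<^esub>i\<in>A. f i x) \<oplus>\<^bsub>V\<^esub> (\<Oplus>\<^bsub>V\<^esub>i\<in>A. f i y)"
    if "x \<in> carrier U" "y \<in> carrier U" for x y
  proof -
    have "(\<Oplus>\<^bsub>V\<^esub>i\<in>A. f i (x \<oplus>\<^bsub>U\<^esub> y)) = (\<Oplus>\<^bsub>V\<^esub>i\<in>A. f i x \<oplus>\<^bsub>V\<^esub> f i y)"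
      using that c by (intro M.finsum_cong') (auto simp: hom_add[OF assms])
    then show ?thesis
      using that c by (subst (asm) M.finsum_addf) auto
  qed
  show "(\<Oplus>\<^bsub>V\<^esub>i\<in>A. f i (k \<odot>\<^bsub>U\<^esub> x)) = k \<odot>\<^bsub>V\<^esub> (\<Oplus>\<^bsub>V\<^esub>i\<in>A. f i x)"
    if "k \<in> carrier K" "x \<in> carrier U" for k x
  proof -
    have "(\<Oplus>\<^bsub>V\<^esub>i\<in>A. f i (k \<odot>\<^bsub>U\<^esub> x)) = (\<Oplus>\<^bsub>V\<^esub>i\<in>A. k \<odot>\<^bsub>V\<^esub> f i x)"
      using that c by (intro M.finsum_cong') (auto simp: hom_smult[OF assms])
    also have "\<dots> = k \<odot>\<^bsub>V\<^esub> (\<Oplus>\<^bsub>V\<^esub>i\<in>A. f i x)"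
      by (rule hom_finsum[symmetric, of "\<lambda>x. k \<odot>\<^bsub>V\<^esub> x"])
        (use that c hom_smult_map[OF hom_id] vs_self in auto)
    finally show ?thesis .
  qed
qed

lemma subspace_iff:
  "subspace K W V \<longleftrightarrow> W \<subseteq> carrier V \<and> \<zero>\<^bsub>V\<^esub> \<in> W \<and> (\<forall>x\<in>W. \<forall>y\<in>W. x \<oplus>\<^bsub>V\<^esub> y \<in> W) \<and>
    (\<forall>c\<in>carrier K. \<forall>x\<in>W. c \<odot>\<^bsub>V\<^esub> x \<in> W)"
proof -
  have "module K V" ..
  then show ?thesis
    unfolding subspace_def submodule_def using vs_self by auto
qed

lemma subspaceI:
  assumes "W \<subseteq> carrier V" "\<zero>\<^bsub>V\<^esub> \<in> W" "\<And>x y. \<lbrakk>x \<in> W; y \<in> W\<rbrakk> \<Longrightarrow> x \<oplus>\<^bsub>V\<^esub> y \<in> W"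
    "\<And>c x. \<lbrakk>c \<in> carrier K; x \<in> W\<rbrakk> \<Longrightarrow> c \<odot>\<^bsub>V\<^esub> x \<in> W"
  shows "subspace K W V"
  using assms by (simp add: subspace_iff)

lemma sub_carrier: "\<lbrakk>subspace K W V; x \<in> W\<rbrakk> \<Longrightarrow> x \<in> carrier V"
  and sub_0: "subspace K W V \<Longrightarrow> \<zero>\<^bsub>V\<^esub> \<in> W"
  and sub_add: "\<lbrakk>subspace K W V; x \<in> W; y \<in> W\<rbrakk> \<Longrightarrow> x \<oplus>\<^bsub>V\<^esub> y \<in> W"
  and sub_smult: "\<lbrakk>subspace K W V; c \<in> carrier K; x \<in> W\<rbrakk> \<Longrightarrow> c \<odot>\<^bsub>V\<^esub> x \<in> W"
  by (auto simp: subspace_iff)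

lemma sub_uminus: "\<lbrakk>subspace K W V; x \<in> W\<rbrakk> \<Longrightarrow> \<ominus>\<^bsub>V\<^esub> x \<in> W"
  using sub_smult[of W "\<ominus>\<^bsub>K\<^esub> \<one>\<^bsub>K\<^esub>" x] sub_carrier[of W x] by (simp add: smult_minus_1)

lemma sub_minus: "\<lbrakk>subspace K W V; x \<in> W; y \<in> W\<rbrakk> \<Longrightarrow> x \<ominus>\<^bsub>V\<^esub> y \<in> W"
  unfolding a_minus_def by (intro sub_add sub_uminus)

lemma sub_finsum:
  assumes "subspace K W V" "\<And>i. i \<in> A \<Longrightarrow> f i \<in> W"
  shows "(\<Oplus>\<^bsub>V\<^esub>i\<in>A. f i) \<in> W"
  using assms(2)
proof (induct A rule: infinite_finite_induct)
  case (insert a A)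
  then have "(\<Oplus>\<^bsub>V\<^esub>i\<in>insert a A. f i) = f a \<oplus>\<^bsub>V\<^esub> (\<Oplus>\<^bsub>V\<^esub>i\<in>A. f i)"
    by (intro M.finsum_insert) (auto intro: sub_carrier[OF assms(1)])
  then show ?case using insert by (auto intro: sub_add[OF assms(1)])
qed (auto intro: sub_0[OF assms(1)])

lemma sub_add_cancel:
  assumes W: "subspace K W V" and x: "x \<in> carrier V" and y: "y \<in> W"
  shows "x \<oplus>\<^bsub>V\<^esub> y \<in> W \<longleftrightarrow> x \<in> W" "y \<oplus>\<^bsub>V\<^esub> x \<in> W \<longleftrightarrow> x \<in> W"
proof -
  have yc: "y \<in> carrier V" by (rule sub_carrier[OF W y])
  have "x = (x \<oplus>\<^bsub>V\<^esub> y) \<ominus>\<^bsub>V\<^esub> y"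
    using x yc by (simp add: a_minus_def M.a_assoc M.r_neg)
  then show "x \<oplus>\<^bsub>V\<^esub> y \<in> W \<longleftrightarrow> x \<in> W"
    by (metis sub_add[OF W _ y] sub_minus[OF W _ y])
  then show "y \<oplus>\<^bsub>V\<^esub> x \<in> W \<longleftrightarrow> x \<in> W"
    using x yc by (simp add: M.a_comm)
qed

lemma minus_swap_in_sub:
  assumes W: "subspace K W V" "x \<in> carrier V" "y \<in> carrier V" "x \<ominus>\<^bsub>V\<^esub> y \<in> W"
  shows "y \<ominus>\<^bsub>V\<^esub> x \<in> W"
proof -
  have "y \<ominus>\<^bsub>V\<^esub> x = \<ominus>\<^bsub>V\<^esub> (x \<ominus>\<^bsub>V\<^esub> y)"
    using assms by (simp add: a_minus_def M.minus_add M.a_comm)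
  then show ?thesis using sub_uminus[OF assms(1,4)] by simp
qed

lemma minus_0: "x \<in> carrier V \<Longrightarrow> x \<ominus>\<^bsub>V\<^esub> \<zero>\<^bsub>V\<^esub> = x"
  using M.r_neg[of "\<zero>\<^bsub>V\<^esub>"] by (simp add: a_minus_def)

lemma minus_eq_0_iff:
  assumes "x \<in> carrier V" "y \<in> carrier V"
  shows "x \<ominus>\<^bsub>V\<^esub> y = \<zero>\<^bsub>V\<^esub> \<longleftrightarrow> x = y"
proof
  assume "x \<ominus>\<^bsub>V\<^esub> y = \<zero>\<^bsub>V\<^esub>"
  then have "(x \<ominus>\<^bsub>V\<^esub> y) \<oplus>\<^bsub>V\<^esub> y = y" using assms by simp
  then show "x = y" using assms by (simp add: a_minus_def M.a_assoc M.l_neg)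
qed (use assms in \<open>simp add: a_minus_def M.r_neg\<close>)

lemma minus_self: "x \<in> carrier V \<Longrightarrow> x \<ominus>\<^bsub>V\<^esub> x = \<zero>\<^bsub>V\<^esub>"
  by (simp add: a_minus_def M.r_neg)

lemma minus_add_cancel: "\<lbrakk>x \<in> carrier V; y \<in> carrier V\<rbrakk> \<Longrightarrow> (x \<ominus>\<^bsub>V\<^esub> y) \<oplus>\<^bsub>V\<^esub> y = x"
  by (simp add: a_minus_def M.a_assoc M.l_neg)

lemma subspace_zero: "subspace K {\<zero>\<^bsub>V\<^esub>} V"
  by (intro subspaceI) auto

lemma subspace_carrier: "subspace K (carrier V) V"
  by (intro subspaceI) auto

lemma subspace_Int: "\<lbrakk>subspace K W V; subspace K W' V\<rbrakk> \<Longrightarrow> subspace K (W \<inter> W') V"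
  by (auto simp: subspace_iff)

lemma subspace_INT: "(\<And>i. subspace K (W i) V) \<Longrightarrow> subspace K (\<Inter>i. W i) V"
  by (fastforce simp: subspace_iff)

lemma set_add_iff: "x \<in> A <+>\<^bsub>V\<^esub> B \<longleftrightarrow> (\<exists>a\<in>A. \<exists>b\<in>B. x = a \<oplus>\<^bsub>V\<^esub> b)"
  by (auto simp: set_add_def')

lemma subspace_set_add:
  assumes A: "subspace K A V" and B: "subspace K B V"
  shows "subspace K (A <+>\<^bsub>V\<^esub> B) V"
proof (rule subspaceI)
  note c = sub_carrier[OF A] sub_carrier[OF B]
  show "A <+>\<^bsub>V\<^esub> B \<subseteq> carrier V" using c by (auto simp: set_add_iff)
  show "\<zero>\<^bsub>V\<^esub> \<in> A <+>\<^bsub>V\<^esub> B"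
    unfolding set_add_iff using sub_0[OF A] sub_0[OF B]
    by (intro bexI[of _ "\<zero>\<^bsub>V\<^esub>"] bexI[of _ "\<zero>\<^bsub>V\<^esub>"]) auto
  fix x y assume "x \<in> A <+>\<^bsub>V\<^esub> B" "y \<in> A <+>\<^bsub>V\<^esub> B"
  then obtain a b a' b' where *: "a \<in> A" "b \<in> B" "a' \<in> A" "b' \<in> B" "x = a \<oplus>\<^bsub>V\<^esub> b" "y = a' \<oplus>\<^bsub>V\<^esub> b'"
    by (auto simp: set_add_iff)
  then have "x \<oplus>\<^bsub>V\<^esub> y = (a \<oplus>\<^bsub>V\<^esub> a') \<oplus>\<^bsub>V\<^esub> (b \<oplus>\<^bsub>V\<^esub> b')"
    using c by (simp add: M.a_ac)
  then show "x \<oplus>\<^bsub>V\<^esub> y \<in> A <+>\<^bsub>V\<^esub> B"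
    unfolding set_add_iff using * by (meson sub_add[OF A] sub_add[OF B])
next
  note c = sub_carrier[OF A] sub_carrier[OF B]
  fix k x assume "k \<in> carrier K" "x \<in> A <+>\<^bsub>V\<^esub> B"
  then show "k \<odot>\<^bsub>V\<^esub> x \<in> A <+>\<^bsub>V\<^esub> B"
    unfolding set_add_iff using c by (metis smult_r_distr sub_smult[OF A] sub_smult[OF B])
qed

lemma set_add_upper1: "\<lbrakk>subspace K A V; subspace K B V\<rbrakk> \<Longrightarrow> A \<subseteq> A <+>\<^bsub>V\<^esub> B"
  unfolding subset_eq set_add_iff by (metis M.r_zero sub_0 sub_carrier)

lemma set_add_upper2: "\<lbrakk>subspace K A V; subspace K B V\<rbrakk> \<Longrightarrow> B \<subseteq> A <+>\<^bsub>V\<^esub> B"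
  unfolding subset_eq set_add_iff by (metis M.l_zero sub_0 sub_carrier)

lemma set_add_least: "\<lbrakk>subspace K C V; A \<subseteq> C; B \<subseteq> C\<rbrakk> \<Longrightarrow> A <+>\<^bsub>V\<^esub> B \<subseteq> C"
  by (auto simp: set_add_iff sub_add subset_iff)

lemma span_least: "\<lbrakk>subspace K W V; S \<subseteq> W\<rbrakk> \<Longrightarrow> span S \<subseteq> W"
  using span_is_subset[of S W] by (simp add: subspace_def)

lemma span_incl: "\<lbrakk>S \<subseteq> carrier V; x \<in> S\<rbrakk> \<Longrightarrow> x \<in> span S"
  using in_own_span by auto

end

lemma subspace_vimage:
  assumes "f \<in> module_hom K V U" "vectorspace K V" "vectorspace K U" "subspace K W U"
  shows "subspace K {x \<in> carrier V. f x \<in> W} V"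
proof -
  interpret V: vectorspace K V by fact
  interpret U: vectorspace K U by fact
  show ?thesis
    by (rule V.subspaceI)
      (use assms in \<open>auto simp: hom_0 hom_add hom_smult intro: U.sub_0 U.sub_add U.sub_smult\<close>)
qed

lemma subspace_image:
  assumes "f \<in> module_hom K V U" "vectorspace K V" "vectorspace K U" "subspace K W V"
  shows "subspace K (f ` W) U"
proof -
  interpret V: vectorspace K V by fact
  interpret U: vectorspace K U by fact
  note c = V.sub_carrier[OF assms(4)]
  show ?thesis
  proof (rule U.subspaceI)
    show "f ` W \<subseteq> carrier U" using c hom_closed[OF assms(1)] by auto
    show "\<zero>\<^bsub>U\<^esub> \<in> f ` W" using hom_0[OF assms(1-3)] V.sub_0[OF assms(4)] by (metis imageI)
    show "x \<oplus>\<^bsub>U\<^esub> y \<in> f ` W" if "x \<in> f ` W" "y \<in> f ` W" for x y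
      using that c hom_add[OF assms(1)] V.sub_add[OF assms(4)] by (smt (verit) image_iff)
    show "k \<odot>\<^bsub>U\<^esub> x \<in> f ` W" if "k \<in> carrier K" "x \<in> f ` W" for k x
      using that c hom_smult[OF assms(1)] V.sub_smult[OF assms(4)] by (smt (verit) image_iff)
  qed
qed

lemma hom_span_subset:
  assumes "f \<in> module_hom K V U" "vectorspace K V" "vectorspace K U" "subspace K W U"
    "S \<subseteq> carrier V" "\<And>x. x \<in> S \<Longrightarrow> f x \<in> W" "x \<in> module.span K V S"
  shows "f x \<in> W"
proof -
  interpret V: vectorspace K V by fact
  have "V.span S \<subseteq> {x \<in> carrier V. f x \<in> W}"
    by (rule V.span_least[OF subspace_vimage[OF assms(1-4)]]) (use assms in auto)
  then show ?thesis using assms(7) by auto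
qed

lemma hom_span_eq:
  assumes "f \<in> module_hom K V U" "g \<in> module_hom K V U" "vectorspace K V" "vectorspace K U"
    "S \<subseteq> carrier V" "\<And>x. x \<in> S \<Longrightarrow> f x = g x" "x \<in> module.span K V S"
  shows "f x = g x"
proof -
  interpret V: vectorspace K V by fact
  interpret U: vectorspace K U by fact
  have "subspace K {x \<in> carrier V. f x = g x} V"
    by (rule V.subspaceI) (use assms in \<open>auto simp: hom_0 hom_add hom_smult\<close>)
  then have "V.span S \<subseteq> {x \<in> carrier V. f x = g x}"
    by (rule V.span_least) (use assms in auto)
  then show ?thesis using assms(7) by auto
qed

lemma hom_restrict:
  assumes "f \<in> module_hom K V U" "W \<subseteq> carrier V"
  shows "f \<in> module_hom K (V\<lparr>carrier := W\<rparr>) U"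
  using assms(2) by (intro homI) (auto simp: subset_iff hom_closed[OF assms(1)] hom_add[OF assms(1)] hom_smult[OF assms(1)])

section \<open>Cosets and quotient spaces\<close>

context vectorspace
begin

text \<open>\<open>p\<close> need not be injective: each axiom of \<open>Q\<close> is the image
  under \<open>p\<close> of the same axiom of \<open>V\<close>. This serves quotient spaces, where
  \<open>p\<close> is the coset map, and changes of record, where it is the identity.\<close>

lemma vs_image:
  assumes c: "carrier Q = p ` carrier V" and z: "\<zero>\<^bsub>Q\<^esub> = p \<zero>\<^bsub>V\<^esub>"
    and a: "\<And>x y. \<lbrakk>x \<in> carrier V; y \<in> carrier V\<rbrakk> \<Longrightarrow> p x \<oplus>\<^bsub>Q\<^esub> p y = p (x \<oplus>\<^bsub>V\<^esub> y)"
    and m: "\<And>k x. \<lbrakk>k \<in> carrier K; x \<in> carrier V\<rbrakk> \<Longrightarrow> k \<odot>\<^bsub>Q\<^esub> p x = p (k \<odot>\<^bsub>V\<^esub> x)"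
  shows "vectorspace K Q"
proof (rule vs_criteria)
  show "field K" ..
  show "\<forall>v\<in>carrier Q. \<exists>u\<in>carrier Q. v \<oplus>\<^bsub>Q\<^esub> u = \<zero>\<^bsub>Q\<^esub>"
  proof
    fix v assume "v \<in> carrier Q"
    then obtain x where x: "x \<in> carrier V" "v = p x" by (auto simp: c)
    then have "v \<oplus>\<^bsub>Q\<^esub> p (\<ominus>\<^bsub>V\<^esub> x) = \<zero>\<^bsub>Q\<^esub>"
      by (simp add: a z M.r_neg)
    then show "\<exists>u\<in>carrier Q. v \<oplus>\<^bsub>Q\<^esub> u = \<zero>\<^bsub>Q\<^esub>"
      using x by (intro bexI[of _ "p (\<ominus>\<^bsub>V\<^esub> x)"]) (auto simp: c)
  qed
qed (auto simp: c z a m M.a_ac smult_r_distr smult_l_distr smult_assoc1)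

lemma
  shows carrier_quotient: "carrier (quotient_space V W) = {W +>\<^bsub>V\<^esub> x | x. x \<in> carrier V}"
    and zero_quotient: "\<zero>\<^bsub>quotient_space V W\<^esub> = W"
  by (auto simp: quotient_space_def A_RCOSETS_def')

lemma mem_coset: "y \<in> W +>\<^bsub>V\<^esub> x \<longleftrightarrow> (\<exists>w\<in>W. y = w \<oplus>\<^bsub>V\<^esub> x)"
  by (auto simp: a_r_coset_def')

context
  fixes W assumes W: "subspace K W V"
begin

lemma mem_coset_iff:
  assumes "x \<in> carrier V"
  shows "y \<in> W +>\<^bsub>V\<^esub> x \<longleftrightarrow> y \<in> carrier V \<and> y \<ominus>\<^bsub>V\<^esub> x \<in> W"
proof
  assume "y \<in> W +>\<^bsub>V\<^esub> x"
  then obtain w where "w \<in> W" "y = w \<oplus>\<^bsub>V\<^esub> x" by (auto simp: mem_coset)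
  then show "y \<in> carrier V \<and> y \<ominus>\<^bsub>V\<^esub> x \<in> W"
    using assms sub_carrier[OF W] by (auto simp: a_minus_def M.a_assoc M.r_neg)
next
  assume *: "y \<in> carrier V \<and> y \<ominus>\<^bsub>V\<^esub> x \<in> W"
  then have "y = (y \<ominus>\<^bsub>V\<^esub> x) \<oplus>\<^bsub>V\<^esub> x"
    using assms by (auto simp: a_minus_def M.a_assoc M.l_neg)
  then show "y \<in> W +>\<^bsub>V\<^esub> x" using * by (auto simp: mem_coset)
qed

lemma coset_self: "x \<in> carrier V \<Longrightarrow> x \<in> W +>\<^bsub>V\<^esub> x"
  by (simp add: mem_coset_iff M.r_neg a_minus_def sub_0[OF W])

lemma coset_eq_iff:
  assumes x: "x \<in> carrier V" and y: "y \<in> carrier V"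
  shows "W +>\<^bsub>V\<^esub> x = W +>\<^bsub>V\<^esub> y \<longleftrightarrow> x \<ominus>\<^bsub>V\<^esub> y \<in> W"
proof
  assume "W +>\<^bsub>V\<^esub> x = W +>\<^bsub>V\<^esub> y"
  then have "x \<in> W +>\<^bsub>V\<^esub> y" using coset_self[OF x] by simp
  then show "x \<ominus>\<^bsub>V\<^esub> y \<in> W" by (simp add: mem_coset_iff[OF y])
next
  assume *: "x \<ominus>\<^bsub>V\<^esub> y \<in> W"
  have "z \<ominus>\<^bsub>V\<^esub> x \<in> W \<longleftrightarrow> z \<ominus>\<^bsub>V\<^esub> y \<in> W" if z: "z \<in> carrier V" for z
  proof -
    have "z \<ominus>\<^bsub>V\<^esub> y = (z \<ominus>\<^bsub>V\<^esub> x) \<oplus>\<^bsub>V\<^esub> (x \<ominus>\<^bsub>V\<^esub> y)"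
    proof -
      have "(z \<ominus>\<^bsub>V\<^esub> x) \<oplus>\<^bsub>V\<^esub> (x \<ominus>\<^bsub>V\<^esub> y) = z \<oplus>\<^bsub>V\<^esub> ((\<ominus>\<^bsub>V\<^esub> x \<oplus>\<^bsub>V\<^esub> x) \<oplus>\<^bsub>V\<^esub> \<ominus>\<^bsub>V\<^esub> y)"
        using x y z by (simp add: a_minus_def M.a_assoc)
      then show ?thesis using x y z by (simp add: a_minus_def M.l_neg)
    qed
    then show ?thesis using sub_add_cancel(1)[OF W _ *, of "z \<ominus>\<^bsub>V\<^esub> x"] x z by simp
  qed
  then show "W +>\<^bsub>V\<^esub> x = W +>\<^bsub>V\<^esub> y"
    by (auto simp: mem_coset_iff[OF x] mem_coset_iff[OF y])
qed

lemma coset_eq_W_iff: "x \<in> carrier V \<Longrightarrow> W +>\<^bsub>V\<^esub> x = W \<longleftrightarrow> x \<in> W"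
proof -
  assume x: "x \<in> carrier V"
  have "W +>\<^bsub>V\<^esub> \<zero>\<^bsub>V\<^esub> = W" using W by (auto simp: mem_coset subspace_iff) 
  then show ?thesis using coset_eq_iff[of x "\<zero>\<^bsub>V\<^esub>"] x by (simp add: minus_0)
qed

lemma coset_add:
  assumes x: "x \<in> carrier V" and y: "y \<in> carrier V"
  shows "(W +>\<^bsub>V\<^esub> x) \<oplus>\<^bsub>quotient_space V W\<^esub> (W +>\<^bsub>V\<^esub> y) = W +>\<^bsub>V\<^esub> (x \<oplus>\<^bsub>V\<^esub> y)"
proof -
  have "(W +>\<^bsub>V\<^esub> x) <+>\<^bsub>V\<^esub> (W +>\<^bsub>V\<^esub> y) = W +>\<^bsub>V\<^esub> (x \<oplus>\<^bsub>V\<^esub> y)"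
  proof (rule equalityI; rule subsetI)
    fix z assume "z \<in> (W +>\<^bsub>V\<^esub> x) <+>\<^bsub>V\<^esub> (W +>\<^bsub>V\<^esub> y)"
    then obtain w w' where "w \<in> W" "w' \<in> W" "z = (w \<oplus>\<^bsub>V\<^esub> x) \<oplus>\<^bsub>V\<^esub> (w' \<oplus>\<^bsub>V\<^esub> y)"
      by (auto simp: set_add_iff mem_coset)
    moreover from this have "z = (w \<oplus>\<^bsub>V\<^esub> w') \<oplus>\<^bsub>V\<^esub> (x \<oplus>\<^bsub>V\<^esub> y)"
      using x y sub_carrier[OF W] by (simp add: M.a_ac)
    ultimately show "z \<in> W +>\<^bsub>V\<^esub> (x \<oplus>\<^bsub>V\<^esub> y)"
      unfolding mem_coset using sub_add[OF W] by blast
  next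
    fix z assume "z \<in> W +>\<^bsub>V\<^esub> (x \<oplus>\<^bsub>V\<^esub> y)"
    then obtain w where "w \<in> W" "z = w \<oplus>\<^bsub>V\<^esub> (x \<oplus>\<^bsub>V\<^esub> y)"
      by (auto simp: mem_coset)
    moreover from this have "z = (w \<oplus>\<^bsub>V\<^esub> x) \<oplus>\<^bsub>V\<^esub> (\<zero>\<^bsub>V\<^esub> \<oplus>\<^bsub>V\<^esub> y)"
      using x y sub_carrier[OF W] by (simp add: M.a_ac)
    ultimately show "z \<in> (W +>\<^bsub>V\<^esub> x) <+>\<^bsub>V\<^esub> (W +>\<^bsub>V\<^esub> y)"
      using sub_0[OF W] \<open>w \<in> W\<close> unfolding set_add_iff
      by (intro bexI[of _ "w \<oplus>\<^bsub>V\<^esub> x"] bexI[of _ "\<zero>\<^bsub>V\<^esub> \<oplus>\<^bsub>V\<^esub> y"]) (auto simp: mem_coset)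
  qed
  then show ?thesis by (simp add: quotient_space_def)
qed

lemma coset_smult:
  assumes c: "c \<in> carrier K" and x: "x \<in> carrier V"
  shows "c \<odot>\<^bsub>quotient_space V W\<^esub> (W +>\<^bsub>V\<^esub> x) = W +>\<^bsub>V\<^esub> (c \<odot>\<^bsub>V\<^esub> x)"
proof -
  \<comment> \<open>The union in \<open>quotient_space\<close> runs over the representatives of one
    coset. Each of them contributes the same coset, so the union is that coset.\<close>
  have "W +>\<^bsub>V\<^esub> (c \<odot>\<^bsub>V\<^esub> y) = W +>\<^bsub>V\<^esub> (c \<odot>\<^bsub>V\<^esub> x)" if "y \<in> W +>\<^bsub>V\<^esub> x" for y
  proof -
    have y: "y \<in> carrier V" "y \<ominus>\<^bsub>V\<^esub> x \<in> W" using that by (auto simp: mem_coset_iff[OF x])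
    then have "c \<odot>\<^bsub>V\<^esub> y \<ominus>\<^bsub>V\<^esub> c \<odot>\<^bsub>V\<^esub> x = c \<odot>\<^bsub>V\<^esub> (y \<ominus>\<^bsub>V\<^esub> x)"
      using c x by (simp add: a_minus_def smult_r_distr smult_r_minus)
    then show ?thesis
      using y c x sub_smult[OF W] by (subst coset_eq_iff) auto
  qed
  then have "(\<Union>y\<in>W +>\<^bsub>V\<^esub> x. W +>\<^bsub>V\<^esub> (c \<odot>\<^bsub>V\<^esub> y)) = W +>\<^bsub>V\<^esub> (c \<odot>\<^bsub>V\<^esub> x)"
    using coset_self[OF x] by blast
  then show ?thesis by (simp add: quotient_space_def)
qed

lemma quotient_vs: "vectorspace K (quotient_space V W)"
proof (rule vs_image)
  show "\<zero>\<^bsub>quotient_space V W\<^esub> = W +>\<^bsub>V\<^esub> \<zero>\<^bsub>V\<^esub>"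
    using coset_eq_W_iff[of "\<zero>\<^bsub>V\<^esub>"] sub_0[OF W] by (simp add: zero_quotient)
qed (auto simp: carrier_quotient coset_add coset_smult)

lemma quotient_proj_hom: "(\<lambda>x. W +>\<^bsub>V\<^esub> x) \<in> module_hom K V (quotient_space V W)"
  by (intro homI) (auto simp: carrier_quotient coset_add coset_smult)

end

end

section \<open>Tensor products\<close>

context field
begin

lemma free_space_vs: "vectorspace R (free_space R S)"
proof (rule vs_criteria)
  let ?F = "free_space R S"
  show "field R" ..
  have fin: "finite {p. h (f p) (g p) \<noteq> \<zero>} \<and> {p. h (f p) (g p) \<noteq> \<zero>} \<subseteq> S"
    if "f \<in> carrier ?F" "g \<in> carrier ?F" "h \<zero> \<zero> = \<zero>" for f g :: "'c \<Rightarrow> 'a" and h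
  proof -
    have "{p. h (f p) (g p) \<noteq> \<zero>} \<subseteq> {p. f p \<noteq> \<zero>} \<union> {p. g p \<noteq> \<zero>}" using that(3) by auto
    moreover have "finite ({p. f p \<noteq> \<zero>} \<union> {p. g p \<noteq> \<zero>})" "{p. f p \<noteq> \<zero>} \<union> {p. g p \<noteq> \<zero>} \<subseteq> S"
      using that(1,2) by (auto simp: free_space_def)
    ultimately show ?thesis by (blast intro: finite_subset)
  qed
  show "\<forall>v\<in>carrier ?F. \<exists>u\<in>carrier ?F. v \<oplus>\<^bsub>?F\<^esub> u = \<zero>\<^bsub>?F\<^esub>"
  proof
    fix v assume v: "v \<in> carrier ?F"
    have "(\<lambda>p. \<ominus> v p) \<in> carrier ?F"
      using v fin[OF v v, of "\<lambda>a b. \<ominus> a"] by (auto simp: free_space_def)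
    then show "\<exists>u\<in>carrier ?F. v \<oplus>\<^bsub>?F\<^esub> u = \<zero>\<^bsub>?F\<^esub>"
      using v by (intro bexI[of _ "\<lambda>p. \<ominus> v p"]) (auto simp: free_space_def r_neg)
  qed
  show "\<forall>v w. v \<in> carrier ?F \<and> w \<in> carrier ?F \<longrightarrow> v \<oplus>\<^bsub>?F\<^esub> w \<in> carrier ?F"
    using fin[of _ _ "\<lambda>a b. a \<oplus> b"] by (simp add: free_space_def)
  show "\<forall>c v. c \<in> carrier R \<and> v \<in> carrier ?F \<longrightarrow> c \<odot>\<^bsub>?F\<^esub> v \<in> carrier ?F"
    using fin[of v v "\<lambda>a b. c \<otimes> a" for c v] by (simp add: free_space_def)
qed (auto simp: free_space_def a_ac m_assoc l_distr r_distr)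

lemma free_gen_closed: "p \<in> S \<Longrightarrow> free_gen R p \<in> carrier (free_space R S)"
  by (auto simp: free_space_def free_gen_def)

lemma free_space_induct [consumes 1, case_names zero add]:
  assumes f: "f \<in> carrier (free_space R S)"
    and z: "P \<zero>\<^bsub>free_space R S\<^esub>"
    and a: "\<And>c p f. \<lbrakk>c \<in> carrier R; p \<in> S; f \<in> carrier (free_space R S); P f\<rbrakk> \<Longrightarrow>
      P (c \<odot>\<^bsub>free_space R S\<^esub> free_gen R p \<oplus>\<^bsub>free_space R S\<^esub> f)"
  shows "P f"
proof -
  have "P f" if "finite A" "f \<in> carrier (free_space R S)" "{p. f p \<noteq> \<zero>} \<subseteq> A" for A f
    using that
  proof (induct A arbitrary: f)
    case empty
    then have "f = \<zero>\<^bsub>free_space R S\<^esub>" by (auto simp: free_space_def)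
    then show ?case using z by simp
  next
    case (insert p A)
    define g where "g = f(p := \<zero>)"
    have "{q. g q \<noteq> \<zero>} \<subseteq> {q. f q \<noteq> \<zero>}" by (auto simp: g_def)
    then have g: "g \<in> carrier (free_space R S)"
      using insert.prems(1) by (auto simp: free_space_def g_def intro: finite_subset)
    have Pg: "P g" by (rule insert(3)[OF g]) (use insert.prems in \<open>auto simp: g_def\<close>)
    show ?case
    proof (cases "f p = \<zero>")
      case True
      then have "g = f" by (auto simp: g_def)
      then show ?thesis using Pg by simp
    next
      case False
      then have "f p \<in> carrier R" "p \<in> S" using insert.prems(1) by (auto simp: free_space_def)
      moreover have "f p \<odot>\<^bsub>free_space R S\<^esub> free_gen R p \<oplus>\<^bsub>free_space R S\<^esub> g = f"
        using insert.prems(1) by (auto simp: free_space_def free_gen_def g_def)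
      ultimately show ?thesis using a[OF _ _ g Pg] by metis
    qed
  qed
  moreover have "finite {p. f p \<noteq> \<zero>}" using f by (simp add: free_space_def)
  ultimately show ?thesis using f by blast
qed

end

section \<open>Linear extension from a free space and the universal property of the tensor
  product\<close>

definition fsum :: "('k, 'y) ring_scheme \<Rightarrow> ('k, 'u, 'z) module_scheme \<Rightarrow> ('p \<Rightarrow> 'u) \<Rightarrow> ('p \<Rightarrow> 'k) \<Rightarrow> 'u" where
  "fsum K U b f = (\<Oplus>\<^bsub>U\<^esub> p \<in> {p. f p \<noteq> \<zero>\<^bsub>K\<^esub>}. f p \<odot>\<^bsub>U\<^esub> b p)"

context vectorspace
begin

text \<open>Sums over different supports can be compared only over a common finite index set; this
  enlarges the support of \<open>f\<close> to such a set.\<close>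

lemma fsum_superset:
  assumes "finite A" "{p. f p \<noteq> \<zero>\<^bsub>K\<^esub>} \<subseteq> A" "\<And>p. p \<in> A \<Longrightarrow> f p \<in> carrier K \<and> b p \<in> carrier V"
  shows "fsum K V b f = (\<Oplus>\<^bsub>V\<^esub> p \<in> A. f p \<odot>\<^bsub>V\<^esub> b p)"
  unfolding fsum_def
  by (rule M.add.finprod_mono_neutral_cong_left) (use assms in auto)

lemma fsum_hom:
  assumes b: "\<And>p. p \<in> S \<Longrightarrow> b p \<in> carrier V"
  shows "fsum K V b \<in> module_hom K (free_space K S) V"
proof (rule homI)
  let ?F = "free_space K S"
  have F: "f p \<in> carrier K" "finite {p. f p \<noteq> \<zero>\<^bsub>K\<^esub>}" "{p. f p \<noteq> \<zero>\<^bsub>K\<^esub>} \<subseteq> S" if "f \<in> carrier ?F" for f p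
    using that by (auto simp: free_space_def)
  show "fsum K V b f \<in> carrier V" if "f \<in> carrier ?F" for f
    unfolding fsum_def using F[OF that] b by (intro M.finsum_closed) auto
  show "fsum K V b (f \<oplus>\<^bsub>?F\<^esub> g) = fsum K V b f \<oplus>\<^bsub>V\<^esub> fsum K V b g" if f: "f \<in> carrier ?F" and g: "g \<in> carrier ?F" for f g
  proof -
    let ?A = "{p. f p \<noteq> \<zero>\<^bsub>K\<^esub>} \<union> {p. g p \<noteq> \<zero>\<^bsub>K\<^esub>}"
    have fg: "f \<oplus>\<^bsub>?F\<^esub> g = (\<lambda>p. f p \<oplus>\<^bsub>K\<^esub> g p)" by (simp add: free_space_def)
    have A: "finite ?A" using F f g by auto
    have "?A \<subseteq> S" using F(3)[OF f] F(3)[OF g] by blast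
    then have bf: "f p \<noteq> \<zero>\<^bsub>K\<^esub> \<Longrightarrow> b p \<in> carrier V" and bg: "g p \<noteq> \<zero>\<^bsub>K\<^esub> \<Longrightarrow> b p \<in> carrier V" for p
      using b by blast+
    note A = A bf bg
    have "fsum K V b (f \<oplus>\<^bsub>?F\<^esub> g) = (\<Oplus>\<^bsub>V\<^esub> p \<in> ?A. (f p \<oplus>\<^bsub>K\<^esub> g p) \<odot>\<^bsub>V\<^esub> b p)"
      unfolding fg by (rule fsum_superset) (use F f g b A in auto)
    also have "\<dots> = (\<Oplus>\<^bsub>V\<^esub> p \<in> ?A. f p \<odot>\<^bsub>V\<^esub> b p \<oplus>\<^bsub>V\<^esub> g p \<odot>\<^bsub>V\<^esub> b p)"
      using A F(1)[OF f] F(1)[OF g] by (intro M.finsum_cong') (auto simp: smult_l_distr)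
    also have "\<dots> = (\<Oplus>\<^bsub>V\<^esub> p \<in> ?A. f p \<odot>\<^bsub>V\<^esub> b p) \<oplus>\<^bsub>V\<^esub> (\<Oplus>\<^bsub>V\<^esub> p \<in> ?A. g p \<odot>\<^bsub>V\<^esub> b p)"
      using A F(1)[OF f] F(1)[OF g] by (intro M.finsum_addf) auto
    also have "\<dots> = fsum K V b f \<oplus>\<^bsub>V\<^esub> fsum K V b g"
      using A F f g by (subst (1 2) fsum_superset[where A = ?A]) auto
    finally show ?thesis .
  qed
  show "fsum K V b (c \<odot>\<^bsub>?F\<^esub> f) = c \<odot>\<^bsub>V\<^esub> fsum K V b f" if c: "c \<in> carrier K" and f: "f \<in> carrier ?F" for c f
  proof -
    let ?A = "{p. f p \<noteq> \<zero>\<^bsub>K\<^esub>}"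
    have cf: "c \<odot>\<^bsub>?F\<^esub> f = (\<lambda>p. c \<otimes>\<^bsub>K\<^esub> f p)" by (simp add: free_space_def)
    have A: "finite ?A" "\<And>p. p \<in> ?A \<Longrightarrow> b p \<in> carrier V" using F[OF f] b by auto
    have "fsum K V b (c \<odot>\<^bsub>?F\<^esub> f) = (\<Oplus>\<^bsub>V\<^esub> p \<in> ?A. (c \<otimes>\<^bsub>K\<^esub> f p) \<odot>\<^bsub>V\<^esub> b p)"
      unfolding cf by (rule fsum_superset) (use F(1)[OF f] A c in auto)
    also have "\<dots> = (\<Oplus>\<^bsub>V\<^esub> p \<in> ?A. c \<odot>\<^bsub>V\<^esub> (f p \<odot>\<^bsub>V\<^esub> b p))"
      using A F(1)[OF f] c by (intro M.finsum_cong') (auto simp: smult_assoc1)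
    also have "\<dots> = c \<odot>\<^bsub>V\<^esub> fsum K V b f"
      unfolding fsum_def
      by (rule hom_finsum[symmetric, of "\<lambda>x. c \<odot>\<^bsub>V\<^esub> x"])
        (use A F(1)[OF f] c hom_smult_map[OF hom_id] vs_self in auto)
    finally show ?thesis .
  qed
qed

lemma fsum_gen: "b p \<in> carrier V \<Longrightarrow> fsum K V b (free_gen K p) = b p"
  by (subst fsum_superset[where A = "{p}"]) (auto simp: free_gen_def)

end

definition bilin ::
  "('k, 'y) ring_scheme \<Rightarrow> ('k, 'v, 'z1) module_scheme \<Rightarrow> ('k, 'w, 'z2) module_scheme \<Rightarrow>
    ('k, 'u, 'z3) module_scheme \<Rightarrow> ('v \<Rightarrow> 'w \<Rightarrow> 'u) \<Rightarrow> bool"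
where
  "bilin K V W U b \<longleftrightarrow> (\<forall>v\<in>carrier V. b v \<in> module_hom K W U) \<and>
    (\<forall>w\<in>carrier W. (\<lambda>v. b v w) \<in> module_hom K V U)"

lemma bilinI:
  assumes "\<And>v. v \<in> carrier V \<Longrightarrow> b v \<in> module_hom K W U"
    and "\<And>w. w \<in> carrier W \<Longrightarrow> (\<lambda>v. b v w) \<in> module_hom K V U"
  shows "bilin K V W U b"
  using assms by (simp add: bilin_def)

lemma bilin_hom1: "\<lbrakk>bilin K V W U b; w \<in> carrier W\<rbrakk> \<Longrightarrow> (\<lambda>v. b v w) \<in> module_hom K V U"
  and bilin_hom2: "\<lbrakk>bilin K V W U b; v \<in> carrier V\<rbrakk> \<Longrightarrow> b v \<in> module_hom K W U"
  by (auto simp: bilin_def)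

lemma bilin_closed: "\<lbrakk>bilin K V W U b; v \<in> carrier V; w \<in> carrier W\<rbrakk> \<Longrightarrow> b v w \<in> carrier U"
  by (auto simp: bilin_def intro: hom_closed)

locale tensor_pair = V: vectorspace K V + W: vectorspace K W
  for K :: "('k, 'y) ring_scheme" and V :: "('k, 'v, 'z1) module_scheme" and W :: "('k, 'w, 'z2) module_scheme"
begin

abbreviation (input) "F \<equiv> free_space K (carrier V \<times> carrier W)"
abbreviation (input) "T \<equiv> tensor K V W"
abbreviation tp (infixl "\<star>" 75) where "v \<star> w \<equiv> pure_tensor K V W v w"

lemma F_vs: "vectorspace K F"
  by (rule V.free_space_vs)

lemma gen_closed: "\<lbrakk>v \<in> carrier V; w \<in> carrier W\<rbrakk> \<Longrightarrow> free_gen K (v, w) \<in> carrier F"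
  by (intro V.free_gen_closed) auto

lemma relators_closed: "tensor_relators K V W \<subseteq> carrier F"
proof -
  interpret F: vectorspace K F by (rule F_vs)
  show ?thesis unfolding tensor_relators_def Let_def
    by (auto simp: gen_closed F.smult_closed)
qed

lemma null_subspace: "subspace K (tensor_null K V W) F"
proof -
  interpret F: vectorspace K F by (rule F_vs)
  show ?thesis unfolding tensor_null_def by (rule F.span_is_subspace[OF relators_closed])
qed

lemma relator_null: "x \<in> tensor_relators K V W \<Longrightarrow> x \<in> tensor_null K V W"
proof -
  interpret F: vectorspace K F by (rule F_vs)
  show "x \<in> tensor_relators K V W \<Longrightarrow> x \<in> tensor_null K V W"
    unfolding tensor_null_def by (rule F.span_incl[OF relators_closed])
qed

lemma tensor_vs: "vectorspace K T"
proof -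
  interpret F: vectorspace K F by (rule F_vs)
  show ?thesis unfolding tensor_def by (rule F.quotient_vs[OF null_subspace])
qed

lemma proj_hom: "(\<lambda>f. tensor_null K V W +>\<^bsub>F\<^esub> f) \<in> module_hom K F T"
proof -
  interpret F: vectorspace K F by (rule F_vs)
  show ?thesis unfolding tensor_def by (rule F.quotient_proj_hom[OF null_subspace])
qed

lemma tp_closed: "\<lbrakk>v \<in> carrier V; w \<in> carrier W\<rbrakk> \<Longrightarrow> v \<star> w \<in> carrier T"
  unfolding pure_tensor_def by (rule hom_closed[OF proj_hom gen_closed])

lemma tp_relation:
  assumes "x \<in> carrier F" "y \<in> carrier F" "x \<ominus>\<^bsub>F\<^esub> y \<in> tensor_relators K V W"
  shows "tensor_null K V W +>\<^bsub>F\<^esub> x = tensor_null K V W +>\<^bsub>F\<^esub> y"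
proof -
  interpret F: vectorspace K F by (rule F_vs)
  show ?thesis
    using F.coset_eq_iff[OF null_subspace] relator_null assms by blast
qed

lemma tp_bilin: "bilin K V W T (\<lambda>v w. v \<star> w)"
proof -
  interpret F: vectorspace K F by (rule F_vs)
  note [simp] = gen_closed F.smult_closed
  note p = hom_add[OF proj_hom, symmetric] hom_smult[OF proj_hom, symmetric]
  show ?thesis
  proof (intro bilinI homI)
    fix v w w' assume v: "v \<in> carrier V" and w: "w \<in> carrier W" "w' \<in> carrier W"
    have "free_gen K (v, w \<oplus>\<^bsub>W\<^esub> w') \<ominus>\<^bsub>F\<^esub> (free_gen K (v, w) \<oplus>\<^bsub>F\<^esub> free_gen K (v, w')) \<in> tensor_relators K V W"
      using v w unfolding tensor_relators_def Let_def by blast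
    then show "(v \<star> (w \<oplus>\<^bsub>W\<^esub> w')) = (v \<star> w) \<oplus>\<^bsub>T\<^esub> (v \<star> w')"
      unfolding pure_tensor_def using v w by (simp add: p tp_relation)
  next
    fix v v' w assume v: "v \<in> carrier V" "v' \<in> carrier V" and w: "w \<in> carrier W"
    have "free_gen K (v \<oplus>\<^bsub>V\<^esub> v', w) \<ominus>\<^bsub>F\<^esub> (free_gen K (v, w) \<oplus>\<^bsub>F\<^esub> free_gen K (v', w)) \<in> tensor_relators K V W"
      using v w unfolding tensor_relators_def Let_def by blast
    then show "((v \<oplus>\<^bsub>V\<^esub> v') \<star> w) = (v \<star> w) \<oplus>\<^bsub>T\<^esub> (v' \<star> w)"
      unfolding pure_tensor_def using v w by (simp add: p tp_relation)
  next
    fix v w c assume v: "v \<in> carrier V" and w: "w \<in> carrier W" and c: "c \<in> carrier K"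
    have "free_gen K (v, c \<odot>\<^bsub>W\<^esub> w) \<ominus>\<^bsub>F\<^esub> (c \<odot>\<^bsub>F\<^esub> free_gen K (v, w)) \<in> tensor_relators K V W"
      using v w c unfolding tensor_relators_def Let_def by blast
    then show "(v \<star> (c \<odot>\<^bsub>W\<^esub> w)) = c \<odot>\<^bsub>T\<^esub> (v \<star> w)"
      unfolding pure_tensor_def using v w c by (simp add: p tp_relation)
    have "free_gen K (c \<odot>\<^bsub>V\<^esub> v, w) \<ominus>\<^bsub>F\<^esub> (c \<odot>\<^bsub>F\<^esub> free_gen K (v, w)) \<in> tensor_relators K V W"
      using v w c unfolding tensor_relators_def Let_def by blast
    then show "((c \<odot>\<^bsub>V\<^esub> v) \<star> w) = c \<odot>\<^bsub>T\<^esub> (v \<star> w)"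
      unfolding pure_tensor_def using v w c by (simp add: p tp_relation)
  qed (auto intro: tp_closed)
qed

lemma carrier_T: "carrier T = {tensor_null K V W +>\<^bsub>F\<^esub> f | f. f \<in> carrier F}"
proof -
  interpret F: vectorspace K F by (rule F_vs)
  show ?thesis unfolding tensor_def by (rule F.carrier_quotient)
qed

text \<open>Neither zero nor scalar multiples need a case: zero is the pure tensor of two zeros, and
  a scalar is absorbed by the left factor of a pure tensor.\<close>

lemma tensor_induct [consumes 1, case_names pure add]:
  assumes t: "t \<in> carrier T"
    and p: "\<And>v w. \<lbrakk>v \<in> carrier V; w \<in> carrier W\<rbrakk> \<Longrightarrow> P (v \<star> w)"
    and a: "\<And>s t. \<lbrakk>s \<in> carrier T; t \<in> carrier T; P s; P t\<rbrakk> \<Longrightarrow> P (s \<oplus>\<^bsub>T\<^esub> t)"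
  shows "P t"
proof -
  interpret F: vectorspace K F by (rule F_vs)
  interpret T: vectorspace K T by (rule tensor_vs)
  have z: "P \<zero>\<^bsub>T\<^esub>"
  proof -
    have "\<zero>\<^bsub>V\<^esub> \<star> \<zero>\<^bsub>W\<^esub> = \<zero>\<^bsub>T\<^esub>"
      using hom_0[OF bilin_hom2[OF tp_bilin] W.vs_self tensor_vs, of "\<zero>\<^bsub>V\<^esub>"] by simp
    then show ?thesis using p[of "\<zero>\<^bsub>V\<^esub>" "\<zero>\<^bsub>W\<^esub>"] by simp
  qed
  obtain f where f: "f \<in> carrier F" "t = tensor_null K V W +>\<^bsub>F\<^esub> f" using t by (auto simp: carrier_T)
  from f(1) have "P (tensor_null K V W +>\<^bsub>F\<^esub> f)"
  proof (induct rule: V.free_space_induct)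
    case zero
    then show ?case using z hom_0[OF proj_hom F_vs tensor_vs] by simp
  next
    case (add c p f)
    obtain v w where vw: "p = (v, w)" "v \<in> carrier V" "w \<in> carrier W" using add(2) by auto
    have "tensor_null K V W +>\<^bsub>F\<^esub> (c \<odot>\<^bsub>F\<^esub> free_gen K p \<oplus>\<^bsub>F\<^esub> f) =
      ((c \<odot>\<^bsub>V\<^esub> v) \<star> w) \<oplus>\<^bsub>T\<^esub> (tensor_null K V W +>\<^bsub>F\<^esub> f)"
      using add vw hom_smult[OF bilin_hom1[OF tp_bilin vw(3)] add(1) vw(2)]
      by (simp add: hom_add[OF proj_hom] hom_smult[OF proj_hom] gen_closed F.smult_closed pure_tensor_def)
    then show ?case
      using vw add by (auto intro!: a p tp_closed hom_closed[OF proj_hom])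
  qed
  then show ?thesis using f by simp
qed

lemma tensor_hom_eq:
  assumes "f \<in> module_hom K T U" "g \<in> module_hom K T U" "t \<in> carrier T"
    "\<And>v w. \<lbrakk>v \<in> carrier V; w \<in> carrier W\<rbrakk> \<Longrightarrow> f (v \<star> w) = g (v \<star> w)"
  shows "f t = g t"
  using assms(3)
  by (induct rule: tensor_induct) (simp_all add: assms(4) hom_add[OF assms(1)] hom_add[OF assms(2)])

lemma span_pure: "t \<in> carrier T \<Longrightarrow> t \<in> module.span K T {v \<star> w | v w. v \<in> carrier V \<and> w \<in> carrier W}"
proof (induct rule: tensor_induct)
  case (pure v w)
  interpret T: vectorspace K T by (rule tensor_vs)
  show ?case by (rule T.span_incl) (use pure in \<open>auto intro: tp_closed\<close>)
next
  case (add s t)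
  interpret T: vectorspace K T by (rule tensor_vs)
  show ?case by (rule T.sub_add[OF T.span_is_subspace add(3,4)]) (auto intro: tp_closed)
qed

context
  fixes U :: "('k, 'u, 'z) module_scheme" and b
  assumes U: "vectorspace K U" and b: "bilin K V W U b"
begin

text \<open>\<open>tensor_lift\<close> evaluates the linear extension of \<open>b\<close> at a
  chosen representative. Bilinearity says that this extension kills the four kinds of relators, so
  the choice does not affect the value.\<close>

lemma lift_coset:
  assumes "f \<in> carrier F"
  shows "tensor_lift K U b (tensor_null K V W +>\<^bsub>F\<^esub> f) = fsum K U (\<lambda>p. b (fst p) (snd p)) f"
proof -
  interpret F: vectorspace K F by (rule F_vs)
  interpret U: vectorspace K U by (rule U)
  let ?s = "fsum K U (\<lambda>p. b (fst p) (snd p))"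
  have hs: "?s \<in> module_hom K F U"
    by (rule U.fsum_hom) (use b in \<open>auto intro: bilin_closed\<close>)
  have sgen: "?s (free_gen K (v, w)) = b v w" if "v \<in> carrier V" "w \<in> carrier W" for v w
    using that by (subst U.fsum_gen) (auto intro: bilin_closed[OF b])
  have zero: "?s x = \<zero>\<^bsub>U\<^esub>" if "x \<in> tensor_null K V W" for x
  proof -
    have "?s x \<in> {\<zero>\<^bsub>U\<^esub>}"
    proof (rule hom_span_subset[OF hs F_vs U U.subspace_zero relators_closed])
      show "x \<in> module.span K F (tensor_relators K V W)"
        using that by (simp add: tensor_null_def)
      fix x assume x: "x \<in> tensor_relators K V W"
      note [simp] = gen_closed F.smult_closed hom_minus[OF hs F_vs U] hom_add[OF hs] hom_smult[OF hs] sgen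
        hom_add[OF bilin_hom1[OF b]] hom_add[OF bilin_hom2[OF b]]
        hom_smult[OF bilin_hom1[OF b]] hom_smult[OF bilin_hom2[OF b]] bilin_closed[OF b]
      show "?s x \<in> {\<zero>\<^bsub>U\<^esub>}"
        using x unfolding tensor_relators_def Let_def
        by (elim UnE) (auto simp: U.minus_eq_0_iff)
    qed
    then show ?thesis by simp
  qed
  define f' where "f' = (SOME f'. f' \<in> tensor_null K V W +>\<^bsub>F\<^esub> f)"
  have "f' \<in> tensor_null K V W +>\<^bsub>F\<^esub> f"
    unfolding f'_def by (rule someI[of _ f]) (rule F.coset_self[OF null_subspace assms])
  then have f': "f' \<in> carrier F" "f' \<ominus>\<^bsub>F\<^esub> f \<in> tensor_null K V W"
    by (auto simp: F.mem_coset_iff[OF null_subspace assms])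
  have "?s f' \<ominus>\<^bsub>U\<^esub> ?s f = \<zero>\<^bsub>U\<^esub>"
    using zero[OF f'(2)] hom_minus[OF hs F_vs U f'(1) assms] by simp
  then have "?s f' = ?s f"
    using f'(1) assms hom_closed[OF hs] by (simp add: U.minus_eq_0_iff)
  then show ?thesis
    by (simp add: tensor_lift_def fsum_def flip: f'_def)
qed

lemma lift_hom: "tensor_lift K U b \<in> module_hom K T U"
proof -
  interpret F: vectorspace K F by (rule F_vs)
  interpret U: vectorspace K U by (rule U)
  let ?s = "fsum K U (\<lambda>p. b (fst p) (snd p))"
  have hs: "?s \<in> module_hom K F U"
    by (rule U.fsum_hom) (use b in \<open>auto intro: bilin_closed\<close>)
  show ?thesis
    by (rule homI)
      (auto simp: carrier_T lift_coset hom_closed[OF hs] hom_add[OF hs] hom_smult[OF hs]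
        simp flip: hom_add[OF proj_hom] hom_smult[OF proj_hom])
qed

lemma lift_pure: "\<lbrakk>v \<in> carrier V; w \<in> carrier W\<rbrakk> \<Longrightarrow> tensor_lift K U b (v \<star> w) = b v w"
proof -
  interpret U: vectorspace K U by (rule U)
  assume "v \<in> carrier V" "w \<in> carrier W"
  then show ?thesis
    unfolding pure_tensor_def
    by (subst lift_coset) (auto simp: gen_closed U.fsum_gen bilin_closed[OF b])
qed

lemma lift_unique:
  assumes "h \<in> module_hom K T U" "\<And>v w. \<lbrakk>v \<in> carrier V; w \<in> carrier W\<rbrakk> \<Longrightarrow> h (v \<star> w) = b v w"
    "t \<in> carrier T"
  shows "h t = tensor_lift K U b t"
  by (rule tensor_hom_eq[OF assms(1) lift_hom assms(3)]) (simp add: assms(2) lift_pure)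

end

end

section \<open>Functionals and separation of tensors\<close>

lemma ground_simps [simp]:
  "carrier (ground_space K) = carrier K" "zero (ground_space K) = zero K"
  "add (ground_space K) = add K" "smult (ground_space K) = mult K"
  by (simp_all add: ground_space_def)

abbreviation dual :: "('k, 'y) ring_scheme \<Rightarrow> ('k, 'v, 'z) module_scheme \<Rightarrow> ('v \<Rightarrow> 'k) set" where
  "dual K V \<equiv> module_hom K V (ground_space K)"

lemma (in field) ground_vs: "vectorspace R (ground_space R)"
proof (rule vs_criteria)
  show "\<forall>v\<in>carrier (ground_space R). \<exists>u\<in>carrier (ground_space R). v \<oplus>\<^bsub>ground_space R\<^esub> u = \<zero>\<^bsub>ground_space R\<^esub>"
    using r_neg by (auto intro!: bexI[of _ "\<ominus> v" for v])
  show "field R" ..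
qed (simp_all add: a_ac m_assoc l_distr r_distr)

context vectorspace
begin

lemma inverse_ex:
  assumes "c \<in> carrier K" "c \<noteq> \<zero>\<^bsub>K\<^esub>"
  obtains d where "d \<in> carrier K" "d \<otimes>\<^bsub>K\<^esub> c = \<one>\<^bsub>K\<^esub>" "d \<noteq> \<zero>\<^bsub>K\<^esub>"
proof -
  have "c \<in> Units K" using assms by (simp add: field_Units)
  then have "inv\<^bsub>K\<^esub> c \<in> carrier K" "inv\<^bsub>K\<^esub> c \<otimes>\<^bsub>K\<^esub> c = \<one>\<^bsub>K\<^esub>" by (auto simp: R.Units_l_inv)
  moreover from this have "inv\<^bsub>K\<^esub> c \<noteq> \<zero>\<^bsub>K\<^esub>" using assms by auto
  ultimately show ?thesis using that by blast
qed

lemma smult_inverse: "\<lbrakk>d \<in> carrier K; c \<in> carrier K; d \<otimes>\<^bsub>K\<^esub> c = \<one>\<^bsub>K\<^esub>; x \<in> carrier V\<rbrakk> \<Longrightarrow> d \<odot>\<^bsub>V\<^esub> (c \<odot>\<^bsub>V\<^esub> x) = x"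
  by (simp flip: smult_assoc1)

lemma sub_smult_iff:
  assumes "subspace K W V" "c \<in> carrier K" "c \<noteq> \<zero>\<^bsub>K\<^esub>" "x \<in> carrier V"
  shows "c \<odot>\<^bsub>V\<^esub> x \<in> W \<longleftrightarrow> x \<in> W"
proof
  assume *: "c \<odot>\<^bsub>V\<^esub> x \<in> W"
  obtain d where "d \<in> carrier K" "d \<otimes>\<^bsub>K\<^esub> c = \<one>\<^bsub>K\<^esub>" using inverse_ex assms by blast
  then show "x \<in> W" using sub_smult[OF assms(1) _ *, of d] assms smult_inverse by auto
qed (use assms in \<open>auto intro: sub_smult\<close>)

definition line :: "'c \<Rightarrow> 'c set" where "line x = {c \<odot>\<^bsub>V\<^esub> x | c. c \<in> carrier K}"

lemma subspace_line: "x \<in> carrier V \<Longrightarrow> subspace K (line x) V"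
  unfolding line_def
proof (rule subspaceI)
  assume x: "x \<in> carrier V"
  show "\<zero>\<^bsub>V\<^esub> \<in> {c \<odot>\<^bsub>V\<^esub> x |c. c \<in> carrier K}"
    using x by (auto intro!: exI[of _ "\<zero>\<^bsub>K\<^esub>"])
  show "y \<oplus>\<^bsub>V\<^esub> z \<in> {c \<odot>\<^bsub>V\<^esub> x |c. c \<in> carrier K}"
    if "y \<in> {c \<odot>\<^bsub>V\<^esub> x |c. c \<in> carrier K}" "z \<in> {c \<odot>\<^bsub>V\<^esub> x |c. c \<in> carrier K}" for y z
    using that x by (auto simp flip: smult_l_distr)
  show "k \<odot>\<^bsub>V\<^esub> y \<in> {c \<odot>\<^bsub>V\<^esub> x |c. c \<in> carrier K}"
    if "k \<in> carrier K" "y \<in> {c \<odot>\<^bsub>V\<^esub> x |c. c \<in> carrier K}" for y k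
    using that x by (auto simp flip: smult_assoc1)
qed auto

lemma in_line: "x \<in> carrier V \<Longrightarrow> x \<in> line x"
  unfolding line_def by (auto intro!: exI[of _ "\<one>\<^bsub>K\<^esub>"])

lemma in_add_line: "y \<in> A <+>\<^bsub>V\<^esub> line x \<longleftrightarrow> (\<exists>a\<in>A. \<exists>c\<in>carrier K. y = a \<oplus>\<^bsub>V\<^esub> c \<odot>\<^bsub>V\<^esub> x)"
  by (auto simp: set_add_iff line_def)

text \<open>Works in any dimension without a basis. By Zorn there is a subspace \<open>T\<close>
  maximal among those that contain \<open>S\<close> and miss \<open>v\<close>; maximality makes
  \<open>T\<close> a complement of the line through \<open>v\<close>, and \<open>f\<close> is the
  coordinate along \<open>v\<close>.\<close>

lemma functional_ex:
  assumes S: "subspace K S V" and v: "v \<in> carrier V" "v \<notin> S"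
  obtains f where "f \<in> dual K V" "\<And>x. x \<in> S \<Longrightarrow> f x = \<zero>\<^bsub>K\<^esub>" "f v = \<one>\<^bsub>K\<^esub>"
proof -
  let ?A = "{T. subspace K T V \<and> S \<subseteq> T \<and> v \<notin> T}"
  have "\<exists>T\<in>?A. \<forall>X\<in>?A. T \<subseteq> X \<longrightarrow> X = T"
  proof (rule subset_Zorn_nonempty)
    show "?A \<noteq> {}" using S v by auto
    fix C assume C: "C \<noteq> {}" "subset.chain ?A C"
    then have sub: "\<And>T. T \<in> C \<Longrightarrow> subspace K T V \<and> S \<subseteq> T \<and> v \<notin> T"
      and lin: "\<And>X Y. \<lbrakk>X \<in> C; Y \<in> C\<rbrakk> \<Longrightarrow> X \<subseteq> Y \<or> Y \<subseteq> X"
      by (auto simp: subset_chain_def)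
    have "subspace K (\<Union>C) V"
    proof (rule subspaceI)
      fix x y assume "x \<in> \<Union>C" "y \<in> \<Union>C"
      then obtain X Y where "x \<in> X" "X \<in> C" "y \<in> Y" "Y \<in> C" by auto
      then have "\<exists>Z\<in>C. x \<in> Z \<and> y \<in> Z" using lin[of X Y] by auto
      then show "x \<oplus>\<^bsub>V\<^esub> y \<in> \<Union>C" using sub sub_add by blast
    qed (use C sub sub_0 sub_carrier sub_smult in blast)+
    then show "\<Union>C \<in> ?A" using C sub by auto
  qed
  then obtain T where T: "subspace K T V" "S \<subseteq> T" "v \<notin> T"
    and max: "\<And>X. \<lbrakk>subspace K X V; S \<subseteq> X; v \<notin> X; T \<subseteq> X\<rbrakk> \<Longrightarrow> X = T"
    by auto
  have ex: "\<exists>c\<in>carrier K. w \<ominus>\<^bsub>V\<^esub> c \<odot>\<^bsub>V\<^esub> v \<in> T" if w: "w \<in> carrier V" for w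
  proof (cases "w \<in> T")
    case True
    then show ?thesis using v w by (intro bexI[of _ "\<zero>\<^bsub>K\<^esub>"]) (auto simp: minus_0)
  next
    case False
    let ?X = "T <+>\<^bsub>V\<^esub> line w"
    note l = subspace_line[OF w]
    have X: "subspace K ?X V" "T \<subseteq> ?X" by (rule subspace_set_add[OF T(1) l] set_add_upper1[OF T(1) l])+
    have Xw: "w \<in> ?X" using set_add_upper2[OF T(1) l] in_line[OF w] by (rule subsetD)
    \<comment> \<open>\<open>T\<close> together with the line through \<open>w\<close> is strictly
      larger than \<open>T\<close>, so by maximality it cannot miss \<open>v\<close>; the resulting
      relation is solved for \<open>w\<close>.\<close>
    then have "v \<in> ?X" using max[of ?X] False T(2) X Xw by blast
    then obtain t c where tc: "t \<in> T" "c \<in> carrier K" "v = t \<oplus>\<^bsub>V\<^esub> c \<odot>\<^bsub>V\<^esub> w" by (auto simp: in_add_line)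
    have t: "t \<in> carrier V" using tc T sub_carrier by blast
    have "c \<noteq> \<zero>\<^bsub>K\<^esub>" using tc T(3) w t by auto
    then obtain d where d: "d \<in> carrier K" "d \<otimes>\<^bsub>K\<^esub> c = \<one>\<^bsub>K\<^esub>" using inverse_ex tc by blast
    have "d \<odot>\<^bsub>V\<^esub> v = d \<odot>\<^bsub>V\<^esub> t \<oplus>\<^bsub>V\<^esub> w"
      using tc d t w by (simp add: smult_r_distr smult_inverse)
    then have "d \<odot>\<^bsub>V\<^esub> v \<ominus>\<^bsub>V\<^esub> w = d \<odot>\<^bsub>V\<^esub> t"
      using d t w by (simp add: a_minus_def M.a_assoc M.r_neg)
    then have "w \<ominus>\<^bsub>V\<^esub> d \<odot>\<^bsub>V\<^esub> v \<in> T"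
      using minus_swap_in_sub[OF T(1), of "d \<odot>\<^bsub>V\<^esub> v" w] sub_smult[OF T(1) d(1) tc(1)] d v w by simp
    then show ?thesis using d by blast
  qed
  have uniq: "c = c'" if "c \<in> carrier K" "c' \<in> carrier K" "w \<in> carrier V"
    "w \<ominus>\<^bsub>V\<^esub> c \<odot>\<^bsub>V\<^esub> v \<in> T" "w \<ominus>\<^bsub>V\<^esub> c' \<odot>\<^bsub>V\<^esub> v \<in> T" for w c c'
  proof (rule ccontr)
    assume ne: "c \<noteq> c'"
    have "(w \<ominus>\<^bsub>V\<^esub> c \<odot>\<^bsub>V\<^esub> v) \<ominus>\<^bsub>V\<^esub> (w \<ominus>\<^bsub>V\<^esub> c' \<odot>\<^bsub>V\<^esub> v) = (c' \<ominus>\<^bsub>K\<^esub> c) \<odot>\<^bsub>V\<^esub> v"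
    proof -
      have "(w \<ominus>\<^bsub>V\<^esub> c \<odot>\<^bsub>V\<^esub> v) \<ominus>\<^bsub>V\<^esub> (w \<ominus>\<^bsub>V\<^esub> c' \<odot>\<^bsub>V\<^esub> v) = (w \<oplus>\<^bsub>V\<^esub> \<ominus>\<^bsub>V\<^esub> w) \<oplus>\<^bsub>V\<^esub> (c' \<odot>\<^bsub>V\<^esub> v \<oplus>\<^bsub>V\<^esub> \<ominus>\<^bsub>V\<^esub> (c \<odot>\<^bsub>V\<^esub> v))"
        using that v by (simp add: a_minus_def M.minus_add M.a_ac)
      then show ?thesis using that v by (simp add: a_minus_def M.r_neg smult_l_distr smult_l_minus)
    qed
    then have "(c' \<ominus>\<^bsub>K\<^esub> c) \<odot>\<^bsub>V\<^esub> v \<in> T" using sub_minus[OF T(1) that(4,5)] by simp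
    moreover have "c' \<ominus>\<^bsub>K\<^esub> c \<noteq> \<zero>\<^bsub>K\<^esub>"
    proof
      assume "c' \<ominus>\<^bsub>K\<^esub> c = \<zero>\<^bsub>K\<^esub>"
      then have "(c' \<ominus>\<^bsub>K\<^esub> c) \<oplus>\<^bsub>K\<^esub> c = c" using that by simp
      then show False using ne that by (simp add: a_minus_def R.a_assoc R.l_neg)
    qed
    ultimately show False using sub_smult_iff[OF T(1)] that v T(3) by auto
  qed
  define f where "f = (\<lambda>w. THE c. c \<in> carrier K \<and> w \<ominus>\<^bsub>V\<^esub> c \<odot>\<^bsub>V\<^esub> v \<in> T)"
  have f: "f w \<in> carrier K" "w \<ominus>\<^bsub>V\<^esub> f w \<odot>\<^bsub>V\<^esub> v \<in> T" if w: "w \<in> carrier V" for w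
  proof -
    have "f w \<in> carrier K \<and> w \<ominus>\<^bsub>V\<^esub> f w \<odot>\<^bsub>V\<^esub> v \<in> T"
      unfolding f_def by (rule theI') (use ex[OF w] uniq w in blast)
    then show "f w \<in> carrier K" "w \<ominus>\<^bsub>V\<^esub> f w \<odot>\<^bsub>V\<^esub> v \<in> T" by auto
  qed
  have fI: "f w = c" if "w \<in> carrier V" "c \<in> carrier K" "w \<ominus>\<^bsub>V\<^esub> c \<odot>\<^bsub>V\<^esub> v \<in> T" for w c
    using uniq f that by blast
  show ?thesis
  proof
    show "f \<in> dual K V"
    proof (rule homI; simp)
      show "f x \<in> carrier K" if "x \<in> carrier V" for x using f that by blast
      fix x y assume xy: "x \<in> carrier V" "y \<in> carrier V"
      have "x \<oplus>\<^bsub>V\<^esub> y \<ominus>\<^bsub>V\<^esub> (f x \<oplus>\<^bsub>K\<^esub> f y) \<odot>\<^bsub>V\<^esub> v = (x \<ominus>\<^bsub>V\<^esub> f x \<odot>\<^bsub>V\<^esub> v) \<oplus>\<^bsub>V\<^esub> (y \<ominus>\<^bsub>V\<^esub> f y \<odot>\<^bsub>V\<^esub> v)"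
        using f xy v by (simp add: a_minus_def smult_l_distr M.minus_add M.a_ac)
      then show "f (x \<oplus>\<^bsub>V\<^esub> y) = f x \<oplus>\<^bsub>K\<^esub> f y"
        using f xy sub_add[OF T(1)] by (intro fI) auto
    next
      fix c x assume cx: "c \<in> carrier K" "x \<in> carrier V"
      have "c \<odot>\<^bsub>V\<^esub> x \<ominus>\<^bsub>V\<^esub> (c \<otimes>\<^bsub>K\<^esub> f x) \<odot>\<^bsub>V\<^esub> v = c \<odot>\<^bsub>V\<^esub> (x \<ominus>\<^bsub>V\<^esub> f x \<odot>\<^bsub>V\<^esub> v)"
        using f cx v by (simp add: a_minus_def smult_r_distr smult_assoc1 smult_r_minus)
      then show "f (c \<odot>\<^bsub>V\<^esub> x) = c \<otimes>\<^bsub>K\<^esub> f x"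
        using f cx sub_smult[OF T(1)] by (intro fI) auto
    qed
    show "f x = \<zero>\<^bsub>K\<^esub>" if "x \<in> S" for x
      using that T S v sub_carrier by (intro fI) (auto simp: minus_0)
    show "f v = \<one>\<^bsub>K\<^esub>"
      using v sub_0[OF T(1)] by (intro fI) (simp_all add: minus_self)
  qed
qed

text \<open>A subspace is cut out by the functionals vanishing on it. Membership in a step of a
  filtration is proved in this form, because the functionals vanishing on \<open>P i\<close> are the
  set \<open>kills i\<close> on which all graded computations rest.\<close>

lemma functional_sub:
  assumes W: "subspace K W V" and x: "x \<in> carrier V"
    and z: "\<And>f. \<lbrakk>f \<in> dual K V; \<And>y. y \<in> W \<Longrightarrow> f y = \<zero>\<^bsub>K\<^esub>\<rbrakk> \<Longrightarrow> f x = \<zero>\<^bsub>K\<^esub>"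
  shows "x \<in> W"
proof (rule ccontr)
  assume "x \<notin> W"
  then obtain f where "f \<in> dual K V" "\<And>y. y \<in> W \<Longrightarrow> f y = \<zero>\<^bsub>K\<^esub>" "f x = \<one>\<^bsub>K\<^esub>"
    using functional_ex[OF W x] by blast
  then show False using z[of f] by simp
qed

lemma functional_sep:
  assumes "x \<in> carrier V" "\<And>f. f \<in> dual K V \<Longrightarrow> f x = \<zero>\<^bsub>K\<^esub>"
  shows "x = \<zero>\<^bsub>V\<^esub>"
  using functional_sub[OF subspace_zero assms(1)] assms(2) by simp

text \<open>Only a separating set \<open>\<Phi>\<close> is tested: on an associated graded space the
  homogeneous functionals separate points, although they are just a part of the dual.\<close>

lemma eq_by_functionals:
  assumes "x \<in> carrier V" "y \<in> carrier V" and F: "\<Phi> \<subseteq> dual K V"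
    and sep: "\<And>a. \<lbrakk>a \<in> carrier V; \<And>f. f \<in> \<Phi> \<Longrightarrow> f a = \<zero>\<^bsub>K\<^esub>\<rbrakk> \<Longrightarrow> a = \<zero>\<^bsub>V\<^esub>"
    and eq: "\<And>f. f \<in> \<Phi> \<Longrightarrow> f x = f y"
  shows "x = y"
proof -
  have "x \<ominus>\<^bsub>V\<^esub> y = \<zero>\<^bsub>V\<^esub>"
  proof (rule sep)
    fix f assume f: "f \<in> \<Phi>"
    then have fd: "f \<in> dual K V" using F by (rule_tac subsetD)
    interpret G: vectorspace K "ground_space K" by (rule ground_vs)
    have "f (x \<ominus>\<^bsub>V\<^esub> y) = f x \<ominus>\<^bsub>ground_space K\<^esub> f y"
      by (rule hom_minus[OF fd vs_self ground_vs assms(1,2)])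
    then show "f (x \<ominus>\<^bsub>V\<^esub> y) = \<zero>\<^bsub>K\<^esub>"
      using eq[OF f] G.minus_self[of "f y"] hom_closed[OF fd assms(2)] by simp
  qed (use assms in simp)
  then show ?thesis using minus_eq_0_iff[OF assms(1,2)] by simp
qed

lemma functional_eqI:
  assumes "x \<in> carrier V" "y \<in> carrier V" "\<And>f. f \<in> dual K V \<Longrightarrow> f x = f y"
  shows "x = y"
  by (rule eq_by_functionals[OF assms(1,2) subset_refl]) (use functional_sep assms(3) in auto)

text \<open>Sums over lists, so that the number of terms of an expression can be the measure of an
  induction.\<close>

fun lsum :: "'c list \<Rightarrow> 'c" where
  "lsum [] = \<zero>\<^bsub>V\<^esub>"
| "lsum (x # xs) = x \<oplus>\<^bsub>V\<^esub> lsum xs"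

lemma lsum_closed: "set xs \<subseteq> carrier V \<Longrightarrow> lsum xs \<in> carrier V"
  by (induct xs) auto

lemma lsum_append: "\<lbrakk>set xs \<subseteq> carrier V; set ys \<subseteq> carrier V\<rbrakk> \<Longrightarrow> lsum (xs @ ys) = lsum xs \<oplus>\<^bsub>V\<^esub> lsum ys"
  by (induct xs) (auto simp: lsum_closed M.a_assoc)

end

section \<open>Bilinear maps, contractions, and functionals on a tensor product\<close>

lemma bilin_comp: "\<lbrakk>bilin K V W U b; h \<in> module_hom K U X\<rbrakk> \<Longrightarrow> bilin K V W X (\<lambda>v w. h (b v w))"
  by (rule bilinI) (rule hom_comp[OF bilin_hom2] hom_comp[OF bilin_hom1]; assumption)+

lemma bilin_subst:
  "\<lbrakk>bilin K V W U b; f \<in> module_hom K V' V; g \<in> module_hom K W' W\<rbrakk> \<Longrightarrow> bilin K V' W' U (\<lambda>v w. b (f v) (g w))"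
  by (rule bilinI) (blast intro: hom_comp[OF _ bilin_hom2] hom_comp[OF _ bilin_hom1] hom_closed)+

lemma bilin_flip: "bilin K V W U b \<Longrightarrow> bilin K W V U (\<lambda>w v. b v w)"
  unfolding bilin_def by auto

lemma bilin_cong:
  assumes b: "bilin K V W U b" and V: "vectorspace K V" and W: "vectorspace K W"
    and eq: "\<And>v w. \<lbrakk>v \<in> carrier V; w \<in> carrier W\<rbrakk> \<Longrightarrow> b v w = b' v w"
  shows "bilin K V W U b'"
proof (rule bilinI)
  show "b' v \<in> module_hom K W U" if "v \<in> carrier V" for v
    by (rule hom_cong[OF bilin_hom2[OF b that] W]) (rule eq[OF that])
  show "(\<lambda>v. b' v w) \<in> module_hom K V U" if "w \<in> carrier W" for w
    by (rule hom_cong[OF bilin_hom1[OF b that] V]) (rule eq[OF _ that])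
qed

lemma (in vectorspace) bilin_scale:
  assumes f: "f \<in> dual K X"
  shows "bilin K X V V (\<lambda>x v. f x \<odot>\<^bsub>V\<^esub> v)"
proof -
  have fc: "f x \<in> carrier K" if "x \<in> carrier X" for x
    using hom_closed[OF f that] by simp
  have "f x \<odot>\<^bsub>V\<^esub> (c \<odot>\<^bsub>V\<^esub> v) = c \<odot>\<^bsub>V\<^esub> (f x \<odot>\<^bsub>V\<^esub> v)" if "x \<in> carrier X" "c \<in> carrier K" "v \<in> carrier V" for x c v
    using that fc[OF that(1)] by (simp add: R.m_comm flip: smult_assoc1)
  then show ?thesis
    by (intro bilinI homI) (simp_all add: fc hom_add[OF f] hom_smult[OF f] smult_r_distr smult_l_distr smult_assoc1)
qed

lemma (in field) bilin_prod:
  assumes "f \<in> dual R V" "g \<in> dual R W"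
  shows "bilin R V W (ground_space R) (\<lambda>v w. f v \<otimes> g w)"
proof -
  interpret G: vectorspace R "ground_space R" by (rule ground_vs)
  have "bilin R V (ground_space R) (ground_space R) (\<lambda>x v. f x \<otimes> v)"
    using G.bilin_scale[OF assms(1)] by simp
  from bilin_subst[OF this hom_id assms(2)] show ?thesis .
qed

abbreviation form_lift where
  "form_lift K \<equiv> tensor_lift K (ground_space K)"

text \<open>This is \<open>f \<otimes> g\<close> followed by the identification of
  \<open>K \<otimes> K\<close> with \<open>K\<close>. By \<open>tensor_sep\<close> such functionals
  separate tensors, so identities between tensors are checked through \<open>ev\<close>.\<close>

definition ev ::
  "('k, 'y) ring_scheme \<Rightarrow> ('v \<Rightarrow> 'k) \<Rightarrow> ('w \<Rightarrow> 'k) \<Rightarrow> ('k, 'v, 'w) tens \<Rightarrow> 'k"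
where
  "ev K f g = form_lift K (\<lambda>a b. f a \<otimes>\<^bsub>K\<^esub> g b)"

definition contr_left ::
  "('k, 'y) ring_scheme \<Rightarrow> ('k, 'w, 'z) module_scheme \<Rightarrow> ('v \<Rightarrow> 'k) \<Rightarrow> ('k, 'v, 'w) tens \<Rightarrow> 'w"
where
  "contr_left K W f = tensor_lift K W (\<lambda>a b. f a \<odot>\<^bsub>W\<^esub> b)"

definition contr_right ::
  "('k, 'y) ring_scheme \<Rightarrow> ('k, 'v, 'z) module_scheme \<Rightarrow> ('w \<Rightarrow> 'k) \<Rightarrow> ('k, 'v, 'w) tens \<Rightarrow> 'v"
where
  "contr_right K V g = tensor_lift K V (\<lambda>a b. g b \<odot>\<^bsub>V\<^esub> a)"

context tensor_pair
begin

lemma tp_zero: "v \<in> carrier V \<Longrightarrow> v \<star> \<zero>\<^bsub>W\<^esub> = \<zero>\<^bsub>T\<^esub>" "w \<in> carrier W \<Longrightarrow> \<zero>\<^bsub>V\<^esub> \<star> w = \<zero>\<^bsub>T\<^esub>"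
  using hom_0[OF bilin_hom2[OF tp_bilin] W.vs_self tensor_vs]
    hom_0[OF bilin_hom1[OF tp_bilin] V.vs_self tensor_vs] by auto

lemmas tp_add1 = hom_add[OF bilin_hom1[OF tp_bilin]]
  and tp_add2 = hom_add[OF bilin_hom2[OF tp_bilin]]
  and tp_smult1 = hom_smult[OF bilin_hom1[OF tp_bilin]]
  and tp_smult2 = hom_smult[OF bilin_hom2[OF tp_bilin]]
  and tp_minus1 = hom_minus[OF bilin_hom1[OF tp_bilin] V.vs_self tensor_vs]

lemma lift_cong:
  assumes "vectorspace K U" "bilin K V W U b" "t \<in> carrier T"
    "\<And>v w. \<lbrakk>v \<in> carrier V; w \<in> carrier W\<rbrakk> \<Longrightarrow> b v w = b' v w"
  shows "tensor_lift K U b t = tensor_lift K U b' t"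
proof -
  have b': "bilin K V W U b'"
    by (rule bilin_cong[OF assms(2) V.vs_self W.vs_self assms(4)])
  show ?thesis
    by (rule lift_unique[OF assms(1) b' lift_hom[OF assms(1,2)] _ assms(3)])
      (simp add: lift_pure[OF assms(1,2)] assms(4))
qed

lemma hom_lift:
  assumes "vectorspace K U" "bilin K V W U b" "vectorspace K X" "h \<in> module_hom K U X" "t \<in> carrier T"
  shows "h (tensor_lift K U b t) = tensor_lift K X (\<lambda>v w. h (b v w)) t"
  by (rule lift_unique[OF assms(3) bilin_comp[OF assms(2,4)] hom_comp[OF lift_hom[OF assms(1,2)] assms(4)] _ assms(5)])
    (simp add: lift_pure[OF assms(1,2)])

text \<open>In a nested lift the inner bilinear map depends on an outer variable. Linearity in that
  variable is what the outer lift requires.\<close>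

lemma lift_param_hom:
  assumes U: "vectorspace K U" and X: "vectorspace K X"
    and b: "\<And>x. x \<in> carrier X \<Longrightarrow> bilin K V W U (b x)"
    and h: "\<And>v w. \<lbrakk>v \<in> carrier V; w \<in> carrier W\<rbrakk> \<Longrightarrow> (\<lambda>x. b x v w) \<in> module_hom K X U"
    and t: "t \<in> carrier T"
  shows "(\<lambda>x. tensor_lift K U (b x) t) \<in> module_hom K X U"
  using t
proof (induct rule: tensor_induct)
  case (pure v w)
  show ?case
    by (rule hom_cong[OF h[OF pure] X]) (simp add: lift_pure[OF U b] pure)
next
  case (add s t)
  interpret U: vectorspace K U by (rule U)
  show ?case
    by (rule hom_cong[OF U.hom_add_map[OF add(3,4)] X]) (simp add: hom_add[OF lift_hom[OF U b]] add)
qed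

lemma ev_hom: "\<lbrakk>f \<in> dual K V; g \<in> dual K W\<rbrakk> \<Longrightarrow> ev K f g \<in> dual K T"
  unfolding ev_def by (intro lift_hom V.ground_vs V.bilin_prod)

lemma ev_pure: "\<lbrakk>f \<in> dual K V; g \<in> dual K W; v \<in> carrier V; w \<in> carrier W\<rbrakk> \<Longrightarrow> ev K f g (v \<star> w) = f v \<otimes>\<^bsub>K\<^esub> g w"
  unfolding ev_def by (intro lift_pure V.ground_vs V.bilin_prod)

lemma contr_left_hom: "f \<in> dual K V \<Longrightarrow> contr_left K W f \<in> module_hom K T W"
  unfolding contr_left_def by (intro lift_hom W.vs_self W.bilin_scale)

lemma contr_left_pure: "\<lbrakk>f \<in> dual K V; v \<in> carrier V; w \<in> carrier W\<rbrakk> \<Longrightarrow> contr_left K W f (v \<star> w) = f v \<odot>\<^bsub>W\<^esub> w"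
  unfolding contr_left_def by (intro lift_pure W.vs_self W.bilin_scale)

lemma contr_right_hom: "g \<in> dual K W \<Longrightarrow> contr_right K V g \<in> module_hom K T V"
  unfolding contr_right_def by (intro lift_hom V.vs_self bilin_flip[OF V.bilin_scale])

lemma contr_right_pure: "\<lbrakk>g \<in> dual K W; v \<in> carrier V; w \<in> carrier W\<rbrakk> \<Longrightarrow> contr_right K V g (v \<star> w) = g w \<odot>\<^bsub>V\<^esub> v"
  unfolding contr_right_def by (subst lift_pure) (auto intro: V.vs_self bilin_flip[OF V.bilin_scale])

lemma ev_contr_left:
  assumes "f \<in> dual K V" "g \<in> dual K W" "t \<in> carrier T"
  shows "g (contr_left K W f t) = ev K f g t"
  by (rule tensor_hom_eq[OF hom_comp[OF contr_left_hom[OF assms(1)] assms(2)] ev_hom[OF assms(1,2)] assms(3)])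
    (use assms in \<open>auto simp: ev_pure contr_left_pure hom_smult dest: hom_closed\<close>)

lemma ev_contr_right:
  assumes "f \<in> dual K V" "g \<in> dual K W" "t \<in> carrier T"
  shows "f (contr_right K V g t) = ev K f g t"
  by (rule tensor_hom_eq[OF hom_comp[OF contr_right_hom[OF assms(2)] assms(1)] ev_hom[OF assms(1,2)] assms(3)])
    (use assms hom_closed[OF assms(1)] hom_closed[OF assms(2)] in \<open>simp add: ev_pure contr_right_pure hom_smult[OF assms(1)] V.R.m_comm\<close>)

sublocale T: vectorspace K T
  by (rule tensor_vs)

abbreviation (input) "tens L \<equiv> T.lsum (map (\<lambda>(a, b). a \<star> b) L)"

lemma tens_closed: "set L \<subseteq> carrier V \<times> carrier W \<Longrightarrow> tens L \<in> carrier T"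
  by (rule T.lsum_closed) (auto intro: tp_closed)

lemma span_tens:
  assumes A: "subspace K A V" and B: "subspace K B W" and "t \<in> T.span {a \<star> b | a b. a \<in> A \<and> b \<in> B}"
  obtains L where "set L \<subseteq> A \<times> B" "t = tens L"
proof -
  note c = V.sub_carrier[OF A] W.sub_carrier[OF B]
  let ?S = "{tens L | L. set L \<subseteq> A \<times> B}"
  have cl: "set L \<subseteq> A \<times> B \<Longrightarrow> set L \<subseteq> carrier V \<times> carrier W" for L using c by auto
  have "subspace K ?S T"
  proof (rule T.subspaceI)
    show "?S \<subseteq> carrier T" using tens_closed cl by auto
    show "\<zero>\<^bsub>T\<^esub> \<in> ?S" by (auto intro!: exI[of _ "[]"])
    fix x y assume "x \<in> ?S" "y \<in> ?S"
    then obtain L L' where L: "x = tens L" "y = tens L'" "set L \<subseteq> A \<times> B" "set L' \<subseteq> A \<times> B" by auto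
    have "tens (L @ L') = tens L \<oplus>\<^bsub>T\<^esub> tens L'"
      unfolding map_append by (rule T.lsum_append) (use L(3,4) c in \<open>auto intro!: tp_closed\<close>)
    then show "x \<oplus>\<^bsub>T\<^esub> y \<in> ?S" using L by (auto intro!: exI[of _ "L @ L'"])
  next
    fix k x assume k: "k \<in> carrier K" and "x \<in> ?S"
    then obtain L where L: "x = tens L" "set L \<subseteq> A \<times> B" by auto
    have "k \<odot>\<^bsub>T\<^esub> tens L = tens (map (\<lambda>(a, b). (k \<odot>\<^bsub>V\<^esub> a, b)) L)" using L(2)
    proof (induct L)
      case (Cons p L)
      then show ?case using k c tens_closed[OF cl, of L]
        by (auto simp: T.smult_r_distr tp_closed tp_smult1)
    qed (use k in simp)
    moreover have "set (map (\<lambda>(a, b). (k \<odot>\<^bsub>V\<^esub> a, b)) L) \<subseteq> A \<times> B"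
      using L k V.sub_smult[OF A] by auto
    ultimately show "k \<odot>\<^bsub>T\<^esub> x \<in> ?S" using L by blast
  qed
  moreover have "{a \<star> b | a b. a \<in> A \<and> b \<in> B} \<subseteq> ?S"
  proof clarify
    fix a b assume "a \<in> A" "b \<in> B"
    then show "\<exists>L. a \<star> b = tens L \<and> set L \<subseteq> A \<times> B"
      using c by (intro exI[of _ "[(a, b)]"]) (auto simp: tp_closed)
  qed
  ultimately have "T.span {a \<star> b | a b. a \<in> A \<and> b \<in> B} \<subseteq> ?S" by (rule T.span_least)
  then show ?thesis using assms(3) that by auto
qed

lemma sub_span_pure:
  assumes "subspace K A V" "subspace K B W"
  shows "subspace K (T.span {a \<star> b | a b. a \<in> A \<and> b \<in> B}) T"
  using V.sub_carrier[OF assms(1)] W.sub_carrier[OF assms(2)]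
  by (intro T.span_is_subspace) (auto intro: tp_closed)

lemma pure_in_span:
  assumes "subspace K A V" "subspace K B W" "a \<in> A" "b \<in> B"
  shows "a \<star> b \<in> T.span {a \<star> b | a b. a \<in> A \<and> b \<in> B}"
  using V.sub_carrier[OF assms(1)] W.sub_carrier[OF assms(2)] assms(3,4)
  by (intro T.span_incl) (auto intro: tp_closed)

text \<open>The induction shortens the list: a functional not vanishing on the first left entry \<open>a\<close>
  rewrites the tensor as \<open>a \<star> b\<close> with \<open>b \<in> B\<close> plus a sum of one term less.\<close>

lemma tens_in_span:
  assumes A: "subspace K A V" and B: "subspace K B W" and F: "\<Phi> \<subseteq> dual K V"
    and sep: "\<And>a. \<lbrakk>a \<in> A; \<And>f. f \<in> \<Phi> \<Longrightarrow> f a = \<zero>\<^bsub>K\<^esub>\<rbrakk> \<Longrightarrow> a = \<zero>\<^bsub>V\<^esub>"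
    and L: "set L \<subseteq> A \<times> carrier W" and cl: "\<And>f. f \<in> \<Phi> \<Longrightarrow> contr_left K W f (tens L) \<in> B"
  shows "tens L \<in> T.span {a \<star> b | a b. a \<in> A \<and> b \<in> B}"
  using L cl
proof (induct "length L" arbitrary: L)
  case 0
  then show ?case using T.sub_0[OF sub_span_pure[OF A B]] by simp
next
  case (Suc n)
  note cA = V.sub_carrier[OF A] and cB = W.sub_carrier[OF B]
  from Suc(2) obtain a b L' where L': "L = (a, b) # L'" by (cases L) auto
  then have ab: "a \<in> A" "a \<in> carrier V" "b \<in> carrier W" and len: "n = length L'"
    and L'c: "set L' \<subseteq> A \<times> carrier W" using Suc cA by auto
  have tl: "tens L' \<in> carrier T" using L'c cA by (intro tens_closed) auto
  show ?case
  proof (cases "a = \<zero>\<^bsub>V\<^esub>")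
    case True
    then have "tens L = tens L'" using L' ab tl by (simp add: tp_zero)
    then show ?thesis using Suc.hyps(1)[OF len L'c] Suc.prems(2) by simp
  next
    case False
    then obtain f where f: "f \<in> \<Phi>" "f a \<noteq> \<zero>\<^bsub>K\<^esub>" using sep ab by blast
    then have fd: "f \<in> dual K V" using F by auto
    have fa: "f x \<in> carrier K" if "x \<in> carrier V" for x using hom_closed[OF fd that] by simp
    obtain d where d: "d \<in> carrier K" "d \<otimes>\<^bsub>K\<^esub> f a = \<one>\<^bsub>K\<^esub>" using V.inverse_ex fa ab f by blast
    define \<beta> where "\<beta> = contr_left K W f (tens L)"
    have \<beta>: "\<beta> \<in> B" "\<beta> \<in> carrier W" using Suc.prems(2)[OF f(1)] cB by (auto simp: \<beta>_def)
    define L'' where "L'' = map (\<lambda>(x, y). (x \<ominus>\<^bsub>V\<^esub> (d \<otimes>\<^bsub>K\<^esub> f x) \<odot>\<^bsub>V\<^esub> a, y)) L'"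
    have L''c: "set L'' \<subseteq> A \<times> carrier W"
      using L'c d fa ab cA unfolding L''_def by (auto intro!: V.sub_minus[OF A] V.sub_smult[OF A])
    have key: "tens (map (\<lambda>(x, y). (x \<ominus>\<^bsub>V\<^esub> (d \<otimes>\<^bsub>K\<^esub> f x) \<odot>\<^bsub>V\<^esub> a, y)) M) =
        tens M \<ominus>\<^bsub>T\<^esub> (a \<star> (d \<odot>\<^bsub>W\<^esub> contr_left K W f (tens M)))" if "set M \<subseteq> A \<times> carrier W" for M
      using that
    proof (induct M)
      case Nil
      have "contr_left K W f \<zero>\<^bsub>T\<^esub> = \<zero>\<^bsub>W\<^esub>" by (rule hom_0[OF contr_left_hom[OF fd] tensor_vs W.vs_self])
      then show ?case using d ab by (simp add: tp_zero T.minus_0)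
    next
      case (Cons p M)
      obtain x y where p: "p = (x, y)" by force
      have xy: "x \<in> carrier V" "y \<in> carrier W" and Mc: "set M \<subseteq> A \<times> carrier W" using Cons(2) p cA by auto
      have tM: "tens M \<in> carrier T" using Mc cA by (intro tens_closed) auto
      have cM: "contr_left K W f (tens M) \<in> carrier W" by (rule hom_closed[OF contr_left_hom[OF fd] tM])
      have 1: "(x \<ominus>\<^bsub>V\<^esub> (d \<otimes>\<^bsub>K\<^esub> f x) \<odot>\<^bsub>V\<^esub> a) \<star> y = (x \<star> y) \<ominus>\<^bsub>T\<^esub> (a \<star> (d \<odot>\<^bsub>W\<^esub> (f x \<odot>\<^bsub>W\<^esub> y)))"
        using xy d fa ab by (simp add: tp_minus1 tp_smult1 tp_smult2 T.smult_assoc1 tp_closed)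
      have 2: "contr_left K W f (tens (p # M)) = f x \<odot>\<^bsub>W\<^esub> y \<oplus>\<^bsub>W\<^esub> contr_left K W f (tens M)"
        using xy tM p by (simp add: hom_add[OF contr_left_hom[OF fd]] contr_left_pure[OF fd] tp_closed)
      have 3: "a \<star> (d \<odot>\<^bsub>W\<^esub> (f x \<odot>\<^bsub>W\<^esub> y \<oplus>\<^bsub>W\<^esub> contr_left K W f (tens M))) =
          (a \<star> (d \<odot>\<^bsub>W\<^esub> (f x \<odot>\<^bsub>W\<^esub> y))) \<oplus>\<^bsub>T\<^esub> (a \<star> (d \<odot>\<^bsub>W\<^esub> contr_left K W f (tens M)))"
        using xy d fa ab cM by (simp add: W.smult_r_distr tp_add2)
      have 4: "(u \<ominus>\<^bsub>T\<^esub> v) \<oplus>\<^bsub>T\<^esub> (u' \<ominus>\<^bsub>T\<^esub> v') = (u \<oplus>\<^bsub>T\<^esub> u') \<ominus>\<^bsub>T\<^esub> (v \<oplus>\<^bsub>T\<^esub> v')"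
        if "u \<in> carrier T" "v \<in> carrier T" "u' \<in> carrier T" "v' \<in> carrier T" for u v u' v'
        using that by (simp add: a_minus_def T.minus_add T.a_ac)
      show ?case
        using Cons(1)[OF Mc] p 1 2 3 xy d fa ab cM tM by (simp add: 4 tp_closed)
    qed
    have tL: "tens L \<in> carrier T" using Suc.prems(1) cA by (intro tens_closed) auto
    define p where "p = a \<star> (d \<odot>\<^bsub>W\<^esub> \<beta>)"
    have p: "p \<in> carrier T" "p \<in> T.span {a \<star> b | a b. a \<in> A \<and> b \<in> B}"
      unfolding p_def using ab d \<beta> by (auto intro!: tp_closed pure_in_span[OF A B] W.sub_smult[OF B])
    \<comment> \<open>Applied to all of \<open>L\<close>, \<open>key\<close> turns the leading entry
      \<open>a\<close> into \<open>a\<close> minus \<open>d f(a)\<close> times \<open>a\<close>,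
      which is zero by the choice of \<open>d\<close>. The remaining list \<open>L''\<close> is one
      term shorter than \<open>L\<close>.\<close>
    have "tens ((\<zero>\<^bsub>V\<^esub>, b) # L'') = tens L \<ominus>\<^bsub>T\<^esub> p"
      using key[OF Suc.prems(1)] ab d fa
      by (simp add: L' L''_def p_def \<beta>_def V.minus_self)
    moreover have "tens L'' \<in> carrier T" using L''c cA by (intro tens_closed) auto
    ultimately have tL'': "tens L'' = tens L \<ominus>\<^bsub>T\<^esub> p" using ab by (simp add: tp_zero)
    have "tens L'' \<in> T.span {a \<star> b | a b. a \<in> A \<and> b \<in> B}"
    proof (rule Suc.hyps(1)[OF _ L''c])
      show "n = length L''" by (simp add: L''_def len)
      fix g assume g: "g \<in> \<Phi>"
      then have gd: "g \<in> dual K V" using F by auto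
      have "contr_left K W g p = g a \<odot>\<^bsub>W\<^esub> (d \<odot>\<^bsub>W\<^esub> \<beta>)"
        using ab d \<beta> by (simp add: p_def contr_left_pure[OF gd])
      moreover have "g a \<in> carrier K" using hom_closed[OF gd ab(2)] by simp
      ultimately have "contr_left K W g p \<in> B" using d \<beta> by (simp add: W.sub_smult[OF B])
      then show "contr_left K W g (tens L'') \<in> B"
        unfolding tL'' using Suc.prems(2)[OF g] tL p
        by (simp add: hom_minus[OF contr_left_hom[OF gd] tensor_vs W.vs_self] W.sub_minus[OF B])
    qed
    then have "tens L'' \<oplus>\<^bsub>T\<^esub> p \<in> T.span {a \<star> b | a b. a \<in> A \<and> b \<in> B}"
      using p by (intro T.sub_add[OF sub_span_pure[OF A B]])
    then show ?thesis unfolding tL'' using tL p by (simp add: T.minus_add_cancel)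
  qed
qed

text \<open>This is \<open>tens_in_span\<close> with the zero subspace as \<open>B\<close>: since
  \<open>\<Psi>\<close> separates \<open>W\<close>, every contraction by \<open>\<Phi>\<close>
  vanishes, so \<open>t\<close> lies in the span of pure tensors with right factor zero.\<close>

lemma tensor_sep:
  assumes t: "t \<in> carrier T" and F: "\<Phi> \<subseteq> dual K V" and G: "\<Psi> \<subseteq> dual K W"
    and sepF: "\<And>a. \<lbrakk>a \<in> carrier V; \<And>f. f \<in> \<Phi> \<Longrightarrow> f a = \<zero>\<^bsub>K\<^esub>\<rbrakk> \<Longrightarrow> a = \<zero>\<^bsub>V\<^esub>"
    and sepG: "\<And>a. \<lbrakk>a \<in> carrier W; \<And>f. f \<in> \<Psi> \<Longrightarrow> f a = \<zero>\<^bsub>K\<^esub>\<rbrakk> \<Longrightarrow> a = \<zero>\<^bsub>W\<^esub>"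
    and z: "\<And>f g. \<lbrakk>f \<in> \<Phi>; g \<in> \<Psi>\<rbrakk> \<Longrightarrow> ev K f g t = \<zero>\<^bsub>K\<^esub>"
  shows "t = \<zero>\<^bsub>T\<^esub>"
proof -
  obtain L where L: "set L \<subseteq> carrier V \<times> carrier W" "t = tens L"
    by (rule span_tens[OF V.subspace_carrier W.subspace_carrier span_pure[OF t]])
  have "t \<in> T.span {a \<star> b | a b. a \<in> carrier V \<and> b \<in> {\<zero>\<^bsub>W\<^esub>}}"
    unfolding L(2)
  proof (rule tens_in_span[OF V.subspace_carrier W.subspace_zero F])
    fix f assume f: "f \<in> \<Phi>"
    have "contr_left K W f t = \<zero>\<^bsub>W\<^esub>"
    proof (rule sepG)
      have fd: "f \<in> dual K V" using f F by (rule_tac subsetD)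
      show "contr_left K W f t \<in> carrier W" by (rule hom_closed[OF contr_left_hom[OF fd] t])
      show "g (contr_left K W f t) = \<zero>\<^bsub>K\<^esub>" if "g \<in> \<Psi>" for g
      proof -
        have "g \<in> dual K W" using that G by (rule_tac subsetD)
        from ev_contr_left[OF fd this t] show ?thesis using z[OF f that] by simp
      qed
    qed
    then show "contr_left K W f (tens L) \<in> {\<zero>\<^bsub>W\<^esub>}" using L by simp
  qed (use L sepF in auto)
  moreover have "T.span {a \<star> b | a b. a \<in> carrier V \<and> b \<in> {\<zero>\<^bsub>W\<^esub>}} \<subseteq> {\<zero>\<^bsub>T\<^esub>}"
    by (rule T.span_least[OF T.subspace_zero]) (auto simp: tp_zero)
  ultimately have "t \<in> {\<zero>\<^bsub>T\<^esub>}" by (rule_tac subsetD)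
  then show ?thesis by simp
qed

lemma tensor_eqI:
  assumes "s \<in> carrier T" "t \<in> carrier T" and F: "\<Phi> \<subseteq> dual K V" and G: "\<Psi> \<subseteq> dual K W"
    and sepF: "\<And>a. \<lbrakk>a \<in> carrier V; \<And>f. f \<in> \<Phi> \<Longrightarrow> f a = \<zero>\<^bsub>K\<^esub>\<rbrakk> \<Longrightarrow> a = \<zero>\<^bsub>V\<^esub>"
    and sepG: "\<And>a. \<lbrakk>a \<in> carrier W; \<And>f. f \<in> \<Psi> \<Longrightarrow> f a = \<zero>\<^bsub>K\<^esub>\<rbrakk> \<Longrightarrow> a = \<zero>\<^bsub>W\<^esub>"
    and z: "\<And>f g. \<lbrakk>f \<in> \<Phi>; g \<in> \<Psi>\<rbrakk> \<Longrightarrow> ev K f g s = ev K f g t"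
  shows "s = t"
proof -
  have "s \<ominus>\<^bsub>T\<^esub> t = \<zero>\<^bsub>T\<^esub>"
  proof (rule tensor_sep[OF _ F G sepF sepG])
    fix f g assume "f \<in> \<Phi>" "g \<in> \<Psi>"
    then have fg: "f \<in> dual K V" "g \<in> dual K W" "ev K f g s = ev K f g t" using F G z by auto
    interpret G: vectorspace K "ground_space K" by (rule V.ground_vs)
    have "ev K f g (s \<ominus>\<^bsub>T\<^esub> t) = ev K f g s \<ominus>\<^bsub>ground_space K\<^esub> ev K f g t"
      by (rule hom_minus[OF ev_hom[OF fg(1,2)] tensor_vs V.ground_vs assms(1,2)])
    also have "\<dots> = \<zero>\<^bsub>K\<^esub>"
      using G.minus_eq_0_iff[of "ev K f g t" "ev K f g t"] fg hom_closed[OF ev_hom[OF fg(1,2)] assms(2)] by simp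
    finally show "ev K f g (s \<ominus>\<^bsub>T\<^esub> t) = \<zero>\<^bsub>K\<^esub>" .
  qed (use assms in auto)
  then show ?thesis using T.minus_eq_0_iff[OF assms(1,2)] by simp
qed

end

lemma tensor_pairI: "\<lbrakk>vectorspace K V; vectorspace K W\<rbrakk> \<Longrightarrow> tensor_pair K V W"
  by (simp add: tensor_pair_def)

section \<open>Coalgebras through their dual algebras\<close>

lemma ev_cong:
  assumes P: "tensor_pair K V W" and f: "f \<in> dual K V" and g: "g \<in> dual K W" and t: "t \<in> carrier (tensor K V W)"
    and "\<And>x. x \<in> carrier V \<Longrightarrow> f x = f' x" "\<And>x. x \<in> carrier W \<Longrightarrow> g x = g' x"
  shows "ev K f g t = ev K f' g' t"
proof -
  interpret tensor_pair K V W by fact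
  show ?thesis
    unfolding ev_def by (rule lift_cong[OF V.ground_vs V.bilin_prod[OF f g] t]) (simp add: assms(5,6))
qed

context
  fixes K V W V' W' f g
  assumes P: "tensor_pair K V W" and P': "tensor_pair K V' W'"
    and f: "f \<in> module_hom K V V'" and g: "g \<in> module_hom K W W'"
begin

interpretation P: tensor_pair K V W by (rule P)
interpretation P': tensor_pair K V' W' by (rule P')

lemma tensor_map_bilin: "bilin K V W (tensor K V' W') (\<lambda>a b. pure_tensor K V' W' (f a) (g b))"
  by (rule bilin_subst[OF P'.tp_bilin f g])

lemma tensor_map_hom: "tensor_map K V' W' f g \<in> module_hom K (tensor K V W) (tensor K V' W')"
  unfolding tensor_map_def by (rule P.lift_hom[OF P'.tensor_vs tensor_map_bilin])

lemma tensor_map_pure: "\<lbrakk>v \<in> carrier V; w \<in> carrier W\<rbrakk> \<Longrightarrow>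
  tensor_map K V' W' f g (pure_tensor K V W v w) = pure_tensor K V' W' (f v) (g w)"
  unfolding tensor_map_def by (rule P.lift_pure[OF P'.tensor_vs tensor_map_bilin])

lemma lift_tensor_map:
  assumes U: "vectorspace K U" and b: "bilin K V' W' U b" and t: "t \<in> carrier (tensor K V W)"
  shows "tensor_lift K U b (tensor_map K V' W' f g t) = tensor_lift K U (\<lambda>v w. b (f v) (g w)) t"
  by (rule P.lift_unique[OF U bilin_subst[OF b f g] hom_comp[OF tensor_map_hom P'.lift_hom[OF U b]] _ t])
    (simp add: tensor_map_pure P'.lift_pure[OF U b] hom_closed[OF f] hom_closed[OF g])

lemma ev_tensor_map:
  assumes "\<phi> \<in> dual K V'" "\<psi> \<in> dual K W'" "t \<in> carrier (tensor K V W)"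
  shows "ev K \<phi> \<psi> (tensor_map K V' W' f g t) = ev K (\<lambda>x. \<phi> (f x)) (\<lambda>x. \<psi> (g x)) t"
  unfolding ev_def by (rule lift_tensor_map[OF P.V.ground_vs P.V.bilin_prod[OF assms(1,2)] assms(3)])

end

lemma ev_swap:
  assumes P: "tensor_pair K V W" and f: "f \<in> dual K V" and g: "g \<in> dual K W" and t: "t \<in> carrier (tensor K V W)"
  shows "ev K g f (tensor_swap K V W t) = ev K f g t"
    and "tensor_swap K V W t \<in> carrier (tensor K W V)"
proof -
  interpret P: tensor_pair K V W by fact
  interpret Q: tensor_pair K W V by (rule tensor_pairI[OF P.W.vs_self P.V.vs_self])
  have h: "tensor_swap K V W \<in> module_hom K (tensor K V W) (tensor K W V)"
    unfolding tensor_swap_def by (rule P.lift_hom[OF Q.tensor_vs bilin_flip[OF Q.tp_bilin]])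
  show "tensor_swap K V W t \<in> carrier (tensor K W V)" by (rule hom_closed[OF h t])
  have p: "tensor_swap K V W (pure_tensor K V W v w) = pure_tensor K W V w v" if "v \<in> carrier V" "w \<in> carrier W" for v w
    unfolding tensor_swap_def using P.lift_pure[OF Q.tensor_vs bilin_flip[OF Q.tp_bilin] that] by simp
  show "ev K g f (tensor_swap K V W t) = ev K f g t"
  proof (rule P.tensor_hom_eq[OF hom_comp[OF h Q.ev_hom[OF g f]] P.ev_hom[OF f g] t])
    fix v w assume vw: "v \<in> carrier V" "w \<in> carrier W"
    then have "f v \<in> carrier K" "g w \<in> carrier K" using hom_closed[OF f] hom_closed[OF g] by auto
    then show "ev K g f (tensor_swap K V W (pure_tensor K V W v w)) = ev K f g (pure_tensor K V W v w)"
      using vw by (simp add: p P.ev_pure[OF f g] Q.ev_pure[OF g f] P.V.R.m_comm)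
  qed
qed

context
  fixes K U V W
  assumes U: "vectorspace K U" and V: "vectorspace K V" and W: "vectorspace K W"
begin

interpretation UV: tensor_pair K U V by (rule tensor_pairI[OF U V])
interpretation VW: tensor_pair K V W by (rule tensor_pairI[OF V W])
interpretation L: tensor_pair K "tensor K U V" W by (rule tensor_pairI[OF UV.tensor_vs W])
interpretation R: tensor_pair K U "tensor K V W" by (rule tensor_pairI[OF U VW.tensor_vs])

lemma assoc_inner_bilin:
  assumes "w \<in> carrier W"
  shows "bilin K U V (tensor K U (tensor K V W)) (\<lambda>u v. pure_tensor K U (tensor K V W) u (pure_tensor K V W v w))"
  by (rule bilin_subst[OF R.tp_bilin hom_id bilin_hom1[OF VW.tp_bilin assms]])

lemma assoc_bilin:
  "bilin K (tensor K U V) W (tensor K U (tensor K V W)) (\<lambda>s w.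
    tensor_lift K (tensor K U (tensor K V W)) (\<lambda>u v. pure_tensor K U (tensor K V W) u (pure_tensor K V W v w)) s)"
proof (rule bilinI)
  fix s assume s: "s \<in> carrier (tensor K U V)"
  show "(\<lambda>w. tensor_lift K (tensor K U (tensor K V W)) (\<lambda>u v. pure_tensor K U (tensor K V W) u (pure_tensor K V W v w)) s)
    \<in> module_hom K W (tensor K U (tensor K V W))"
    by (rule UV.lift_param_hom[OF R.tensor_vs W assoc_inner_bilin _ s])
      (assumption, rule hom_comp[OF bilin_hom2[OF VW.tp_bilin] bilin_hom2[OF R.tp_bilin]])
qed (rule UV.lift_hom[OF R.tensor_vs assoc_inner_bilin])

lemma tensor_assoc_hom: "tensor_assoc K U V W \<in>
    module_hom K (tensor K (tensor K U V) W) (tensor K U (tensor K V W))"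
  unfolding tensor_assoc_def Let_def by (rule L.lift_hom[OF R.tensor_vs assoc_bilin])

lemma tensor_assoc_pure:
  assumes "u \<in> carrier U" "v \<in> carrier V" "w \<in> carrier W"
  shows "tensor_assoc K U V W (pure_tensor K (tensor K U V) W (pure_tensor K U V u v) w) =
    pure_tensor K U (tensor K V W) u (pure_tensor K V W v w)"
  unfolding tensor_assoc_def Let_def
  using L.lift_pure[OF R.tensor_vs assoc_bilin UV.tp_closed[OF assms(1,2)] assms(3)]
    UV.lift_pure[OF R.tensor_vs assoc_inner_bilin[OF assms(3)] assms(1,2)] by simp

text \<open>On pure tensors this is associativity of the multiplication in \<open>K\<close>. It
  relates the functionals that test the two sides of coassociativity.\<close>

lemma ev_assoc:
  assumes f: "f \<in> dual K U" and g: "g \<in> dual K V" and h: "h \<in> dual K W"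
    and t: "t \<in> carrier (tensor K (tensor K U V) W)"
  shows "ev K f (ev K g h) (tensor_assoc K U V W t) = ev K (ev K f g) h t"
  using t
proof (induct rule: L.tensor_induct)
  case (pure s w)
  let ?l = "\<lambda>s. ev K f (ev K g h) (tensor_assoc K U V W (pure_tensor K (tensor K U V) W s w))"
  let ?r = "\<lambda>s. ev K (ev K f g) h (pure_tensor K (tensor K U V) W s w)"
  note fc = hom_closed[OF f, simplified] and gc = hom_closed[OF g, simplified] and hc = hom_closed[OF h, simplified]
  show ?case
  proof (rule UV.tensor_hom_eq[of ?l _ ?r])
    show "?l \<in> module_hom K (tensor K U V) (ground_space K)"
      by (rule hom_comp[OF hom_comp[OF bilin_hom1[OF L.tp_bilin pure(2)] tensor_assoc_hom] R.ev_hom[OF f VW.ev_hom[OF g h]]])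
    show "?r \<in> module_hom K (tensor K U V) (ground_space K)"
      by (rule hom_comp[OF bilin_hom1[OF L.tp_bilin pure(2)] L.ev_hom[OF UV.ev_hom[OF f g] h]])
    fix u v assume uv: "u \<in> carrier U" "v \<in> carrier V"
    then show "?l (pure_tensor K U V u v) = ?r (pure_tensor K U V u v)"
      using pure fc gc hc
      by (simp add: tensor_assoc_pure R.ev_pure[OF f VW.ev_hom[OF g h]] VW.ev_pure[OF g h] VW.tp_closed
          L.ev_pure[OF UV.ev_hom[OF f g] h] UV.ev_pure[OF f g] UV.tp_closed UV.V.R.m_assoc)
  qed (rule pure(1))
next
  case (add s t)
  then show ?case
    by (simp add: hom_add[OF L.ev_hom[OF UV.ev_hom[OF f g] h]] hom_add[OF tensor_assoc_hom]
        hom_add[OF R.ev_hom[OF f VW.ev_hom[OF g h]]] hom_closed[OF tensor_assoc_hom])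
qed

end

section \<open>The convolution product on functionals and the coalgebra axioms in terms of
  it\<close>

definition conv ::
  "('k, 'y) ring_scheme \<Rightarrow> ('k, 'v, 'z) coalg_scheme \<Rightarrow> ('v \<Rightarrow> 'k) \<Rightarrow> ('v \<Rightarrow> 'k) \<Rightarrow> 'v \<Rightarrow> 'k"
where
  "conv K C f g x = ev K f g (comult C x)"

text \<open>The linear data without the axioms, so that convolution is available on an associated
  graded space before coassociativity and the counit laws are known there; \<open>coalgebraI\<close>
  then supplies them.\<close>

locale precoalgebra = vectorspace K C
  for K :: "('k, 'y) ring_scheme" and C :: "('k, 'v, 'z) coalg_scheme" +
  assumes comult_hom: "comult C \<in> module_hom K C (tensor K C C)"
    and counit_hom: "counit C \<in> dual K C"
begin

sublocale CC: tensor_pair K C C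
  by (rule tensor_pairI[OF vs_self vs_self])

lemma comult_closed: "x \<in> carrier C \<Longrightarrow> comult C x \<in> carrier (tensor K C C)"
  by (rule hom_closed[OF comult_hom])

lemma conv_dual: "\<lbrakk>f \<in> dual K C; g \<in> dual K C\<rbrakk> \<Longrightarrow> conv K C f g \<in> dual K C"
  unfolding conv_def by (rule hom_comp[OF comult_hom CC.ev_hom])

lemma conv_cong:
  assumes "f \<in> dual K C" "g \<in> dual K C" "x \<in> carrier C"
    "\<And>y. y \<in> carrier C \<Longrightarrow> f y = f' y" "\<And>y. y \<in> carrier C \<Longrightarrow> g y = g' y"
  shows "conv K C f g x = conv K C f' g' x"
  unfolding conv_def
  by (rule ev_cong[OF CC.tensor_pair_axioms assms(1,2) comult_closed[OF assms(3)] assms(4,5)])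

text \<open>Together with \<open>ev_coassoc2\<close>: the two sides of coassociativity, tested on
  three functionals, are the two bracketings of a triple convolution.\<close>

lemma ev_coassoc1:
  assumes f: "f \<in> dual K C" and g: "g \<in> dual K C" and h: "h \<in> dual K C" and x: "x \<in> carrier C"
  shows "ev K f (ev K g h) (tensor_assoc K C C C (tensor_map K (tensor K C C) C (comult C) (\<lambda>b. b) (comult C x))) =
    conv K C (conv K C f g) h x"
proof -
  interpret L: tensor_pair K "tensor K C C" C by (rule tensor_pairI[OF CC.tensor_vs vs_self])
  note P = CC.tensor_pair_axioms and Q = L.tensor_pair_axioms
  note m = hom_closed[OF tensor_map_hom[OF P Q comult_hom hom_id] comult_closed[OF x]]
  show ?thesis
    unfolding ev_assoc[OF vs_self vs_self vs_self f g h m]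
      ev_tensor_map[OF P Q comult_hom hom_id CC.ev_hom[OF f g] h comult_closed[OF x]]
    by (simp add: conv_def[abs_def])
qed

lemma ev_coassoc2:
  assumes f: "f \<in> dual K C" and g: "g \<in> dual K C" and h: "h \<in> dual K C" and x: "x \<in> carrier C"
  shows "ev K f (ev K g h) (tensor_map K C (tensor K C C) (\<lambda>a. a) (comult C) (comult C x)) =
    conv K C f (conv K C g h) x"
proof -
  interpret R: tensor_pair K C "tensor K C C" by (rule tensor_pairI[OF vs_self CC.tensor_vs])
  show ?thesis
    unfolding ev_tensor_map[OF CC.tensor_pair_axioms R.tensor_pair_axioms hom_id comult_hom f CC.ev_hom[OF g h] comult_closed[OF x]]
    by (simp add: conv_def[abs_def])
qed

lemma counit_left_ev:
  assumes g: "g \<in> dual K C" and x: "x \<in> carrier C"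
  shows "g (tensor_lift K C (\<lambda>a b. counit C a \<odot>\<^bsub>C\<^esub> b) (comult C x)) = conv K C (counit C) g x"
  using CC.ev_contr_left[OF counit_hom g comult_closed[OF x]] by (simp add: conv_def contr_left_def)

lemma counit_right_ev:
  assumes g: "g \<in> dual K C" and x: "x \<in> carrier C"
  shows "g (tensor_lift K C (\<lambda>a b. counit C b \<odot>\<^bsub>C\<^esub> a) (comult C x)) = conv K C g (counit C) x"
  using CC.ev_contr_right[OF g counit_hom comult_closed[OF x]] by (simp add: conv_def contr_right_def)

text \<open>Coassociativity is an identity in \<open>C \<otimes> (C \<otimes> C)\<close>, where the
  functionals \<open>ev K f (ev K g h)\<close> with entries in \<open>\<Phi>\<close> separate, by
  two uses of \<open>tensor_sep\<close>. So it is enough that convolution on \<open>\<Phi>\<close>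
  is associative and has the counit as its unit.\<close>

lemma coalgebraI:
  assumes F: "\<Phi> \<subseteq> dual K C"
    and sep: "\<And>a. \<lbrakk>a \<in> carrier C; \<And>f. f \<in> \<Phi> \<Longrightarrow> f a = \<zero>\<^bsub>K\<^esub>\<rbrakk> \<Longrightarrow> a = \<zero>\<^bsub>C\<^esub>"
    and assoc: "\<And>f g h x. \<lbrakk>f \<in> \<Phi>; g \<in> \<Phi>; h \<in> \<Phi>; x \<in> carrier C\<rbrakk> \<Longrightarrow>
      conv K C (conv K C f g) h x = conv K C f (conv K C g h) x"
    and unit: "\<And>f x. \<lbrakk>f \<in> \<Phi>; x \<in> carrier C\<rbrakk> \<Longrightarrow> conv K C (counit C) f x = f x"
      "\<And>f x. \<lbrakk>f \<in> \<Phi>; x \<in> carrier C\<rbrakk> \<Longrightarrow> conv K C f (counit C) x = f x"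
  shows "coalgebra K C"
proof
  have Fd: "f \<in> \<Phi> \<Longrightarrow> f \<in> dual K C" for f using F by (rule_tac subsetD)
  show "comult C \<in> module_hom K C (tensor K C C)" by (rule comult_hom)
  show "counit C \<in> dual K C" by (rule counit_hom)
  fix x assume x: "x \<in> carrier C"
  show "tensor_lift K C (\<lambda>a b. counit C a \<odot>\<^bsub>C\<^esub> b) (comult C x) = x"
  proof (rule eq_by_functionals[OF _ x F sep])
    show "tensor_lift K C (\<lambda>a b. counit C a \<odot>\<^bsub>C\<^esub> b) (comult C x) \<in> carrier C"
      by (rule hom_closed[OF CC.lift_hom[OF vs_self bilin_scale[OF counit_hom]] comult_closed[OF x]])
    show "f (tensor_lift K C (\<lambda>a b. counit C a \<odot>\<^bsub>C\<^esub> b) (comult C x)) = f x" if "f \<in> \<Phi>" for f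
      using counit_left_ev[OF Fd[OF that] x] unit(1)[OF that x] by simp
  qed
  show "tensor_lift K C (\<lambda>a b. counit C b \<odot>\<^bsub>C\<^esub> a) (comult C x) = x"
  proof (rule eq_by_functionals[OF _ x F sep])
    show "tensor_lift K C (\<lambda>a b. counit C b \<odot>\<^bsub>C\<^esub> a) (comult C x) \<in> carrier C"
      by (rule hom_closed[OF CC.lift_hom[OF vs_self bilin_flip[OF bilin_scale[OF counit_hom]]] comult_closed[OF x]])
    show "f (tensor_lift K C (\<lambda>a b. counit C b \<odot>\<^bsub>C\<^esub> a) (comult C x)) = f x" if "f \<in> \<Phi>" for f
      using counit_right_ev[OF Fd[OF that] x] unit(2)[OF that x] by simp
  qed
  interpret L: tensor_pair K "tensor K C C" C by (rule tensor_pairI[OF CC.tensor_vs vs_self])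
  interpret R: tensor_pair K C "tensor K C C" by (rule tensor_pairI[OF vs_self CC.tensor_vs])
  show "tensor_assoc K C C C (tensor_map K (tensor K C C) C (comult C) (\<lambda>b. b) (comult C x)) =
      tensor_map K C (tensor K C C) (\<lambda>a. a) (comult C) (comult C x)"
  proof (rule R.tensor_eqI[of _ _ \<Phi> "{ev K g h | g h. g \<in> \<Phi> \<and> h \<in> \<Phi>}"])
    show "tensor_assoc K C C C (tensor_map K (tensor K C C) C (comult C) (\<lambda>b. b) (comult C x))
        \<in> carrier (tensor K C (tensor K C C))"
      by (rule hom_closed[OF tensor_assoc_hom[OF vs_self vs_self vs_self]
        hom_closed[OF tensor_map_hom[OF CC.tensor_pair_axioms L.tensor_pair_axioms comult_hom hom_id] comult_closed[OF x]]])
    show "tensor_map K C (tensor K C C) (\<lambda>a. a) (comult C) (comult C x) \<in> carrier (tensor K C (tensor K C C))"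
      by (rule hom_closed[OF tensor_map_hom[OF CC.tensor_pair_axioms R.tensor_pair_axioms hom_id comult_hom] comult_closed[OF x]])
    show "{ev K g h | g h. g \<in> \<Phi> \<and> h \<in> \<Phi>} \<subseteq> dual K (tensor K C C)"
      by (auto intro: CC.ev_hom Fd)
    show "t = \<zero>\<^bsub>tensor K C C\<^esub>" if "t \<in> carrier (tensor K C C)"
      "\<And>e. e \<in> {ev K g h | g h. g \<in> \<Phi> \<and> h \<in> \<Phi>} \<Longrightarrow> e t = \<zero>\<^bsub>K\<^esub>" for t
      by (rule CC.tensor_sep[OF that(1) F F sep sep]) (use that(2) in auto)
    fix f e assume f: "f \<in> \<Phi>" and "e \<in> {ev K g h | g h. g \<in> \<Phi> \<and> h \<in> \<Phi>}"
    then obtain g h where gh: "e = ev K g h" "g \<in> \<Phi>" "h \<in> \<Phi>" by auto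
    show "ev K f e (tensor_assoc K C C C (tensor_map K (tensor K C C) C (comult C) (\<lambda>b. b) (comult C x))) =
      ev K f e (tensor_map K C (tensor K C C) (\<lambda>a. a) (comult C) (comult C x))"
      unfolding gh(1) ev_coassoc1[OF Fd[OF f] Fd[OF gh(2)] Fd[OF gh(3)] x]
        ev_coassoc2[OF Fd[OF f] Fd[OF gh(2)] Fd[OF gh(3)] x] by (rule assoc[OF f gh(2,3) x])
  qed (rule F sep; assumption)+
qed

end

sublocale coalgebra \<subseteq> precoalgebra K C
  by unfold_locales (rule comult_linear counit_linear)+

context coalgebra
begin

lemma conv_assoc:
  assumes f: "f \<in> dual K C" and g: "g \<in> dual K C" and h: "h \<in> dual K C" and x: "x \<in> carrier C"
  shows "conv K C (conv K C f g) h x = conv K C f (conv K C g h) x"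
  using ev_coassoc1[OF assms] ev_coassoc2[OF assms] coassoc[OF x] by simp

lemma conv_counit:
  assumes f: "f \<in> dual K C" and x: "x \<in> carrier C"
  shows "conv K C (counit C) f x = f x" "conv K C f (counit C) x = f x"
  using counit_left_ev[OF assms] counit_right_ev[OF assms] counit_left[OF x] counit_right[OF x] by simp_all

end

section \<open>Four-fold tensor products and coalgebra maps defined on a tensor product\<close>

context
  fixes K A B C D X q
  assumes A: "vectorspace K A" and B: "vectorspace K B" and C: "vectorspace K C" and D: "vectorspace K D"
    and X: "vectorspace K X"
    and q1: "\<And>a b. \<lbrakk>a \<in> carrier A; b \<in> carrier B\<rbrakk> \<Longrightarrow> bilin K C D X (q a b)"
    and q2: "\<And>c d. \<lbrakk>c \<in> carrier C; d \<in> carrier D\<rbrakk> \<Longrightarrow> bilin K A B X (\<lambda>a b. q a b c d)"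
begin

interpretation AB: tensor_pair K A B by (rule tensor_pairI[OF A B])
interpretation CD: tensor_pair K C D by (rule tensor_pairI[OF C D])
interpretation S: tensor_pair K "tensor K A B" "tensor K C D" by (rule tensor_pairI[OF AB.tensor_vs CD.tensor_vs])

text \<open>Lifting one pair of variables leaves a map that is bilinear in the other pair.
  \<open>tensor_middle_swap\<close> and \<open>conv2\<close> both have this nested shape.\<close>

lemma quad_inner_bilin:
  assumes t: "t \<in> carrier (tensor K C D)"
  shows "bilin K A B X (\<lambda>a b. tensor_lift K X (q a b) t)"
proof (rule bilinI)
  show "(\<lambda>b. tensor_lift K X (q a b) t) \<in> module_hom K B X" if "a \<in> carrier A" for a
    by (rule CD.lift_param_hom[OF X B q1[OF that] bilin_hom2[OF q2 that] t])
  show "(\<lambda>a. tensor_lift K X (q a b) t) \<in> module_hom K A X" if "b \<in> carrier B" for b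
    by (rule CD.lift_param_hom[OF X A q1[OF _ that] bilin_hom1[OF q2 that] t])
qed

lemma quad_bilin:
  "bilin K (tensor K A B) (tensor K C D) X (\<lambda>s t. tensor_lift K X (\<lambda>a b. tensor_lift K X (q a b) t) s)"
proof (rule bilinI)
  fix s assume s: "s \<in> carrier (tensor K A B)"
  show "(\<lambda>t. tensor_lift K X (\<lambda>a b. tensor_lift K X (q a b) t) s) \<in> module_hom K (tensor K C D) X"
    by (rule AB.lift_param_hom[OF X CD.tensor_vs quad_inner_bilin CD.lift_hom[OF X q1] s])
qed (rule AB.lift_hom[OF X quad_inner_bilin])

end

context
  fixes K A B C D
  assumes A: "vectorspace K A" and B: "vectorspace K B" and C: "vectorspace K C" and D: "vectorspace K D"
begin

interpretation AB: tensor_pair K A B by (rule tensor_pairI[OF A B])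
interpretation CD: tensor_pair K C D by (rule tensor_pairI[OF C D])
interpretation AC: tensor_pair K A C by (rule tensor_pairI[OF A C])
interpretation BD: tensor_pair K B D by (rule tensor_pairI[OF B D])
interpretation S: tensor_pair K "tensor K A B" "tensor K C D" by (rule tensor_pairI[OF AB.tensor_vs CD.tensor_vs])
interpretation Q: tensor_pair K "tensor K A C" "tensor K B D" by (rule tensor_pairI[OF AC.tensor_vs BD.tensor_vs])

lemma middle_q:
  assumes Z: "bilin K (tensor K A C) (tensor K B D) X Z"
  shows "\<lbrakk>a \<in> carrier A; b \<in> carrier B\<rbrakk> \<Longrightarrow> bilin K C D X (\<lambda>c d. Z (pure_tensor K A C a c) (pure_tensor K B D b d))"
    and "\<lbrakk>c \<in> carrier C; d \<in> carrier D\<rbrakk> \<Longrightarrow> bilin K A B X (\<lambda>a b. Z (pure_tensor K A C a c) (pure_tensor K B D b d))"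
  by (rule bilin_subst[OF Z bilin_hom2[OF AC.tp_bilin] bilin_hom2[OF BD.tp_bilin]]
      bilin_subst[OF Z bilin_hom1[OF AC.tp_bilin] bilin_hom1[OF BD.tp_bilin]]; assumption)+

lemma middle_swap_hom:
  "tensor_middle_swap K A B C D \<in> module_hom K (tensor K (tensor K A B) (tensor K C D))
    (tensor K (tensor K A C) (tensor K B D))"
  unfolding tensor_middle_swap_def Let_def
  by (rule S.lift_hom[OF Q.tensor_vs quad_bilin[OF A B C D Q.tensor_vs middle_q[OF Q.tp_bilin]]])

text \<open>Linearity moves the functional through both nested lifts down to pure tensors, where it
  splits as a product.\<close>

lemma ev_middle_swap:
  assumes F: "F \<in> dual K (tensor K A C)" and G: "G \<in> dual K (tensor K B D)"
    and s: "s \<in> carrier (tensor K A B)" and t: "t \<in> carrier (tensor K C D)"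
  shows "ev K F G (tensor_middle_swap K A B C D (pure_tensor K (tensor K A B) (tensor K C D) s t)) =
    form_lift K (\<lambda>a b. form_lift K
      (\<lambda>c d. F (pure_tensor K A C a c) \<otimes>\<^bsub>K\<^esub> G (pure_tensor K B D b d)) t) s"
proof -
  note gv = AB.V.ground_vs
  note p = AB.V.bilin_prod[OF F G]
  have 1: "tensor_middle_swap K A B C D (pure_tensor K (tensor K A B) (tensor K C D) s t) =
    tensor_lift K (tensor K (tensor K A C) (tensor K B D)) (\<lambda>a b. tensor_lift K (tensor K (tensor K A C) (tensor K B D))
      (\<lambda>c d. pure_tensor K (tensor K A C) (tensor K B D) (pure_tensor K A C a c) (pure_tensor K B D b d)) t) s"
    unfolding tensor_middle_swap_def Let_def
    by (rule S.lift_pure[OF Q.tensor_vs quad_bilin[OF A B C D Q.tensor_vs middle_q[OF Q.tp_bilin]] s t])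
  have 2: "ev K F G (tensor_lift K (tensor K (tensor K A C) (tensor K B D))
      (\<lambda>c d. pure_tensor K (tensor K A C) (tensor K B D) (pure_tensor K A C a c) (pure_tensor K B D b d)) t) =
    form_lift K (\<lambda>c d. F (pure_tensor K A C a c) \<otimes>\<^bsub>K\<^esub> G (pure_tensor K B D b d)) t"
    if ab: "a \<in> carrier A" "b \<in> carrier B" for a b
    unfolding CD.hom_lift[OF Q.tensor_vs middle_q(1)[OF Q.tp_bilin ab] gv Q.ev_hom[OF F G] t]
    by (rule CD.lift_cong[OF gv bilin_comp[OF middle_q(1)[OF Q.tp_bilin ab] Q.ev_hom[OF F G]] t])
      (simp add: Q.ev_pure[OF F G] AC.tp_closed BD.tp_closed ab)
  show ?thesis
    unfolding 1
    by (rule trans[OF AB.hom_lift[OF Q.tensor_vs quad_inner_bilin[OF A B C D Q.tensor_vs middle_q[OF Q.tp_bilin] t] gv Q.ev_hom[OF F G] s]])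
      (assumption+, rule AB.lift_cong[OF gv bilin_comp[OF quad_inner_bilin[OF A B C D Q.tensor_vs middle_q[OF Q.tp_bilin] t] Q.ev_hom[OF F G]] s 2])
qed

end

text \<open>The form \<open>f \<otimes> g\<close> applied to the product of \<open>s\<close> and
  \<open>t\<close> under the factorwise action of \<open>H \<otimes> H\<close> on
  \<open>M \<otimes> M\<close>. For \<open>s = \<Delta> h\<close> and \<open>t = \<Delta> m\<close>
  it is the value of \<open>f \<otimes> g\<close> on \<open>\<Delta> h \<Delta> m\<close>.\<close>

definition conv2 ::
  "('k, 'y) ring_scheme \<Rightarrow> ('h \<Rightarrow> 'm \<Rightarrow> 'n) \<Rightarrow> ('n \<Rightarrow> 'k) \<Rightarrow> ('n \<Rightarrow> 'k) \<Rightarrow> ('k, 'h, 'h) tens \<Rightarrow> ('k, 'm, 'm) tens \<Rightarrow> 'k"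
where
  "conv2 K \<alpha> f g s t = form_lift K
    (\<lambda>a b. form_lift K (\<lambda>c d. f (\<alpha> a c) \<otimes>\<^bsub>K\<^esub> g (\<alpha> b d)) t) s"

text \<open>Used for the action of \<open>H\<close> on \<open>M\<close>, for the multiplication of
  \<open>H\<close>, and for the operations that both induce on associated graded spaces.\<close>

locale coalgebra_action = H: coalgebra K H + M: coalgebra K M
  for K :: "('k, 'y) ring_scheme" and H :: "('k, 'h, 'z1) coalg_scheme" and M :: "('k, 'm, 'z2) coalg_scheme" +
  fixes \<alpha> :: "'h \<Rightarrow> 'm \<Rightarrow> 'm"
  assumes bil: "bilin K H M M \<alpha>"
begin

sublocale HM: tensor_pair K H M by (rule tensor_pairI[OF H.vs_self M.vs_self])

lemma act_functional: "\<lbrakk>f \<in> dual K M; h \<in> carrier H\<rbrakk> \<Longrightarrow> (\<lambda>m. f (\<alpha> h m)) \<in> dual K M"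
  by (rule hom_comp[OF bilin_hom2[OF bil]])

lemma act_functional2: "\<lbrakk>f \<in> dual K M; m \<in> carrier M\<rbrakk> \<Longrightarrow> (\<lambda>h. f (\<alpha> h m)) \<in> dual K H"
  by (rule hom_comp[OF bilin_hom1[OF bil]])

lemma conv2_q:
  assumes "f \<in> dual K M" "g \<in> dual K M"
  shows "\<lbrakk>a \<in> carrier H; b \<in> carrier H\<rbrakk> \<Longrightarrow> bilin K M M (ground_space K) (\<lambda>c d. f (\<alpha> a c) \<otimes>\<^bsub>K\<^esub> g (\<alpha> b d))"
    "\<lbrakk>c \<in> carrier M; d \<in> carrier M\<rbrakk> \<Longrightarrow> bilin K H H (ground_space K) (\<lambda>a b. f (\<alpha> a c) \<otimes>\<^bsub>K\<^esub> g (\<alpha> b d))"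
  using act_functional act_functional2 assms by (auto intro!: H.bilin_prod)

lemma conv2_bilin:
  assumes "f \<in> dual K M" "g \<in> dual K M"
  shows "bilin K (tensor K H H) (tensor K M M) (ground_space K) (conv2 K \<alpha> f g)"
  unfolding conv2_def
  by (rule quad_bilin[OF H.vs_self H.vs_self M.vs_self M.vs_self H.ground_vs conv2_q[OF assms]])

lemma conv2_comult:
  assumes f: "f \<in> dual K M" and g: "g \<in> dual K M" and s: "s \<in> carrier (tensor K H H)" and y: "y \<in> carrier M"
  shows "conv2 K \<alpha> f g s (comult M y) =
    form_lift K (\<lambda>a b. conv K M (\<lambda>m. f (\<alpha> a m)) (\<lambda>m. g (\<alpha> b m)) y) s"
  by (simp add: conv2_def conv_def ev_def)

lemma act_lift_hom: "tensor_lift K M \<alpha> \<in> module_hom K (tensor K H M) M"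
  by (rule HM.lift_hom[OF M.vs_self bil])

lemma hom_tensor_coalgebra: "module_hom K (tensor_coalgebra K H M) U = module_hom K (tensor K H M) U"
  by (simp add: module_hom_def tensor_coalgebra_def)

lemma comult_tensor_hom:
  "comult (tensor_coalgebra K H M) \<in> module_hom K (tensor K H M) (tensor K (tensor K H M) (tensor K H M))"
proof -
  interpret S: tensor_pair K "tensor K H H" "tensor K M M" by (rule tensor_pairI[OF H.CC.tensor_vs M.CC.tensor_vs])
  show ?thesis
    unfolding tensor_coalgebra_def using hom_comp[OF tensor_map_hom[OF HM.tensor_pair_axioms S.tensor_pair_axioms H.comult_hom M.comult_hom]
        middle_swap_hom[OF H.vs_self H.vs_self M.vs_self M.vs_self]] by simp
qed

lemma ev_act_comult:
  assumes f: "f \<in> dual K M" and g: "g \<in> dual K M" and h: "h \<in> carrier H" and m: "m \<in> carrier M"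
  shows "ev K f g (tensor_map K M M (tensor_lift K M \<alpha>) (tensor_lift K M \<alpha>)
      (comult (tensor_coalgebra K H M) (pure_tensor K H M h m))) = conv2 K \<alpha> f g (comult H h) (comult M m)"
proof -
  interpret S: tensor_pair K "tensor K H H" "tensor K M M" by (rule tensor_pairI[OF H.CC.tensor_vs M.CC.tensor_vs])
  interpret Q: tensor_pair K "tensor K H M" "tensor K H M" by (rule tensor_pairI[OF HM.tensor_vs HM.tensor_vs])
  let ?A = "tensor_lift K M \<alpha>"
  have 1: "comult (tensor_coalgebra K H M) (pure_tensor K H M h m) =
    tensor_middle_swap K H H M M (pure_tensor K (tensor K H H) (tensor K M M) (comult H h) (comult M m))"
    using tensor_map_pure[OF HM.tensor_pair_axioms S.tensor_pair_axioms H.comult_hom M.comult_hom h m]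
    by (simp add: tensor_coalgebra_def)
  have fA: "(\<lambda>x. f (?A x)) \<in> dual K (tensor K H M)" "(\<lambda>x. g (?A x)) \<in> dual K (tensor K H M)"
    by (rule hom_comp[OF act_lift_hom f] hom_comp[OF act_lift_hom g])+
  have c: "comult (tensor_coalgebra K H M) (pure_tensor K H M h m) \<in> carrier (tensor K (tensor K H M) (tensor K H M))"
    by (rule hom_closed[OF comult_tensor_hom HM.tp_closed[OF h m]])
  have "ev K f g (tensor_map K M M ?A ?A (comult (tensor_coalgebra K H M) (pure_tensor K H M h m))) =
    ev K (\<lambda>x. f (?A x)) (\<lambda>x. g (?A x)) (comult (tensor_coalgebra K H M) (pure_tensor K H M h m))"
    by (rule ev_tensor_map[OF Q.tensor_pair_axioms M.CC.tensor_pair_axioms act_lift_hom act_lift_hom f g c])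
  also have "\<dots> = form_lift K (\<lambda>a b. form_lift K
      (\<lambda>c d. f (?A (pure_tensor K H M a c)) \<otimes>\<^bsub>K\<^esub> g (?A (pure_tensor K H M b d))) (comult M m)) (comult H h)"
    unfolding 1 by (rule ev_middle_swap[OF H.vs_self H.vs_self M.vs_self M.vs_self fA H.comult_closed[OF h] M.comult_closed[OF m]])
  also have "\<dots> = conv2 K \<alpha> f g (comult H h) (comult M m)"
  proof -
    have i: "form_lift K
      (\<lambda>c d. f (?A (pure_tensor K H M a c)) \<otimes>\<^bsub>K\<^esub> g (?A (pure_tensor K H M b d))) (comult M m) =
      form_lift K (\<lambda>c d. f (\<alpha> a c) \<otimes>\<^bsub>K\<^esub> g (\<alpha> b d)) (comult M m)"
      if "a \<in> carrier H" "b \<in> carrier H" for a b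
      by (rule M.CC.lift_cong[OF H.ground_vs conv2_q(1)[OF f g that] M.comult_closed[OF m], symmetric])
        (simp add: HM.lift_pure[OF M.vs_self bil] that)
    show ?thesis
      unfolding conv2_def
      by (rule H.CC.lift_cong[OF H.ground_vs quad_inner_bilin[OF H.vs_self H.vs_self M.vs_self M.vs_self H.ground_vs conv2_q[OF f g]
          M.comult_closed[OF m]] H.comult_closed[OF h], symmetric]) (assumption+, rule i[symmetric])
  qed
  finally show ?thesis .
qed

lemma counit_tensor:
  "counit (tensor_coalgebra K H M) \<in> dual K (tensor K H M)"
  "\<lbrakk>h \<in> carrier H; m \<in> carrier M\<rbrakk> \<Longrightarrow>
    counit (tensor_coalgebra K H M) (pure_tensor K H M h m) = counit H h \<otimes>\<^bsub>K\<^esub> counit M m"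
  using HM.ev_hom[OF H.counit_hom M.counit_hom] HM.ev_pure[OF H.counit_hom M.counit_hom]
  by (simp_all add: tensor_coalgebra_def ev_def)

text \<open>The two composites in the definition of a coalgebra map are linear on
  \<open>H \<otimes> M\<close>, so pure tensors suffice; there the equation is tested on pairs from
  the separating set \<open>\<Phi>\<close>.\<close>

lemma coalgebra_homI:
  assumes F: "\<Phi> \<subseteq> dual K M"
    and sep: "\<And>a. \<lbrakk>a \<in> carrier M; \<And>f. f \<in> \<Phi> \<Longrightarrow> f a = \<zero>\<^bsub>K\<^esub>\<rbrakk> \<Longrightarrow> a = \<zero>\<^bsub>M\<^esub>"
    and mult: "\<And>f g h m. \<lbrakk>f \<in> \<Phi>; g \<in> \<Phi>; h \<in> carrier H; m \<in> carrier M\<rbrakk> \<Longrightarrow>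
      conv K M f g (\<alpha> h m) = conv2 K \<alpha> f g (comult H h) (comult M m)"
    and unit: "\<And>h m. \<lbrakk>h \<in> carrier H; m \<in> carrier M\<rbrakk> \<Longrightarrow> counit M (\<alpha> h m) = counit H h \<otimes>\<^bsub>K\<^esub> counit M m"
  shows "coalgebra_hom K (tensor_coalgebra K H M) M (tensor_lift K M \<alpha>)"
proof -
  interpret Q: tensor_pair K "tensor K H M" "tensor K H M" by (rule tensor_pairI[OF HM.tensor_vs HM.tensor_vs])
  let ?A = "tensor_lift K M \<alpha>"
  note Fd = subsetD[OF F]
  note h1 = hom_comp[OF act_lift_hom M.comult_hom]
  note h2 = hom_comp[OF comult_tensor_hom tensor_map_hom[OF Q.tensor_pair_axioms M.CC.tensor_pair_axioms act_lift_hom act_lift_hom]]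
  have "comult M (?A t) = tensor_map K M M ?A ?A (comult (tensor_coalgebra K H M) t)"
    if t: "t \<in> carrier (tensor K H M)" for t
  proof (rule HM.tensor_hom_eq[OF h1 h2 t])
    fix h m assume hm: "h \<in> carrier H" "m \<in> carrier M"
    note c = HM.tp_closed[OF hm]
    show "comult M (?A (pure_tensor K H M h m)) =
      tensor_map K M M ?A ?A (comult (tensor_coalgebra K H M) (pure_tensor K H M h m))"
    proof (rule M.CC.tensor_eqI[OF hom_closed[OF h1 c] hom_closed[OF h2 c] F F sep sep])
      fix f g assume fg: "f \<in> \<Phi>" "g \<in> \<Phi>"
      show "ev K f g (comult M (?A (pure_tensor K H M h m))) =
        ev K f g (tensor_map K M M ?A ?A (comult (tensor_coalgebra K H M) (pure_tensor K H M h m)))"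
        unfolding ev_act_comult[OF Fd[OF fg(1)] Fd[OF fg(2)] hm]
        using mult[OF fg hm] by (simp add: HM.lift_pure[OF M.vs_self bil hm] conv_def)
    qed
  qed
  moreover have "counit M (?A t) = counit (tensor_coalgebra K H M) t" if t: "t \<in> carrier (tensor K H M)" for t
    by (rule HM.tensor_hom_eq[OF hom_comp[OF act_lift_hom M.counit_hom] counit_tensor(1) t])
      (simp add: HM.lift_pure[OF M.vs_self bil] unit counit_tensor(2))
  ultimately show ?thesis
    unfolding coalgebra_hom_def hom_tensor_coalgebra using act_lift_hom by (simp add: tensor_coalgebra_def)
qed

lemma coalgebra_homD:
  assumes "coalgebra_hom K (tensor_coalgebra K H M) M (tensor_lift K M \<alpha>)"
    and hm: "h \<in> carrier H" "m \<in> carrier M"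
  shows "\<lbrakk>f \<in> dual K M; g \<in> dual K M\<rbrakk> \<Longrightarrow> conv K M f g (\<alpha> h m) = conv2 K \<alpha> f g (comult H h) (comult M m)"
    and "counit M (\<alpha> h m) = counit H h \<otimes>\<^bsub>K\<^esub> counit M m"
proof -
  have t: "pure_tensor K H M h m \<in> carrier (tensor_coalgebra K H M)"
    using HM.tp_closed[OF hm] by (simp add: tensor_coalgebra_def)
  note l = HM.lift_pure[OF M.vs_self bil hm]
  have c: "comult M (tensor_lift K M \<alpha> (pure_tensor K H M h m)) = tensor_map K M M (tensor_lift K M \<alpha>) (tensor_lift K M \<alpha>)
      (comult (tensor_coalgebra K H M) (pure_tensor K H M h m))"
    and e: "counit M (tensor_lift K M \<alpha> (pure_tensor K H M h m)) = counit (tensor_coalgebra K H M) (pure_tensor K H M h m)"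
    using assms(1) t unfolding coalgebra_hom_def by blast+
  show "conv K M f g (\<alpha> h m) = conv2 K \<alpha> f g (comult H h) (comult M m)" if "f \<in> dual K M" "g \<in> dual K M"
    using arg_cong[OF c, of "ev K f g"] unfolding ev_act_comult[OF that hm] l conv_def .
  show "counit M (\<alpha> h m) = counit H h \<otimes>\<^bsub>K\<^esub> counit M m"
    using e unfolding counit_tensor(2)[OF hm] l .
qed

end

section \<open>Associated graded spaces\<close>

lemma (in vectorspace) finsum_sub:
  assumes W: "subspace K W V" and f: "\<And>i. i \<in> A \<Longrightarrow> f i \<in> W"
  shows "finsum (V\<lparr>carrier := W\<rparr>) f A = finsum V f A"
  using f
proof (induct A rule: infinite_finite_induct)
  case (insert a A)
  interpret S: vectorspace K "V\<lparr>carrier := W\<rparr>" by (rule subspace_is_vs[OF W])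
  have "finsum (V\<lparr>carrier := W\<rparr>) f (insert a A) = f a \<oplus>\<^bsub>V\<^esub> finsum (V\<lparr>carrier := W\<rparr>) f A"
    using insert by (subst S.finsum_insert) auto
  moreover have "finsum V f (insert a A) = f a \<oplus>\<^bsub>V\<^esub> finsum V f A"
    using insert sub_carrier[OF W] by (subst M.finsum_insert) auto
  ultimately show ?case using insert by simp
next
  case (infinite A)
  interpret S: vectorspace K "V\<lparr>carrier := W\<rparr>" by (rule subspace_is_vs[OF W])
  show ?case using infinite S.finsum_infinite[OF infinite(1), of f] M.finsum_infinite[OF infinite(1), of f] by simp
next
  case empty
  interpret S: vectorspace K "V\<lparr>carrier := W\<rparr>" by (rule subspace_is_vs[OF W])
  show ?case using S.finsum_empty[of f] M.finsum_empty[of f] by simp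
qed

lemma coset_sub: "A +>\<^bsub>V\<lparr>carrier := W\<rparr>\<^esub> x = A +>\<^bsub>V\<^esub> x"
  by (simp add: a_r_coset_def')

text \<open>Arbitrary sequences without a support condition. They hold families of representatives
  of graded elements, and later the tuples on which comatrices act.\<close>

definition seq_space :: "('k, 'm, 'z) module_scheme \<Rightarrow> ('k, nat \<Rightarrow> 'm) module" where
  "seq_space M = \<lparr>carrier = {p. \<forall>i. p i \<in> carrier M}, mult = (\<lambda>_ _ _. \<zero>\<^bsub>M\<^esub>), one = (\<lambda>_. \<zero>\<^bsub>M\<^esub>), zero = (\<lambda>_. \<zero>\<^bsub>M\<^esub>),
     add = (\<lambda>p q i. p i \<oplus>\<^bsub>M\<^esub> q i), smult = (\<lambda>c p i. c \<odot>\<^bsub>M\<^esub> p i)\<rparr>"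

lemma seq_space_simps: "p \<in> carrier (seq_space M) \<longleftrightarrow> (\<forall>i. p i \<in> carrier M)" "zero (seq_space M) = (\<lambda>_. \<zero>\<^bsub>M\<^esub>)"
  "add (seq_space M) = (\<lambda>p q i. p i \<oplus>\<^bsub>M\<^esub> q i)" "smult (seq_space M) = (\<lambda>c p i. c \<odot>\<^bsub>M\<^esub> p i)"
  by (simp_all add: seq_space_def)

lemma seq_proj: "(\<lambda>p. p i) \<in> module_hom K (seq_space V) V"
  by (rule homI) (simp_all add: seq_space_simps)

locale filtered = vectorspace K V
  for K :: "('k, 'y) ring_scheme" and V :: "('k, 'v, 'z) module_scheme" (structure) +
  fixes P :: "nat \<Rightarrow> 'v set"
  assumes P_sub: "subspace K (P n) V"
    and P_Suc: "P (Suc n) \<subseteq> P n"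
    and P_0: "P 0 = carrier V"
begin

abbreviation (input) "G \<equiv> gr_space V P"
abbreviation (input) "cmp \<equiv> gr_component V P"
abbreviation (input) "cls \<equiv> gr_class V P"

lemma P_antimono: "i \<le> j \<Longrightarrow> P j \<subseteq> P i"
  by (rule lift_Suc_antimono_le[of P]) (rule P_Suc)

lemma P_mem_antimono: "\<lbrakk>x \<in> P j; i \<le> j\<rbrakk> \<Longrightarrow> x \<in> P i"
  using P_antimono by blast

lemma P_carrier: "x \<in> P n \<Longrightarrow> x \<in> carrier V"
  by (rule sub_carrier[OF P_sub])

lemma Pn_vs: "vectorspace K (V\<lparr>carrier := P n\<rparr>)"
  by (rule subspace_is_vs[OF P_sub])

lemma PSuc_sub: "subspace K (P (Suc n)) (V\<lparr>carrier := P n\<rparr>)"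
proof -
  interpret S: vectorspace K "V\<lparr>carrier := P n\<rparr>" by (rule Pn_vs)
  show ?thesis
    by (rule S.subspaceI) (use P_Suc sub_0[OF P_sub] sub_add[OF P_sub] sub_smult[OF P_sub] in auto)
qed

lemma comp_vs: "vectorspace K (cmp n)"
proof -
  interpret S: vectorspace K "V\<lparr>carrier := P n\<rparr>" by (rule Pn_vs)
  show ?thesis unfolding gr_component_def by (rule S.quotient_vs[OF PSuc_sub])
qed

lemma comp_proj_hom: "(\<lambda>x. P (Suc n) +> x) \<in> module_hom K (V\<lparr>carrier := P n\<rparr>) (cmp n)"
proof -
  interpret S: vectorspace K "V\<lparr>carrier := P n\<rparr>" by (rule Pn_vs)
  show ?thesis unfolding gr_component_def using S.quotient_proj_hom[OF PSuc_sub] by (simp add: coset_sub)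
qed

lemma comp_carrier: "carrier (cmp n) = {P (Suc n) +> x | x. x \<in> P n}"
proof -
  interpret S: vectorspace K "V\<lparr>carrier := P n\<rparr>" by (rule Pn_vs)
  show ?thesis unfolding gr_component_def by (simp add: S.carrier_quotient coset_sub)
qed

lemma comp_zero: "\<zero>\<^bsub>cmp n\<^esub> = P (Suc n)"
proof -
  interpret S: vectorspace K "V\<lparr>carrier := P n\<rparr>" by (rule Pn_vs)
  show ?thesis unfolding gr_component_def by (rule S.zero_quotient)
qed

lemma comp_add: "\<lbrakk>x \<in> P n; y \<in> P n\<rbrakk> \<Longrightarrow> (P (Suc n) +> x) \<oplus>\<^bsub>cmp n\<^esub> (P (Suc n) +> y) = P (Suc n) +> (x \<oplus> y)"
  using hom_add[OF comp_proj_hom, of x n y] by simp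

lemma comp_smult: "\<lbrakk>c \<in> carrier K; x \<in> P n\<rbrakk> \<Longrightarrow> c \<odot>\<^bsub>cmp n\<^esub> (P (Suc n) +> x) = P (Suc n) +> (c \<odot> x)"
  using hom_smult[OF comp_proj_hom, of c x n] by simp

lemmas P_coset_eq = coset_eq_iff[OF P_sub] and P_coset_zero = coset_eq_W_iff[OF P_sub]
  and P_coset_self = coset_self[OF P_sub] and P_mem_coset = mem_coset_iff[OF P_sub]

lemma G_carrier: "p \<in> carrier G \<longleftrightarrow> (\<forall>n. \<exists>x\<in>P n. p n = P (Suc n) +> x) \<and> finite {n. p n \<noteq> P (Suc n)}"
  by (auto simp: gr_space_def gr_support_def comp_carrier)

lemma G_ops: "(p \<oplus>\<^bsub>G\<^esub> q) n = p n \<oplus>\<^bsub>cmp n\<^esub> q n" "(c \<odot>\<^bsub>G\<^esub> p) n = c \<odot>\<^bsub>cmp n\<^esub> p n" "\<zero>\<^bsub>G\<^esub> n = P (Suc n)"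
  by (simp_all add: gr_space_def)

lemma G_comp: "p \<in> carrier G \<Longrightarrow> p n \<in> carrier (cmp n)"
  by (simp add: gr_space_def)

lemma G_vs: "vectorspace K G"
proof (rule vs_criteria)
  have fin: "finite {n. h n (p n) (q n) \<noteq> P (Suc n)}"
    if "p \<in> carrier G" "q \<in> carrier G" "\<And>n. h n (P (Suc n)) (P (Suc n)) = P (Suc n)" for p q h
  proof (rule finite_subset)
    show "{n. h n (p n) (q n) \<noteq> P (Suc n)} \<subseteq> {n. p n \<noteq> P (Suc n)} \<union> {n. q n \<noteq> P (Suc n)}"
      using that(3) by auto
    show "finite ({n. p n \<noteq> P (Suc n)} \<union> {n. q n \<noteq> P (Suc n)})"
      using that(1,2) by (simp add: G_carrier)
  qed
  have G: "p \<in> carrier G \<longleftrightarrow> (\<forall>n. p n \<in> carrier (cmp n)) \<and> finite {n. p n \<noteq> P (Suc n)}" for p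
    by (simp add: gr_space_def gr_support_def)
  interpret C: vectorspace K "cmp n" for n by (rule comp_vs)
  show "field K" ..
  show "\<zero>\<^bsub>G\<^esub> \<in> carrier G" using C.M.zero_closed by (simp add: G G_ops comp_zero)
  show "\<forall>v w. v \<in> carrier G \<and> w \<in> carrier G \<longrightarrow> v \<oplus>\<^bsub>G\<^esub> w \<in> carrier G"
    using fin[of _ _ "\<lambda>n. add (cmp n)"] C.M.r_zero[OF C.M.zero_closed] by (simp add: G G_ops comp_zero)
  show "\<forall>c v. c \<in> carrier K \<and> v \<in> carrier G \<longrightarrow> c \<odot>\<^bsub>G\<^esub> v \<in> carrier G"
    using fin[of v v "\<lambda>n a b. c \<odot>\<^bsub>cmp n\<^esub> a" for c v] C.smult_r_null by (simp add: G G_ops comp_zero)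
  then have "(\<ominus>\<^bsub>K\<^esub> \<one>\<^bsub>K\<^esub>) \<odot>\<^bsub>G\<^esub> v \<in> carrier G" if "v \<in> carrier G" for v using that by simp
  moreover have "v \<oplus>\<^bsub>G\<^esub> (\<ominus>\<^bsub>K\<^esub> \<one>\<^bsub>K\<^esub>) \<odot>\<^bsub>G\<^esub> v = \<zero>\<^bsub>G\<^esub>" if "v \<in> carrier G" for v
    using that by (simp add: G fun_eq_iff G_ops C.smult_minus_1 C.M.r_neg comp_zero)
  ultimately show "\<forall>v\<in>carrier G. \<exists>u\<in>carrier G. v \<oplus>\<^bsub>G\<^esub> u = \<zero>\<^bsub>G\<^esub>" by metis
  have z': "x \<oplus>\<^bsub>cmp n\<^esub> P (Suc n) = x" if "x \<in> carrier (cmp n)" for x n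
    using C.M.r_zero[OF that] by (simp add: comp_zero)
  show "\<forall>v\<in>carrier G. v \<oplus>\<^bsub>G\<^esub> \<zero>\<^bsub>G\<^esub> = v" by (simp add: G fun_eq_iff G_ops z')
  note r = G fun_eq_iff G_ops C.M.a_ac C.smult_assoc1 C.smult_r_distr C.smult_l_distr
  show "\<forall>v w. v \<in> carrier G \<and> w \<in> carrier G \<longrightarrow> v \<oplus>\<^bsub>G\<^esub> w = w \<oplus>\<^bsub>G\<^esub> v" by (simp add: r)
  show "\<forall>v w x. v \<in> carrier G \<and> w \<in> carrier G \<and> x \<in> carrier G \<longrightarrow>
      (v \<oplus>\<^bsub>G\<^esub> w) \<oplus>\<^bsub>G\<^esub> x = v \<oplus>\<^bsub>G\<^esub> (w \<oplus>\<^bsub>G\<^esub> x)" by (simp add: r)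
  show "\<forall>a b v. a \<in> carrier K \<and> b \<in> carrier K \<and> v \<in> carrier G \<longrightarrow>
      (a \<otimes>\<^bsub>K\<^esub> b) \<odot>\<^bsub>G\<^esub> v = a \<odot>\<^bsub>G\<^esub> (b \<odot>\<^bsub>G\<^esub> v)" by (simp add: r)
  show "\<forall>v\<in>carrier G. \<one>\<^bsub>K\<^esub> \<odot>\<^bsub>G\<^esub> v = v" by (simp add: r)
  show "\<forall>a b v. a \<in> carrier K \<and> b \<in> carrier K \<and> v \<in> carrier G \<longrightarrow>
      (a \<oplus>\<^bsub>K\<^esub> b) \<odot>\<^bsub>G\<^esub> v = (a \<odot>\<^bsub>G\<^esub> v) \<oplus>\<^bsub>G\<^esub> (b \<odot>\<^bsub>G\<^esub> v)" by (simp add: r)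
  show "\<forall>a v w. a \<in> carrier K \<and> v \<in> carrier G \<and> w \<in> carrier G \<longrightarrow>
      a \<odot>\<^bsub>G\<^esub> (v \<oplus>\<^bsub>G\<^esub> w) = (a \<odot>\<^bsub>G\<^esub> v) \<oplus>\<^bsub>G\<^esub> (a \<odot>\<^bsub>G\<^esub> w)" by (simp add: r)
qed

sublocale G: vectorspace K G by (rule G_vs)

lemma G_mem: "\<lbrakk>p \<in> carrier G; x \<in> p n\<rbrakk> \<Longrightarrow> x \<in> P n \<and> p n = P (Suc n) +> x"
proof -
  assume "p \<in> carrier G" and x: "x \<in> p n"
  then obtain y where y: "y \<in> P n" "p n = P (Suc n) +> y" by (auto simp: G_carrier)
  have xy: "x \<in> carrier V" "x \<ominus> y \<in> P (Suc n)"
    using x y P_mem_coset[OF P_carrier] by auto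
  then have "(x \<ominus> y) \<oplus> y \<in> P n"
    using P_Suc y by (intro sub_add[OF P_sub]) auto
  then show ?thesis
    using xy y P_carrier by (auto simp: minus_add_cancel P_coset_eq intro: minus_swap_in_sub[OF P_sub])
qed

text \<open>The very choice made inside \<open>gr_comult\<close>, so that
  \<open>gr_comult_alt\<close> holds by reflexivity.\<close>

definition rep :: "(nat \<Rightarrow> 'v set) \<Rightarrow> nat \<Rightarrow> 'v" where "rep p n = (SOME x. x \<in> p n)"

lemma rep_in: "p \<in> carrier G \<Longrightarrow> rep p n \<in> p n"
proof -
  assume "p \<in> carrier G"
  then obtain y where "y \<in> P n" "p n = P (Suc n) +> y" by (auto simp: G_carrier)
  then have "y \<in> p n" using P_coset_self P_carrier by auto
  then show ?thesis unfolding rep_def by (rule someI)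
qed

lemma rep_P: "p \<in> carrier G \<Longrightarrow> rep p n \<in> P n" and rep_coset: "p \<in> carrier G \<Longrightarrow> p n = P (Suc n) +> rep p n"
  using G_mem rep_in by blast+

lemma G_memD:
  assumes "p \<in> carrier G" "x \<in> p n"
  shows "x \<in> P n" "x \<in> carrier V" "p n = P (Suc n) +> x"
  using G_mem[OF assms] P_carrier[of x n] by simp_all

lemma mem_diff:
  assumes "p \<in> carrier G" "x \<in> p n" "y \<in> p n"
  shows "x \<ominus> y \<in> P (Suc n)"
proof -
  have "P (Suc n) +> x = P (Suc n) +> y"
    using G_memD(3)[OF assms(1,2)] G_memD(3)[OF assms(1,3)] by simp
  then show ?thesis
    using P_coset_eq[OF G_memD(2)[OF assms(1,2)] G_memD(2)[OF assms(1,3)]] by simp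
qed

lemma add_mem:
  assumes "p \<in> carrier G" "q \<in> carrier G" "x \<in> p n" "y \<in> q n"
  shows "x \<oplus> y \<in> (p \<oplus>\<^bsub>G\<^esub> q) n"
proof -
  note x = G_memD[OF assms(1,3)] and y = G_memD[OF assms(2,4)]
  have "(p \<oplus>\<^bsub>G\<^esub> q) n = P (Suc n) +> (x \<oplus> y)"
    unfolding G_ops using comp_add[OF x(1) y(1)] x(3) y(3) by simp
  then show ?thesis using P_coset_self[OF M.a_closed[OF x(2) y(2)]] by simp
qed

lemma smult_mem:
  assumes "p \<in> carrier G" "c \<in> carrier K" "x \<in> p n"
  shows "c \<odot> x \<in> (c \<odot>\<^bsub>G\<^esub> p) n"
proof -
  note x = G_memD[OF assms(1,3)]
  have "(c \<odot>\<^bsub>G\<^esub> p) n = P (Suc n) +> (c \<odot> x)"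
    unfolding G_ops using comp_smult[OF assms(2) x(1)] x(3) by simp
  then show ?thesis using P_coset_self[OF smult_closed[OF assms(2) x(2)]] by simp
qed

lemma cls_at: "cls n x n = P (Suc n) +> x" "i \<noteq> n \<Longrightarrow> cls n x i = P (Suc i)"
  by (simp_all add: gr_class_def)

lemma P_coset_0: "P n +> \<zero> = P n"
  using P_coset_zero[of "\<zero>" n] sub_0[OF P_sub] by simp

lemma cls_closed:
  assumes x: "x \<in> P n"
  shows "cls n x \<in> carrier G"
  unfolding G_carrier
proof (intro conjI allI)
  show "\<exists>y\<in>P i. cls n x i = P (Suc i) +> y" for i
  proof (cases "i = n")
    case True
    then show ?thesis using x by (intro bexI[of _ x]) (simp_all add: cls_at)
  next
    case False
    then show ?thesis using sub_0[OF P_sub, of i] by (intro bexI[of _ "\<zero>"]) (simp_all add: cls_at P_coset_0)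
  qed
  have "{i. cls n x i \<noteq> P (Suc i)} \<subseteq> {n}" using cls_at(2) by auto
  then show "finite {i. cls n x i \<noteq> P (Suc i)}" by (rule finite_subset) simp
qed

lemma cls_mem: "x \<in> P n \<Longrightarrow> x \<in> cls n x n" "\<lbrakk>i \<noteq> n; y \<in> cls n x i\<rbrakk> \<Longrightarrow> y \<in> P (Suc i)"
  "i \<noteq> n \<Longrightarrow> \<zero> \<in> cls n x i"
  using P_coset_self[OF P_carrier] sub_0[OF P_sub] by (simp_all add: cls_at)

lemma zero_add_P: "P (Suc n) \<oplus>\<^bsub>cmp n\<^esub> P (Suc n) = P (Suc n)" "c \<in> carrier K \<Longrightarrow> c \<odot>\<^bsub>cmp n\<^esub> P (Suc n) = P (Suc n)"
proof -
  interpret C: vectorspace K "cmp n" by (rule comp_vs)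
  show "P (Suc n) \<oplus>\<^bsub>cmp n\<^esub> P (Suc n) = P (Suc n)" using C.M.r_zero[OF C.M.zero_closed] by (simp add: comp_zero)
  show "c \<in> carrier K \<Longrightarrow> c \<odot>\<^bsub>cmp n\<^esub> P (Suc n) = P (Suc n)" using C.smult_r_null by (simp add: comp_zero)
qed

lemma cls_hom: "cls n \<in> module_hom K (V\<lparr>carrier := P n\<rparr>) G"
proof (rule homI; simp)
  show "cls n x \<in> carrier G" if "x \<in> P n" for x using that by (rule cls_closed)
  show "cls n (x \<oplus> y) = cls n x \<oplus>\<^bsub>G\<^esub> cls n y" if "x \<in> P n" "y \<in> P n" for x y
    using that by (auto simp: fun_eq_iff G_ops gr_class_def comp_add zero_add_P)
  show "cls n (c \<odot> x) = c \<odot>\<^bsub>G\<^esub> cls n x" if "c \<in> carrier K" "x \<in> P n" for c x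
    using that by (auto simp: fun_eq_iff G_ops gr_class_def comp_smult zero_add_P)
qed

lemma cls_zero_iff: "x \<in> P n \<Longrightarrow> cls n x = \<zero>\<^bsub>G\<^esub> \<longleftrightarrow> x \<in> P (Suc n)"
proof -
  assume x: "x \<in> P n"
  have "cls n x = \<zero>\<^bsub>G\<^esub> \<longleftrightarrow> P (Suc n) +> x = P (Suc n)"
    by (auto simp: fun_eq_iff G_ops gr_class_def)
  then show ?thesis using P_coset_zero P_carrier[OF x] by simp
qed

text \<open>Zero needs no case because it is the class of zero in degree 0, and a scalar multiple of
  a class is again a class.\<close>

lemma gr_induct [consumes 1, case_names cls add]:
  assumes p: "p \<in> carrier G"
    and c: "\<And>n x. x \<in> P n \<Longrightarrow> Q (cls n x)"
    and a: "\<And>p q. \<lbrakk>p \<in> carrier G; q \<in> carrier G; Q p; Q q\<rbrakk> \<Longrightarrow> Q (p \<oplus>\<^bsub>G\<^esub> q)"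
  shows "Q p"
proof -
  have "Q p" if "finite A" "p \<in> carrier G" "{n. p n \<noteq> P (Suc n)} \<subseteq> A" for A p
    using that
  proof (induct A arbitrary: p)
    case empty
    then have "p = \<zero>\<^bsub>G\<^esub>" by (auto simp: fun_eq_iff G_ops)
    moreover have "cls 0 \<zero> = \<zero>\<^bsub>G\<^esub>" using cls_zero_iff sub_0[OF P_sub] by blast
    ultimately show ?case using c[of "\<zero>" 0] sub_0[OF P_sub] by simp
  next
    case (insert n A)
    define q where "q = p(n := P (Suc n))"
    have "{i. q i \<noteq> P (Suc i)} \<subseteq> {i. p i \<noteq> P (Suc i)}" by (auto simp: q_def)
    then have fin: "finite {i. q i \<noteq> P (Suc i)}"
      by (rule finite_subset) (use insert.prems(1) in \<open>simp add: G_carrier\<close>)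
    have q: "q \<in> carrier G"
      unfolding G_carrier
    proof (intro conjI allI fin)
      fix i
      show "\<exists>x\<in>P i. q i = P (Suc i) +> x"
      proof (cases "i = n")
        case True
        then show ?thesis using sub_0[OF P_sub, of i] by (intro bexI[of _ "\<zero>"]) (simp_all add: q_def P_coset_0)
      next
        case False
        then show ?thesis using insert.prems(1) by (simp add: q_def G_carrier)
      qed
    qed
    have Qq: "Q q" by (rule insert(3)[OF q]) (use insert.prems in \<open>auto simp: q_def\<close>)
    have r: "rep p n \<in> P n" "p n = P (Suc n) +> rep p n" by (rule rep_P rep_coset, rule insert.prems(1))+
    have z: "P (Suc i) \<oplus>\<^bsub>cmp i\<^esub> p i = p i" "p i \<oplus>\<^bsub>cmp i\<^esub> P (Suc i) = p i" for i
    proof -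
      interpret C: vectorspace K "cmp i" by (rule comp_vs)
      show "P (Suc i) \<oplus>\<^bsub>cmp i\<^esub> p i = p i" "p i \<oplus>\<^bsub>cmp i\<^esub> P (Suc i) = p i"
        using C.M.l_zero[OF G_comp[OF insert.prems(1)]] C.M.r_zero[OF G_comp[OF insert.prems(1)]] by (simp_all add: comp_zero)
    qed
    have "cls n (rep p n) \<oplus>\<^bsub>G\<^esub> q = p"
    proof
      fix i
      show "(cls n (rep p n) \<oplus>\<^bsub>G\<^esub> q) i = p i"
        by (cases "i = n") (simp_all add: G_ops q_def cls_at z flip: r(2))
    qed
    then show ?case using a[OF cls_closed[OF r(1)] q c[OF r(1)] Qq] by simp
  qed
  from this[OF _ p order_refl] show ?thesis using p by (simp add: G_carrier)
qed

lemma G_carrierI: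
  assumes "\<And>n. x n \<in> P n" "\<And>n. p n = P (Suc n) +> x n" "finite S" "\<And>n. n \<notin> S \<Longrightarrow> p n = P (Suc n)"
  shows "p \<in> carrier G"
  unfolding G_carrier
proof (intro conjI allI)
  show "\<exists>x\<in>P n. p n = P (Suc n) +> x" for n by (rule bexI[where x = "x n"]) (rule assms)+
  have "{n. p n \<noteq> P (Suc n)} \<subseteq> S" using assms(4) by auto
  then show "finite {n. p n \<noteq> P (Suc n)}" by (rule finite_subset[OF _ assms(3)])
qed

lemma gr_hom_eq:
  assumes "f \<in> module_hom K G U" "g \<in> module_hom K G U" "p \<in> carrier G"
    "\<And>n x. x \<in> P n \<Longrightarrow> f (cls n x) = g (cls n x)"
  shows "f p = g p"
  using assms(3)
  by (induct rule: gr_induct) (simp_all add: assms(4) hom_add[OF assms(1)] hom_add[OF assms(2)])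

definition kills :: "nat \<Rightarrow> ('v \<Rightarrow> 'k) set" where
  "kills i = {f \<in> dual K V. \<forall>x\<in>P i. f x = \<zero>\<^bsub>K\<^esub>}"

text \<open>A functional that kills \<open>P (Suc i)\<close> induces one on
  \<open>P i / P (Suc i)\<close>; for such \<open>f\<close> this is the induced functional in degree
  \<open>i\<close>, extended by zero to the other degrees. By \<open>hf_mem\<close> any
  representative gives the same value.\<close>

definition hf :: "nat \<Rightarrow> ('v \<Rightarrow> 'k) \<Rightarrow> (nat \<Rightarrow> 'v set) \<Rightarrow> 'k" where
  "hf i f p = f (SOME x. x \<in> p i)"

lemma killsD: "f \<in> kills i \<Longrightarrow> f \<in> dual K V" "\<lbrakk>f \<in> kills i; i \<le> j; x \<in> P j\<rbrakk> \<Longrightarrow> f x = \<zero>\<^bsub>K\<^esub>"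
  using P_mem_antimono by (auto simp: kills_def)

lemma hf_mem:
  assumes f: "f \<in> kills (Suc i)" and "p \<in> carrier G" "x \<in> p i"
  shows "hf i f p = f x"
proof -
  note r = rep_in[OF assms(2), of i]
  note c = G_memD(2)[OF assms(2) r] G_memD(2)[OF assms(2,3)]
  interpret K: vectorspace K "ground_space K" by (rule ground_vs)
  have "f (rep p i) \<ominus>\<^bsub>ground_space K\<^esub> f x = \<zero>\<^bsub>K\<^esub>"
    using hom_minus[OF killsD(1)[OF f] vs_self ground_vs c] killsD(2)[OF f order_refl mem_diff[OF assms(2) r assms(3)]] by simp
  then show ?thesis
    using K.minus_eq_0_iff[of "f (rep p i)" "f x"] hom_closed[OF killsD(1)[OF f]] c by (simp add: hf_def rep_def)
qed

lemma hf_dual: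
  assumes f: "f \<in> kills (Suc i)"
  shows "hf i f \<in> dual K G"
proof (rule homI)
  note fd = killsD(1)[OF f]
  show "hf i f p \<in> carrier (ground_space K)" if p: "p \<in> carrier G" for p
    using hf_mem[OF f p rep_in[OF p]] hom_closed[OF fd P_carrier[OF rep_P[OF p]]] by simp
  show "hf i f (p \<oplus>\<^bsub>G\<^esub> q) = hf i f p \<oplus>\<^bsub>ground_space K\<^esub> hf i f q" if p: "p \<in> carrier G" and q: "q \<in> carrier G" for p q
    using hf_mem[OF f p rep_in[OF p]] hf_mem[OF f q rep_in[OF q]] hf_mem[OF f _ add_mem[OF p q rep_in[OF p] rep_in[OF q]]]
      hom_add[OF fd P_carrier[OF rep_P[OF p]] P_carrier[OF rep_P[OF q]]] p q by simp
  show "hf i f (c \<odot>\<^bsub>G\<^esub> p) = c \<odot>\<^bsub>ground_space K\<^esub> hf i f p" if c: "c \<in> carrier K" and p: "p \<in> carrier G" for c p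
    using hf_mem[OF f p rep_in[OF p]] hf_mem[OF f _ smult_mem[OF p c rep_in[OF p]]]
      hom_smult[OF fd c P_carrier[OF rep_P[OF p]]] p c by simp
qed

lemma hf_cls:
  assumes f: "f \<in> kills (Suc i)" and x: "x \<in> P n"
  shows "hf i f (cls n x) = (if n = i then f x else \<zero>\<^bsub>K\<^esub>)"
proof (cases "n = i")
  case True
  then show ?thesis using hf_mem[OF f cls_closed[OF x]] cls_mem(1)[OF x] by simp
next
  case False
  then have "hf i f (cls n x) = f \<zero>" by (intro hf_mem[OF f cls_closed[OF x]] cls_mem(3)) auto
  then show ?thesis using hom_0[OF killsD(1)[OF f] vs_self ground_vs] False by simp
qed

definition hfs :: "((nat \<Rightarrow> 'v set) \<Rightarrow> 'k) set" where
  "hfs = {hf i f | i f. f \<in> kills (Suc i)}"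

lemma hfs_dual: "hfs \<subseteq> dual K G"
  by (auto simp: hfs_def intro: hf_dual)

text \<open>Degree by degree: a representative on which every functional vanishing on
  \<open>P (Suc n)\<close> is zero lies in \<open>P (Suc n)\<close>, so the component is
  trivial.\<close>

lemma hfs_sep:
  assumes p: "p \<in> carrier G" and z: "\<And>e. e \<in> hfs \<Longrightarrow> e p = \<zero>\<^bsub>K\<^esub>"
  shows "p = \<zero>\<^bsub>G\<^esub>"
proof
  fix n
  have "rep p n \<in> P (Suc n)"
  proof (rule functional_sub[OF P_sub P_carrier[OF rep_P[OF p]]])
    fix f assume "f \<in> dual K V" "\<And>y. y \<in> P (Suc n) \<Longrightarrow> f y = \<zero>\<^bsub>K\<^esub>"
    then have f: "f \<in> kills (Suc n)" by (simp add: kills_def)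
    then show "f (rep p n) = \<zero>\<^bsub>K\<^esub>"
      using z[of "hf n f"] hf_mem[OF f p rep_in[OF p]] by (auto simp: hfs_def)
  qed
  then show "p n = \<zero>\<^bsub>G\<^esub> n"
    using rep_coset[OF p, of n] P_coset_zero[OF P_carrier[OF rep_P[OF p]]] by (simp add: G_ops)
qed

lemma gr_linear_cls:
  assumes f: "f \<in> module_hom K V V" and fP: "\<And>n x. x \<in> P n \<Longrightarrow> f x \<in> P n"
  shows "gr_linear V P f \<in> module_hom K G G" "x \<in> P n \<Longrightarrow> gr_linear V P f (cls n x) = cls n (f x)"
proof -
  have val: "gr_linear V P f p n = P (Suc n) +> f x" if p: "p \<in> carrier G" and x: "x \<in> p n" for p n x
  proof -
    note xc = G_memD(2)[OF p x]
    have "P (Suc n) +> f y = P (Suc n) +> f x" if y: "y \<in> p n" for y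
    proof -
      note yc = G_memD(2)[OF p y]
      have "f y \<ominus> f x \<in> P (Suc n)"
        using fP[OF mem_diff[OF p y x]] hom_minus[OF f vs_self vs_self yc xc] by simp
      then show ?thesis using P_coset_eq[OF hom_closed[OF f yc] hom_closed[OF f xc]] by simp
    qed
    then show ?thesis unfolding gr_linear_def using x by blast
  qed
  have cl: "gr_linear V P f p \<in> carrier G" if p: "p \<in> carrier G" for p
  proof (rule G_carrierI)
    show "f (rep p n) \<in> P n" for n by (rule fP[OF rep_P[OF p]])
    show "gr_linear V P f p n = P (Suc n) +> f (rep p n)" for n by (rule val[OF p rep_in[OF p]])
    show "finite {n. p n \<noteq> P (Suc n)}" using p by (simp add: G_carrier)
    show "gr_linear V P f p n = P (Suc n)" if "n \<notin> {n. p n \<noteq> P (Suc n)}" for n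
    proof -
      have "\<zero> \<in> p n" using that sub_0[OF P_sub] by simp
      then show ?thesis using val[OF p] P_coset_0 hom_0[OF f vs_self vs_self] by simp
    qed
  qed
  note fc = hom_closed[OF f]
  have rc: "rep p n \<in> carrier V" if "p \<in> carrier G" for p n by (rule P_carrier[OF rep_P[OF that]])
  show "gr_linear V P f \<in> module_hom K G G"
  proof (rule homI)
    show "gr_linear V P f (p \<oplus>\<^bsub>G\<^esub> q) = gr_linear V P f p \<oplus>\<^bsub>G\<^esub> gr_linear V P f q"
      if p: "p \<in> carrier G" and q: "q \<in> carrier G" for p q
    proof
      fix n
      have "gr_linear V P f (p \<oplus>\<^bsub>G\<^esub> q) n = P (Suc n) +> f (rep p n \<oplus> rep q n)"
        by (rule val[OF G.M.a_closed[OF p q] add_mem[OF p q rep_in[OF p] rep_in[OF q]]])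
      also have "\<dots> = gr_linear V P f p n \<oplus>\<^bsub>cmp n\<^esub> gr_linear V P f q n"
        using comp_add[OF fP[OF rep_P[OF p, of n]] fP[OF rep_P[OF q, of n]]]
        by (simp add: val[OF p rep_in[OF p]] val[OF q rep_in[OF q]] hom_add[OF f rc[OF p] rc[OF q]])
      finally show "gr_linear V P f (p \<oplus>\<^bsub>G\<^esub> q) n = (gr_linear V P f p \<oplus>\<^bsub>G\<^esub> gr_linear V P f q) n"
        by (subst G_ops(1))
    qed
    show "gr_linear V P f (c \<odot>\<^bsub>G\<^esub> p) = c \<odot>\<^bsub>G\<^esub> gr_linear V P f p"
      if c: "c \<in> carrier K" and p: "p \<in> carrier G" for c p
    proof
      fix n
      have "gr_linear V P f (c \<odot>\<^bsub>G\<^esub> p) n = P (Suc n) +> f (c \<odot> rep p n)"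
        by (rule val[OF G.smult_closed[OF c p] smult_mem[OF p c rep_in[OF p]]])
      also have "\<dots> = c \<odot>\<^bsub>cmp n\<^esub> gr_linear V P f p n"
        using comp_smult[OF c fP[OF rep_P[OF p, of n]]]
        by (simp add: val[OF p rep_in[OF p]] hom_smult[OF f c rc[OF p]])
      finally show "gr_linear V P f (c \<odot>\<^bsub>G\<^esub> p) n = (c \<odot>\<^bsub>G\<^esub> gr_linear V P f p) n"
        by (subst G_ops(2))
    qed
  qed (rule cl)
  show "gr_linear V P f (cls n x) = cls n (f x)" if x: "x \<in> P n"
  proof
    fix i
    show "gr_linear V P f (cls n x) i = cls n (f x) i"
    proof (cases "i = n")
      case True
      then show ?thesis using val[OF cls_closed[OF x]] cls_mem(1)[OF x] by (simp add: cls_at)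
    next
      case False
      then show ?thesis
        using val[OF cls_closed[OF x] cls_mem(3)[OF False]] hom_0[OF f vs_self vs_self]
          by (simp add: cls_at P_coset_0)
    qed
  qed
qed

end

section \<open>The bilinear operation induced on associated graded spaces\<close>

locale filtered_bilinear = H: filtered K H P + M: filtered K M Q
  for K :: "('k, 'y) ring_scheme" and H :: "('k, 'h, 'z1) module_scheme" and P
    and M :: "('k, 'm, 'z2) module_scheme" (structure) and Q +
  fixes \<beta> :: "'h \<Rightarrow> 'm \<Rightarrow> 'm"
  assumes bil: "bilin K H M M \<beta>"
    and \<beta>_PQ: "\<lbrakk>x \<in> P i; y \<in> Q j\<rbrakk> \<Longrightarrow> \<beta> x y \<in> Q (i + j)"
begin

abbreviation (input) "GH \<equiv> gr_space H P"
abbreviation (input) "GM \<equiv> gr_space M Q"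
abbreviation (input) "act_gr \<equiv> gr_bilinear M Q \<beta>"

text \<open>The usual splitting of a difference of products into \<open>\<beta> (x - x') y\<close>
  and \<open>\<beta> x' (y - y')\<close>; each summand gains one degree.\<close>

lemma \<beta>_minus:
  assumes "x \<in> P i" "y \<in> Q j" "x' \<in> P i" "y' \<in> Q j" "x \<ominus>\<^bsub>H\<^esub> x' \<in> P (Suc i)" "y \<ominus> y' \<in> Q (Suc j)"
  shows "\<beta> x y \<ominus> \<beta> x' y' \<in> Q (Suc (i + j))"
proof -
  note c = H.P_carrier[OF assms(1)] H.P_carrier[OF assms(3)] M.P_carrier[OF assms(2)] M.P_carrier[OF assms(4)]
  note bc = bilin_closed[OF bil]
  have "\<beta> (x \<ominus>\<^bsub>H\<^esub> x') y = \<beta> x y \<ominus> \<beta> x' y"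
    by (rule hom_minus[OF bilin_hom1[OF bil c(3)] H.vs_self M.vs_self c(1,2)])
  then have 1: "\<beta> x y \<ominus> \<beta> x' y \<in> Q (Suc (i + j))" using \<beta>_PQ[OF assms(5,2)] by simp
  have "\<beta> x' (y \<ominus> y') = \<beta> x' y \<ominus> \<beta> x' y'"
    by (rule hom_minus[OF bilin_hom2[OF bil c(2)] M.vs_self M.vs_self c(3,4)])
  then have 2: "\<beta> x' y \<ominus> \<beta> x' y' \<in> Q (Suc (i + j))" using \<beta>_PQ[OF assms(3,6)] by simp
  note b = bc[OF c(1,3)] bc[OF c(2,3)] bc[OF c(2,4)]
  have "(\<beta> x y \<ominus> \<beta> x' y) \<oplus> (\<beta> x' y \<ominus> \<beta> x' y') = ((\<beta> x y \<ominus> \<beta> x' y) \<oplus> \<beta> x' y) \<ominus> \<beta> x' y'"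
    using b by (simp add: a_minus_def M.M.a_assoc)
  also have "\<dots> = \<beta> x y \<ominus> \<beta> x' y'" using b by (simp add: M.minus_add_cancel)
  finally show ?thesis using M.sub_add[OF M.P_sub 1 2] by simp
qed

text \<open>The representatives are arbitrary on purpose: later they are taken to be zero outside
  the support, or inside a given stable subspace.\<close>

lemma act_gr_val:
  assumes p: "p \<in> carrier GH" and q: "q \<in> carrier GM"
    and x: "\<And>i. x i \<in> p i" and y: "\<And>i. y i \<in> q i"
  shows "act_gr p q n = Q (Suc n) +> (\<Oplus> i\<in>{..n}. \<beta> (x i) (y (n - i)))"
    and "(\<Oplus> i\<in>{..n}. \<beta> (x i) (y (n - i))) \<in> Q n"
proof -
  have xP: "x i \<in> P i" and yQ: "y i \<in> Q i" for i by (rule H.G_memD[OF p x] M.G_memD[OF q y])+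
  have bQ: "\<beta> (x i) (y (n - i)) \<in> Q n" if "i \<le> n" for i
    using \<beta>_PQ[OF xP yQ, of i "n - i"] that by simp
  then show "(\<Oplus> i\<in>{..n}. \<beta> (x i) (y (n - i))) \<in> Q n"
    by (intro M.sub_finsum[OF M.P_sub]) auto
  have i: "(\<Union>u\<in>p i. \<Union>v\<in>q (n - i). Q (Suc n) +> \<beta> u v) = Q (Suc n) +> \<beta> (x i) (y (n - i))" if "i \<le> n" for i
  proof -
    have uv: "Q (Suc n) +> \<beta> u v = Q (Suc n) +> \<beta> (x i) (y (n - i))" if u: "u \<in> p i" and v: "v \<in> q (n - i)" for u v
    proof -
      note uv = H.G_memD(1)[OF p u] M.G_memD(1)[OF q v]
      have "\<beta> u v \<ominus> \<beta> (x i) (y (n - i)) \<in> Q (Suc (i + (n - i)))"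
        by (rule \<beta>_minus[OF uv xP yQ H.mem_diff[OF p u x] M.mem_diff[OF q v y]])
      then show ?thesis
        using \<open>i \<le> n\<close> M.P_coset_eq[of "\<beta> u v" "\<beta> (x i) (y (n - i))" "Suc n"]
          bilin_closed[OF bil H.P_carrier[OF uv(1)] M.P_carrier[OF uv(2)]] M.P_carrier[OF bQ[OF \<open>i \<le> n\<close>]] by simp
    qed
    have "(\<Union>v\<in>q (n - i). Q (Suc n) +> \<beta> u v) = Q (Suc n) +> \<beta> (x i) (y (n - i))" if "u \<in> p i" for u
      by (rule UN_constant_eq[OF y[of "n - i"]]) (intro ballI uv[OF that])
    then show ?thesis by (intro UN_constant_eq[OF x[of i]] ballI)
  qed
  interpret C: vectorspace K "gr_component M Q n" by (rule M.comp_vs)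
  have bc: "Q (Suc n) +> \<beta> (x i) (y (n - i)) \<in> carrier (gr_component M Q n)" if "i \<le> n" for i
    using bQ[OF that] by (auto simp: M.comp_carrier)
  have "act_gr p q n = (\<Oplus>\<^bsub>gr_component M Q n\<^esub> i\<in>{..n}. Q (Suc n) +> \<beta> (x i) (y (n - i)))"
    unfolding gr_bilinear_def by (rule C.M.finsum_cong') (use i bc in auto)
  also have "\<dots> = Q (Suc n) +> (\<Oplus>\<^bsub>M\<lparr>carrier := Q n\<rparr>\<^esub> i\<in>{..n}. \<beta> (x i) (y (n - i)))"
    by (rule hom_finsum[OF M.comp_proj_hom M.Pn_vs M.comp_vs, symmetric]) (use bQ in auto)
  also have "(\<Oplus>\<^bsub>M\<lparr>carrier := Q n\<rparr>\<^esub> i\<in>{..n}. \<beta> (x i) (y (n - i))) = (\<Oplus> i\<in>{..n}. \<beta> (x i) (y (n - i)))"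
    by (rule M.finsum_sub[OF M.P_sub]) (use bQ in auto)
  finally show "act_gr p q n = Q (Suc n) +> (\<Oplus> i\<in>{..n}. \<beta> (x i) (y (n - i)))" .
qed

lemma act_gr_closed:
  assumes p: "p \<in> carrier GH" and q: "q \<in> carrier GM"
  shows "act_gr p q \<in> carrier GM"
proof -
  note v = act_gr_val[of p q "H.rep p" "M.rep q", OF p q H.rep_in[OF p] M.rep_in[OF q]]
  have "finite {n. p n \<noteq> P (Suc n)}" "finite {n. q n \<noteq> Q (Suc n)}" using p q by (auto simp: H.G_carrier M.G_carrier)
  then obtain a b where a: "\<And>n. p n \<noteq> P (Suc n) \<Longrightarrow> n \<le> a" and b: "\<And>n. q n \<noteq> Q (Suc n) \<Longrightarrow> n \<le> b"
    unfolding finite_nat_set_iff_bounded_le mem_Collect_eq by blast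
  have "act_gr p q n = Q (Suc n)" if n: "n > a + b" for n
  proof -
    \<comment> \<open>Zero represents every trivial component. With this choice each product in a
      degree above \<open>a + b\<close> has a zero factor.\<close>
    define x where "x i = (if p i = P (Suc i) then \<zero>\<^bsub>H\<^esub> else H.rep p i)" for i
    define y where "y i = (if q i = Q (Suc i) then \<zero> else M.rep q i)" for i
    have xx: "x i \<in> p i" for i using H.rep_in[OF p] H.sub_0[OF H.P_sub] by (auto simp: x_def)
    have yy: "y i \<in> q i" for i using M.rep_in[OF q] M.sub_0[OF M.P_sub] by (auto simp: y_def)
    have xc: "x i \<in> carrier H" and yc: "y i \<in> carrier M" for i
      by (rule H.G_memD(2)[OF p xx] M.G_memD(2)[OF q yy])+
    have "\<beta> (x i) (y (n - i)) = \<zero>" for i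
    proof (cases "i \<le> a")
      case True
      then have "\<not> n - i \<le> b" using n by simp
      then have "y (n - i) = \<zero>" using b[of "n - i"] by (cases "q (n - i) = Q (Suc (n - i))") (simp_all add: y_def)
      then show ?thesis using hom_0[OF bilin_hom2[OF bil xc] M.vs_self M.vs_self] by simp
    next
      case False
      then have "x i = \<zero>\<^bsub>H\<^esub>" using a[of i] by (auto simp: x_def)
      then show ?thesis using hom_0[OF bilin_hom1[OF bil yc] H.vs_self M.vs_self] by simp
    qed
    then have "(\<Oplus> i\<in>{..n}. \<beta> (x i) (y (n - i))) = \<zero>" by (simp add: M.M.finsum_zero)
    then show ?thesis
      using act_gr_val(1)[OF p q xx yy, of n] by (simp add: M.P_coset_0)
  qed
  then show ?thesis
    by (intro M.G_carrierI[OF v(2,1), of "{..a + b}"]) (simp_all add: not_le)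
qed

text \<open>In each degree the operation is the class of a bilinear expression \<open>?S n\<close>
  in sequences of representatives. Sums and multiples of representatives represent sums and
  multiples, so linearity is inherited from \<open>?S n\<close>.\<close>

lemma act_gr_bilin: "bilin K (GH) (GM) (GM) act_gr"
proof -
  let ?S = "\<lambda>n x y. \<Oplus> i\<in>{..n}. \<beta> (x i) (y (n - i))"
  have S: "bilin K (seq_space H) (seq_space M) M (?S n)" for n
    by (intro bilinI M.hom_finsum_map hom_comp[OF seq_proj bilin_hom1[OF bil]] hom_comp[OF seq_proj bilin_hom2[OF bil]])
      (simp_all add: seq_space_simps)
  have rH: "H.rep p \<in> carrier (seq_space H)" if "p \<in> carrier (GH)" for p
    using H.P_carrier[OF H.rep_P[OF that]] by (simp add: seq_space_simps)
  have rM: "M.rep q \<in> carrier (seq_space M)" if "q \<in> carrier (GM)" for q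
    using M.P_carrier[OF M.rep_P[OF that]] by (simp add: seq_space_simps)
  note iH = H.rep_in and iM = M.rep_in
  have v: "act_gr p q n = Q (Suc n) +> ?S n (H.rep p) (M.rep q)" "?S n (H.rep p) (M.rep q) \<in> Q n"
    if "p \<in> carrier (GH)" "q \<in> carrier (GM)" for p q n
    by (rule act_gr_val[OF that iH[OF that(1)] iM[OF that(2)]])+
  note S1 = bilin_hom1[OF S rM] and S2 = bilin_hom2[OF S rH]
  show ?thesis
  proof (intro bilinI homI)
    fix p q q' assume p: "p \<in> carrier (GH)" and q: "q \<in> carrier (GM)" and q': "q' \<in> carrier (GM)"
    show "act_gr p (q \<oplus>\<^bsub>GM\<^esub> q') = act_gr p q \<oplus>\<^bsub>GM\<^esub> act_gr p q'"
    proof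
      fix n
      have "act_gr p (q \<oplus>\<^bsub>GM\<^esub> q') n = Q (Suc n) +> ?S n (H.rep p) (\<lambda>i. M.rep q i \<oplus> M.rep q' i)"
        by (rule act_gr_val(1)[OF p M.G.M.a_closed[OF q q'] iH[OF p] M.add_mem[OF q q' iM[OF q] iM[OF q']]])
      also have "\<dots> = act_gr p q n \<oplus>\<^bsub>M.cmp n\<^esub> act_gr p q' n"
        unfolding v(1)[OF p q] v(1)[OF p q'] M.comp_add[OF v(2)[OF p q] v(2)[OF p q']]
        using hom_add[OF S2[OF p] rM[OF q] rM[OF q'], of n] by (simp add: seq_space_simps)
      finally show "act_gr p (q \<oplus>\<^bsub>GM\<^esub> q') n = (act_gr p q \<oplus>\<^bsub>GM\<^esub> act_gr p q') n" by (subst M.G_ops(1))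
    qed
  next
    fix p q c assume p: "p \<in> carrier (GH)" and c: "c \<in> carrier K" and q: "q \<in> carrier (GM)"
    show "act_gr p (c \<odot>\<^bsub>GM\<^esub> q) = c \<odot>\<^bsub>GM\<^esub> act_gr p q"
    proof
      fix n
      have "act_gr p (c \<odot>\<^bsub>GM\<^esub> q) n = Q (Suc n) +> ?S n (H.rep p) (\<lambda>i. c \<odot> M.rep q i)"
        by (rule act_gr_val(1)[OF p M.G.smult_closed[OF c q] iH[OF p] M.smult_mem[OF q c iM[OF q]]])
      also have "\<dots> = c \<odot>\<^bsub>M.cmp n\<^esub> act_gr p q n"
        unfolding v(1)[OF p q] M.comp_smult[OF c v(2)[OF p q]]
        using hom_smult[OF S2[OF p] c rM[OF q], of n] by (simp add: seq_space_simps)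
      finally show "act_gr p (c \<odot>\<^bsub>GM\<^esub> q) n = (c \<odot>\<^bsub>GM\<^esub> act_gr p q) n" by (subst M.G_ops(2))
    qed
  next
    fix p p' q assume q: "q \<in> carrier (GM)" and p: "p \<in> carrier (GH)" and p': "p' \<in> carrier (GH)"
    show "act_gr (p \<oplus>\<^bsub>GH\<^esub> p') q = act_gr p q \<oplus>\<^bsub>GM\<^esub> act_gr p' q"
    proof
      fix n
      have "act_gr (p \<oplus>\<^bsub>GH\<^esub> p') q n = Q (Suc n) +> ?S n (\<lambda>i. H.rep p i \<oplus>\<^bsub>H\<^esub> H.rep p' i) (M.rep q)"
        by (rule act_gr_val(1)[OF H.G.M.a_closed[OF p p'] q H.add_mem[OF p p' iH[OF p] iH[OF p']] iM[OF q]])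
      also have "\<dots> = act_gr p q n \<oplus>\<^bsub>M.cmp n\<^esub> act_gr p' q n"
        unfolding v(1)[OF p q] v(1)[OF p' q] M.comp_add[OF v(2)[OF p q] v(2)[OF p' q]]
        using hom_add[OF S1[OF q] rH[OF p] rH[OF p'], of n] by (simp add: seq_space_simps)
      finally show "act_gr (p \<oplus>\<^bsub>GH\<^esub> p') q n = (act_gr p q \<oplus>\<^bsub>GM\<^esub> act_gr p' q) n" by (subst M.G_ops(1))
    qed
  next
    fix p q c assume q: "q \<in> carrier (GM)" and c: "c \<in> carrier K" and p: "p \<in> carrier (GH)"
    show "act_gr (c \<odot>\<^bsub>GH\<^esub> p) q = c \<odot>\<^bsub>GM\<^esub> act_gr p q"
    proof
      fix n
      have "act_gr (c \<odot>\<^bsub>GH\<^esub> p) q n = Q (Suc n) +> ?S n (\<lambda>i. c \<odot>\<^bsub>H\<^esub> H.rep p i) (M.rep q)"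
        by (rule act_gr_val(1)[OF H.G.smult_closed[OF c p] q H.smult_mem[OF p c iH[OF p]] iM[OF q]])
      also have "\<dots> = c \<odot>\<^bsub>M.cmp n\<^esub> act_gr p q n"
        unfolding v(1)[OF p q] M.comp_smult[OF c v(2)[OF p q]]
        using hom_smult[OF S1[OF q] c rH[OF p], of n] by (simp add: seq_space_simps)
      finally show "act_gr (c \<odot>\<^bsub>GH\<^esub> p) q n = (c \<odot>\<^bsub>GM\<^esub> act_gr p q) n" by (subst M.G_ops(2))
    qed
  qed (rule act_gr_closed; assumption)+
qed

lemma act_gr_cls:
  assumes a: "a \<in> P i" and b: "b \<in> Q j"
  shows "act_gr (gr_class H P i a) (gr_class M Q j b) = gr_class M Q (i + j) (\<beta> a b)"
proof
  fix n
  define x where "x k = (if k = i then a else \<zero>\<^bsub>H\<^esub>)" for k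
  define y where "y k = (if k = j then b else \<zero>)" for k
  note p = H.cls_closed[OF a] and q = M.cls_closed[OF b]
  note ac = H.P_carrier[OF a] and bc = M.P_carrier[OF b]
  have xx: "x k \<in> gr_class H P i a k" for k using H.cls_mem(1)[OF a] H.cls_mem(3)[of k i a] by (auto simp: x_def)
  have yy: "y k \<in> gr_class M Q j b k" for k using M.cls_mem(1)[OF b] M.cls_mem(3)[of k j b] by (auto simp: y_def)
  have z: "\<beta> (x k) (y (n - k)) = (if k = i \<and> n - k = j then \<beta> a b else \<zero>)" for k
    using hom_0[OF bilin_hom2[OF bil ac] M.vs_self M.vs_self] hom_0[OF bilin_hom1[OF bil bc] H.vs_self M.vs_self]
      hom_0[OF bilin_hom1[OF bil M.M.zero_closed] H.vs_self M.vs_self] by (auto simp: x_def y_def)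
  have s: "(\<Oplus> k\<in>{..n}. \<beta> (x k) (y (n - k))) = (if n = i + j then \<beta> a b else \<zero>)"
  proof (cases "n = i + j")
    case True
    have "(\<Oplus> k\<in>{..n}. \<beta> (x k) (y (n - k))) = (\<Oplus> k\<in>{..n}. if i = k then \<beta> a b else \<zero>)"
      by (rule M.M.finsum_cong') (use z True bilin_closed[OF bil ac bc] in auto)
    also have "\<dots> = \<beta> a b" by (rule M.M.finsum_singleton) (use True bilin_closed[OF bil ac bc] in auto)
    finally show ?thesis using True by simp
  next
    case False
    have "(\<Oplus> k\<in>{..n}. \<beta> (x k) (y (n - k))) = (\<Oplus> k\<in>{..n}. \<zero>)"
      by (rule M.M.finsum_cong') (use z False in auto)
    then show ?thesis using False by (simp add: M.M.finsum_zero)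
  qed
  show "act_gr (gr_class H P i a) (gr_class M Q j b) n = gr_class M Q (i + j) (\<beta> a b) n"
    unfolding act_gr_val(1)[OF p q xx yy] s
    by (auto simp: gr_class_def M.P_coset_0)
qed

end

section \<open>The comultiplication of an associated graded coalgebra\<close>

text \<open>\<open>gr_hopf K H\<close> and \<open>gr_modcoalg K H M\<close> agree with
  \<open>gr_space\<close> in carrier, zero, addition and scalars but are records of other types.
  This and the following congruences carry statements across.\<close>

lemma tensor_cong:
  assumes "carrier V = carrier V'" "add V = add V'" "smult V = smult V'"
    "carrier W = carrier W'" "add W = add W'" "smult W = smult W'"
  shows "tensor K V W = tensor K V' W'" "pure_tensor K V W = pure_tensor K V' W'"
  unfolding tensor_def pure_tensor_def tensor_null_def tensor_relators_def assms by simp_all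

lemma module_hom_cong:
  assumes "carrier V = carrier V'" "add V = add V'" "smult V = smult V'"
    "carrier W = carrier W'" "add W = add W'" "smult W = smult W'"
  shows "module_hom K V W = module_hom K V' W'"
  unfolding module_hom_def assms by simp

lemma tensor_lift_cong:
  assumes "carrier U = carrier U'" "zero U = zero U'" "add U = add U'" "smult U = smult U'"
  shows "tensor_lift K U = tensor_lift K U'"
  unfolding tensor_lift_def[abs_def] finsum_def finprod_def by (simp only: assms monoid.simps partial_object.simps)

lemma bilin_record_cong:
  assumes "carrier V = carrier V'" "add V = add V'" "smult V = smult V'"
    "carrier W = carrier W'" "add W = add W'" "smult W = smult W'"
    "carrier U = carrier U'" "add U = add U'" "smult U = smult U'"
  shows "bilin K V W U b = bilin K V' W' U' b"
  unfolding bilin_def module_hom_def assms by simp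

lemma (in vectorspace) vs_record_cong:
  assumes "carrier V' = carrier V" "zero V' = zero V" "add V' = add V" "smult V' = smult V"
  shows "vectorspace K V'"
  by (rule vs_image[where p = "\<lambda>x. x"]) (simp_all add: assms)

locale filtered_coalgebra = coalgebra K C + filtered K C P
  for K :: "('k, 'y) ring_scheme" and C :: "('k, 'v, 'z) coalg_scheme" and P +
  assumes comult_P: "x \<in> P n \<Longrightarrow> comult C x \<in>
      LinearCombinations.module.span K (tensor K C C) {pure_tensor K C C a b | a b. \<exists>k\<le>n. a \<in> P k \<and> b \<in> P (n - k)}"
    and counit_P: "x \<in> P 1 \<Longrightarrow> counit C x = \<zero>\<^bsub>K\<^esub>"
begin

sublocale GG: tensor_pair K "gr_space C P" "gr_space C P"
  by (rule tensor_pairI[OF G_vs G_vs])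

abbreviation (input) "PP n k \<equiv> tensor K (C\<lparr>carrier := P k\<rparr>) (C\<lparr>carrier := P (n - k)\<rparr>)"
abbreviation (input) "incl \<equiv> tensor_map K C C (\<lambda>a. a) (\<lambda>b. b)"

lemma PP_pair: "tensor_pair K (C\<lparr>carrier := P k\<rparr>) (C\<lparr>carrier := P l\<rparr>)"
  by (rule tensor_pairI[OF Pn_vs Pn_vs])

lemma incl_hom: "(\<lambda>a. a) \<in> module_hom K (C\<lparr>carrier := P k\<rparr>) C"
  by (rule homI) (simp_all add: P_carrier)

lemma incl_tensor_hom: "incl \<in> module_hom K (PP n k) (tensor K C C)"
  by (rule tensor_map_hom[OF PP_pair CC.tensor_pair_axioms incl_hom incl_hom])

lemma cls_tensor_hom: "tensor_map K G G (cls k) (cls (n - k)) \<in> module_hom K (PP n k) (tensor K G G)"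
  by (rule tensor_map_hom[OF PP_pair GG.tensor_pair_axioms cls_hom cls_hom])

text \<open>The tensors that admit such a decomposition form a subspace containing every pure tensor
  of total degree \<open>n\<close>, hence the whole span in which \<open>comult_P\<close> places
  \<open>comult C x\<close>.\<close>

lemma decomposition_ex:
  assumes x: "x \<in> P n"
  shows "\<exists>t. gr_decomposition K C P n x t"
proof -
  define D where "D = {s \<in> carrier (tensor K C C). \<exists>t. (\<forall>i\<le>n. t i \<in> carrier (PP n i)) \<and> s = (\<Oplus>\<^bsub>tensor K C C\<^esub> i\<in>{..n}. incl (t i))}"
  have ic: "incl t \<in> carrier (tensor K C C)" if "t \<in> carrier (PP n i)" for t i
    by (rule hom_closed[OF incl_tensor_hom that])
  have i0: "incl \<zero>\<^bsub>PP n i\<^esub> = \<zero>\<^bsub>tensor K C C\<^esub>" for i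
    by (rule hom_0[OF incl_tensor_hom tensor_pair.tensor_vs[OF PP_pair] CC.tensor_vs])
  have z: "\<zero>\<^bsub>PP n i\<^esub> \<in> carrier (PP n i)" for i
  proof -
    interpret T: vectorspace K "PP n i" by (rule tensor_pair.tensor_vs[OF PP_pair])
    show ?thesis by simp
  qed
  have D: "subspace K D (tensor K C C)"
  proof (rule CC.T.subspaceI)
    show "D \<subseteq> carrier (tensor K C C)" by (auto simp: D_def)
    show "\<zero>\<^bsub>tensor K C C\<^esub> \<in> D"
      unfolding D_def using z i0
      by (simp add: exI[of _ "\<lambda>i. \<zero>\<^bsub>PP n i\<^esub>"] CC.T.M.finsum_zero)
  next
    fix s s' assume "s \<in> D" "s' \<in> D"
    then obtain t t' where s: "s \<in> carrier (tensor K C C)" "s' \<in> carrier (tensor K C C)" "\<forall>i\<le>n. t i \<in> carrier (PP n i)" "\<forall>i\<le>n. t' i \<in> carrier (PP n i)"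
      "s = (\<Oplus>\<^bsub>tensor K C C\<^esub> i\<in>{..n}. incl (t i))" "s' = (\<Oplus>\<^bsub>tensor K C C\<^esub> i\<in>{..n}. incl (t' i))" by (auto simp: D_def)
    have tc: "t i \<oplus>\<^bsub>PP n i\<^esub> t' i \<in> carrier (PP n i)" if "i \<le> n" for i
    proof -
      interpret T: vectorspace K "PP n i" by (rule tensor_pair.tensor_vs[OF PP_pair])
      show ?thesis using s that by simp
    qed
    have "s \<oplus>\<^bsub>tensor K C C\<^esub> s' = (\<Oplus>\<^bsub>tensor K C C\<^esub> i\<in>{..n}. incl (t i) \<oplus>\<^bsub>tensor K C C\<^esub> incl (t' i))"
      unfolding s(5,6) by (rule CC.T.M.finsum_addf[symmetric]) (use s(3,4) ic in auto)
    also have "\<dots> = (\<Oplus>\<^bsub>tensor K C C\<^esub> i\<in>{..n}. incl (t i \<oplus>\<^bsub>PP n i\<^esub> t' i))"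
    proof (rule CC.T.M.finsum_cong')
      fix i assume "i \<in> {..n}"
      then show "incl (t i) \<oplus>\<^bsub>tensor K C C\<^esub> incl (t' i) = incl (t i \<oplus>\<^bsub>PP n i\<^esub> t' i)"
        using hom_add[OF incl_tensor_hom[where n = n and k = i], of "t i" "t' i"] s(3,4) by simp
    qed (use ic tc in auto)
    finally show "s \<oplus>\<^bsub>tensor K C C\<^esub> s' \<in> D"
      unfolding D_def using CC.T.M.a_closed[OF s(1,2)] tc by (intro CollectI conjI exI[of _ "\<lambda>i. t i \<oplus>\<^bsub>PP n i\<^esub> t' i"]) simp_all
  next
    fix c s assume c: "c \<in> carrier K" and "s \<in> D"
    then obtain t where s: "s \<in> carrier (tensor K C C)" "\<forall>i\<le>n. t i \<in> carrier (PP n i)" 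
      "s = (\<Oplus>\<^bsub>tensor K C C\<^esub> i\<in>{..n}. incl (t i))" by (auto simp: D_def)
    have tc: "c \<odot>\<^bsub>PP n i\<^esub> t i \<in> carrier (PP n i)" if "i \<le> n" for i
    proof -
      interpret T: vectorspace K "PP n i" by (rule tensor_pair.tensor_vs[OF PP_pair])
      show ?thesis using s c that by simp
    qed
    have "c \<odot>\<^bsub>tensor K C C\<^esub> s = (\<Oplus>\<^bsub>tensor K C C\<^esub> i\<in>{..n}. c \<odot>\<^bsub>tensor K C C\<^esub> incl (t i))"
      unfolding s(3) by (rule hom_finsum[OF CC.T.hom_smult_map[OF hom_id c] CC.tensor_vs CC.tensor_vs]) (use s(2) ic in auto)
    also have "\<dots> = (\<Oplus>\<^bsub>tensor K C C\<^esub> i\<in>{..n}. incl (c \<odot>\<^bsub>PP n i\<^esub> t i))"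
    proof (rule CC.T.M.finsum_cong')
      fix i assume "i \<in> {..n}"
      then show "c \<odot>\<^bsub>tensor K C C\<^esub> incl (t i) = incl (c \<odot>\<^bsub>PP n i\<^esub> t i)"
        using hom_smult[OF incl_tensor_hom[where n = n and k = i] c, of "t i"] s(2) by simp
    qed (use ic tc in auto)
    finally show "c \<odot>\<^bsub>tensor K C C\<^esub> s \<in> D"
      unfolding D_def using CC.T.smult_closed[OF c s(1)] tc by (intro CollectI conjI exI[of _ "\<lambda>i. c \<odot>\<^bsub>PP n i\<^esub> t i"]) simp_all
  qed
  have "pure_tensor K C C a b \<in> D" if k: "k \<le> n" "a \<in> P k" "b \<in> P (n - k)" for a b k
  proof -
    define t where "t i = (if i = k then pure_tensor K (C\<lparr>carrier := P k\<rparr>) (C\<lparr>carrier := P (n - k)\<rparr>) a b else \<zero>\<^bsub>PP n i\<^esub>)" for i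
    have tc: "t i \<in> carrier (PP n i)" if "i \<le> n" for i
      using tensor_pair.tp_closed[OF PP_pair, of a k b "n - k"] k z by (auto simp: t_def)
    have tk: "incl (t i) = (if k = i then pure_tensor K C C a b else \<zero>\<^bsub>tensor K C C\<^esub>)" for i
      using tensor_map_pure[OF PP_pair CC.tensor_pair_axioms incl_hom incl_hom, of a k b "n - k"] k i0 by (auto simp: t_def)
    have pc: "pure_tensor K C C a b \<in> carrier (tensor K C C)" by (rule CC.tp_closed[OF P_carrier[OF k(2)] P_carrier[OF k(3)]])
    have "pure_tensor K C C a b = (\<Oplus>\<^bsub>tensor K C C\<^esub> i\<in>{..n}. if k = i then pure_tensor K C C a b else \<zero>\<^bsub>tensor K C C\<^esub>)"
      by (rule CC.T.M.finsum_singleton[symmetric]) (use k pc in auto)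
    also have "\<dots> = (\<Oplus>\<^bsub>tensor K C C\<^esub> i\<in>{..n}. incl (t i))"
      by (rule CC.T.M.finsum_cong') (use pc in \<open>auto simp: tk\<close>)
    finally show ?thesis
      unfolding D_def using pc tc by (intro CollectI conjI exI[of _ t]) simp_all
  qed
  then have "{pure_tensor K C C a b | a b. \<exists>k\<le>n. a \<in> P k \<and> b \<in> P (n - k)} \<subseteq> D" by auto
  then have "CC.T.span {pure_tensor K C C a b | a b. \<exists>k\<le>n. a \<in> P k \<and> b \<in> P (n - k)} \<subseteq> D" by (rule CC.T.span_least[OF D])
  then have "comult C x \<in> D" using comult_P[OF x] by (rule subsetD)
  then show ?thesis unfolding gr_decomposition_def D_def by auto
qed

text \<open>The graded tensor produced by one particular decomposition. It is named so that
  different decompositions can be compared, as \<open>gr_comult\<close> picks one by choice.\<close>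

definition grT :: "nat \<Rightarrow> (nat \<Rightarrow> ('k, 'v, 'v) tens) \<Rightarrow> ('k, nat \<Rightarrow> 'v set, nat \<Rightarrow> 'v set) tens" where
  "grT n t = (\<Oplus>\<^bsub>tensor K G G\<^esub> i\<in>{..n}. tensor_map K G G (cls i) (cls (n - i)) (t i))"

lemma grT_closed:
  assumes "gr_decomposition K C P n x t"
  shows "grT n t \<in> carrier (tensor K G G)"
  unfolding grT_def using assms hom_closed[OF cls_tensor_hom]
  by (intro GG.T.M.finsum_closed) (auto simp: gr_decomposition_def)

text \<open>Transfers computations from the graded space to \<open>C\<close>. The lift of the graded
  tensor is a sum over bidegrees, and in each of them agreement of \<open>B\<close> on classes with
  \<open>b\<close> on representatives makes the summands equal, whatever decomposition is
  used.\<close>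

lemma lift_grT:
  assumes t: "gr_decomposition K C P n x t" and U: "vectorspace K U" and B: "bilin K G G U B" and b: "bilin K C C U b"
    and eq: "\<And>k a a'. \<lbrakk>k \<le> n; a \<in> P k; a' \<in> P (n - k)\<rbrakk> \<Longrightarrow> B (cls k a) (cls (n - k) a') = b a a'"
  shows "tensor_lift K U B (grT n t) = tensor_lift K U b (comult C x)"
proof -
  interpret U: vectorspace K U by (rule U)
  have tc: "t i \<in> carrier (PP n i)" if "i \<le> n" for i using t that by (simp add: gr_decomposition_def)
  have bi: "bilin K (C\<lparr>carrier := P i\<rparr>) (C\<lparr>carrier := P j\<rparr>) U b" for i j by (rule bilin_subst[OF b incl_hom incl_hom])
  have "tensor_lift K U B (grT n t) = (\<Oplus>\<^bsub>U\<^esub> i\<in>{..n}. tensor_lift K U B (tensor_map K G G (cls i) (cls (n - i)) (t i)))"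
    unfolding grT_def by (rule hom_finsum[OF GG.lift_hom[OF U B] GG.tensor_vs U]) (rule hom_closed[OF cls_tensor_hom tc], simp)
  also have "\<dots> = (\<Oplus>\<^bsub>U\<^esub> i\<in>{..n}. tensor_lift K U b (incl (t i)))"
  proof (rule U.M.finsum_cong')
    fix i assume "i \<in> {..n}"
    then have i: "i \<le> n" by simp
    interpret T: tensor_pair K "C\<lparr>carrier := P i\<rparr>" "C\<lparr>carrier := P (n - i)\<rparr>" by (rule PP_pair)
    have "tensor_lift K U B (tensor_map K G G (cls i) (cls (n - i)) (t i)) = tensor_lift K U (\<lambda>v w. B (cls i v) (cls (n - i) w)) (t i)"
      by (rule lift_tensor_map[OF PP_pair GG.tensor_pair_axioms cls_hom cls_hom U B tc[OF i]])
    also have "\<dots> = tensor_lift K U b (t i)"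
      by (rule T.lift_cong[OF U bilin_subst[OF B cls_hom cls_hom] tc[OF i]]) (rule eq[OF i], simp_all)
    also have "\<dots> = tensor_lift K U b (incl (t i))"
      by (rule lift_tensor_map[OF PP_pair CC.tensor_pair_axioms incl_hom incl_hom U b tc[OF i], symmetric])
    finally show "tensor_lift K U B (tensor_map K G G (cls i) (cls (n - i)) (t i)) = tensor_lift K U b (incl (t i))" .
  qed (use hom_closed[OF CC.lift_hom[OF U b] hom_closed[OF incl_tensor_hom tc]] in auto)
  also have "\<dots> = tensor_lift K U b (\<Oplus>\<^bsub>tensor K C C\<^esub> i\<in>{..n}. incl (t i))"
    by (rule hom_finsum[OF CC.lift_hom[OF U b] CC.tensor_vs U, symmetric]) (rule hom_closed[OF incl_tensor_hom tc], simp)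
  finally show ?thesis using t by (simp add: gr_decomposition_def)
qed

text \<open>In a pure tensor of total degree \<open>i + j + 1\<close> either the left factor has
  degree above \<open>i\<close> or the right one has degree above \<open>j\<close>; so
  \<open>f\<close> or \<open>g\<close> kills its factor.\<close>

lemma conv_kills:
  assumes f: "f \<in> kills (Suc i)" and g: "g \<in> kills (Suc j)"
  shows "conv K C f g \<in> kills (Suc (i + j))"
proof -
  note fd = killsD(1)[OF f] killsD(1)[OF g]
  have "conv K C f g x = \<zero>\<^bsub>K\<^esub>" if x: "x \<in> P (Suc (i + j))" for x
    unfolding conv_def
  proof (rule hom_span_eq[OF CC.ev_hom[OF fd] vectorspace.hom_zero_map[OF ground_vs, simplified] CC.tensor_vs ground_vs _ _ comult_P[OF x]])
    show "{pure_tensor K C C a b | a b. \<exists>k\<le>Suc (i + j). a \<in> P k \<and> b \<in> P (Suc (i + j) - k)} \<subseteq> carrier (tensor K C C)"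
      using CC.tp_closed P_carrier by auto
    fix s assume "s \<in> {pure_tensor K C C a b | a b. \<exists>k\<le>Suc (i + j). a \<in> P k \<and> b \<in> P (Suc (i + j) - k)}"
    then obtain a b k where s: "s = pure_tensor K C C a b" "k \<le> Suc (i + j)" "a \<in> P k" "b \<in> P (Suc (i + j) - k)" by auto
    note c = P_carrier[OF s(3)] P_carrier[OF s(4)]
    note fc = hom_closed[OF fd(1) c(1)] hom_closed[OF fd(2) c(2)]
    have "f a \<otimes>\<^bsub>K\<^esub> g b = \<zero>\<^bsub>K\<^esub>"
    proof (cases "Suc i \<le> k")
      case True
      then show ?thesis using killsD(2)[OF f True s(3)] fc by simp
    next
      case False
      then show ?thesis using killsD(2)[OF g _ s(4)] fc by simp
    qed
    then show "ev K f g s = \<zero>\<^bsub>K\<^esub>" using CC.ev_pure[OF fd c] s(1) by simp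
  qed
  then show ?thesis using conv_dual[OF fd] by (simp add: kills_def)
qed

text \<open>For \<open>n = i + j\<close> the graded form and \<open>f \<otimes> g\<close> agree in
  every bidegree \<open>(k, n - k)\<close>: clearly for \<open>k = i\<close>, and otherwise both
  vanish, because \<open>f\<close> kills the left factor if \<open>k > i\<close> and
  \<open>g\<close> the right one if \<open>k < i\<close>. For other \<open>n\<close> no bidegree
  matches. The value does not involve \<open>t\<close>, which yields independence of all
  choices.\<close>

lemma ev_grT:
  assumes f: "f \<in> kills (Suc i)" and g: "g \<in> kills (Suc j)" and t: "gr_decomposition K C P n x t" and x: "x \<in> P n"
  shows "ev K (hf i f) (hf j g) (grT n t) = (if n = i + j then conv K C f g x else \<zero>\<^bsub>K\<^esub>)"
proof -
  note fd = killsD(1)[OF f] killsD(1)[OF g]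
  interpret k: vectorspace K "ground_space K" by (rule ground_vs)
  have fc: "f a \<in> carrier K" "g a \<in> carrier K" if "a \<in> P k" for a k
    using hom_closed[OF fd(1) P_carrier[OF that]] hom_closed[OF fd(2) P_carrier[OF that]] by simp_all
  show ?thesis
  proof (cases "n = i + j")
    case True
    have "form_lift K (\<lambda>v w. hf i f v \<otimes>\<^bsub>K\<^esub> hf j g w) (grT n t) = form_lift K (\<lambda>v w. f v \<otimes>\<^bsub>K\<^esub> g w) (comult C x)"
    proof (rule lift_grT[OF t ground_vs bilin_prod[OF hf_dual[OF f] hf_dual[OF g]] bilin_prod[OF fd]])
      fix k a a' assume k: "k \<le> n" "a \<in> P k" "a' \<in> P (n - k)"
      consider "k = i" | "k > i" | "k < i" by linarith
      then show "hf i f (cls k a) \<otimes>\<^bsub>K\<^esub> hf j g (cls (n - k) a') = f a \<otimes>\<^bsub>K\<^esub> g a'"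
      proof cases
        case 1
        then show ?thesis using hf_cls[OF f k(2)] hf_cls[OF g k(3)] True by simp
      next
        case 2
        then show ?thesis using killsD(2)[OF f _ k(2)] fc[OF k(2)] fc[OF k(3)] hf_cls[OF f k(2)] hf_cls[OF g k(3)] True by simp
      next
        case 3
        then show ?thesis using killsD(2)[OF g _ k(3)] fc[OF k(2)] fc[OF k(3)] hf_cls[OF f k(2)] hf_cls[OF g k(3)] True by simp
      qed
    qed
    then show ?thesis using True by (simp add: ev_def conv_def)
  next
    case False
    have zb: "bilin K C C (ground_space K) (\<lambda>v w. \<zero>\<^bsub>K\<^esub>)"
      by (rule bilinI) (use k.hom_zero_map in simp_all)
    have "form_lift K (\<lambda>v w. hf i f v \<otimes>\<^bsub>K\<^esub> hf j g w) (grT n t) = form_lift K (\<lambda>v w. \<zero>\<^bsub>K\<^esub>) (comult C x)"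
    proof (rule lift_grT[OF t ground_vs bilin_prod[OF hf_dual[OF f] hf_dual[OF g]] zb])
      fix k a a' assume k: "k \<le> n" "a \<in> P k" "a' \<in> P (n - k)"
      then show "hf i f (cls k a) \<otimes>\<^bsub>K\<^esub> hf j g (cls (n - k) a') = \<zero>\<^bsub>K\<^esub>"
        using False fc[OF k(2)] fc[OF k(3)] by (auto simp: hf_cls[OF f k(2)] hf_cls[OF g k(3)])
    qed
    also have "\<dots> = \<zero>\<^bsub>K\<^esub>"
      by (rule CC.lift_unique[OF ground_vs zb vectorspace.hom_zero_map[OF ground_vs, simplified] refl comult_closed, symmetric]) (rule P_carrier, rule x)
    finally show ?thesis using False by (simp add: ev_def)
  qed
qed

lemma hf_conv_cls:
  assumes f: "f \<in> kills (Suc i)" and g: "g \<in> kills (Suc j)" and x: "x \<in> P n"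
  shows "hf (i + j) (conv K C f g) (cls n x) = (if n = i + j then conv K C f g x else \<zero>\<^bsub>K\<^esub>)"
  by (rule hf_cls[OF conv_kills[OF f g] x])

abbreviation (input) "choice p n \<equiv> SOME t. gr_decomposition K C P n (rep p n) t"

lemma choice: "p \<in> carrier G \<Longrightarrow> gr_decomposition K C P n (rep p n) (choice p n)"
  by (rule someI_ex[OF decomposition_ex[OF rep_P]])

lemma gr_comult_alt: "gr_comult K C P p = (\<Oplus>\<^bsub>tensor K G G\<^esub> n\<in>{n. p n \<noteq> P (Suc n)}. grT n (choice p n))"
  unfolding gr_comult_def Let_def grT_def rep_def gr_support_def by (rule refl)

lemma gr_comult_closed: "p \<in> carrier G \<Longrightarrow> gr_comult K C P p \<in> carrier (tensor K G G)"
  unfolding gr_comult_alt by (intro GG.T.M.finsum_closed Pi_I grT_closed[OF choice])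

text \<open>In terms of dual algebras: homogeneous functionals of degrees \<open>i\<close> and
  \<open>j\<close> multiply to the homogeneous functional of degree \<open>i + j\<close> given by
  their convolution on \<open>C\<close>. The coalgebra axioms of the associated graded space are
  deduced from this formula.\<close>

lemma ev_gr_comult:
  assumes f: "f \<in> kills (Suc i)" and g: "g \<in> kills (Suc j)" and p: "p \<in> carrier G"
  shows "ev K (hf i f) (hf j g) (gr_comult K C P p) = hf (i + j) (conv K C f g) p"
proof -
  interpret k: vectorspace K "ground_space K" by (rule ground_vs)
  note cf = conv_kills[OF f g]
  let ?S = "{n. p n \<noteq> P (Suc n)}" and ?c = "conv K C f g (rep p (i + j))"
  have cc: "?c \<in> carrier K" using hom_closed[OF killsD(1)[OF cf] P_carrier[OF rep_P[OF p]]] by simp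
  have "ev K (hf i f) (hf j g) (gr_comult K C P p) =
      (\<Oplus>\<^bsub>ground_space K\<^esub> n\<in>?S. ev K (hf i f) (hf j g) (grT n (choice p n)))"
    unfolding gr_comult_alt
    by (rule hom_finsum[OF GG.ev_hom[OF hf_dual[OF f] hf_dual[OF g]] GG.tensor_vs ground_vs]) (rule grT_closed[OF choice[OF p]])
  also have "\<dots> = (\<Oplus>\<^bsub>ground_space K\<^esub> n\<in>?S. if i + j = n then ?c else \<zero>\<^bsub>K\<^esub>)"
    by (rule k.M.finsum_cong') (use cc k.M.zero_closed ev_grT[OF f g choice[OF p] rep_P[OF p]] in \<open>auto split: if_split_asm\<close>)
  also have "\<dots> = hf (i + j) (conv K C f g) p"
  proof (cases "i + j \<in> ?S")
    case True
    have "(\<Oplus>\<^bsub>ground_space K\<^esub> n\<in>?S. if i + j = n then ?c else \<zero>\<^bsub>K\<^esub>) = ?c"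
      using k.M.finsum_singleton[OF True, of "\<lambda>_. ?c", unfolded ground_simps] p cc by (simp add: G_carrier)
    then show ?thesis using hf_mem[OF cf p rep_in[OF p]] by simp
  next
    case False
    then have "(\<Oplus>\<^bsub>ground_space K\<^esub> n\<in>?S. if i + j = n then ?c else \<zero>\<^bsub>K\<^esub>) = (\<Oplus>\<^bsub>ground_space K\<^esub> n\<in>?S. \<zero>\<^bsub>ground_space K\<^esub>)"
      by (intro k.M.finsum_cong') auto
    also have "\<dots> = \<zero>\<^bsub>K\<^esub>" by (simp add: k.M.finsum_zero)
    also have "\<dots> = hf (i + j) (conv K C f g) p"
      using hf_mem[OF cf p, of "\<zero>\<^bsub>C\<^esub>"] False sub_0[OF P_sub] hom_0[OF killsD(1)[OF cf] vs_self ground_vs] by simp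
    finally show ?thesis .
  qed
  finally show ?thesis .
qed

lemma gr_tensor_eqI:
  assumes "s \<in> carrier (tensor K G G)" "t \<in> carrier (tensor K G G)"
    and eq: "\<And>i j f g. \<lbrakk>f \<in> kills (Suc i); g \<in> kills (Suc j)\<rbrakk> \<Longrightarrow> ev K (hf i f) (hf j g) s = ev K (hf i f) (hf j g) t"
  shows "s = t"
proof (rule GG.tensor_eqI[OF assms(1,2) hfs_dual hfs_dual])
  fix f' g' assume "f' \<in> hfs" "g' \<in> hfs"
  then show "ev K f' g' s = ev K f' g' t" using eq by (auto simp: hfs_def)
qed (rule hfs_sep; assumption)+

text \<open>Linearity is invisible in the definition, which chooses representatives and
  decompositions. It holds because every pair of homogeneous functionals evaluates the
  comultiplication to a linear expression.\<close>

lemma gr_comult_hom: "gr_comult K C P \<in> module_hom K G (tensor K G G)"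
proof (rule homI)
  interpret k: vectorspace K "ground_space K" by (rule ground_vs)
  show "gr_comult K C P (p \<oplus>\<^bsub>G\<^esub> q) = gr_comult K C P p \<oplus>\<^bsub>tensor K G G\<^esub> gr_comult K C P q"
    if c: "p \<in> carrier G" "q \<in> carrier G" for p q
  proof (rule gr_tensor_eqI)
    fix i j f g assume f: "f \<in> kills (Suc i)" and g: "g \<in> kills (Suc j)"
    show "ev K (hf i f) (hf j g) (gr_comult K C P (p \<oplus>\<^bsub>G\<^esub> q)) = ev K (hf i f) (hf j g) (gr_comult K C P p \<oplus>\<^bsub>tensor K G G\<^esub> gr_comult K C P q)"
      using hom_add[OF GG.ev_hom[OF hf_dual[OF f] hf_dual[OF g]] gr_comult_closed gr_comult_closed, OF c]
        hom_add[OF hf_dual[OF conv_kills[OF f g]] c] ev_gr_comult[OF f g] c by simp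
  qed (use c gr_comult_closed in simp_all)
  show "gr_comult K C P (c \<odot>\<^bsub>G\<^esub> p) = c \<odot>\<^bsub>tensor K G G\<^esub> gr_comult K C P p"
    if c: "c \<in> carrier K" "p \<in> carrier G" for c p
  proof (rule gr_tensor_eqI)
    fix i j f g assume f: "f \<in> kills (Suc i)" and g: "g \<in> kills (Suc j)"
    show "ev K (hf i f) (hf j g) (gr_comult K C P (c \<odot>\<^bsub>G\<^esub> p)) = ev K (hf i f) (hf j g) (c \<odot>\<^bsub>tensor K G G\<^esub> gr_comult K C P p)"
      using hom_smult[OF GG.ev_hom[OF hf_dual[OF f] hf_dual[OF g]] c(1) gr_comult_closed[OF c(2)]]
        hom_smult[OF hf_dual[OF conv_kills[OF f g]] c] ev_gr_comult[OF f g] c by simp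
  qed (use c gr_comult_closed in simp_all)
qed (rule gr_comult_closed)

text \<open>On a single class any decomposition computes \<open>gr_comult\<close>, since the value
  in \<open>ev_grT\<close> does not depend on it; so \<open>lift_grT\<close> applies.\<close>

lemma lift_gr_comult_cls:
  assumes x: "x \<in> P n" and U: "vectorspace K U" and B: "bilin K G G U B" and b: "bilin K C C U b"
    and eq: "\<And>k a a'. \<lbrakk>k \<le> n; a \<in> P k; a' \<in> P (n - k)\<rbrakk> \<Longrightarrow> B (cls k a) (cls (n - k) a') = b a a'"
  shows "tensor_lift K U B (gr_comult K C P (cls n x)) = tensor_lift K U b (comult C x)"
proof -
  obtain t where t: "gr_decomposition K C P n x t" using decomposition_ex[OF x] by blast
  have "gr_comult K C P (cls n x) = grT n t"
  proof (rule gr_tensor_eqI[OF gr_comult_closed[OF cls_closed[OF x]] grT_closed[OF t]])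
    fix i j f g assume f: "f \<in> kills (Suc i)" and g: "g \<in> kills (Suc j)"
    show "ev K (hf i f) (hf j g) (gr_comult K C P (cls n x)) = ev K (hf i f) (hf j g) (grT n t)"
      unfolding ev_grT[OF f g t x] ev_gr_comult[OF f g cls_closed[OF x]] hf_conv_cls[OF f g x] by (rule refl)
  qed
  then show ?thesis using lift_grT[OF t U B b eq] by simp
qed

lemma gr_eqI:
  assumes "p \<in> carrier G" "q \<in> carrier G" and eq: "\<And>i f. f \<in> kills (Suc i) \<Longrightarrow> hf i f p = hf i f q"
  shows "p = q"
  by (rule G.eq_by_functionals[OF assms(1,2) hfs_dual hfs_sep]) (use eq in \<open>auto simp: hfs_def\<close>)

text \<open>The vector-valued form of the transfer, used for the antipode axioms. The result is
  concentrated in degree \<open>n\<close>, so for a test functional of another degree the comparison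
  form is zero.\<close>

lemma lift_gr_comult_graded:
  assumes x: "x \<in> P n" and B: "bilin K G G G B" and b: "bilin K C C C b"
    and bP: "\<And>k a a'. \<lbrakk>k \<le> n; a \<in> P k; a' \<in> P (n - k)\<rbrakk> \<Longrightarrow> b a a' \<in> P n \<and> B (cls k a) (cls (n - k) a') = cls n (b a a')"
    and l: "tensor_lift K C b (comult C x) \<in> P n"
  shows "tensor_lift K G B (gr_comult K C P (cls n x)) = cls n (tensor_lift K C b (comult C x))"
proof (rule gr_eqI)
  note t = gr_comult_closed[OF cls_closed[OF x]]
  show "tensor_lift K G B (gr_comult K C P (cls n x)) \<in> carrier G" by (rule hom_closed[OF GG.lift_hom[OF G_vs B] t])
  show "cls n (tensor_lift K C b (comult C x)) \<in> carrier G" by (rule cls_closed[OF l])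
  fix i f assume f: "f \<in> kills (Suc i)"
  interpret k: vectorspace K "ground_space K" by (rule ground_vs)
  note fd = killsD(1)[OF f] and e = hf_dual[OF f]
  let ?b = "\<lambda>a a'. if n = i then f (b a a') else \<zero>\<^bsub>K\<^esub>"
  have zb: "bilin K C C (ground_space K) (\<lambda>_ _. \<zero>\<^bsub>K\<^esub>)" by (rule bilinI) (use k.hom_zero_map in simp_all)
  have bb: "bilin K C C (ground_space K) ?b" using bilin_comp[OF b fd] zb by (cases "n = i") simp_all
  have "hf i f (tensor_lift K G B (gr_comult K C P (cls n x))) = form_lift K (\<lambda>a a'. hf i f (B a a')) (gr_comult K C P (cls n x))"
    by (rule GG.hom_lift[OF G_vs B ground_vs e t])
  also have "\<dots> = form_lift K ?b (comult C x)"
    by (rule lift_gr_comult_cls[OF x ground_vs bilin_comp[OF B e] bb]) (use bP hf_cls[OF f] in simp)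
  also have "\<dots> = (if n = i then f (tensor_lift K C b (comult C x)) else \<zero>\<^bsub>K\<^esub>)"
    using CC.hom_lift[OF vs_self b ground_vs fd comult_closed[OF P_carrier[OF x]]]
      CC.lift_unique[OF ground_vs zb k.hom_zero_map[simplified] refl comult_closed[OF P_carrier[OF x]]] by simp
  also have "\<dots> = hf i f (cls n (tensor_lift K C b (comult C x)))" by (rule hf_cls[OF f l, symmetric])
  finally show "hf i f (tensor_lift K G B (gr_comult K C P (cls n x))) = hf i f (cls n (tensor_lift K C b (comult C x)))" .
qed

lemma counit_kills: "counit C \<in> kills (Suc 0)"
  using counit_hom counit_P by (simp add: kills_def)

lemma gr_counit_alt: "gr_counit C = hf 0 (counit C)"
  by (simp add: gr_counit_def hf_def fun_eq_iff)

text \<open>\<open>D\<close> is any record extending the graded data, so that one proof covers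
  \<open>gr_hopf\<close> and \<open>gr_modcoalg\<close>. By \<open>ev_gr_comult\<close> the laws of
  convolution for homogeneous functionals are those for functionals on \<open>C\<close>.\<close>

lemma gr_coalgebra:
  fixes D :: "('k, nat \<Rightarrow> 'v set, 'd) coalg_scheme"
  assumes D: "carrier D = carrier G" "zero D = zero G" "add D = add G" "smult D = smult G"
    and cm: "comult D = gr_comult K C P" and cu: "counit D = gr_counit C"
  shows "coalgebra K D"
proof -
  have tD: "tensor K D D = tensor K G G" by (rule tensor_cong) (simp_all add: D)
  have hD: "module_hom K D U = module_hom K G U" for U :: "('k, 'u, 'zu) module_scheme" by (rule module_hom_cong) (simp_all add: D)
  interpret D: precoalgebra K D
  proof (intro precoalgebra.intro precoalgebra_axioms.intro)
    show "vectorspace K D" by (rule G.vs_record_cong) (simp_all add: D)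
    show "comult D \<in> module_hom K D (tensor K D D)" unfolding tD cm hD by (rule gr_comult_hom)
    show "counit D \<in> dual K D" unfolding cu hD gr_counit_alt by (rule hf_dual[OF counit_kills])
  qed
  have c: "conv K D (hf i f) (hf j g) p = hf (i + j) (conv K C f g) p" 
    if "f \<in> kills (Suc i)" "g \<in> kills (Suc j)" "p \<in> carrier G" for i j f g p
    unfolding conv_def[of K D] cm by (rule ev_gr_comult[OF that])
  have dD: "hf i f \<in> dual K D" if "f \<in> kills (Suc i)" for i f unfolding hD by (rule hf_dual[OF that])
  show ?thesis
  proof (rule D.coalgebraI[of hfs])
    show "hfs \<subseteq> dual K D" unfolding hD by (rule hfs_dual)
    show "a = \<zero>\<^bsub>D\<^esub>" if "a \<in> carrier D" "\<And>f. f \<in> hfs \<Longrightarrow> f a = \<zero>\<^bsub>K\<^esub>" for a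
      unfolding D by (rule hfs_sep) (use that D in simp_all)
  next
    fix f' g' h' p assume a: "f' \<in> hfs" "g' \<in> hfs" "h' \<in> hfs" and "p \<in> carrier D"
    then have p: "p \<in> carrier G" by (simp add: D)
    obtain i f where f: "f' = hf i f" "f \<in> kills (Suc i)" using a(1) by (auto simp: hfs_def)
    obtain j g where g: "g' = hf j g" "g \<in> kills (Suc j)" using a(2) by (auto simp: hfs_def)
    obtain k h where h: "h' = hf k h" "h \<in> kills (Suc k)" using a(3) by (auto simp: hfs_def)
    note fg = conv_kills[OF f(2) g(2)] and gh = conv_kills[OF g(2) h(2)]
    have "conv K D (conv K D f' g') h' p = conv K D (hf (i + j) (conv K C f g)) (hf k h) p"
      unfolding f(1) g(1) h(1)
      by (rule D.conv_cong[OF D.conv_dual[OF dD[OF f(2)] dD[OF g(2)]] dD[OF h(2)]])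
        (use p c[OF f(2) g(2)] in \<open>simp_all add: D\<close>)
    also have "\<dots> = hf (i + j + k) (conv K C (conv K C f g) h) p" by (rule c[OF fg h(2) p])
    also have "\<dots> = conv K C (conv K C f g) h (rep p (i + j + k))"
      by (rule hf_mem[OF conv_kills[OF fg h(2)] p rep_in[OF p]])
    also have "\<dots> = conv K C f (conv K C g h) (rep p (i + j + k))"
      by (rule conv_assoc[OF killsD(1)[OF f(2)] killsD(1)[OF g(2)] killsD(1)[OF h(2)] P_carrier[OF rep_P[OF p]]])
    also have "\<dots> = hf (i + (j + k)) (conv K C f (conv K C g h)) p"
      using hf_mem[OF conv_kills[OF f(2) gh] p rep_in[OF p]] by (simp add: add.assoc)
    also have "\<dots> = conv K D (hf i f) (hf (j + k) (conv K C g h)) p" by (rule c[OF f(2) gh p, symmetric])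
    also have "\<dots> = conv K D f' (conv K D g' h') p"
      unfolding f(1) g(1) h(1)
      by (rule D.conv_cong[symmetric, OF dD[OF f(2)] D.conv_dual[OF dD[OF g(2)] dD[OF h(2)]]])
        (use p c[OF g(2) h(2)] in \<open>simp_all add: D\<close>)
    finally show "conv K D (conv K D f' g') h' p = conv K D f' (conv K D g' h') p" .
  next
    fix f' p assume a: "f' \<in> hfs" and "p \<in> carrier D"
    then have p: "p \<in> carrier G" by (simp add: D)
    obtain i f where f: "f' = hf i f" "f \<in> kills (Suc i)" using a(1) by (auto simp: hfs_def)
    note r = P_carrier[OF rep_P[OF p]]
    show "conv K D (counit D) f' p = f' p"
      unfolding f(1) cu gr_counit_alt c[OF counit_kills f(2) p] 
      using hf_mem[OF conv_kills[OF counit_kills f(2)] p rep_in[OF p]] hf_mem[OF f(2) p rep_in[OF p]]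
        conv_counit(1)[OF killsD(1)[OF f(2)] r] by simp
    show "conv K D f' (counit D) p = f' p"
      unfolding f(1) cu gr_counit_alt c[OF f(2) counit_kills p] 
      using hf_mem[OF conv_kills[OF f(2) counit_kills] p rep_in[OF p]] hf_mem[OF f(2) p rep_in[OF p]]
        conv_counit(2)[OF killsD(1)[OF f(2)] r] by simp
  qed
qed

end

section \<open>The associated graded module coalgebra\<close>

locale filtered_action = HF: filtered_coalgebra K H P + MF: filtered_coalgebra K M Q + filtered_bilinear K H P M Q \<beta>
  for K :: "('k, 'y) ring_scheme" and H :: "('k, 'h, 'z1) coalg_scheme" and P
    and M :: "('k, 'm, 'z2) coalg_scheme" and Q and \<beta> +
  assumes chom: "coalgebra_hom K (tensor_coalgebra K H M) M (tensor_lift K M \<beta>)"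
begin

sublocale coalgebra_action K H M \<beta>
  by unfold_locales (rule bil)


abbreviation (input) "clsH \<equiv> gr_class H P"
abbreviation (input) "clsM \<equiv> gr_class M Q"

lemma hf_act_cls:
  assumes f: "f \<in> MF.kills (Suc i)" and a: "a \<in> P k" and c: "c \<in> Q l"
  shows "MF.hf i f (act_gr (clsH k a) (clsM l c)) = (if k + l = i then f (\<beta> a c) else \<zero>\<^bsub>K\<^esub>)"
  unfolding act_gr_cls[OF a c] by (rule MF.hf_cls[OF f \<beta>_PQ[OF a c]])

text \<open>Both sides are bilinear in the two arguments, so homogeneous classes suffice. With test
  functionals of degrees \<open>i\<close>, \<open>j\<close> and classes of degrees \<open>n\<close>,
  \<open>p\<close>, both sides vanish unless \<open>n + p = i + j\<close>, and then they are the two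
  sides of the same identity for \<open>\<beta>\<close>.\<close>

lemma gr_action_coalgebra_hom:
  fixes DH :: "('k, nat \<Rightarrow> 'h set, 'd1) coalg_scheme" and DM :: "('k, nat \<Rightarrow> 'm set, 'd2) coalg_scheme"
  assumes DH: "carrier DH = carrier GH" "zero DH = zero GH" "add DH = add GH" "smult DH = smult GH"
      "comult DH = gr_comult K H P" "counit DH = gr_counit H"
    and DM: "carrier DM = carrier GM" "zero DM = zero GM" "add DM = add GM" "smult DM = smult GM"
      "comult DM = gr_comult K M Q" "counit DM = gr_counit M"
  shows "coalgebra_hom K (tensor_coalgebra K DH DM) DM (tensor_lift K DM act_gr)"
proof -
  interpret DH: coalgebra K DH by (rule HF.gr_coalgebra[OF DH])
  interpret DM: coalgebra K DM by (rule MF.gr_coalgebra[OF DM])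
  have bD: "bilin K DH DM DM act_gr = bilin K GH GM GM act_gr" by (rule bilin_record_cong) (simp_all add: DH DM)
  interpret A: coalgebra_action K DH DM act_gr
    by unfold_locales (unfold bD, rule act_gr_bilin)
  interpret k: vectorspace K "ground_space K" by (rule HF.ground_vs)
  have hH: "module_hom K DH U = module_hom K GH U" for U :: "('k, 'u, 'zu) module_scheme" by (rule module_hom_cong) (simp_all add: DH)
  have hM: "module_hom K DM U = module_hom K GM U" for U :: "('k, 'u, 'zu) module_scheme" by (rule module_hom_cong) (simp_all add: DM)
  have tH: "tensor K DH DH = tensor K GH GH" by (rule tensor_cong) (simp_all add: DH)
  have tM: "tensor K DM DM = tensor K GM GM" by (rule tensor_cong) (simp_all add: DM)
  have bilin_eq: "L \<xi> \<eta> = R \<xi> \<eta>" if L: "bilin K GH GM (ground_space K) L" and R: "bilin K GH GM (ground_space K) R"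
    and eq: "\<And>n p h m. \<lbrakk>h \<in> P n; m \<in> Q p\<rbrakk> \<Longrightarrow> L (clsH n h) (clsM p m) = R (clsH n h) (clsM p m)"
    and c: "\<xi> \<in> carrier GH" "\<eta> \<in> carrier GM" for L R \<xi> \<eta>
  proof (rule HF.gr_hom_eq[OF bilin_hom1[OF L c(2)] bilin_hom1[OF R c(2)] c(1)])
    show "L (clsH n h) \<eta> = R (clsH n h) \<eta>" if h: "h \<in> P n" for n h
      by (rule MF.gr_hom_eq[OF bilin_hom2[OF L HF.cls_closed[OF h]] bilin_hom2[OF R HF.cls_closed[OF h]] c(2)]) (rule eq[OF h])
  qed
  have zb: "bilin K X Y (ground_space K) (\<lambda>v w. \<zero>\<^bsub>K\<^esub>)" for X :: "('k, 'x, 'zx) module_scheme" and Y :: "('k, 'x2, 'zx2) module_scheme"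
    by (rule bilinI) (use k.hom_zero_map in simp_all)
  show ?thesis
  proof (rule A.coalgebra_homI[of MF.hfs])
    show "MF.hfs \<subseteq> dual K DM" unfolding hM by (rule MF.hfs_dual)
    show "a = \<zero>\<^bsub>DM\<^esub>" if "a \<in> carrier DM" "\<And>f. f \<in> MF.hfs \<Longrightarrow> f a = \<zero>\<^bsub>K\<^esub>" for a
      unfolding DM by (rule MF.hfs_sep) (use that DM in simp_all)
  next
    fix f' g' \<xi> \<eta> assume a: "f' \<in> MF.hfs" "g' \<in> MF.hfs" and "\<xi> \<in> carrier DH" "\<eta> \<in> carrier DM"
    then have \<xi>: "\<xi> \<in> carrier GH" "\<eta> \<in> carrier GM" by (simp_all add: DH DM)
    obtain i f where f: "f' = MF.hf i f" "f \<in> MF.kills (Suc i)" using a(1) by (auto simp: MF.hfs_def)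
    obtain j g where g: "g' = MF.hf j g" "g \<in> MF.kills (Suc j)" using a(2) by (auto simp: MF.hfs_def)
    note fd = MF.killsD(1)[OF f(2)] MF.killsD(1)[OF g(2)]
    have dD: "f' \<in> dual K DM" "g' \<in> dual K DM" unfolding f(1) g(1) hM by (rule MF.hf_dual[OF f(2)] MF.hf_dual[OF g(2)])+
    have L: "bilin K GH GM (ground_space K) (\<lambda>\<xi> \<eta>. conv K DM f' g' (act_gr \<xi> \<eta>))"
      by (rule bilin_comp[OF act_gr_bilin]) (use DM.conv_dual[OF dD] in \<open>simp add: hM\<close>)
    have R: "bilin K GH GM (ground_space K) (\<lambda>\<xi> \<eta>. conv2 K act_gr f' g' (comult DH \<xi>) (comult DM \<eta>))"
      by (rule bilin_subst[OF A.conv2_bilin[OF dD]]) (use DH.comult_hom DM.comult_hom in \<open>simp_all add: hH hM\<close>)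
    show "conv K DM f' g' (act_gr \<xi> \<eta>) = conv2 K act_gr f' g' (comult DH \<xi>) (comult DM \<eta>)"
    proof (rule bilin_eq[OF L R _ \<xi>])
      fix n p h m assume h: "h \<in> P n" and m: "m \<in> Q p"
      note hc = HF.P_carrier[OF h] and mc = MF.P_carrier[OF m] and hC = HF.cls_closed[OF h] and mC = MF.cls_closed[OF m]
      have "conv K DM f' g' (act_gr (clsH n h) (clsM p m)) =
          MF.hf (i + j) (conv K M f g) (clsM (n + p) (\<beta> h m))"
        unfolding conv_def[of K DM] DM f(1) g(1)
        using MF.ev_gr_comult[OF f(2) g(2) act_gr_closed[OF hC mC]] by (simp add: act_gr_cls[OF h m])
      also have "\<dots> = (if n + p = i + j then conv K M f g (\<beta> h m) else \<zero>\<^bsub>K\<^esub>)"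
        by (rule MF.hf_conv_cls[OF f(2) g(2) \<beta>_PQ[OF h m]])
      finally have lhs: "conv K DM f' g' (act_gr (clsH n h) (clsM p m)) =
          (if n + p = i + j then conv K M f g (\<beta> h m) else \<zero>\<^bsub>K\<^esub>)" .
      let ?q = "\<lambda>a b c d. f' (act_gr a c) \<otimes>\<^bsub>K\<^esub> g' (act_gr b d)" and ?r = "\<lambda>a b c d. f (\<beta> a c) \<otimes>\<^bsub>K\<^esub> g (\<beta> b d)"
      have q1: "bilin K GM GM (ground_space K) (?q a b)" if "a \<in> carrier GH" "b \<in> carrier GH" for a b
        using A.conv2_q(1)[OF dD, of a b] that by (simp add: bilin_def hM DM DH)
      have q2: "bilin K GH GH (ground_space K) (\<lambda>a b. ?q a b c d)" if "c \<in> carrier GM" "d \<in> carrier GM" for c d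
        using A.conv2_q(2)[OF dD, of c d] that by (simp add: bilin_def hH DM DH)
      have B: "bilin K GH GH (ground_space K) (\<lambda>a b. form_lift K (?q a b) (gr_comult K M Q (clsM p m)))"
        by (rule quad_inner_bilin[OF HF.G_vs HF.G_vs MF.G_vs MF.G_vs HF.ground_vs q1 q2 MF.gr_comult_closed[OF mC]])
      have b: "bilin K H H (ground_space K) (\<lambda>a b. form_lift K (?r a b) (comult M m))"
        by (rule quad_inner_bilin[OF HF.vs_self HF.vs_self MF.vs_self MF.vs_self HF.ground_vs conv2_q(1)[OF fd] conv2_q(2)[OF fd] MF.comult_closed[OF mc]])
      have fc: "f (\<beta> a c) \<in> carrier K" "g (\<beta> a c) \<in> carrier K" if "a \<in> P k" "c \<in> Q l" for a c k l
        using hom_closed[OF fd(1) MF.P_carrier[OF \<beta>_PQ[OF that]]] hom_closed[OF fd(2) MF.P_carrier[OF \<beta>_PQ[OF that]]] by simp_all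
      let ?e = "n + p = i + j"
      \<comment> \<open>The comparison form carries the condition on total degrees, since the graded
        side is zero when \<open>n + p\<close> differs from \<open>i + j\<close>.\<close>
      let ?c = "\<lambda>a b. if ?e then form_lift K (?r a b) (comult M m) else \<zero>\<^bsub>K\<^esub>"
      have cb: "bilin K H H (ground_space K) ?c" using b zb by (cases ?e) simp_all
      have zM: "form_lift K (\<lambda>_ _. \<zero>\<^bsub>K\<^esub>) (comult M m) = \<zero>\<^bsub>K\<^esub>"
        by (rule MF.CC.lift_unique[OF HF.ground_vs zb k.hom_zero_map[simplified] refl MF.comult_closed[OF mc], symmetric])
      have zH: "form_lift K (\<lambda>_ _. \<zero>\<^bsub>K\<^esub>) (comult H h) = \<zero>\<^bsub>K\<^esub>"
        by (rule HF.CC.lift_unique[OF HF.ground_vs zb k.hom_zero_map[simplified] refl HF.comult_closed[OF hc], symmetric])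
      have "form_lift K (\<lambda>a b. form_lift K (?q a b) (gr_comult K M Q (clsM p m)))
          (gr_comult K H P (clsH n h)) = form_lift K ?c (comult H h)"
      proof (rule HF.lift_gr_comult_cls[OF h HF.ground_vs B cb])
        fix k a a' assume k: "k \<le> n" "a \<in> P k" "a' \<in> P (n - k)"
        note aC = HF.cls_closed[OF k(2)] HF.cls_closed[OF k(3)] and ac = HF.P_carrier[OF k(2)] HF.P_carrier[OF k(3)]
        let ?d = "\<lambda>c d. if ?e then ?r a a' c d else \<zero>\<^bsub>K\<^esub>"
        have db: "bilin K M M (ground_space K) ?d" using conv2_q(1)[OF fd ac] zb by (cases ?e) simp_all
        have "form_lift K (?q (clsH k a) (clsH (n - k) a')) (gr_comult K M Q (clsM p m)) =
          form_lift K ?d (comult M m)"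
        proof (rule MF.lift_gr_comult_cls[OF m HF.ground_vs q1[OF aC] db])
          fix l c c' assume l: "l \<le> p" "c \<in> Q l" "c' \<in> Q (p - l)"
          note fc' = fc[OF k(2) l(2)] fc[OF k(3) l(3)]
          note h' = hf_act_cls[OF f(2) k(2) l(2)] hf_act_cls[OF g(2) k(3) l(3)]
          \<comment> \<open>In a bidegree with \<open>k + l \<noteq> i\<close> the graded side is
            zero, so the ungraded product has to vanish as well: for \<open>k + l > i\<close> the
            functional \<open>f\<close> kills it, otherwise the complementary degree exceeds
            \<open>j\<close> and \<open>g\<close> does.\<close>
          have z: "f (\<beta> a c) \<otimes>\<^bsub>K\<^esub> g (\<beta> a' c') = \<zero>\<^bsub>K\<^esub>" if e: "?e" "k + l \<noteq> i"
          proof (cases "i < k + l")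
            case True
            then have "f (\<beta> a c) = \<zero>\<^bsub>K\<^esub>" using MF.killsD(2)[OF f(2) _ \<beta>_PQ[OF k(2) l(2)]] by simp
            then show ?thesis using fc' by simp
          next
            case False
            then have "Suc j \<le> n - k + (p - l)" using e k l by simp
            then have "g (\<beta> a' c') = \<zero>\<^bsub>K\<^esub>" using MF.killsD(2)[OF g(2) _ \<beta>_PQ[OF k(3) l(3)]] by simp
            then show ?thesis using fc' by simp
          qed
          have "n - k + (p - l) = j \<longleftrightarrow> ?e" if "k + l = i" using that k l by auto
          then show "?q (clsH k a) (clsH (n - k) a') (clsM l c) (clsM (p - l) c') = ?d c c'"
            unfolding f(1) g(1) h' using z fc' by auto
        qed
        also have "\<dots> = ?c a a'" using zM by simp
        finally show "form_lift K (?q (clsH k a) (clsH (n - k) a')) (gr_comult K M Q (clsM p m)) = ?c a a'" .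
      qed
      also have "\<dots> = (if ?e then conv K M f g (\<beta> h m) else \<zero>\<^bsub>K\<^esub>)"
        using coalgebra_homD(1)[OF chom hc mc fd] zH by (simp add: conv2_def)
      finally have "form_lift K (\<lambda>a b. form_lift K (?q a b) (gr_comult K M Q (clsM p m)))
          (gr_comult K H P (clsH n h)) = (if ?e then conv K M f g (\<beta> h m) else \<zero>\<^bsub>K\<^esub>)" .
      then show "conv K DM f' g' (act_gr (clsH n h) (clsM p m)) =
          conv2 K act_gr f' g' (comult DH (clsH n h)) (comult DM (clsM p m))"
        unfolding lhs DH DM conv2_def by simp
    qed
  next
    fix \<xi> \<eta> assume "\<xi> \<in> carrier DH" "\<eta> \<in> carrier DM"
    then have \<xi>: "\<xi> \<in> carrier GH" "\<eta> \<in> carrier GM" by (simp_all add: DH DM)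
    have L: "bilin K GH GM (ground_space K) (\<lambda>\<xi> \<eta>. counit DM (act_gr \<xi> \<eta>))"
      by (rule bilin_comp[OF act_gr_bilin]) (use DM.counit_hom in \<open>simp add: hM\<close>)
    have R: "bilin K GH GM (ground_space K) (\<lambda>\<xi> \<eta>. counit DH \<xi> \<otimes>\<^bsub>K\<^esub> counit DM \<eta>)"
      by (rule HF.bilin_prod) (use DH.counit_hom DM.counit_hom in \<open>simp_all add: hH hM\<close>)
    show "counit DM (act_gr \<xi> \<eta>) = counit DH \<xi> \<otimes>\<^bsub>K\<^esub> counit DM \<eta>"
    proof (rule bilin_eq[OF L R _ \<xi>])
      fix n p h m assume h: "h \<in> P n" and m: "m \<in> Q p"
      note hc = HF.P_carrier[OF h] and mc = MF.P_carrier[OF m]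
      have c: "counit H h \<in> carrier K" "counit M m \<in> carrier K"
        using hom_closed[OF HF.counit_hom hc] hom_closed[OF MF.counit_hom mc] by simp_all
      show "counit DM (act_gr (clsH n h) (clsM p m)) = counit DH (clsH n h) \<otimes>\<^bsub>K\<^esub> counit DM (clsM p m)"
        unfolding DH DM HF.gr_counit_alt MF.gr_counit_alt
        using hf_act_cls[OF MF.counit_kills h m] HF.hf_cls[OF HF.counit_kills h] MF.hf_cls[OF MF.counit_kills m] c
          coalgebra_homD(2)[OF chom hc mc] by auto
    qed
  qed
qed

end

text \<open>The comultiplication of a product is the product of the comultiplications, which is the
  nested lift \<open>?Z\<close>. A nested lift can be placed in \<open>S\<close> by looking only at
  pure tensors from the two spanning families.\<close>

lemma (in coalgebra_action) comult_act_mem: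
  assumes chom: "coalgebra_hom K (tensor_coalgebra K H M) M (tensor_lift K M \<alpha>)"
    and hm: "h \<in> carrier H" "m \<in> carrier M"
    and h: "comult H h \<in> LinearCombinations.module.span K (tensor K H H) {pure_tensor K H H a b | a b. A a b}"
    and m: "comult M m \<in> LinearCombinations.module.span K (tensor K M M) {pure_tensor K M M c d | c d. B c d}"
    and A: "\<And>a b. A a b \<Longrightarrow> a \<in> carrier H \<and> b \<in> carrier H" and B: "\<And>c d. B c d \<Longrightarrow> c \<in> carrier M \<and> d \<in> carrier M"
    and S: "subspace K S (tensor K M M)"
    and mem: "\<And>a b c d. \<lbrakk>A a b; B c d\<rbrakk> \<Longrightarrow> pure_tensor K M M (\<alpha> a c) (\<alpha> b d) \<in> S"
  shows "comult M (\<alpha> h m) \<in> S"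
proof -
  let ?T = "tensor K M M" and ?q = "\<lambda>a b c d. pure_tensor K M M (\<alpha> a c) (\<alpha> b d)"
  let ?B = "\<lambda>a b. tensor_lift K ?T (?q a b) (comult M m)"
  let ?Z = "tensor_lift K ?T ?B (comult H h)"
  note sc = H.comult_closed[OF hm(1)] and tc = M.comult_closed[OF hm(2)]
  have q1: "bilin K M M ?T (?q a b)" if "a \<in> carrier H" "b \<in> carrier H" for a b
    by (rule bilin_subst[OF M.CC.tp_bilin bilin_hom2[OF bil that(1)] bilin_hom2[OF bil that(2)]])
  have q2: "bilin K H H ?T (\<lambda>a b. ?q a b c d)" if "c \<in> carrier M" "d \<in> carrier M" for c d
    by (rule bilin_subst[OF M.CC.tp_bilin bilin_hom1[OF bil that(1)] bilin_hom1[OF bil that(2)]])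
  have Bb: "bilin K H H ?T ?B"
    by (rule quad_inner_bilin[OF H.vs_self H.vs_self M.vs_self M.vs_self M.CC.tensor_vs q1 q2 tc])
  have Zc: "?Z \<in> carrier ?T" by (rule hom_closed[OF H.CC.lift_hom[OF M.CC.tensor_vs Bb] sc])
  note hc = bilin_closed[OF bil hm]
  have "comult M (\<alpha> h m) = ?Z"
  proof (rule M.CC.tensor_eqI[of _ _ "dual K M" "dual K M"])
    fix f g assume f: "f \<in> dual K M" and g: "g \<in> dual K M"
    note e = M.CC.ev_hom[OF f g]
    have in1: "ev K f g (?B a b) = form_lift K (\<lambda>c d. f (\<alpha> a c) \<otimes>\<^bsub>K\<^esub> g (\<alpha> b d)) (comult M m)"
      if ab: "a \<in> carrier H" "b \<in> carrier H" for a b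
    proof -
      have "ev K f g (?B a b) = form_lift K (\<lambda>c d. ev K f g (?q a b c d)) (comult M m)"
        by (rule M.CC.hom_lift[OF M.CC.tensor_vs q1[OF ab] H.ground_vs e tc])
      also have "\<dots> = form_lift K (\<lambda>c d. f (\<alpha> a c) \<otimes>\<^bsub>K\<^esub> g (\<alpha> b d)) (comult M m)"
        by (rule M.CC.lift_cong[OF H.ground_vs bilin_comp[OF q1[OF ab] e] tc])
          (use M.CC.ev_pure[OF f g bilin_closed[OF bil ab(1)] bilin_closed[OF bil ab(2)]] in simp)
      finally show ?thesis .
    qed
    have "ev K f g ?Z = form_lift K (\<lambda>a b. ev K f g (?B a b)) (comult H h)"
      by (rule H.CC.hom_lift[OF M.CC.tensor_vs Bb H.ground_vs e sc])
    also have "\<dots> = conv2 K \<alpha> f g (comult H h) (comult M m)"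
      unfolding conv2_def by (rule H.CC.lift_cong[OF H.ground_vs bilin_comp[OF Bb e] sc in1])
    also have "\<dots> = ev K f g (comult M (\<alpha> h m))"
      using coalgebra_homD(1)[OF chom hm f g] by (simp add: conv_def)
    finally show "ev K f g (comult M (\<alpha> h m)) = ev K f g ?Z" by (rule sym)
  qed (use Zc M.comult_closed[OF hc] M.functional_sep in auto)
  moreover have "?Z \<in> S"
  proof (rule hom_span_subset[OF H.CC.lift_hom[OF M.CC.tensor_vs Bb] H.CC.tensor_vs M.CC.tensor_vs S _ _ h])
    show "{pure_tensor K H H a b | a b. A a b} \<subseteq> carrier (tensor K H H)" using A H.CC.tp_closed by auto
    fix s assume "s \<in> {pure_tensor K H H a b | a b. A a b}"
    then obtain a b where s: "s = pure_tensor K H H a b" "A a b" by auto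
    then have ab: "a \<in> carrier H" "b \<in> carrier H" using A by auto
    have "?B a b \<in> S"
    proof (rule hom_span_subset[OF M.CC.lift_hom[OF M.CC.tensor_vs q1[OF ab]] M.CC.tensor_vs M.CC.tensor_vs S _ _ m])
      show "{pure_tensor K M M c d | c d. B c d} \<subseteq> carrier (tensor K M M)" using B M.CC.tp_closed by auto
      fix t assume "t \<in> {pure_tensor K M M c d | c d. B c d}"
      then obtain c d where t: "t = pure_tensor K M M c d" "B c d" by auto
      then show "tensor_lift K ?T (?q a b) t \<in> S"
        using M.CC.lift_pure[OF M.CC.tensor_vs q1[OF ab], of c d] B[OF t(2)] mem[OF s(2) t(2)] by simp
    qed
    then show "tensor_lift K ?T ?B s \<in> S"
      using H.CC.lift_pure[OF M.CC.tensor_vs Bb ab] s(1) by simp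
  qed
  ultimately show ?thesis by simp
qed

section \<open>The augmentation filtration of a Hopf algebra\<close>

context hopf_algebra
begin

abbreviation (input) "\<omega> \<equiv> aug_ideal K H"
abbreviation (input) "Hp \<equiv> aug_power K H"

lemma mult_bilin: "bilin K H H H (mult H)"
  by (intro bilinI homI) (simp_all add: l_distr r_distr smult_mult_left smult_mult_right)

lemma counit_carrier: "x \<in> carrier H \<Longrightarrow> counit H x \<in> carrier K"
  using hom_closed[OF counit_hom, of x] by simp

lemma minus_counit_aug:
  assumes x: "x \<in> carrier H"
  shows "x \<ominus>\<^bsub>H\<^esub> counit H x \<odot>\<^bsub>H\<^esub> \<one>\<^bsub>H\<^esub> \<in> \<omega>"
proof -
  interpret k: vectorspace K "ground_space K" by (rule ground_vs)
  note c = counit_carrier[OF x]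
  have "counit H (x \<ominus>\<^bsub>H\<^esub> counit H x \<odot>\<^bsub>H\<^esub> \<one>\<^bsub>H\<^esub>) = counit H x \<ominus>\<^bsub>ground_space K\<^esub> counit H x"
    using hom_minus[OF counit_hom vs_self ground_vs x smult_closed[OF c one_closed]] hom_smult[OF counit_hom c one_closed] counit_one c by simp
  then show ?thesis using k.minus_self[of "counit H x"] x c by (simp add: aug_ideal_def)
qed

interpretation mult: coalgebra_action K H H "mult H"
  by unfold_locales (rule mult_bilin)

lemma counit_mult: "\<lbrakk>x \<in> carrier H; y \<in> carrier H\<rbrakk> \<Longrightarrow> counit H (x \<otimes>\<^bsub>H\<^esub> y) = counit H x \<otimes>\<^bsub>K\<^esub> counit H y"
  by (rule mult.coalgebra_homD(2)[OF mult_coalgebra_hom])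

lemma aug_ideal_mult: "\<lbrakk>h \<in> carrier H; x \<in> \<omega>\<rbrakk> \<Longrightarrow> h \<otimes>\<^bsub>H\<^esub> x \<in> \<omega>"
  using counit_mult[of h x] counit_carrier[of h] by (simp add: aug_ideal_def)

lemma Hp_subspace: "subspace K (Hp n) H"
proof (induct n)
  case 0
  show ?case by (simp add: subspace_carrier)
next
  case (Suc n)
  have "{x \<otimes>\<^bsub>H\<^esub> y | x y. x \<in> \<omega> \<and> y \<in> Hp n} \<subseteq> carrier H" using sub_carrier[OF Suc] by (auto simp: aug_ideal_def)
  then show ?case unfolding aug_power.simps by (rule span_is_subspace)
qed

lemmas Hp_carrier = sub_carrier[OF Hp_subspace]

lemma Hp_gen: "\<lbrakk>x \<in> \<omega>; y \<in> Hp n\<rbrakk> \<Longrightarrow> x \<otimes>\<^bsub>H\<^esub> y \<in> Hp (Suc n)"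
proof -
  assume "x \<in> \<omega>" "y \<in> Hp n"
  moreover have "{x \<otimes>\<^bsub>H\<^esub> y | x y. x \<in> \<omega> \<and> y \<in> Hp n} \<subseteq> carrier H" using Hp_carrier by (auto simp: aug_ideal_def)
  ultimately show ?thesis unfolding aug_power.simps by (intro span_incl) auto
qed

text \<open>The linear map \<open>f\<close> is arbitrary so that the same induction serves the
  comultiplication, the counit and multiplication by a fixed element.\<close>

lemma Hp_hom_induct:
  assumes f: "f \<in> module_hom K H V" and V: "vectorspace K V" and W: "subspace K W V" and h: "h \<in> Hp (Suc n)"
    and gen: "\<And>x y. \<lbrakk>x \<in> \<omega>; y \<in> Hp n\<rbrakk> \<Longrightarrow> f (x \<otimes>\<^bsub>H\<^esub> y) \<in> W"
  shows "f h \<in> W"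
proof (rule hom_span_subset[OF f vs_self V W _ _ h[unfolded aug_power.simps]])
  show "{x \<otimes>\<^bsub>H\<^esub> y | x y. x \<in> \<omega> \<and> y \<in> Hp n} \<subseteq> carrier H" using Hp_carrier by (auto simp: aug_ideal_def)
  show "f z \<in> W" if "z \<in> {x \<otimes>\<^bsub>H\<^esub> y | x y. x \<in> \<omega> \<and> y \<in> Hp n}" for z using that gen by auto
qed

text \<open>A generator of a positive power begins with an element of the augmentation ideal, and
  the augmentation ideal is itself a left ideal.\<close>

lemma Hp_left_ideal: "\<lbrakk>h \<in> carrier H; x \<in> Hp n\<rbrakk> \<Longrightarrow> h \<otimes>\<^bsub>H\<^esub> x \<in> Hp n"
proof (induct n)
  case (Suc n)
  show ?case
  proof (rule Hp_hom_induct[OF bilin_hom2[OF mult_bilin Suc(2)] vs_self Hp_subspace Suc(3)])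
    fix x y assume x: "x \<in> \<omega>" "y \<in> Hp n"
    have "h \<otimes>\<^bsub>H\<^esub> (x \<otimes>\<^bsub>H\<^esub> y) = (h \<otimes>\<^bsub>H\<^esub> x) \<otimes>\<^bsub>H\<^esub> y"
      using x Suc(2) Hp_carrier[OF x(2)] by (simp add: m_assoc aug_ideal_def)
    then show "h \<otimes>\<^bsub>H\<^esub> (x \<otimes>\<^bsub>H\<^esub> y) \<in> Hp (Suc n)" using Hp_gen[OF aug_ideal_mult[OF Suc(2) x(1)] x(2)] by simp
  qed
qed simp

lemma Hp_Suc: "Hp (Suc n) \<subseteq> Hp n"
proof (induct n)
  case 0
  show ?case using Hp_carrier[of _ "Suc 0"] by auto
next
  case (Suc n)
  show ?case
  proof
    fix h assume "h \<in> Hp (Suc (Suc n))"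
    then show "h \<in> Hp (Suc n)"
      by (rule Hp_hom_induct[OF hom_id vs_self Hp_subspace]) (use Hp_gen Suc in blast)
  qed
qed

lemma Hp_mult: "\<lbrakk>x \<in> Hp i; y \<in> Hp j\<rbrakk> \<Longrightarrow> x \<otimes>\<^bsub>H\<^esub> y \<in> Hp (i + j)"
proof (induct i arbitrary: x)
  case 0
  then show ?case using Hp_left_ideal by simp
next
  case (Suc i)
  show ?case
  proof (rule Hp_hom_induct[OF bilin_hom1[OF mult_bilin Hp_carrier[OF Suc(3)]] vs_self Hp_subspace Suc(2)])
    fix a b assume a: "a \<in> \<omega>" "b \<in> Hp i"
    have "(a \<otimes>\<^bsub>H\<^esub> b) \<otimes>\<^bsub>H\<^esub> y = a \<otimes>\<^bsub>H\<^esub> (b \<otimes>\<^bsub>H\<^esub> y)"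
      using a Hp_carrier[OF a(2)] Hp_carrier[OF Suc(3)] by (simp add: m_assoc aug_ideal_def)
    then show "(a \<otimes>\<^bsub>H\<^esub> b) \<otimes>\<^bsub>H\<^esub> y \<in> Hp (Suc i + j)" using Hp_gen[OF a(1) Suc(1)[OF a(2) Suc(3)]] by simp
  qed
qed

lemma aug_in_Hp1: "x \<in> \<omega> \<Longrightarrow> x \<in> Hp (Suc 0)"
  using Hp_gen[of x "\<one>\<^bsub>H\<^esub>" 0] by (simp add: aug_ideal_def)

lemma counit_Hp: 
  assumes "x \<in> Hp (Suc n)"
  shows "counit H x = \<zero>\<^bsub>K\<^esub>"
proof -
  have "counit H x \<in> {\<zero>\<^bsub>ground_space K\<^esub>}"
    by (rule Hp_hom_induct[OF counit_hom ground_vs vectorspace.subspace_zero[OF ground_vs] assms])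
      (use counit_mult counit_carrier Hp_carrier in \<open>auto simp: aug_ideal_def\<close>)
  then show ?thesis by simp
qed

abbreviation (input) "HpHp n \<equiv> {pure_tensor K H H a b | a b. \<exists>k\<le>n. a \<in> Hp k \<and> b \<in> Hp (n - k)}"

lemma HpHp_carrier: "HpHp n \<subseteq> carrier (tensor K H H)"
  using CC.tp_closed Hp_carrier by auto

lemma HpHp_span: "\<lbrakk>k \<le> n; a \<in> Hp k; b \<in> Hp (n - k)\<rbrakk> \<Longrightarrow> pure_tensor K H H a b \<in> CC.T.span (HpHp n)"
  by (rule CC.T.span_incl[OF HpHp_carrier]) blast

text \<open>Applying \<open>(id - \<epsilon> 1) \<otimes> id\<close> to \<open>\<Delta> x\<close>
  gives \<open>\<Delta> x - 1 \<otimes> x\<close> by the counit law, and the result is a sum of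
  tensors with left factor in the augmentation ideal. The correction \<open>1 \<otimes> x\<close>
  has its right factor there.\<close>

lemma comult_aug:
  assumes x: "x \<in> \<omega>"
  shows "comult H x \<in> CC.T.span (HpHp 1)"
proof -
  let ?S = "CC.T.span (HpHp 1)"
  have S: "subspace K ?S (tensor K H H)" by (rule CC.T.span_is_subspace[OF HpHp_carrier])
  have xc: "x \<in> carrier H" "counit H x = \<zero>\<^bsub>K\<^esub>" using x by (simp_all add: aug_ideal_def)
  let ?f = "\<lambda>t. t \<ominus>\<^bsub>tensor K H H\<^esub> pure_tensor K H H \<one>\<^bsub>H\<^esub> (contr_left K H (counit H) t)"
  have pf: "pure_tensor K H H \<one>\<^bsub>H\<^esub> (contr_left K H (counit H) t) \<in> carrier (tensor K H H)" if "t \<in> carrier (tensor K H H)" for t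
    by (rule CC.tp_closed[OF one_closed hom_closed[OF CC.contr_left_hom[OF counit_hom] that]])
  have "?f t \<in> ?S" if "t \<in> carrier (tensor K H H)" for t
    using that
  proof (induct t rule: CC.tensor_induct)
    case (pure a b)
    note c = counit_carrier[OF pure(1)]
    have "?f (pure_tensor K H H a b) = pure_tensor K H H (a \<ominus>\<^bsub>H\<^esub> counit H a \<odot>\<^bsub>H\<^esub> \<one>\<^bsub>H\<^esub>) b"
      using CC.tp_minus1[OF pure(2) pure(1) smult_closed[OF c one_closed]] CC.contr_left_pure[OF counit_hom pure]
        CC.tp_smult2[OF one_closed c pure(2)] CC.tp_smult1[OF pure(2) c one_closed] by simp
    moreover have "pure_tensor K H H (a \<ominus>\<^bsub>H\<^esub> counit H a \<odot>\<^bsub>H\<^esub> \<one>\<^bsub>H\<^esub>) b \<in> ?S"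
      by (rule HpHp_span[of 1]) (use aug_in_Hp1[OF minus_counit_aug[OF pure(1)]] pure(2) in simp_all)
    ultimately show ?case by simp
  next
    case (add s t)
    have "?f (s \<oplus>\<^bsub>tensor K H H\<^esub> t) = ?f s \<oplus>\<^bsub>tensor K H H\<^esub> ?f t"
      using add(1,2) pf[OF add(1)] pf[OF add(2)] hom_add[OF CC.contr_left_hom[OF counit_hom] add(1,2)]
        CC.tp_add2[OF one_closed hom_closed[OF CC.contr_left_hom[OF counit_hom] add(1)] hom_closed[OF CC.contr_left_hom[OF counit_hom] add(2)]]
      by (simp add: a_minus_def CC.T.M.minus_add CC.T.M.a_ac)
    then show ?case using CC.T.sub_add[OF S add(3,4)] by simp
  qed
  from this[OF comult_closed[OF xc(1)]]
  have "comult H x \<ominus>\<^bsub>tensor K H H\<^esub> pure_tensor K H H \<one>\<^bsub>H\<^esub> x \<in> ?S"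
    using counit_left[OF xc(1)] by (simp add: contr_left_def)
  moreover have "pure_tensor K H H \<one>\<^bsub>H\<^esub> x \<in> ?S"
    by (rule HpHp_span[of 0]) (use aug_in_Hp1[OF x] in simp_all)
  ultimately have "(comult H x \<ominus>\<^bsub>tensor K H H\<^esub> pure_tensor K H H \<one>\<^bsub>H\<^esub> x) \<oplus>\<^bsub>tensor K H H\<^esub> pure_tensor K H H \<one>\<^bsub>H\<^esub> x \<in> ?S"
    by (rule CC.T.sub_add[OF S])
  then show ?thesis
    using CC.T.minus_add_cancel[OF comult_closed[OF xc(1)] CC.tp_closed[OF one_closed xc(1)]] by simp
qed

text \<open>A generator is the product of an element of degree 1 and one of degree \<open>n\<close>,
  and the bidegrees of their comultiplications add.\<close>

lemma comult_Hp: "x \<in> Hp n \<Longrightarrow> comult H x \<in> CC.T.span (HpHp n)"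
proof (induct n arbitrary: x)
  case 0
  have "HpHp 0 = {pure_tensor K H H a b | a b. a \<in> carrier H \<and> b \<in> carrier H}" by auto
  then show ?case using CC.span_pure[OF comult_closed] 0 by simp
next
  case (Suc n)
  have S: "subspace K (CC.T.span (HpHp (Suc n))) (tensor K H H)" by (rule CC.T.span_is_subspace[OF HpHp_carrier])
  show ?case
  proof (rule Hp_hom_induct[OF comult_hom CC.tensor_vs S Suc(2)])
    fix x y assume x: "x \<in> \<omega>" "y \<in> Hp n"
    have xc: "x \<in> carrier H" using x by (simp add: aug_ideal_def)
    show "comult H (x \<otimes>\<^bsub>H\<^esub> y) \<in> CC.T.span (HpHp (Suc n))"
    proof (rule mult.comult_act_mem[OF mult_coalgebra_hom xc Hp_carrier[OF x(2)] comult_aug[OF x(1)] Suc(1)[OF x(2)] _ _ S])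
      fix a b c d assume "\<exists>k\<le>1. a \<in> Hp k \<and> b \<in> Hp (1 - k)" "\<exists>k\<le>n. c \<in> Hp k \<and> d \<in> Hp (n - k)"
      then obtain k l where k: "k \<le> 1" "a \<in> Hp k" "b \<in> Hp (1 - k)" and l: "l \<le> n" "c \<in> Hp l" "d \<in> Hp (n - l)" by blast
      have "1 - k + (n - l) = Suc n - (k + l)" using k(1) l(1) by simp
      then have "a \<otimes>\<^bsub>H\<^esub> c \<in> Hp (k + l)" "b \<otimes>\<^bsub>H\<^esub> d \<in> Hp (Suc n - (k + l))"
        using Hp_mult[OF k(2) l(2)] Hp_mult[OF k(3) l(3)] by simp_all
      then show "pure_tensor K H H (a \<otimes>\<^bsub>H\<^esub> c) (b \<otimes>\<^bsub>H\<^esub> d) \<in> CC.T.span (HpHp (Suc n))"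
        using k(1) l(1) by (intro HpHp_span[of "k + l"]) simp_all
    qed (use Hp_carrier in blast)+
  qed
qed

lemma hopf_filtered: "filtered_coalgebra K H Hp"
proof (intro filtered_coalgebra.intro filtered_coalgebra_axioms.intro filtered.intro filtered_axioms.intro)
  show "coalgebra K H" ..
  show "comult H x \<in> CC.T.span (HpHp n)" if "x \<in> Hp n" for x n by (rule comult_Hp[OF that])
  show "counit H x = \<zero>\<^bsub>K\<^esub>" if "x \<in> Hp 1" for x using counit_Hp[of x 0] that by (simp only: One_nat_def)
qed (rule vs_self Hp_subspace Hp_Suc aug_power.simps)+

text \<open>For \<open>n > 0\<close> read
  \<open>0 = \<epsilon>(x) 1 = \<Sigma> S(x\<^sub>1) x\<^sub>2\<close> modulo the
  \<open>n\<close>-th power. Terms of bidegree \<open>(k, n - k)\<close> with \<open>k < n\<close>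
  vanish by the induction hypothesis. If \<open>k = n\<close>, the left factor also has degree
  \<open>n - 1\<close>, so the right factor may be replaced by its counit. What is left is
  \<open>S(x)\<close>, which is therefore zero modulo the \<open>n\<close>-th power.\<close>

lemma antipode_Hp: "x \<in> Hp n \<Longrightarrow> antipode H x \<in> Hp n"
proof (induct n arbitrary: x rule: less_induct)
  case (less n)
  note xc = Hp_carrier[OF less(2)]
  note sc = hom_closed[OF antipode_linear]
  show ?case
  proof (cases n)
    case 0
    then show ?thesis using sc xc by simp
  next
    case n: (Suc m)
    show ?thesis
    proof (rule functional_sub[OF Hp_subspace sc[OF xc]])
      fix f assume f: "f \<in> dual K H" and fz: "\<And>y. y \<in> Hp n \<Longrightarrow> f y = \<zero>\<^bsub>K\<^esub>"
      let ?b = "\<lambda>a b. f (antipode H a \<otimes>\<^bsub>H\<^esub> b)" and ?c = "\<lambda>a b. counit H b \<otimes>\<^bsub>K\<^esub> f (antipode H a)"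
      note fs = hom_comp[OF antipode_linear f]
      have bm: "bilin K H H H (\<lambda>a b. antipode H a \<otimes>\<^bsub>H\<^esub> b)" by (rule bilin_subst[OF mult_bilin antipode_linear hom_id])
      have b: "bilin K H H (ground_space K) ?b" by (rule bilin_comp[OF bm f])
      have c: "bilin K H H (ground_space K) ?c" by (rule bilin_flip[OF bilin_prod[OF counit_hom fs]])
      have s: "bilin K H H H (\<lambda>a b. counit H b \<odot>\<^bsub>H\<^esub> a)" by (rule bilin_flip[OF bilin_scale[OF counit_hom]])
      have f1: "f (antipode H a \<otimes>\<^bsub>H\<^esub> b) = \<zero>\<^bsub>K\<^esub>" if "a \<in> Hp k" "b \<in> Hp (n - k)" "k < n" for a b k
        using fz Hp_mult[OF less(1)[OF that(3,1)] that(2)] that(3) by simp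
      have "form_lift K ?b (comult H x) = form_lift K ?c (comult H x)"
      proof (rule hom_span_eq[OF CC.lift_hom[OF ground_vs b] CC.lift_hom[OF ground_vs c] CC.tensor_vs ground_vs HpHp_carrier _ comult_Hp[OF less(2)]])
        fix t assume "t \<in> HpHp n"
        then obtain a b' k where t: "t = pure_tensor K H H a b'" and k: "k \<le> n" "a \<in> Hp k" "b' \<in> Hp (n - k)" by blast
        note ac = Hp_carrier[OF k(2)] and bc = Hp_carrier[OF k(3)]
        have fc: "f (antipode H a) \<in> carrier K" using hom_closed[OF fs ac] by simp
        have "?b a b' = ?c a b'"
        proof (cases "k = n")
          case False
          \<comment> \<open>Here \<open>n - k\<close> is positive, so the counit of the right factor
            vanishes and both forms are zero.\<close>
          then have "counit H b' = \<zero>\<^bsub>K\<^esub>" using k counit_Hp[of b' "n - Suc k"] Suc_diff_Suc[of k n] by (simp del: aug_power.simps)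
          then show ?thesis using f1[OF k(2,3)] False k(1) fc by simp
        next
          case True
          \<comment> \<open>The induction hypothesis does not reach degree \<open>n\<close>, so
            \<open>a\<close> is taken in degree \<open>m = n - 1\<close>; the missing degree is
            supplied by \<open>b' - \<epsilon>(b') 1\<close>.\<close>
          have am: "a \<in> Hp m" using k(2) Hp_Suc[of m] True n by auto
          have d: "counit H b' \<odot>\<^bsub>H\<^esub> \<one>\<^bsub>H\<^esub> \<in> carrier H" by (rule smult_closed[OF counit_carrier[OF bc] one_closed])
          have z: "f (antipode H a \<otimes>\<^bsub>H\<^esub> (b' \<ominus>\<^bsub>H\<^esub> counit H b' \<odot>\<^bsub>H\<^esub> \<one>\<^bsub>H\<^esub>)) = \<zero>\<^bsub>K\<^esub>"
            by (rule f1[OF am]) (use aug_in_Hp1[OF minus_counit_aug[OF bc]] n in simp_all)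
          have "?b a b' = ?b a ((b' \<ominus>\<^bsub>H\<^esub> counit H b' \<odot>\<^bsub>H\<^esub> \<one>\<^bsub>H\<^esub>) \<oplus>\<^bsub>H\<^esub> counit H b' \<odot>\<^bsub>H\<^esub> \<one>\<^bsub>H\<^esub>)"
            by (simp only: minus_add_cancel[OF bc d])
          also have "\<dots> = ?b a (b' \<ominus>\<^bsub>H\<^esub> counit H b' \<odot>\<^bsub>H\<^esub> \<one>\<^bsub>H\<^esub>) \<oplus>\<^bsub>K\<^esub> ?b a (counit H b' \<odot>\<^bsub>H\<^esub> \<one>\<^bsub>H\<^esub>)"
            using hom_add[OF bilin_hom2[OF b ac] M.minus_closed[OF bc d] d] by simp
          also have "\<dots> = \<zero>\<^bsub>K\<^esub> \<oplus>\<^bsub>K\<^esub> counit H b' \<otimes>\<^bsub>K\<^esub> f (antipode H a)"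
            unfolding z using hom_smult[OF bilin_hom2[OF b ac] counit_carrier[OF bc] one_closed] sc[OF ac] by simp
          also have "\<dots> = ?c a b'" using fc counit_carrier[OF bc] by simp
          finally show ?thesis .
        qed
        then show "form_lift K ?b t = form_lift K ?c t"
          unfolding t CC.lift_pure[OF ground_vs b ac bc] CC.lift_pure[OF ground_vs c ac bc] .
      qed
      moreover have "form_lift K ?b (comult H x) = \<zero>\<^bsub>K\<^esub>"
      proof -
        have "form_lift K ?b (comult H x) = f (tensor_lift K H (\<lambda>a b. antipode H a \<otimes>\<^bsub>H\<^esub> b) (comult H x))"
          by (rule CC.hom_lift[OF vs_self bm ground_vs f comult_closed[OF xc], symmetric])
        also have "\<dots> = f \<zero>\<^bsub>H\<^esub>"
          unfolding antipode_left[OF xc] using counit_Hp[of x m] less(2) n lmult_0[OF one_closed] by (simp del: aug_power.simps)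
        finally show ?thesis using hom_0[OF f vs_self ground_vs] by simp
      qed
      moreover have "form_lift K ?c (comult H x) = f (antipode H x)"
      proof -
        have "form_lift K ?c (comult H x) = form_lift K (\<lambda>a b. f (antipode H (counit H b \<odot>\<^bsub>H\<^esub> a))) (comult H x)"
          by (rule CC.lift_cong[OF ground_vs c comult_closed[OF xc]]) (use hom_smult[OF fs counit_carrier] in simp)
        also have "\<dots> = f (antipode H (tensor_lift K H (\<lambda>a b. counit H b \<odot>\<^bsub>H\<^esub> a) (comult H x)))"
          by (rule CC.hom_lift[OF vs_self s ground_vs fs comult_closed[OF xc], symmetric])
        finally show ?thesis unfolding counit_right[OF xc] .
      qed
      ultimately show "f (antipode H x) = \<zero>\<^bsub>K\<^esub>" by simp
    qed
  qed
qed

end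

section \<open>The augmentation filtration of a module coalgebra\<close>

context module_coalgebra
begin

abbreviation (input) "Hp \<equiv> aug_power K H"
abbreviation (input) "Mp \<equiv> aug_filtration K H M"

lemma act_bilin: "bilin K H M M (act M)"
  by (intro bilinI homI) (simp_all add: act_closed act_add_left act_add_right act_smult_left act_smult_right)

sublocale action: coalgebra_action K H M "act M"
  by unfold_locales (rule act_bilin)

lemma Mp_gens: "{act M f e | f e. f \<in> Hp n \<and> e \<in> carrier M} \<subseteq> carrier M"
  using act_closed H.Hp_carrier by auto

lemma Mp_subspace: "subspace K (Mp n) M"
  unfolding aug_filtration_def span_act_def by (rule M.span_is_subspace[OF Mp_gens])

lemmas Mp_carrier = M.sub_carrier[OF Mp_subspace]

lemma Mp_gen: "\<lbrakk>h \<in> Hp n; m \<in> carrier M\<rbrakk> \<Longrightarrow> act M h m \<in> Mp n"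
  unfolding aug_filtration_def span_act_def by (rule M.span_incl[OF Mp_gens]) blast

lemma Mp_hom_induct:
  assumes f: "f \<in> module_hom K M V" and V: "vectorspace K V" and W: "subspace K W V" and m: "m \<in> Mp n"
    and gen: "\<And>h x. \<lbrakk>h \<in> Hp n; x \<in> carrier M\<rbrakk> \<Longrightarrow> f (act M h x) \<in> W"
  shows "f m \<in> W"
  by (rule hom_span_subset[OF f M.vs_self V W Mp_gens _ m[unfolded aug_filtration_def span_act_def]]) (use gen in auto)

lemma Mp_0: "Mp 0 = carrier M"
proof
  show "carrier M \<subseteq> Mp 0" using Mp_gen[of "\<one>\<^bsub>H\<^esub>" 0] act_one by auto
qed (use Mp_carrier in auto)

lemma Mp_Suc: "Mp (Suc n) \<subseteq> Mp n"
proof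
  show "m \<in> Mp n" if "m \<in> Mp (Suc n)" for m
    by (rule Mp_hom_induct[OF hom_id M.vs_self Mp_subspace that]) (use Mp_gen H.Hp_Suc in blast)
qed

lemma act_Hp_Mp:
  assumes h: "h \<in> Hp i" and m: "m \<in> Mp j"
  shows "act M h m \<in> Mp (i + j)"
proof (rule Mp_hom_induct[OF bilin_hom2[OF act_bilin H.Hp_carrier[OF h]] M.vs_self Mp_subspace m])
  fix h' x assume x: "h' \<in> Hp j" "x \<in> carrier M"
  show "act M h (act M h' x) \<in> Mp (i + j)"
    using act_mult[OF H.Hp_carrier[OF h] H.Hp_carrier[OF x(1)] x(2)] Mp_gen[OF H.Hp_mult[OF h x(1)] x(2)] by simp
qed

lemma counit_act: "\<lbrakk>h \<in> carrier H; m \<in> carrier M\<rbrakk> \<Longrightarrow> counit M (act M h m) = counit H h \<otimes>\<^bsub>K\<^esub> counit M m"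
  by (rule action.coalgebra_homD(2)[OF act_coalgebra_hom])

lemma counit_Mp:
  assumes "m \<in> Mp 1"
  shows "counit M m = \<zero>\<^bsub>K\<^esub>"
proof -
  have "counit M m \<in> {\<zero>\<^bsub>ground_space K\<^esub>}"
  proof (rule Mp_hom_induct[OF M.counit_hom H.ground_vs vectorspace.subspace_zero[OF H.ground_vs] assms])
    fix h x assume h: "h \<in> Hp 1" and x: "x \<in> carrier M"
    then have "counit H h = \<zero>\<^bsub>K\<^esub>" "counit M x \<in> carrier K"
      using H.counit_Hp[of h 0] hom_closed[OF M.counit_hom x] by (simp_all only: One_nat_def ground_simps)
    then show "counit M (act M h x) \<in> {\<zero>\<^bsub>ground_space K\<^esub>}"
      using counit_act[OF H.Hp_carrier[OF h] x] by simp
  qed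
  then show ?thesis by simp
qed

abbreviation (input) "MpMp n \<equiv> {pure_tensor K M M a b | a b. \<exists>k\<le>n. a \<in> Mp k \<and> b \<in> Mp (n - k)}"

lemma MpMp_carrier: "MpMp n \<subseteq> carrier (tensor K M M)"
  using M.CC.tp_closed Mp_carrier by auto

lemma comult_Mp:
  assumes "m \<in> Mp n"
  shows "comult M m \<in> M.CC.T.span (MpMp n)"
proof -
  have S: "subspace K (M.CC.T.span (MpMp n)) (tensor K M M)" by (rule M.CC.T.span_is_subspace[OF MpMp_carrier])
  show ?thesis
  proof (rule Mp_hom_induct[OF M.comult_hom M.CC.tensor_vs S assms])
    fix h x assume h: "h \<in> Hp n" and x: "x \<in> carrier M"
    show "comult M (act M h x) \<in> M.CC.T.span (MpMp n)"
    proof (rule action.comult_act_mem[OF act_coalgebra_hom H.Hp_carrier[OF h] x H.comult_Hp[OF h] M.CC.span_pure[OF M.comult_closed[OF x]] _ _ S])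
      fix a b c d assume "\<exists>k\<le>n. a \<in> Hp k \<and> b \<in> Hp (n - k)" "c \<in> carrier M \<and> d \<in> carrier M"
      then obtain k where k: "k \<le> n" "a \<in> Hp k" "b \<in> Hp (n - k)" and c: "c \<in> carrier M" "d \<in> carrier M" by blast
      have "act M a c \<in> Mp k" "act M b d \<in> Mp (n - k)" by (rule Mp_gen[OF k(2) c(1)] Mp_gen[OF k(3) c(2)])+
      then show "pure_tensor K M M (act M a c) (act M b d) \<in> M.CC.T.span (MpMp n)"
        using k(1) by (intro M.CC.T.span_incl[OF MpMp_carrier]) blast
    qed (use H.Hp_carrier in blast)+
  qed
qed

lemma module_filtered: "filtered_coalgebra K M Mp"
proof (intro filtered_coalgebra.intro filtered_coalgebra_axioms.intro filtered.intro filtered_axioms.intro)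
  show "coalgebra K M" ..
  show "comult M x \<in> M.CC.T.span (MpMp n)" if "x \<in> Mp n" for x n by (rule comult_Mp[OF that])
qed (rule M.vs_self Mp_subspace Mp_Suc Mp_0 counit_Mp; assumption)+

sublocale gr: filtered_action K H Hp M Mp "act M"
proof (intro filtered_action.intro filtered_action_axioms.intro filtered_bilinear.intro filtered_bilinear_axioms.intro)
  show "filtered_coalgebra K H Hp" by (rule H.hopf_filtered)
  show "filtered_coalgebra K M Mp" by (rule module_filtered)
  show "filtered K H Hp" by (rule filtered_coalgebra.axioms(2)[OF H.hopf_filtered])
  show "filtered K M Mp" by (rule filtered_coalgebra.axioms(2)[OF module_filtered])
qed (rule act_bilin act_Hp_Mp act_coalgebra_hom; assumption)+

end

section \<open>The Hopf algebra structure on the associated graded space of \<open>H\<close>\<close>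

context hopf_algebra
begin

interpretation gr: filtered_action K H Hp H Hp "mult H"
proof (intro filtered_action.intro filtered_action_axioms.intro filtered_bilinear.intro filtered_bilinear_axioms.intro)
  show "filtered_coalgebra K H Hp" by (rule hopf_filtered)
  then show "filtered_coalgebra K H Hp" .
  show "filtered K H Hp" by (rule filtered_coalgebra.axioms(2)[OF hopf_filtered])
  then show "filtered K H Hp" .
qed (rule mult_bilin Hp_mult mult_coalgebra_hom; assumption)+

abbreviation (input) "G \<equiv> gr_space H Hp"

lemma gr_hopf_simps: "carrier (gr_hopf K H) = carrier G" "zero (gr_hopf K H) = zero G"
  "add (gr_hopf K H) = add G" "smult (gr_hopf K H) = smult G" "mult (gr_hopf K H) = gr_bilinear H Hp (mult H)"
  "one (gr_hopf K H) = gr_class H Hp 0 \<one>\<^bsub>H\<^esub>"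
  "comult (gr_hopf K H) = gr_comult K H Hp" "counit (gr_hopf K H) = gr_counit H" "antipode (gr_hopf K H) = gr_linear H Hp (antipode H)"
  by (simp_all add: gr_hopf_def Let_def)

lemma gr_one_closed: "gr_class H Hp 0 \<one>\<^bsub>H\<^esub> \<in> carrier G"
  by (rule gr.HF.cls_closed) simp

lemma gr_hopf_algebra: "hopf_algebra K (gr_hopf K H)"
proof -
  let ?D = "gr_hopf K H" and ?m = "gr_bilinear H Hp (mult H)" and ?one = "gr_class H Hp 0 \<one>\<^bsub>H\<^esub>"
  note s = gr_hopf_simps
  have hD: "module_hom K ?D U = module_hom K G U" for U :: "('k, 'u, 'zu) module_scheme" by (rule module_hom_cong) (simp_all add: s)
  have hD2: "module_hom K ?D ?D = module_hom K G G" by (rule module_hom_cong) (simp_all add: s)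
  have tD: "tensor K ?D ?D = tensor K G G" "pure_tensor K ?D ?D = pure_tensor K G G" by (rule tensor_cong, simp_all add: s)+
  have lD: "tensor_lift K ?D = (tensor_lift K G :: _ \<Rightarrow> (((nat \<Rightarrow> 'h set) \<times> (nat \<Rightarrow> 'h set)) \<Rightarrow> 'k) set \<Rightarrow> _)" by (rule tensor_lift_cong) (simp_all add: s)
  interpret D: coalgebra K ?D by (rule gr.HF.gr_coalgebra) (simp_all add: s)
  note cl = gr.HF.cls_closed and ac = gr.act_gr_closed and ab = gr.act_gr_bilin
  have mh1: "(\<lambda>v. ?m v w) \<in> module_hom K G G" if "w \<in> carrier G" for w by (rule bilin_hom1[OF ab that])
  have mh2: "?m v \<in> module_hom K G G" if "v \<in> carrier G" for v by (rule bilin_hom2[OF ab that])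
  have one0: "\<one>\<^bsub>H\<^esub> \<in> Hp 0" by simp
  have l_one: "?m ?one \<xi> = \<xi>" if "\<xi> \<in> carrier G" for \<xi>
    by (rule gr.HF.gr_hom_eq[OF mh2[OF gr_one_closed] hom_id that]) (use gr.act_gr_cls[OF one0] Hp_carrier in simp)
  have r_one: "?m \<xi> ?one = \<xi>" if "\<xi> \<in> carrier G" for \<xi>
    by (rule gr.HF.gr_hom_eq[OF mh1[OF gr_one_closed] hom_id that]) (use gr.act_gr_cls[OF _ one0] Hp_carrier in simp)
  \<comment> \<open>Three reductions to homogeneous classes, one for each variable, leave
    associativity in \<open>H\<close>.\<close>
  have assoc: "?m (?m \<xi> \<eta>) \<zeta> = ?m \<xi> (?m \<eta> \<zeta>)" if c: "\<xi> \<in> carrier G" "\<eta> \<in> carrier G" "\<zeta> \<in> carrier G" for \<xi> \<eta> \<zeta>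
  proof (rule gr.HF.gr_hom_eq[OF hom_comp[OF mh1[OF c(2)] mh1[OF c(3)]] mh1[OF ac[OF c(2,3)]] c(1)])
    fix n x assume x: "x \<in> Hp n"
    show "?m (?m (gr_class H Hp n x) \<eta>) \<zeta> = ?m (gr_class H Hp n x) (?m \<eta> \<zeta>)"
    proof (rule gr.HF.gr_hom_eq[OF hom_comp[OF mh2[OF cl[OF x]] mh1[OF c(3)]] hom_comp[OF mh1[OF c(3)] mh2[OF cl[OF x]]] c(2)])
      fix p y assume y: "y \<in> Hp p"
      show "?m (?m (gr_class H Hp n x) (gr_class H Hp p y)) \<zeta> = ?m (gr_class H Hp n x) (?m (gr_class H Hp p y) \<zeta>)"
      proof (rule gr.HF.gr_hom_eq[OF mh2[OF ac[OF cl[OF x] cl[OF y]]] hom_comp[OF mh2[OF cl[OF y]] mh2[OF cl[OF x]]] c(3)])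
        fix q z assume z: "z \<in> Hp q"
        show "?m (?m (gr_class H Hp n x) (gr_class H Hp p y)) (gr_class H Hp q z) = ?m (gr_class H Hp n x) (?m (gr_class H Hp p y) (gr_class H Hp q z))"
          using x y z Hp_carrier[OF x] Hp_carrier[OF y] Hp_carrier[OF z] Hp_mult[OF x y] Hp_mult[OF y z]
          by (simp only: gr.act_gr_cls m_assoc add.assoc)
      qed
    qed
  qed
  interpret D: ring ?D
  proof (rule ringI)
    show "abelian_group ?D" ..
    show "monoid ?D"
      by (rule monoidI) (simp_all add: s ac gr_one_closed assoc l_one r_one)
  qed (use hom_add[OF mh1] hom_add[OF mh2] in \<open>simp_all add: s\<close>)
  interpret D: assoc_algebra K ?D
    by unfold_locales (use hom_smult[OF mh1] hom_smult[OF mh2] in \<open>simp_all add: s\<close>)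
  have Sh: "gr_linear H Hp (antipode H) \<in> module_hom K G G" by (rule gr.HF.gr_linear_cls(1)[OF antipode_linear antipode_Hp])
  have Sc: "gr_linear H Hp (antipode H) (gr_class H Hp n x) = gr_class H Hp n (antipode H x)" if "x \<in> Hp n" for n x
    by (rule gr.HF.gr_linear_cls(2)[OF antipode_linear antipode_Hp that])
  \<comment> \<open>Both antipode axioms at once: \<open>p\<close> and \<open>q\<close> will be the
    antipode and the identity in either order, and \<open>p0\<close> and \<open>q0\<close> are the
    maps of \<open>H\<close> that induce them.\<close>
  have anti: "tensor_lift K G (\<lambda>a b. ?m (p a) (q b)) (gr_comult K H Hp \<xi>) = gr_counit H \<xi> \<odot>\<^bsub>G\<^esub> ?one"
    if p: "p \<in> module_hom K G G" "\<And>n x. x \<in> Hp n \<Longrightarrow> p (gr_class H Hp n x) = gr_class H Hp n (p0 x)" "p0 \<in> module_hom K H H" "\<And>n x. x \<in> Hp n \<Longrightarrow> p0 x \<in> Hp n"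
      and q: "q \<in> module_hom K G G" "\<And>n x. x \<in> Hp n \<Longrightarrow> q (gr_class H Hp n x) = gr_class H Hp n (q0 x)" "q0 \<in> module_hom K H H" "\<And>n x. x \<in> Hp n \<Longrightarrow> q0 x \<in> Hp n"
      and eq: "\<And>x. x \<in> carrier H \<Longrightarrow> tensor_lift K H (\<lambda>a b. p0 a \<otimes>\<^bsub>H\<^esub> q0 b) (comult H x) = counit H x \<odot>\<^bsub>H\<^esub> \<one>\<^bsub>H\<^esub>"
      and \<xi>: "\<xi> \<in> carrier G" for p q p0 q0 \<xi>
  proof -
    have bG: "bilin K G G G (\<lambda>a b. ?m (p a) (q b))" by (rule bilin_subst[OF ab p(1) q(1)])
    have bH: "bilin K H H H (\<lambda>a b. p0 a \<otimes>\<^bsub>H\<^esub> q0 b)" by (rule bilin_subst[OF mult_bilin p(3) q(3)])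
    note LG = gr.HF.GG.lift_hom[OF gr.HF.G_vs bG]
    have R: "(\<lambda>\<xi>. gr_counit H \<xi> \<odot>\<^bsub>G\<^esub> ?one) \<in> module_hom K G G"
      by (rule bilin_hom1[OF gr.HF.G.bilin_scale[OF gr.HF.hf_dual[OF gr.HF.counit_kills, folded gr.HF.gr_counit_alt]] gr_one_closed])
    show ?thesis
    proof (rule gr.HF.gr_hom_eq[OF hom_comp[OF gr.HF.gr_comult_hom LG] R \<xi>])
      fix n x assume x: "x \<in> Hp n"
      note xc = Hp_carrier[OF x] and e = eq[OF Hp_carrier[OF x]]
      have z: "counit H x = \<zero>\<^bsub>K\<^esub>" if "n \<noteq> 0" using counit_Hp[of x "n - 1"] x that by (simp del: aug_power.simps)
      \<comment> \<open>In positive degree the counit of \<open>x\<close> vanishes, so the element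
        is zero; in degree 0 there is no condition.\<close>
      have u: "counit H x \<odot>\<^bsub>H\<^esub> \<one>\<^bsub>H\<^esub> \<in> Hp n"
        using smult_closed[OF counit_carrier[OF xc] one_closed] z lmult_0[OF one_closed] sub_0[OF Hp_subspace] by (cases n) (simp_all del: aug_power.simps(2))
      have "tensor_lift K G (\<lambda>a b. ?m (p a) (q b)) (gr_comult K H Hp (gr_class H Hp n x)) =
          gr_class H Hp n (tensor_lift K H (\<lambda>a b. p0 a \<otimes>\<^bsub>H\<^esub> q0 b) (comult H x))"
      proof (rule gr.HF.lift_gr_comult_graded[OF x bG bH])
        show "p0 a \<otimes>\<^bsub>H\<^esub> q0 b \<in> Hp n \<and> ?m (p (gr_class H Hp k a)) (q (gr_class H Hp (n - k) b)) = gr_class H Hp n (p0 a \<otimes>\<^bsub>H\<^esub> q0 b)"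
          if k: "k \<le> n" "a \<in> Hp k" "b \<in> Hp (n - k)" for k a b
          using Hp_mult[OF p(4)[OF k(2)] q(4)[OF k(3)]] gr.act_gr_cls[OF p(4)[OF k(2)] q(4)[OF k(3)]] p(2)[OF k(2)] q(2)[OF k(3)] k(1) by simp
      qed (use e u in simp)
      also have "\<dots> = gr_counit H (gr_class H Hp n x) \<odot>\<^bsub>G\<^esub> ?one"
      proof (cases n)
        case 0
        then show ?thesis
          using hom_smult[OF gr.HF.cls_hom[of 0] counit_carrier[OF xc], of "\<one>\<^bsub>H\<^esub>"] gr.HF.hf_cls[OF gr.HF.counit_kills x]
          by (simp add: e gr.HF.gr_counit_alt)
      next
        case (Suc k)
        then have "gr_class H Hp n (counit H x \<odot>\<^bsub>H\<^esub> \<one>\<^bsub>H\<^esub>) = \<zero>\<^bsub>G\<^esub>"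
          using z lmult_0[OF one_closed] iffD2[OF gr.HF.cls_zero_iff[OF sub_0[OF Hp_subspace]] sub_0[OF Hp_subspace]] by simp
        then show ?thesis
          using gr.HF.hf_cls[OF gr.HF.counit_kills x] gr.HF.G.lmult_0[OF gr_one_closed] Suc by (simp add: e gr.HF.gr_counit_alt)
      qed
      finally show "tensor_lift K G (\<lambda>a b. ?m (p a) (q b)) (gr_comult K H Hp (gr_class H Hp n x)) = gr_counit H (gr_class H Hp n x) \<odot>\<^bsub>G\<^esub> ?one" .
    qed
  qed
  show ?thesis
  proof unfold_locales
    show "coalgebra_hom K (tensor_coalgebra K ?D ?D) ?D (tensor_lift K ?D (mult ?D))"
      unfolding s(5) by (rule gr.gr_action_coalgebra_hom) (simp_all add: s)
    \<comment> \<open>Both sides live in bidegree \<open>(0, 0)\<close>: test functionals of other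
      degrees vanish on the class of the unit, and for \<open>i = j = 0\<close> the claim is
      \<open>comult_one\<close> tested on \<open>f\<close> and \<open>g\<close>.\<close>
    show "comult ?D \<one>\<^bsub>?D\<^esub> = pure_tensor K ?D ?D \<one>\<^bsub>?D\<^esub> \<one>\<^bsub>?D\<^esub>"
      unfolding s tD
    proof (rule gr.HF.gr_tensor_eqI[OF gr.HF.gr_comult_closed[OF gr_one_closed] gr.HF.GG.tp_closed[OF gr_one_closed gr_one_closed]])
      fix i j f g assume f: "f \<in> gr.HF.kills (Suc i)" and g: "g \<in> gr.HF.kills (Suc j)"
      note fd = gr.HF.killsD(1)[OF f] gr.HF.killsD(1)[OF g]
      have c: "f \<one>\<^bsub>H\<^esub> \<in> carrier K" "g \<one>\<^bsub>H\<^esub> \<in> carrier K"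
        using hom_closed[OF fd(1) one_closed] hom_closed[OF fd(2) one_closed] by simp_all
      have "conv K H f g \<one>\<^bsub>H\<^esub> = f \<one>\<^bsub>H\<^esub> \<otimes>\<^bsub>K\<^esub> g \<one>\<^bsub>H\<^esub>"
        unfolding conv_def comult_one by (rule CC.ev_pure[OF fd one_closed one_closed])
      then show "ev K (gr.HF.hf i f) (gr.HF.hf j g) (gr_comult K H Hp ?one) =
          ev K (gr.HF.hf i f) (gr.HF.hf j g) (pure_tensor K G G ?one ?one)"
        unfolding gr.HF.ev_gr_comult[OF f g gr_one_closed] gr.HF.hf_conv_cls[OF f g one0]
          gr.HF.GG.ev_pure[OF gr.HF.hf_dual[OF f] gr.HF.hf_dual[OF g] gr_one_closed gr_one_closed]
          gr.HF.hf_cls[OF f one0] gr.HF.hf_cls[OF g one0] using c by auto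
    qed
    show "counit ?D \<one>\<^bsub>?D\<^esub> = \<one>\<^bsub>K\<^esub>"
      using gr.HF.hf_cls[OF gr.HF.counit_kills one0] counit_one by (simp add: s gr.HF.gr_counit_alt)
    show "antipode ?D \<in> module_hom K ?D ?D" unfolding hD2 s by (rule Sh)
    fix \<xi> assume "\<xi> \<in> carrier ?D"
    then have \<xi>: "\<xi> \<in> carrier G" by (simp add: s)
    show "tensor_lift K ?D (\<lambda>a b. antipode ?D a \<otimes>\<^bsub>?D\<^esub> b) (comult ?D \<xi>) = counit ?D \<xi> \<odot>\<^bsub>?D\<^esub> \<one>\<^bsub>?D\<^esub>"
      unfolding s lD by (rule anti[OF Sh Sc antipode_linear antipode_Hp hom_id _ hom_id _ antipode_left \<xi>]; (assumption | rule refl)?)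
    show "tensor_lift K ?D (\<lambda>a b. a \<otimes>\<^bsub>?D\<^esub> antipode ?D b) (comult ?D \<xi>) = counit ?D \<xi> \<odot>\<^bsub>?D\<^esub> \<one>\<^bsub>?D\<^esub>"
      unfolding s lD by (rule anti[OF hom_id _ hom_id _ Sh Sc antipode_linear antipode_Hp antipode_right \<xi>]; (assumption | rule refl)?)
  qed
qed

end


section \<open>The module coalgebra structure on the associated graded space of
  \<open>M\<close>\<close>

lemma (in module_coalgebra) gr_modcoalg_simps:
  fixes N defines "N \<equiv> gr_modcoalg K H M"
  shows "carrier N = carrier gr.GM" "zero N = zero gr.GM" "add N = add gr.GM" "smult N = smult gr.GM"
    "comult N = gr_comult K M Mp" "counit N = gr_counit M" "act N = gr_bilinear M Mp (act M)"
    by (simp_all add: N_def gr_modcoalg_def Let_def)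

lemma (in module_coalgebra) gr_module_coalgebra: "module_coalgebra K (gr_hopf K H) (gr_modcoalg K H M)"
proof -
  let ?D = "gr_hopf K H" and ?N = "gr_modcoalg K H M" and ?a = "gr_bilinear M Mp (act M)"
  note s = H.gr_hopf_simps and n = gr_modcoalg_simps
  interpret D: hopf_algebra K ?D by (rule H.gr_hopf_algebra)
  interpret N: coalgebra K ?N by (rule gr.MF.gr_coalgebra) (simp_all add: n)
  note ac = gr.act_gr_closed and ab = gr.act_gr_bilin
  note clH = gr.HF.cls_closed and clM = gr.MF.cls_closed
  have mh1: "(\<lambda>v. ?a v w) \<in> module_hom K gr.GH gr.GM" if "w \<in> carrier gr.GM" for w by (rule bilin_hom1[OF ab that])
  have mh2: "?a v \<in> module_hom K gr.GM gr.GM" if "v \<in> carrier gr.GH" for v by (rule bilin_hom2[OF ab that])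
  have hm: "bilin K gr.GH gr.GH gr.GH (gr_bilinear H Hp (mult H))"
    using D.mult_bilin bilin_record_cong[of ?D gr.GH ?D gr.GH ?D gr.GH K] by (simp add: s)
  have hc: "gr_bilinear H Hp (mult H) (gr_class H Hp n x) (gr_class H Hp p y) = gr_class H Hp (n + p) (x \<otimes>\<^bsub>H\<^esub> y)"
    if "x \<in> Hp n" "y \<in> Hp p" for x y n p
  proof -
    interpret m: filtered_bilinear K H Hp H Hp "mult H"
      by (intro filtered_bilinear.intro filtered_bilinear_axioms.intro H.mult_bilin H.Hp_mult
        filtered_coalgebra.axioms(2)[OF H.hopf_filtered])
    show ?thesis by (rule m.act_gr_cls[OF that])
  qed
  have one0: "\<one>\<^bsub>H\<^esub> \<in> Hp 0" by simp
  have act1: "?a (gr_class H Hp 0 \<one>\<^bsub>H\<^esub>) f = f" if "f \<in> carrier gr.GM" for f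
    by (rule gr.MF.gr_hom_eq[OF mh2[OF H.gr_one_closed] hom_id that]) (use gr.act_gr_cls[OF one0] Mp_carrier act_one in simp)
  have assoc: "?a (gr_bilinear H Hp (mult H) f g) \<zeta> = ?a f (?a g \<zeta>)"
    if c: "f \<in> carrier gr.GH" "g \<in> carrier gr.GH" "\<zeta> \<in> carrier gr.GM" for f g \<zeta>
  proof (rule gr.HF.gr_hom_eq[OF hom_comp[OF bilin_hom1[OF hm c(2)] mh1[OF c(3)]] mh1[OF ac[OF c(2,3)]] c(1)])
    fix n x assume x: "x \<in> Hp n"
    show "?a (gr_bilinear H Hp (mult H) (gr_class H Hp n x) g) \<zeta> = ?a (gr_class H Hp n x) (?a g \<zeta>)"
    proof (rule gr.HF.gr_hom_eq[OF hom_comp[OF bilin_hom2[OF hm clH[OF x]] mh1[OF c(3)]] hom_comp[OF mh1[OF c(3)] mh2[OF clH[OF x]]] c(2)])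
      fix p y assume y: "y \<in> Hp p"
      show "?a (gr_bilinear H Hp (mult H) (gr_class H Hp n x) (gr_class H Hp p y)) \<zeta> = ?a (gr_class H Hp n x) (?a (gr_class H Hp p y) \<zeta>)"
      proof (rule gr.MF.gr_hom_eq[OF mh2[OF bilin_closed[OF hm clH[OF x] clH[OF y]]] hom_comp[OF mh2[OF clH[OF y]] mh2[OF clH[OF x]]] c(3)])
        fix q z assume z: "z \<in> Mp q"
        show "?a (gr_bilinear H Hp (mult H) (gr_class H Hp n x) (gr_class H Hp p y)) (gr_class M Mp q z) =
            ?a (gr_class H Hp n x) (?a (gr_class H Hp p y) (gr_class M Mp q z))"
          using x y z H.Hp_carrier[OF x] H.Hp_carrier[OF y] Mp_carrier[OF z] H.Hp_mult[OF x y] act_Hp_Mp[OF y z]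
          by (simp only: hc gr.act_gr_cls act_mult add.assoc)
      qed
    qed
  qed
  show ?thesis
  proof unfold_locales
    show "coalgebra_hom K (tensor_coalgebra K ?D ?N) ?N (tensor_lift K ?N (act ?N))"
      unfolding n(7) by (rule gr.gr_action_coalgebra_hom) (simp_all add: s n)
  qed (use hom_add[OF mh1] hom_add[OF mh2] hom_smult[OF mh1] hom_smult[OF mh2] ac assoc act1 in \<open>simp_all add: s n\<close>)
qed

section \<open>Relative dimension\<close>

context vectorspace
begin

text \<open>\<open>rel Y X n\<close> holds if \<open>Y \<subseteq> X\<close> are subspaces and \<open>X / Y\<close> has dimension \<open>n\<close>.\<close>

inductive rel :: "'c set \<Rightarrow> 'c set \<Rightarrow> nat \<Rightarrow> bool" where
  rel_refl: "subspace K X V \<Longrightarrow> rel X X 0"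
| rel_step: "\<lbrakk>rel Y X n; x \<in> carrier V; x \<notin> X\<rbrakk> \<Longrightarrow> rel Y (X <+>\<^bsub>V\<^esub> line x) (Suc n)"

lemma subspace_add_line: "\<lbrakk>subspace K X V; x \<in> carrier V\<rbrakk> \<Longrightarrow> subspace K (X <+>\<^bsub>V\<^esub> line x) V"
  by (rule subspace_set_add[OF _ subspace_line])

lemma add_line_upper: "\<lbrakk>subspace K X V; x \<in> carrier V\<rbrakk> \<Longrightarrow> X \<subseteq> X <+>\<^bsub>V\<^esub> line x"
  by (rule set_add_upper1[OF _ subspace_line])

lemma add_line_mem: "\<lbrakk>subspace K X V; x \<in> carrier V\<rbrakk> \<Longrightarrow> x \<in> X <+>\<^bsub>V\<^esub> line x"
  using set_add_upper2[OF _ subspace_line] in_line by blast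

lemma add_line_least: "\<lbrakk>subspace K W V; X \<subseteq> W; x \<in> W\<rbrakk> \<Longrightarrow> X <+>\<^bsub>V\<^esub> line x \<subseteq> W"
  by (rule set_add_least) (auto simp: line_def sub_smult)

lemma rel_sub: "rel Y X n \<Longrightarrow> subspace K Y V \<and> subspace K X V \<and> Y \<subseteq> X"
proof (induct rule: rel.induct)
  case (rel_step Y X n x)
  then show ?case using subspace_add_line[of X x] add_line_upper[of X x] by auto
qed simp

lemma rel_0: "rel Y X 0 \<longleftrightarrow> subspace K Y V \<and> X = Y"
  by (auto elim: rel.cases intro: rel_refl)

lemma rel_SucE:
  assumes "rel Y X (Suc n)"
  obtains X0 x where "rel Y X0 n" "x \<in> carrier V" "x \<notin> X0" "X = X0 <+>\<^bsub>V\<^esub> line x"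
  using assms by (auto elim: rel.cases)

text \<open>Steinitz exchange: the coefficient of \<open>x\<close> in \<open>y\<close> is nonzero
  because \<open>y\<close> lies outside \<open>X\<close>, so the relation can be solved for
  \<open>x\<close>.\<close>

lemma add_line_exchange:
  assumes X: "subspace K X V" and x: "x \<in> carrier V" and y: "y \<in> X <+>\<^bsub>V\<^esub> line x" "y \<notin> X"
  shows "x \<in> X <+>\<^bsub>V\<^esub> line y" "X <+>\<^bsub>V\<^esub> line x = X <+>\<^bsub>V\<^esub> line y"
proof -
  obtain a c where a: "a \<in> X" "c \<in> carrier K" "y = a \<oplus>\<^bsub>V\<^esub> c \<odot>\<^bsub>V\<^esub> x" using y(1) by (auto simp: in_add_line)
  have ac: "a \<in> carrier V" by (rule sub_carrier[OF X a(1)])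
  have yc: "y \<in> carrier V" using a ac x by simp
  have c0: "c \<noteq> \<zero>\<^bsub>K\<^esub>" using a x ac y(2) by auto
  have S: "subspace K (X <+>\<^bsub>V\<^esub> line y) V" by (rule subspace_add_line[OF X yc])
  have "y \<ominus>\<^bsub>V\<^esub> a \<in> X <+>\<^bsub>V\<^esub> line y"
    by (rule sub_minus[OF S add_line_mem[OF X yc] subsetD[OF add_line_upper[OF X yc] a(1)]])
  moreover have "y \<ominus>\<^bsub>V\<^esub> a = c \<odot>\<^bsub>V\<^esub> x" using a(2,3) ac x by (simp add: a_minus_def M.a_ac M.r_neg1 M.r_neg2)
  ultimately show 1: "x \<in> X <+>\<^bsub>V\<^esub> line y" using sub_smult_iff[OF S a(2) c0 x] by simp
  show "X <+>\<^bsub>V\<^esub> line x = X <+>\<^bsub>V\<^esub> line y"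
    using add_line_least[OF S add_line_upper[OF X yc] 1]
      add_line_least[OF subspace_add_line[OF X x] add_line_upper[OF X x] y(1)] by simp
qed

text \<open>The vector \<open>w\<close> lies outside every member of the chain from \<open>A\<close>
  to \<open>X\<close>, and by exchange each new vector of the chain remains new after
  \<open>w\<close> has been added. So the shifted chain is still strict.\<close>

lemma rel_add_line:
  assumes "rel A X b" "w \<in> carrier V" "w \<notin> X"
  shows "rel (A <+>\<^bsub>V\<^esub> line w) (X <+>\<^bsub>V\<^esub> line w) b"
  using assms
proof (induct rule: rel.induct)
  case (rel_refl X)
  then show ?case by (intro rel.rel_refl subspace_add_line)
next
  case (rel_step A X n x)
  have X: "subspace K X V" using rel_sub[OF rel_step(1)] by simp
  have wX: "w \<notin> X" using rel_step(6) add_line_upper[OF X rel_step(3)] by blast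
  have IH: "rel (A <+>\<^bsub>V\<^esub> line w) (X <+>\<^bsub>V\<^esub> line w) n" by (rule rel_step(2)[OF rel_step(5) wX])
  have "x \<notin> X <+>\<^bsub>V\<^esub> line w" using add_line_exchange(1)[OF X rel_step(5) _ rel_step(4)] rel_step(6) by blast
  from rel.rel_step[OF IH rel_step(3) this]
  have r: "rel (A <+>\<^bsub>V\<^esub> line w) ((X <+>\<^bsub>V\<^esub> line w) <+>\<^bsub>V\<^esub> line x) (Suc n)" .
  have S: "subspace K ((X <+>\<^bsub>V\<^esub> line w) <+>\<^bsub>V\<^esub> line x) V" "subspace K ((X <+>\<^bsub>V\<^esub> line x) <+>\<^bsub>V\<^esub> line w) V"
    "subspace K (X <+>\<^bsub>V\<^esub> line w) V" "subspace K (X <+>\<^bsub>V\<^esub> line x) V"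
    by (intro subspace_add_line X rel_step(3,5))+
  have "(X <+>\<^bsub>V\<^esub> line w) <+>\<^bsub>V\<^esub> line x = (X <+>\<^bsub>V\<^esub> line x) <+>\<^bsub>V\<^esub> line w"
  proof
    note u = add_line_upper[OF S(4) rel_step(5)] add_line_upper[OF X rel_step(3)] add_line_mem[OF X rel_step(3)] add_line_mem[OF S(4) rel_step(5)]
    show "(X <+>\<^bsub>V\<^esub> line w) <+>\<^bsub>V\<^esub> line x \<subseteq> (X <+>\<^bsub>V\<^esub> line x) <+>\<^bsub>V\<^esub> line w"
      using u by (intro add_line_least[OF S(2)]) auto
    note u = add_line_upper[OF S(3) rel_step(3)] add_line_upper[OF X rel_step(5)] add_line_mem[OF X rel_step(5)] add_line_mem[OF S(3) rel_step(3)]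
    show "(X <+>\<^bsub>V\<^esub> line x) <+>\<^bsub>V\<^esub> line w \<subseteq> (X <+>\<^bsub>V\<^esub> line w) <+>\<^bsub>V\<^esub> line x"
      using u by (intro add_line_least[OF S(1)]) auto
  qed
  then show ?case using r by simp
qed

text \<open>Induction along the chain, applied to \<open>W \<inter> X\<close>. If \<open>W\<close>
  is not inside \<open>X\<close>, some \<open>w\<close> of \<open>W\<close> outside \<open>X\<close>
  can replace the last vector \<open>x\<close> of the chain, and then \<open>W\<close> is
  \<open>W \<inter> X\<close> plus the line of \<open>w\<close>.\<close>

lemma rel_split:
  assumes "rel Y X n" "subspace K W V" "Y \<subseteq> W" "W \<subseteq> X"
  shows "\<exists>a b. rel Y W a \<and> rel W X b \<and> n = a + b"
  using assms
proof (induct arbitrary: W rule: rel.induct)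
  case (rel_refl X)
  then have "W = X" by simp
  then show ?case using rel.rel_refl[OF rel_refl(1)] by (intro exI[of _ 0]) simp
next
  case (rel_step Y X n x)
  have X: "subspace K X V" "subspace K Y V" "Y \<subseteq> X" using rel_sub[OF rel_step(1)] by simp_all
  have S: "subspace K (W \<inter> X) V" by (rule subspace_Int[OF rel_step(5) X(1)])
  obtain a b where ab: "rel Y (W \<inter> X) a" "rel (W \<inter> X) X b" "n = a + b"
    using rel_step(2)[OF S] X(3) rel_step(6) by auto
  show ?case
  proof (cases "W \<subseteq> X")
    case True
    then have W: "W \<inter> X = W" by blast
    have "rel W (X <+>\<^bsub>V\<^esub> line x) (Suc b)" using ab(2) W by (intro rel.rel_step[OF _ rel_step(3,4)]) simp
    then show ?thesis using ab W by (intro exI[of _ a] exI[of _ "Suc b"]) simp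
  next
    case False
    then obtain w where w: "w \<in> W" "w \<notin> X" by blast
    have wc: "w \<in> carrier V" by (rule sub_carrier[OF rel_step(5) w(1)])
    have Xw: "X <+>\<^bsub>V\<^esub> line x = X <+>\<^bsub>V\<^esub> line w"
      by (rule add_line_exchange(2)[OF X(1) rel_step(3)]) (use w rel_step(7) in auto)
    have "W = (W \<inter> X) <+>\<^bsub>V\<^esub> line w"
    proof
      show "(W \<inter> X) <+>\<^bsub>V\<^esub> line w \<subseteq> W" by (rule add_line_least[OF rel_step(5) _ w(1)]) simp
      show "W \<subseteq> (W \<inter> X) <+>\<^bsub>V\<^esub> line w"
      proof
        fix y assume y: "y \<in> W"
        then obtain a c where a: "a \<in> X" "c \<in> carrier K" "y = a \<oplus>\<^bsub>V\<^esub> c \<odot>\<^bsub>V\<^esub> w"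
          using subsetD[OF rel_step(7) y] unfolding Xw by (auto simp: in_add_line)
        have "a \<in> W" using y sub_add_cancel(1)[OF rel_step(5) sub_carrier[OF X(1) a(1)] sub_smult[OF rel_step(5) a(2) w(1)]] a(3) by simp
        then show "y \<in> (W \<inter> X) <+>\<^bsub>V\<^esub> line w" using a by (auto simp: in_add_line)
      qed
    qed
    moreover have "rel Y ((W \<inter> X) <+>\<^bsub>V\<^esub> line w) (Suc a)" by (rule rel.rel_step[OF ab(1) wc]) (use w in simp)
    moreover have "rel ((W \<inter> X) <+>\<^bsub>V\<^esub> line w) (X <+>\<^bsub>V\<^esub> line w) b" by (rule rel_add_line[OF ab(2) wc w(2)])
    ultimately show ?thesis using Xw ab(3) by (intro exI[of _ "Suc a"] exI[of _ b]) simp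
  qed
qed

lemma rel_strict: "rel Y X (Suc n) \<Longrightarrow> X \<noteq> Y"
proof
  assume r: "rel Y X (Suc n)" and e: "X = Y"
  obtain X0 x where x: "rel Y X0 n" "x \<in> carrier V" "x \<notin> X0" "X = X0 <+>\<^bsub>V\<^esub> line x" by (rule rel_SucE[OF r])
  then show False using rel_sub[OF x(1)] add_line_mem[of X0 x] e by auto
qed

lemma rel_line_unique:
  assumes X: "subspace K X V" and x: "x \<in> carrier V" "x \<notin> X" and r: "rel X (X <+>\<^bsub>V\<^esub> line x) b"
  shows "b = 1"
proof (cases b)
  case 0
  then show ?thesis using r add_line_mem[OF X x(1)] x(2) by (auto simp: rel_0)
next
  case (Suc n)
  then obtain X1 y where y: "rel X X1 n" "y \<in> carrier V" "y \<notin> X1" "X <+>\<^bsub>V\<^esub> line x = X1 <+>\<^bsub>V\<^esub> line y"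
    using r rel_SucE by blast
  have X1: "subspace K X1 V" "X \<subseteq> X1" using rel_sub[OF y(1)] by simp_all
  have sub: "X1 \<subseteq> X <+>\<^bsub>V\<^esub> line x" using y add_line_upper[OF X1(1) y(2)] by simp
  have "X1 = X"
  proof (rule ccontr)
    assume "X1 \<noteq> X"
    then obtain z where z: "z \<in> X1" "z \<notin> X" using X1(2) by blast
    have "X <+>\<^bsub>V\<^esub> line x = X <+>\<^bsub>V\<^esub> line z" by (rule add_line_exchange(2)[OF X x(1)]) (use z sub in auto)
    also have "\<dots> \<subseteq> X1" by (rule add_line_least[OF X1 z(1)])
    finally show False using y(3,4) add_line_mem[OF X1(1) y(2)] by auto
  qed
  then show ?thesis using y(1) rel_strict[of X X] Suc by (cases n) auto
qed

lemma rel_unique: "\<lbrakk>rel Y X n; rel Y X n'\<rbrakk> \<Longrightarrow> n = n'"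
proof (induct n arbitrary: X n')
  case 0
  then show ?case using rel_strict[of Y X] by (cases n') (auto simp: rel_0)
next
  case (Suc n)
  obtain X0 x where x: "rel Y X0 n" "x \<in> carrier V" "x \<notin> X0" "X = X0 <+>\<^bsub>V\<^esub> line x" by (rule rel_SucE[OF Suc(2)])
  have X0: "subspace K X0 V" "Y \<subseteq> X0" using rel_sub[OF x(1)] by simp_all
  obtain a b where ab: "rel Y X0 a" "rel X0 X b" "n' = a + b"
    using rel_split[OF Suc(3) X0] add_line_upper[OF X0(1) x(2)] x(4) by auto
  have "b = 1" by (rule rel_line_unique[OF X0(1) x(2,3)]) (use ab x in simp)
  then show ?case using Suc(1)[OF x(1) ab(1)] ab(3) by simp
qed

lemma rel_trans: "\<lbrakk>rel W X b; rel Y W a\<rbrakk> \<Longrightarrow> rel Y X (a + b)"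
proof (induct arbitrary: Y a rule: rel.induct)
  case (rel_step W X n x)
  then show ?case using rel.rel_step[OF rel_step(2)[OF rel_step(5)] rel_step(3,4)] by simp
qed simp

text \<open>\<open>Y\<close> and \<open>X\<close> may both be infinite-dimensional, as \<Omega> and
  the subspaces above it can be. For \<open>Y\<close> zero these are the usual notions, by
  \<open>fin_dim_subspace\<close>.\<close>

definition fin :: "'c set \<Rightarrow> 'c set \<Rightarrow> bool" where "fin Y X \<longleftrightarrow> (\<exists>n. rel Y X n)"
definition rdim :: "'c set \<Rightarrow> 'c set \<Rightarrow> nat" where "rdim Y X = (THE n. rel Y X n)"

lemma rdim_eq: "rel Y X n \<Longrightarrow> rdim Y X = n"
  unfolding rdim_def by (rule the_equality) (auto intro: rel_unique)

lemma rel_iff: "rel Y X n \<longleftrightarrow> fin Y X \<and> rdim Y X = n"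
  by (auto simp: fin_def rdim_eq)

lemma fin_sub: "fin Y X \<Longrightarrow> subspace K Y V" "fin Y X \<Longrightarrow> subspace K X V" "fin Y X \<Longrightarrow> Y \<subseteq> X"
  using rel_sub by (auto simp: fin_def)

lemma rdim_split:
  assumes "fin Y X" "subspace K W V" "Y \<subseteq> W" "W \<subseteq> X"
  shows "fin Y W" "fin W X" "rdim Y X = rdim Y W + rdim W X"
proof -
  obtain n where n: "rel Y X n" using assms(1) by (auto simp: fin_def)
  then obtain a b where "rel Y W a" "rel W X b" "n = a + b" using rel_split[OF n assms(2-4)] by auto
  then show "fin Y W" "fin W X" "rdim Y X = rdim Y W + rdim W X" using n by (auto simp: rel_iff)
qed

lemma fin_trans: "\<lbrakk>fin Y W; fin W X\<rbrakk> \<Longrightarrow> fin Y X" "\<lbrakk>fin Y W; fin W X\<rbrakk> \<Longrightarrow> rdim Y X = rdim Y W + rdim W X"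
  using rel_trans by (auto simp: rel_iff)

lemma fin_self: "subspace K X V \<Longrightarrow> fin X X" "subspace K X V \<Longrightarrow> rdim X X = 0"
  using rel_refl[of X] by (auto simp: rel_iff)

lemma rdim_0: "\<lbrakk>fin Y X; rdim Y X = 0\<rbrakk> \<Longrightarrow> X = Y"
  using rel_0[of Y X] by (simp add: rel_iff)

lemma fin_line:
  assumes "fin Y X" "x \<in> carrier V"
  shows "fin Y (X <+>\<^bsub>V\<^esub> line x)"
proof (cases "x \<in> X")
  case True
  have X: "subspace K X V" by (rule fin_sub(2)[OF assms(1)])
  have "X <+>\<^bsub>V\<^esub> line x = X" using add_line_least[OF X _ True] add_line_upper[OF X assms(2)] by auto
  then show ?thesis using assms by simp
next
  case False
  obtain n where "rel Y X n" using assms(1) by (auto simp: fin_def)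
  from rel_step[OF this assms(2) False] show ?thesis by (auto simp: fin_def)
qed

end

text \<open>Only finiteness is claimed, because the images of the successive lines may be redundant.
  The exact dimension comes from \<open>rel_vimage\<close>.\<close>

lemma fin_set_add_image:
  assumes f: "f \<in> module_hom K V U" and V: "vectorspace K V" and U: "vectorspace K U" and Y: "subspace K Y U"
    and r: "vectorspace.rel K V Q X n" and Q: "f ` Q \<subseteq> Y"
  shows "vectorspace.fin K U Y (Y <+>\<^bsub>U\<^esub> f ` X)"
proof -
  interpret V: vectorspace K V by (rule V)
  interpret U: vectorspace K U by (rule U)
  have s: "subspace K (Y <+>\<^bsub>U\<^esub> f ` X) U" "Y \<subseteq> Y <+>\<^bsub>U\<^esub> f ` X" "f ` X \<subseteq> Y <+>\<^bsub>U\<^esub> f ` X" if "subspace K X V" for X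
    using subspace_image[OF f V U that] U.subspace_set_add[OF Y] U.set_add_upper1[OF Y] U.set_add_upper2[OF Y] by simp_all
  show ?thesis
    using r Q
  proof (induct rule: V.rel.induct)
    case (rel_refl X)
    have "Y <+>\<^bsub>U\<^esub> f ` X = Y" using U.set_add_least[OF Y subset_refl rel_refl(2)] s(2)[OF rel_refl(1)] by simp
    then show ?case using U.fin_self[OF Y] by simp
  next
    case (rel_step Q X n x)
    have X: "subspace K X V" using V.rel_sub[OF rel_step(1)] by simp
    let ?X = "X <+>\<^bsub>V\<^esub> V.line x" and ?Z = "(Y <+>\<^bsub>U\<^esub> f ` X) <+>\<^bsub>U\<^esub> U.line (f x)"
    note Xl = s[OF V.subspace_add_line[OF X rel_step(3)]] and fx = hom_closed[OF f rel_step(3)]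
    have Z: "U.fin Y ?Z" by (rule U.fin_line[OF rel_step(2)[OF rel_step(5)] fx])
    have "f ` ?X \<subseteq> ?Z"
    proof
      fix y assume "y \<in> f ` ?X"
      then obtain a c where a: "a \<in> X" "c \<in> carrier K" "y = f (a \<oplus>\<^bsub>V\<^esub> c \<odot>\<^bsub>V\<^esub> x)" by (auto simp: V.in_add_line)
      have "y = f a \<oplus>\<^bsub>U\<^esub> c \<odot>\<^bsub>U\<^esub> f x"
        using a hom_add[OF f V.sub_carrier[OF X a(1)] V.smult_closed[OF a(2) rel_step(3)]] hom_smult[OF f a(2) rel_step(3)] by simp
      then show "y \<in> ?Z" using a s(3)[OF X] by (auto simp: U.in_add_line)
    qed
    then have "Y <+>\<^bsub>U\<^esub> f ` ?X \<subseteq> ?Z" by (rule U.set_add_least[OF U.fin_sub(2,3)[OF Z]])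
    then show ?case by (rule U.rdim_split(1)[OF Z Xl(1,2)])
  qed
qed

text \<open>Pulls a chain from \<open>Y\<close> to \<open>Y + f X\<close> back to \<open>X\<close>:
  the preimage of the last but one member is smaller by exactly one line, spanned by a vector whose
  image is the last vector of the chain modulo \<open>Y\<close>.\<close>

lemma rel_vimage:
  assumes f: "f \<in> module_hom K V U" and V: "vectorspace K V" and U: "vectorspace K U"
    and r: "vectorspace.rel K U Y Z n" and X: "subspace K X V" and Z: "Z = Y <+>\<^bsub>U\<^esub> f ` X"
  shows "vectorspace.rel K V {x \<in> X. f x \<in> Y} X n"
proof -
  interpret V: vectorspace K V by (rule V)
  interpret U: vectorspace K U by (rule U)
  have Q: "subspace K {x \<in> X. f x \<in> W} V" if "subspace K W U" "subspace K X V" for W X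
  proof -
    have "{x \<in> X. f x \<in> W} = X \<inter> {x \<in> carrier V. f x \<in> W}" using V.sub_carrier[OF that(2)] by auto
    then show ?thesis using V.subspace_Int[OF that(2) subspace_vimage[OF f V U that(1)]] by simp
  qed
  show ?thesis
    using r X Z
  proof (induct arbitrary: X rule: U.rel.induct)
    case (rel_refl Y)
    have "f ` X \<subseteq> Y" using rel_refl(3) U.set_add_upper2[OF rel_refl(1) subspace_image[OF f V U rel_refl(2)]] by simp
    then have "{x \<in> X. f x \<in> Y} = X" by auto
    then show ?case using V.rel_refl[OF rel_refl(2)] by simp
  next
    case (rel_step Y Z n z)
    have Z: "subspace K Z U" "subspace K Y U" "Y \<subseteq> Z" using U.rel_sub[OF rel_step(1)] by simp_all
    note X = rel_step(5) and e = rel_step(6)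
    have fX: "subspace K (f ` X) U" by (rule subspace_image[OF f V U X])
    define X0 where "X0 = {x \<in> X. f x \<in> Z}"
    have X0: "subspace K X0 V" unfolding X0_def by (rule Q[OF Z(1) X])
    have fX0: "subspace K (f ` X0) U" by (rule subspace_image[OF f V U X0])
    have "Z = Y <+>\<^bsub>U\<^esub> f ` X0"
    proof
      show "Y <+>\<^bsub>U\<^esub> f ` X0 \<subseteq> Z" by (rule U.set_add_least[OF Z(1,3)]) (auto simp: X0_def)
      show "Z \<subseteq> Y <+>\<^bsub>U\<^esub> f ` X0"
      proof
        fix w assume w: "w \<in> Z"
        then have "w \<in> Y <+>\<^bsub>U\<^esub> f ` X" using e U.add_line_upper[OF Z(1) rel_step(3)] by auto
        then obtain y x where y: "y \<in> Y" "x \<in> X" "w = y \<oplus>\<^bsub>U\<^esub> f x" by (auto simp: U.set_add_iff)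
        have "f x \<in> Z"
          using U.sub_add_cancel(2)[OF Z(1) hom_closed[OF f V.sub_carrier[OF X y(2)]] subsetD[OF Z(3) y(1)]] w y(3) by simp
        then show "w \<in> Y <+>\<^bsub>U\<^esub> f ` X0" using y by (auto simp: U.set_add_iff X0_def)
      qed
    qed
    from rel_step(2)[OF X0 this] have r0: "V.rel {x \<in> X0. f x \<in> Y} X0 n" .
    have "z \<in> Y <+>\<^bsub>U\<^esub> f ` X" using e U.add_line_mem[OF Z(1) rel_step(3)] by simp
    then obtain y x where y: "y \<in> Y" "x \<in> X" "z = y \<oplus>\<^bsub>U\<^esub> f x" by (auto simp: U.set_add_iff)
    have xc: "x \<in> carrier V" by (rule V.sub_carrier[OF X y(2)])
    have fxc: "f x \<in> carrier U" by (rule hom_closed[OF f xc])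
    have fx: "f x \<notin> Z" using rel_step(4) y U.sub_add[OF Z(1) subsetD[OF Z(3) y(1)]] by auto
    have fxm: "f x \<in> Z <+>\<^bsub>U\<^esub> U.line z" using e y U.set_add_upper2[OF Z(2) fX] by auto
    have ex: "Z <+>\<^bsub>U\<^esub> U.line z = Z <+>\<^bsub>U\<^esub> U.line (f x)" by (rule U.add_line_exchange(2)[OF Z(1) rel_step(3) fxm fx])
    have "X0 <+>\<^bsub>V\<^esub> V.line x = X"
    proof
      show "X0 <+>\<^bsub>V\<^esub> V.line x \<subseteq> X" by (rule V.add_line_least[OF X _ y(2)]) (auto simp: X0_def)
      show "X \<subseteq> X0 <+>\<^bsub>V\<^esub> V.line x"
      proof
        fix x' assume x': "x' \<in> X"
        then have "f x' \<in> Z <+>\<^bsub>U\<^esub> U.line (f x)" using U.set_add_upper2[OF Z(2) fX] e ex by auto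
        then obtain w c where w: "w \<in> Z" "c \<in> carrier K" "f x' = w \<oplus>\<^bsub>U\<^esub> c \<odot>\<^bsub>U\<^esub> f x" by (auto simp: U.in_add_line)
        note xc' = V.sub_carrier[OF X x'] and cx = V.smult_closed[OF w(2) xc] and wc = U.sub_carrier[OF Z(1) w(1)]
        have "f (x' \<ominus>\<^bsub>V\<^esub> c \<odot>\<^bsub>V\<^esub> x) = w"
          using hom_minus[OF f V U xc' cx] hom_smult[OF f w(2) xc] w fxc wc by (simp add: a_minus_def U.M.a_assoc U.M.r_neg)
        then have "x' \<ominus>\<^bsub>V\<^esub> c \<odot>\<^bsub>V\<^esub> x \<in> X0" using V.sub_minus[OF X x' V.sub_smult[OF X w(2) y(2)]] w(1) by (simp add: X0_def)
        then show "x' \<in> X0 <+>\<^bsub>V\<^esub> V.line x"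
          unfolding V.in_add_line using w(2) V.minus_add_cancel[OF xc' cx] by (intro bexI[of _ "x' \<ominus>\<^bsub>V\<^esub> c \<odot>\<^bsub>V\<^esub> x"] bexI[of _ c]) simp_all
      qed
    qed
    moreover have "{x \<in> X0. f x \<in> Y} = {x \<in> X. f x \<in> Y}" using Z(3) by (auto simp: X0_def)
    ultimately show ?case using V.rel_step[OF r0 xc] fx by (simp add: X0_def)
  qed
qed

lemma ground_uminus: "a_inv (ground_space K) = a_inv K"
  by (simp add: a_inv_def m_inv_def fun_eq_iff)

lemma (in vectorspace) set_add_0: "subspace K X V \<Longrightarrow> {\<zero>\<^bsub>V\<^esub>} <+>\<^bsub>V\<^esub> X = X"
  by (rule equalityI[OF set_add_least set_add_upper2]) (simp_all add: sub_0 subspace_zero)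

lemma (in vectorspace) set_add_absorb: "\<lbrakk>subspace K X V; subspace K Y V; Y \<subseteq> X\<rbrakk> \<Longrightarrow> Y <+>\<^bsub>V\<^esub> X = X"
  by (rule equalityI[OF set_add_least set_add_upper2]) simp_all

lemma subspace_inter_vimage:
  assumes f: "f \<in> module_hom K V U" and V: "vectorspace K V" and U: "vectorspace K U"
    and X: "subspace K X V" and Y: "subspace K Y U"
  shows "subspace K {x \<in> X. f x \<in> Y} V"
proof -
  interpret V: vectorspace K V by (rule V)
  have "{x \<in> X. f x \<in> Y} = X \<inter> {x \<in> carrier V. f x \<in> Y}" using V.sub_carrier[OF X] by auto
  then show ?thesis using V.subspace_Int[OF X subspace_vimage[OF f V U Y]] by simp
qed

text \<open>The quotients \<open>X / Q\<close> and \<open>(Y + f X) / Y\<close> are isomorphic. With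
  an inclusion as \<open>f\<close> this also gives the second isomorphism theorem and a change of
  the ambient space.\<close>

lemma fin_image:
  assumes f: "f \<in> module_hom K V U" and V: "vectorspace K V" and U: "vectorspace K U"
    and X: "subspace K X V" and Y: "subspace K Y U" and Q: "Q = {x \<in> X. f x \<in> Y}"
  shows "vectorspace.fin K V Q X \<longleftrightarrow> vectorspace.fin K U Y (Y <+>\<^bsub>U\<^esub> f ` X)"
    and "vectorspace.fin K V Q X \<Longrightarrow> vectorspace.rdim K U Y (Y <+>\<^bsub>U\<^esub> f ` X) = vectorspace.rdim K V Q X"
proof -
  interpret V: vectorspace K V by (rule V)
  interpret U: vectorspace K U by (rule U)
  have r: "V.rel Q X n" if "U.rel Y (Y <+>\<^bsub>U\<^esub> f ` X) n" for n
    unfolding Q by (rule rel_vimage[OF f V U that X refl])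
  have i: "U.fin Y (Y <+>\<^bsub>U\<^esub> f ` X)" if "V.rel Q X n" for n
    by (rule fin_set_add_image[OF f V U Y that]) (auto simp: Q)
  show "V.fin Q X \<longleftrightarrow> U.fin Y (Y <+>\<^bsub>U\<^esub> f ` X)"
    unfolding V.fin_def using r i by (auto simp: U.fin_def)
  show "U.rdim Y (Y <+>\<^bsub>U\<^esub> f ` X) = V.rdim Q X" if Qf: "V.fin Q X"
  proof -
    obtain n where "U.rel Y (Y <+>\<^bsub>U\<^esub> f ` X) n" using Qf i by (auto simp: V.fin_def U.fin_def)
    from U.rdim_eq[OF this] V.rdim_eq[OF r[OF this]] show ?thesis by simp
  qed
qed

text \<open>Insert the sum of \<open>A\<close> and the kernel of \<open>f\<close> on
  \<open>D\<close> between \<open>A\<close> and \<open>D\<close>: the lower step is measured by the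
  kernels, the upper one by the images.\<close>

lemma rdim_kernel_image:
  assumes f: "f \<in> module_hom K V U" and V: "vectorspace K V" and U: "vectorspace K U"
    and A: "subspace K A V" and D: "subspace K D V" and AD: "A \<subseteq> D"
  shows "vectorspace.fin K V A D \<longleftrightarrow> vectorspace.fin K V {x \<in> A. f x = \<zero>\<^bsub>U\<^esub>} {x \<in> D. f x = \<zero>\<^bsub>U\<^esub>} \<and> vectorspace.fin K U (f ` A) (f ` D)"
    and "vectorspace.fin K V A D \<Longrightarrow> vectorspace.rdim K V A D =
      vectorspace.rdim K V {x \<in> A. f x = \<zero>\<^bsub>U\<^esub>} {x \<in> D. f x = \<zero>\<^bsub>U\<^esub>} + vectorspace.rdim K U (f ` A) (f ` D)"
proof -
  interpret V: vectorspace K V by (rule V)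
  interpret U: vectorspace K U by (rule U)
  let ?N = "{x \<in> D. f x = \<zero>\<^bsub>U\<^esub>}" and ?NA = "{x \<in> A. f x = \<zero>\<^bsub>U\<^esub>}"
  have N: "subspace K ?N V" using subspace_inter_vimage[OF f V U D U.subspace_zero] by simp
  have fA: "subspace K (f ` A) U" and fD: "subspace K (f ` D) U" by (rule subspace_image[OF f V U], rule A D)+
  have S: "subspace K (A <+>\<^bsub>V\<^esub> ?N) V" by (rule V.subspace_set_add[OF A N])
  have SD: "A <+>\<^bsub>V\<^esub> ?N \<subseteq> D" by (rule V.set_add_least[OF D AD]) auto
  have AS: "A \<subseteq> A <+>\<^bsub>V\<^esub> ?N" by (rule V.set_add_upper1[OF A N])
  have e1: "?NA = {x \<in> ?N. x \<in> A}" using AD by auto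
  have i1: "V.fin ?NA ?N \<longleftrightarrow> V.fin A (A <+>\<^bsub>V\<^esub> ?N)" "V.fin ?NA ?N \<Longrightarrow> V.rdim A (A <+>\<^bsub>V\<^esub> ?N) = V.rdim ?NA ?N"
    using fin_image[OF hom_id V V N A e1] by simp_all
  have e2: "A <+>\<^bsub>V\<^esub> ?N = {x \<in> D. f x \<in> f ` A}"
  proof
    show "A <+>\<^bsub>V\<^esub> ?N \<subseteq> {x \<in> D. f x \<in> f ` A}"
    proof
      fix x assume x: "x \<in> A <+>\<^bsub>V\<^esub> ?N"
      then obtain a b where a: "a \<in> A" "b \<in> D" "f b = \<zero>\<^bsub>U\<^esub>" "x = a \<oplus>\<^bsub>V\<^esub> b" by (auto simp: V.set_add_iff)
      have "f x = f a" using a hom_add[OF f V.sub_carrier[OF A a(1)] V.sub_carrier[OF D a(2)]] hom_closed[OF f V.sub_carrier[OF A a(1)]] by simp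
      then show "x \<in> {x \<in> D. f x \<in> f ` A}" using subsetD[OF SD x] a(1) by auto
    qed
    show "{x \<in> D. f x \<in> f ` A} \<subseteq> A <+>\<^bsub>V\<^esub> ?N"
    proof
      fix x assume "x \<in> {x \<in> D. f x \<in> f ` A}"
      then obtain a where a: "x \<in> D" "a \<in> A" "f x = f a" by auto
      note c = V.sub_carrier[OF D a(1)] V.sub_carrier[OF A a(2)]
      have "f (x \<ominus>\<^bsub>V\<^esub> a) = \<zero>\<^bsub>U\<^esub>" using hom_minus[OF f V U c] a(3) U.minus_self hom_closed[OF f c(2)] by simp
      then have "x \<ominus>\<^bsub>V\<^esub> a \<in> ?N" using V.sub_minus[OF D a(1) subsetD[OF AD a(2)]] by simp
      moreover have "x = a \<oplus>\<^bsub>V\<^esub> (x \<ominus>\<^bsub>V\<^esub> a)" using V.minus_add_cancel[OF c] V.M.a_comm[OF c(2) V.M.minus_closed[OF c]] by simp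
      ultimately show "x \<in> A <+>\<^bsub>V\<^esub> ?N" using a(2) by (auto simp: V.set_add_iff)
    qed
  qed
  have e3: "f ` A <+>\<^bsub>U\<^esub> f ` D = f ` D" by (rule U.set_add_absorb[OF fD fA image_mono[OF AD]])
  have i2: "V.fin (A <+>\<^bsub>V\<^esub> ?N) D \<longleftrightarrow> U.fin (f ` A) (f ` D)" "V.fin (A <+>\<^bsub>V\<^esub> ?N) D \<Longrightarrow> U.rdim (f ` A) (f ` D) = V.rdim (A <+>\<^bsub>V\<^esub> ?N) D"
    using fin_image[OF f V U D fA e2] e3 by simp_all
  show "V.fin A D \<longleftrightarrow> V.fin ?NA ?N \<and> U.fin (f ` A) (f ` D)"
    using V.rdim_split(1,2)[OF _ S AS SD] V.fin_trans(1)[of A "A <+>\<^bsub>V\<^esub> ?N" D] i1 i2 by blast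
  show "V.rdim A D = V.rdim ?NA ?N + U.rdim (f ` A) (f ` D)" if "V.fin A D"
    using V.rdim_split[OF that S AS SD] i1 i2 by simp
qed

section \<open>Relative dimension, bases and dual bases\<close>

context vectorspace
begin

lemma span_insert_line:
  assumes "B \<subseteq> carrier V" "x \<in> carrier V"
  shows "span (insert x B) = span B <+>\<^bsub>V\<^esub> line x"
proof
  have S: "subspace K (span B) V" by (rule span_is_subspace[OF assms(1)])
  have I: "insert x B \<subseteq> carrier V" using assms by simp
  show "span (insert x B) \<subseteq> span B <+>\<^bsub>V\<^esub> line x"
    using span_incl[OF assms(1)] add_line_upper[OF S assms(2)] add_line_mem[OF S assms(2)]
    by (intro span_least[OF subspace_add_line[OF S assms(2)]]) auto
  have T: "subspace K (span (insert x B)) V" by (rule span_is_subspace[OF I])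
  show "span B <+>\<^bsub>V\<^esub> line x \<subseteq> span (insert x B)"
  proof (rule add_line_least[OF T])
    show "span B \<subseteq> span (insert x B)" by (rule span_least[OF T]) (use span_incl[OF I] in auto)
    show "x \<in> span (insert x B)" by (rule span_incl[OF I]) simp
  qed
qed

lemma span_empty_0: "span {} = {\<zero>\<^bsub>V\<^esub>}"
  using span_least[OF subspace_zero, of "{}"] sub_0[OF span_is_subspace[of "{}"]] by auto

lemma rel_basis:
  assumes "rel Y X n" "Y = {\<zero>\<^bsub>V\<^esub>}"
  shows "\<exists>B. finite B \<and> card B = n \<and> B \<subseteq> carrier V \<and> \<not> lin_dep B \<and> span B = X"
  using assms
proof (induct rule: rel.induct)
  case (rel_refl X)
  have "\<not> lin_dep {}" unfolding lin_dep_def by auto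
  then show ?case using rel_refl span_empty_0 by (intro exI[of _ "{}"]) simp
next
  case (rel_step Y X n x)
  then obtain B where B: "finite B" "card B = n" "B \<subseteq> carrier V" "\<not> lin_dep B" "span B = X" by auto
  have xB: "x \<notin> B" using span_incl[OF B(3), of x] rel_step(4) B(5) by auto
  have "\<not> lin_dep (B \<union> {x})" using lin_dep_iff_in_span[OF B(3,4) rel_step(3) xB] rel_step(4) B(5) by simp
  then show ?case using B xB rel_step(3) span_insert_line[OF B(3) rel_step(3)]
    by (intro exI[of _ "insert x B"]) simp
qed

lemma fin_span: "\<lbrakk>finite B; B \<subseteq> carrier V\<rbrakk> \<Longrightarrow> fin {\<zero>\<^bsub>V\<^esub>} (span B)"
proof (induct B rule: finite_induct)
  case empty
  then show ?case using fin_self(1)[OF subspace_zero] by (simp add: span_empty_0)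
next
  case (insert x B)
  then show ?case using fin_line[of "{\<zero>\<^bsub>V\<^esub>}" "span B" x] span_insert_line[of B x] by simp
qed

lemma fin_dim_iff: "fin_dim \<longleftrightarrow> fin {\<zero>\<^bsub>V\<^esub>} (carrier V)"
proof
  assume "fin_dim"
  then obtain A where A: "finite A \<and> A \<subseteq> carrier V \<and> span A = carrier V" unfolding fin_dim_def by (rule exE)
  then show "fin {\<zero>\<^bsub>V\<^esub>} (carrier V)" using fin_span[of A] by simp
next
  assume "fin {\<zero>\<^bsub>V\<^esub>} (carrier V)"
  then obtain n where "rel {\<zero>\<^bsub>V\<^esub>} (carrier V) n" unfolding fin_def by (rule exE)
  from rel_basis[OF this refl] obtain B where "finite B" "B \<subseteq> carrier V" "span B = carrier V" by (elim exE conjE)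
  then show "fin_dim" unfolding fin_dim_def by (intro exI conjI)
qed

lemma dim_eq_rdim:
  assumes "fin {\<zero>\<^bsub>V\<^esub>} (carrier V)"
  shows "dim = rdim {\<zero>\<^bsub>V\<^esub>} (carrier V)"
proof -
  obtain n where n: "rel {\<zero>\<^bsub>V\<^esub>} (carrier V) n" using assms unfolding fin_def by (rule exE)
  from rel_basis[OF n refl] obtain B where B: "finite B" "card B = n" "B \<subseteq> carrier V" "\<not> lin_dep B" "span B = carrier V" by (elim exE conjE)
  then have "basis B" by (simp add: basis_def)
  then show ?thesis using dim_basis[OF B(1)] B(2) rdim_eq[OF n] by simp
qed

lemma fin_in_subspace:
  assumes X: "subspace K X V" and E: "subspace K E V" "E \<subseteq> X"
  shows "vectorspace.fin K (V\<lparr>carrier := X\<rparr>) E X \<longleftrightarrow> fin E X"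
    and "fin E X \<Longrightarrow> vectorspace.rdim K (V\<lparr>carrier := X\<rparr>) E X = rdim E X"
proof -
  interpret S: vectorspace K "V\<lparr>carrier := X\<rparr>" by (rule subspace_is_vs[OF X])
  have h: "(\<lambda>x. x) \<in> module_hom K (V\<lparr>carrier := X\<rparr>) V" by (rule hom_restrict[OF hom_id]) (use sub_carrier[OF X] in auto)
  have XS: "subspace K X (V\<lparr>carrier := X\<rparr>)" using S.subspace_carrier by simp
  have e: "E = {x \<in> X. x \<in> E}" using E(2) by auto
  have "E <+>\<^bsub>V\<^esub> (\<lambda>x. x) ` X = X" using set_add_absorb[OF X E] by simp
  then show "S.fin E X \<longleftrightarrow> fin E X" "fin E X \<Longrightarrow> S.rdim E X = rdim E X"
    using fin_image[OF h S.vs_self vs_self XS E(1) e] by simp_all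
qed

lemma fin_dim_subspace:
  assumes X: "subspace K X V"
  shows "vectorspace.fin_dim K (V\<lparr>carrier := X\<rparr>) \<longleftrightarrow> fin {\<zero>\<^bsub>V\<^esub>} X"
    and "fin {\<zero>\<^bsub>V\<^esub>} X \<Longrightarrow> vectorspace.dim K (V\<lparr>carrier := X\<rparr>) = rdim {\<zero>\<^bsub>V\<^esub>} X"
proof -
  interpret S: vectorspace K "V\<lparr>carrier := X\<rparr>" by (rule subspace_is_vs[OF X])
  note i = fin_in_subspace[OF X subspace_zero, simplified, OF sub_0[OF X]]
  show "S.fin_dim \<longleftrightarrow> fin {\<zero>\<^bsub>V\<^esub>} X" using S.fin_dim_iff i by simp
  show "S.dim = rdim {\<zero>\<^bsub>V\<^esub>} X" if "fin {\<zero>\<^bsub>V\<^esub>} X" using S.dim_eq_rdim i that by simp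
qed

lemma dim_quotient:
  assumes X: "subspace K X V" and E: "subspace K E V" "E \<subseteq> X" and fin: "fin E X"
  shows "vectorspace.dim K (quotient_space (V\<lparr>carrier := X\<rparr>) E) = rdim E X"
proof -
  interpret S: vectorspace K "V\<lparr>carrier := X\<rparr>" by (rule subspace_is_vs[OF X])
  have ES: "subspace K E (V\<lparr>carrier := X\<rparr>)"
    by (rule S.subspaceI) (use E sub_0[OF E(1)] sub_add[OF E(1)] sub_smult[OF E(1)] in auto)
  let ?Q = "quotient_space (V\<lparr>carrier := X\<rparr>) E" and ?p = "\<lambda>x. E +>\<^bsub>V\<lparr>carrier := X\<rparr>\<^esub> x"
  interpret Q: vectorspace K ?Q by (rule S.quotient_vs[OF ES])
  note h = S.quotient_proj_hom[OF ES]
  have XS: "subspace K X (V\<lparr>carrier := X\<rparr>)" using S.subspace_carrier by simp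
  have z: "\<zero>\<^bsub>?Q\<^esub> = E" by (rule S.zero_quotient)
  have im: "?p ` X = carrier ?Q" by (auto simp: S.carrier_quotient)
  have e: "E = {x \<in> X. ?p x \<in> {\<zero>\<^bsub>?Q\<^esub>}}"
    using S.coset_eq_W_iff[OF ES] E(2) by (auto simp: z)
  note f = fin_image[OF h S.vs_self Q.vs_self XS Q.subspace_zero e]
  have "{\<zero>\<^bsub>?Q\<^esub>} <+>\<^bsub>?Q\<^esub> ?p ` X = carrier ?Q" unfolding im by (rule Q.set_add_0[OF Q.subspace_carrier])
  then have "Q.fin {\<zero>\<^bsub>?Q\<^esub>} (carrier ?Q)" "Q.rdim {\<zero>\<^bsub>?Q\<^esub>} (carrier ?Q) = rdim E X"
    using f fin_in_subspace[OF X E] fin by simp_all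
  then show ?thesis using Q.dim_eq_rdim by simp
qed

text \<open>The functionals are defined on all of \<open>V\<close>. When a vector \<open>x\<close>
  is added, it receives a functional \<open>g\<close> that vanishes on \<open>X\<close> and is 1 at
  \<open>x\<close>, and the multiple \<open>\<beta> i (x) g\<close> is subtracted from each earlier
  \<open>\<beta> i\<close>.\<close>

lemma dual_basis:
  assumes "fin {\<zero>\<^bsub>V\<^esub>} X"
  shows "\<exists>(n::nat) b \<beta>. (\<forall>i<n. b i \<in> X \<and> \<beta> i \<in> module_hom K V (ground_space K)) \<and>
    (\<forall>i<n. \<forall>l<n. \<beta> i (b l) = (if i = l then \<one>\<^bsub>K\<^esub> else \<zero>\<^bsub>K\<^esub>)) \<and> (\<forall>v\<in>X. v = (\<Oplus>\<^bsub>V\<^esub> l\<in>{..<n}. \<beta> l v \<odot>\<^bsub>V\<^esub> b l))"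
proof -
  obtain n where "rel {\<zero>\<^bsub>V\<^esub>} X n" using assms by (auto simp: fin_def)
  then show ?thesis
  proof (induct "{\<zero>\<^bsub>V\<^esub>}" X n rule: rel.induct)
    case rel_refl
    then show ?case by (intro exI[of _ 0]) simp
  next
    case (rel_step X m x)
    from rel_step(2) obtain n :: nat and b \<beta> where C: "(\<forall>i<n. b i \<in> X \<and> \<beta> i \<in> module_hom K V (ground_space K)) \<and>
      (\<forall>i<n. \<forall>l<n. \<beta> i (b l) = (if i = l then \<one>\<^bsub>K\<^esub> else \<zero>\<^bsub>K\<^esub>)) \<and> (\<forall>v\<in>X. v = (\<Oplus>\<^bsub>V\<^esub> l\<in>{..<n}. \<beta> l v \<odot>\<^bsub>V\<^esub> b l))"
      by (elim exE)
    have b: "b i \<in> X" "\<beta> i \<in> module_hom K V (ground_space K)" if "i < n" for i using C that by simp_all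
    have d: "\<beta> i (b l) = (if i = l then \<one>\<^bsub>K\<^esub> else \<zero>\<^bsub>K\<^esub>)" if "i < n" "l < n" for i l using C that by simp
    have e: "v = (\<Oplus>\<^bsub>V\<^esub> l\<in>{..<n}. \<beta> l v \<odot>\<^bsub>V\<^esub> b l)" if "v \<in> X" for v
      by (rule C[THEN conjunct2, THEN conjunct2, THEN bspec, OF that])
    have X: "subspace K X V" using rel_sub[OF rel_step(1)] by simp
    note x = rel_step(3,4)
    obtain g where g: "g \<in> module_hom K V (ground_space K)" "\<And>y. y \<in> X \<Longrightarrow> g y = \<zero>\<^bsub>K\<^esub>" "g x = \<one>\<^bsub>K\<^esub>"
      by (rule functional_ex[OF X x]) blast
    interpret k: vectorspace K "ground_space K" by (rule ground_vs)
    have bx: "\<beta> i x \<in> carrier K" if "i < n" for i using hom_closed[OF b(2)[OF that] x(1)] by simp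
    define b' where "b' i = (if i = n then x else b i)" for i
    define \<beta>' where "\<beta>' i = (if i = n then g else (\<lambda>v. \<beta> i v \<ominus>\<^bsub>ground_space K\<^esub> \<beta> i x \<otimes>\<^bsub>K\<^esub> g v))" for i
    have gc: "g v \<in> carrier K" if "v \<in> carrier V" for v using hom_closed[OF g(1) that] by simp
    have bc: "\<beta> i v \<in> carrier K" if "i < n" "v \<in> carrier V" for v i using hom_closed[OF b(2)[OF that(1)] that(2)] by simp
    have \<beta>'h: "\<beta>' i \<in> module_hom K V (ground_space K)" if "i < Suc n" for i
    proof (cases "i = n")
      case False
      then have i: "i < n" using that by simp
      have "(\<lambda>v. \<beta> i v \<oplus>\<^bsub>ground_space K\<^esub> (\<ominus>\<^bsub>K\<^esub> \<beta> i x) \<odot>\<^bsub>ground_space K\<^esub> g v) \<in> module_hom K V (ground_space K)"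
        by (rule k.hom_add_map[OF b(2)[OF i] k.hom_smult_map[OF g(1)]]) (use bx[OF i] in simp)
      then show ?thesis
        by (rule hom_cong[OF _ vs_self]) (use i False bx[OF i] gc in \<open>simp add: \<beta>'_def a_minus_def l_minus ground_uminus\<close>)
    qed (use g(1) in \<open>simp add: \<beta>'_def\<close>)
    have \<beta>'X: "\<beta>' i v = (if i = n then \<zero>\<^bsub>K\<^esub> else \<beta> i v)" if "i < Suc n" "v \<in> X" for i v
    proof (cases "i = n")
      case False
      then have i: "i < n" using that by simp
      show ?thesis using False g(2)[OF that(2)] bx[OF i] bc[OF i sub_carrier[OF X that(2)]] k.minus_0[of "\<beta> i v"] by (simp add: \<beta>'_def)
    qed (use g(2)[OF that(2)] in \<open>simp add: \<beta>'_def\<close>)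
    have \<beta>'x: "\<beta>' i x = (if i = n then \<one>\<^bsub>K\<^esub> else \<zero>\<^bsub>K\<^esub>)" if "i < Suc n" for i
      using that bx k.minus_self[of "\<beta> i x"] g(3) by (auto simp: \<beta>'_def)
    have bV: "b i \<in> carrier V" if "i < n" for i by (rule sub_carrier[OF X b(1)[OF that]])
    show ?case
    proof (rule exI[of _ "Suc n"], rule exI[of _ b'], rule exI[of _ \<beta>'], intro conjI allI impI ballI)
      fix i assume i: "i < Suc n"
      show "b' i \<in> X <+>\<^bsub>V\<^esub> line x"
        using i b(1) add_line_mem[OF X x(1)] add_line_upper[OF X x(1)] by (auto simp: b'_def)
      show "\<beta>' i \<in> module_hom K V (ground_space K)" by (rule \<beta>'h[OF i])
      fix l assume l: "l < Suc n"
      show "\<beta>' i (b' l) = (if i = l then \<one>\<^bsub>K\<^esub> else \<zero>\<^bsub>K\<^esub>)"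
        using i l \<beta>'x[OF i] \<beta>'X[OF i b(1), of l] d[of i l] by (auto simp: b'_def)
    next
      fix v assume "v \<in> X <+>\<^bsub>V\<^esub> line x"
      then obtain a c where a: "a \<in> X" "c \<in> carrier K" "v = a \<oplus>\<^bsub>V\<^esub> c \<odot>\<^bsub>V\<^esub> x" by (auto simp: in_add_line)
      note ac = sub_carrier[OF X a(1)]
      have \<beta>'v: "\<beta>' i v = (if i = n then c else \<beta> i a)" if "i < Suc n" for i
        using hom_add[OF \<beta>'h[OF that] ac smult_closed[OF a(2) x(1)]] hom_smult[OF \<beta>'h[OF that] a(2) x(1)]
          \<beta>'x[OF that] \<beta>'X[OF that a(1)] a(2,3) that bc[of i a] ac by auto
      have "(\<Oplus>\<^bsub>V\<^esub> l\<in>{..<Suc n}. \<beta>' l v \<odot>\<^bsub>V\<^esub> b' l) = \<beta>' n v \<odot>\<^bsub>V\<^esub> b' n \<oplus>\<^bsub>V\<^esub> (\<Oplus>\<^bsub>V\<^esub> l\<in>{..<n}. \<beta>' l v \<odot>\<^bsub>V\<^esub> b' l)"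
        unfolding lessThan_Suc by (rule M.finsum_insert) (use \<beta>'v bV a(2) x(1) bc[OF _ ac] in \<open>auto simp: b'_def\<close>)
      also have "(\<Oplus>\<^bsub>V\<^esub> l\<in>{..<n}. \<beta>' l v \<odot>\<^bsub>V\<^esub> b' l) = (\<Oplus>\<^bsub>V\<^esub> l\<in>{..<n}. \<beta> l a \<odot>\<^bsub>V\<^esub> b l)"
        by (rule M.finsum_cong') (use \<beta>'v bV bc[OF _ ac] in \<open>auto simp: b'_def\<close>)
      also have "\<dots> = a" by (rule e[OF a(1), symmetric])
      finally show "v = (\<Oplus>\<^bsub>V\<^esub> l\<in>{..<Suc n}. \<beta>' l v \<odot>\<^bsub>V\<^esub> b' l)"
        using a(2,3) \<beta>'v[of n] M.a_comm[OF ac smult_closed[OF a(2) x(1)]] by (simp add: b'_def)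
    qed
  qed
qed

end

section \<open>Optimal stable subspaces\<close>

text \<open>Tuples are sequences that vanish from index \<open>f\<close> on, so that all lengths
  live in one space and the kernel of the last coordinate consists of the shorter tuples.\<close>

definition tuples :: "('k, 'm, 'z) module_scheme \<Rightarrow> 'm set \<Rightarrow> nat \<Rightarrow> (nat \<Rightarrow> 'm) set" where
  "tuples M C f = {p. (\<forall>i<f. p i \<in> C) \<and> (\<forall>i\<ge>f. p i = \<zero>\<^bsub>M\<^esub>)}"

lemma (in vectorspace) seq_space_vs: "vectorspace K (seq_space V)"
proof (rule vs_criteria)
  show "\<forall>v\<in>carrier (seq_space V). \<exists>u\<in>carrier (seq_space V). v \<oplus>\<^bsub>seq_space V\<^esub> u = \<zero>\<^bsub>seq_space V\<^esub>"
  proof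
    fix v assume "v \<in> carrier (seq_space V)"
    then show "\<exists>u\<in>carrier (seq_space V). v \<oplus>\<^bsub>seq_space V\<^esub> u = \<zero>\<^bsub>seq_space V\<^esub>"
      by (intro bexI[of _ "\<lambda>i. \<ominus>\<^bsub>V\<^esub> v i"]) (simp_all add: seq_space_simps M.r_neg)
  qed
  show "field K" ..
qed (simp_all add: seq_space_simps fun_eq_iff M.a_ac smult_assoc1 smult_r_distr smult_l_distr)

lemma (in vectorspace) finsum_swap:
  assumes "\<And>i k. \<lbrakk>i < f; k < (f::nat)\<rbrakk> \<Longrightarrow> w i k \<in> carrier V"
  shows "(\<Oplus>\<^bsub>V\<^esub> i\<in>{..<f}. \<Oplus>\<^bsub>V\<^esub> k\<in>{..<f}. w i k) = (\<Oplus>\<^bsub>V\<^esub> k\<in>{..<f}. \<Oplus>\<^bsub>V\<^esub> i\<in>{..<f}. w i k)"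
proof -
  have "(\<Oplus>\<^bsub>V\<^esub> i\<in>{..<n}. \<Oplus>\<^bsub>V\<^esub> k\<in>{..<f}. w i k) = (\<Oplus>\<^bsub>V\<^esub> k\<in>{..<f}. \<Oplus>\<^bsub>V\<^esub> i\<in>{..<n}. w i k)" if "n \<le> f" for n
    using that
  proof (induct n)
    case 0
    show ?case by (simp add: M.finsum_zero)
  next
    case (Suc n)
    have "(\<Oplus>\<^bsub>V\<^esub> i\<in>{..<Suc n}. \<Oplus>\<^bsub>V\<^esub> k\<in>{..<f}. w i k) = (\<Oplus>\<^bsub>V\<^esub> k\<in>{..<f}. w n k) \<oplus>\<^bsub>V\<^esub> (\<Oplus>\<^bsub>V\<^esub> i\<in>{..<n}. \<Oplus>\<^bsub>V\<^esub> k\<in>{..<f}. w i k)"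
      unfolding lessThan_Suc using Suc(2) assms by (intro M.finsum_insert) auto
    also have "\<dots> = (\<Oplus>\<^bsub>V\<^esub> k\<in>{..<f}. w n k \<oplus>\<^bsub>V\<^esub> (\<Oplus>\<^bsub>V\<^esub> i\<in>{..<n}. w i k))"
      using Suc assms by (subst M.finsum_addf) auto
    also have "\<dots> = (\<Oplus>\<^bsub>V\<^esub> k\<in>{..<f}. \<Oplus>\<^bsub>V\<^esub> i\<in>{..<Suc n}. w i k)"
    proof (rule M.finsum_cong')
      fix k assume "k \<in> {..<f}"
      then show "w n k \<oplus>\<^bsub>V\<^esub> (\<Oplus>\<^bsub>V\<^esub> i\<in>{..<n}. w i k) = (\<Oplus>\<^bsub>V\<^esub> i\<in>{..<Suc n}. w i k)"
        unfolding lessThan_Suc using Suc(2) assms by (intro M.finsum_insert[symmetric]) auto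
    qed (use Suc(2) assms in auto)
    finally show ?case .
  qed
  then show ?thesis by simp
qed

text \<open>\<open>X True g\<close> and \<open>X False g\<close> stand for the right and left
  coefficients by \<open>g\<close>, and \<open>GS\<close> for the functionals that kill some
  \<open>M\<^sub>n\<close>. \<Omega> is stable under \<open>GS\<close> but in general not under all
  functionals, so the two sets are kept apart.\<close>

locale operator_family = vectorspace K M
  for K :: "('k, 'y) ring_scheme" and M :: "('k, 'm, 'z) module_scheme" (structure) +
  fixes X :: "bool \<Rightarrow> ('m \<Rightarrow> 'k) \<Rightarrow> 'm \<Rightarrow> 'm" and GS :: "('m \<Rightarrow> 'k) set" and \<Omega> :: "'m set"
  assumes X_hom: "g \<in> dual K M \<Longrightarrow> X b g \<in> module_hom K M M"
    and GS_dual: "GS \<subseteq> dual K M"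
    and \<Omega>_sub: "subspace K \<Omega> M"
    and X_\<Omega>: "\<lbrakk>g \<in> GS; x \<in> \<Omega>\<rbrakk> \<Longrightarrow> X b g x \<in> \<Omega>"
begin

sublocale S: vectorspace K "seq_space M" by (rule seq_space_vs)

abbreviation (input) "tup \<equiv> tuples M"
abbreviation (input) "Z \<equiv> {\<zero>\<^bsub>seq_space M\<^esub>}"

definition lat :: "'m set set" where
  "lat = {C. fin \<Omega> C \<and> (\<forall>b. \<forall>g\<in>GS. \<forall>x\<in>C. X b g x \<in> C)}"

text \<open>Spaces of tuples that need not consist of all tuples from one subspace: images and
  preimages under a comatrix do not have that form in general.\<close>

definition lat_tuples :: "nat \<Rightarrow> (nat \<Rightarrow> 'm) set set" where
  "lat_tuples f = {D. S.fin (tup \<Omega> f) D \<and> D \<subseteq> tup (carrier M) f \<and> (\<forall>b. \<forall>g\<in>GS. \<forall>p\<in>D. (\<lambda>i. X b g (p i)) \<in> D)}"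

text \<open>The test runs over all functionals, not only over \<open>GS\<close>. With
  \<open>GS\<close> alone every element of \<Omega> in \<open>E\<close> would have its coefficients
  in \<Omega>, and the core over \<Omega> would not be zero.\<close>

definition core :: "'m set \<Rightarrow> 'm set \<Rightarrow> 'm set" where
  "core E C = {e \<in> E. \<forall>g\<in>dual K M. X True g e \<in> C}"

definition core_tuples :: "'m set \<Rightarrow> nat \<Rightarrow> (nat \<Rightarrow> 'm) set \<Rightarrow> (nat \<Rightarrow> 'm) set" where
  "core_tuples E f D = {p \<in> tup E f. \<forall>g\<in>dual K M. (\<lambda>i. X True g (p i)) \<in> D}"

text \<open>The ratio of \<open>j\<close> to \<open>m\<close> is the price of one dimension of
  \<open>C\<close> over \<Omega>. Clearing denominators keeps the values integral, so that bounded
  values attain a maximum.\<close>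

definition val :: "nat \<Rightarrow> nat \<Rightarrow> 'm set \<Rightarrow> 'm set \<Rightarrow> int" where
  "val m j E C = int m * int (rdim {\<zero>} (core E C)) - int j * int (rdim \<Omega> C)"

definition val_tuples :: "nat \<Rightarrow> nat \<Rightarrow> 'm set \<Rightarrow> nat \<Rightarrow> (nat \<Rightarrow> 'm) set \<Rightarrow> int" where
  "val_tuples m j E f D = int m * int (S.rdim Z (core_tuples E f D)) - int j * int (S.rdim (tup \<Omega> f) D)"

lemma X_closed: "\<lbrakk>g \<in> dual K M; x \<in> carrier M\<rbrakk> \<Longrightarrow> X b g x \<in> carrier M"
  by (rule hom_closed[OF X_hom])

lemma X_0: "g \<in> dual K M \<Longrightarrow> X b g \<zero> = \<zero>"
  by (rule hom_0[OF X_hom vs_self vs_self])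

lemma tup_subspace: "subspace K C M \<Longrightarrow> subspace K (tup C f) (seq_space M)"
proof -
  assume C: "subspace K C M"
  show ?thesis
  proof (rule S.subspaceI)
    show "tup C f \<subseteq> carrier (seq_space M)"
    proof
      fix p assume p: "p \<in> tup C f"
      have "p i \<in> carrier M" for i
        using p sub_carrier[OF C] by (cases "i < f") (simp_all add: tuples_def)
      then show "p \<in> carrier (seq_space M)" by (simp add: seq_space_simps)
    qed
  qed (use sub_0[OF C] sub_add[OF C] sub_smult[OF C] in \<open>simp_all add: tuples_def seq_space_simps\<close>)
qed

lemma tup_mono: "A \<subseteq> C \<Longrightarrow> tup A f \<subseteq> tup C f"
  by (auto simp: tuples_def)

lemma tup_ker: "subspace K C M \<Longrightarrow> {p \<in> tup C (Suc f). p f = \<zero>} = tup C f"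
proof -
  assume C: "subspace K C M"
  show ?thesis
  proof
    show "{p \<in> tup C (Suc f). p f = \<zero>} \<subseteq> tup C f"
    proof
      fix p assume p: "p \<in> {p \<in> tup C (Suc f). p f = \<zero>}"
      have "p i = \<zero>" if "f \<le> i" for i using p that by (cases "i = f") (simp_all add: tuples_def)
      then show "p \<in> tup C f" using p by (simp add: tuples_def)
    qed
    show "tup C f \<subseteq> {p \<in> tup C (Suc f). p f = \<zero>}"
      using sub_0[OF C] by (auto simp: tuples_def less_Suc_eq)
  qed
qed

lemma single_tup: "\<lbrakk>subspace K C M; x \<in> C; i < f\<rbrakk> \<Longrightarrow> (\<lambda>l. if l = i then x else \<zero>) \<in> tup C f"
  using sub_0 by (auto simp: tuples_def)

lemma tup_last: "subspace K C M \<Longrightarrow> (\<lambda>p. p f) ` tup C (Suc f) = C"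
proof
  assume C: "subspace K C M"
  show "C \<subseteq> (\<lambda>p. p f) ` tup C (Suc f)"
    using single_tup[OF C, of _ f "Suc f"] by (auto intro!: rev_image_eqI)
qed (auto simp: tuples_def)

lemma tup_0: "tup C 0 = Z"
  by (auto simp: tuples_def seq_space_simps)

lemma tup_fin:
  assumes "fin A C"
  shows "S.fin (tup A f) (tup C f)" "S.rdim (tup A f) (tup C f) = f * rdim A C"
proof -
  note s = fin_sub[OF assms]
  have "S.fin (tup A f) (tup C f) \<and> S.rdim (tup A f) (tup C f) = f * rdim A C"
  proof (induct f)
    case 0
    then show ?case using S.fin_self[OF S.subspace_zero] by (simp add: tup_0)
  next
    case (Suc f)
    note r = rdim_kernel_image[OF seq_proj[of f] S.vs_self vs_self tup_subspace[OF s(1), of "Suc f"] tup_subspace[OF s(2)] tup_mono[OF s(3)],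
        unfolded tup_ker[OF s(1)] tup_ker[OF s(2)] tup_last[OF s(1)] tup_last[OF s(2)]]
    show ?case using r Suc assms by simp
  qed
  then show "S.fin (tup A f) (tup C f)" "S.rdim (tup A f) (tup C f) = f * rdim A C" by simp_all
qed

lemma lat_sub: "C \<in> lat \<Longrightarrow> subspace K C M" "C \<in> lat \<Longrightarrow> \<Omega> \<subseteq> C" "C \<in> lat \<Longrightarrow> fin \<Omega> C"
  using fin_sub by (auto simp: lat_def)

lemma lat_X: "\<lbrakk>C \<in> lat; g \<in> GS; x \<in> C\<rbrakk> \<Longrightarrow> X b g x \<in> C"
  by (simp add: lat_def)

lemma lat_tuples_sub: "D \<in> lat_tuples f \<Longrightarrow> subspace K D (seq_space M)" "D \<in> lat_tuples f \<Longrightarrow> tup \<Omega> f \<subseteq> D"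
  using S.fin_sub by (auto simp: lat_tuples_def)

lemma core_subspace:
  assumes E: "subspace K E M" and C: "subspace K C M"
  shows "subspace K (core E C) M"
proof (rule subspaceI)
  fix x y assume "x \<in> core E C" "y \<in> core E C"
  then show "x \<oplus> y \<in> core E C"
    using sub_add[OF E] sub_add[OF C] hom_add[OF X_hom] sub_carrier[OF E] by (simp add: core_def)
next
  fix c x assume "c \<in> carrier K" "x \<in> core E C"
  then show "c \<odot> x \<in> core E C"
    using sub_smult[OF E] sub_smult[OF C] hom_smult[OF X_hom] sub_carrier[OF E] by (simp add: core_def)
qed (use sub_carrier[OF E] sub_0[OF E] sub_0[OF C] X_0 in \<open>auto simp: core_def\<close>)

lemma core_tuples_subspace:
  assumes E: "subspace K E M" and D: "subspace K D (seq_space M)"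
  shows "subspace K (core_tuples E f D) (seq_space M)"
proof (rule S.subspaceI)
  note T = tup_subspace[OF E, of f]
  have c: "p i \<in> carrier M" if "p \<in> tup E f" for p i using S.sub_carrier[OF T that] by (simp add: seq_space_simps)
  show "core_tuples E f D \<subseteq> carrier (seq_space M)" using S.sub_carrier[OF T] by (auto simp: core_tuples_def)
  show "\<zero>\<^bsub>seq_space M\<^esub> \<in> core_tuples E f D"
    using S.sub_0[OF T] S.sub_0[OF D] X_0 by (simp add: core_tuples_def seq_space_simps)
  fix p q assume a: "p \<in> core_tuples E f D" "q \<in> core_tuples E f D"
  show "p \<oplus>\<^bsub>seq_space M\<^esub> q \<in> core_tuples E f D"
    unfolding core_tuples_def
  proof (intro CollectI conjI ballI)
    show "p \<oplus>\<^bsub>seq_space M\<^esub> q \<in> tup E f" using a S.sub_add[OF T] by (simp add: core_tuples_def)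
    fix g assume g: "g \<in> dual K M"
    have "(\<lambda>i. X True g ((p \<oplus>\<^bsub>seq_space M\<^esub> q) i)) = (\<lambda>i. X True g (p i)) \<oplus>\<^bsub>seq_space M\<^esub> (\<lambda>i. X True g (q i))"
      using a hom_add[OF X_hom[OF g] c c] by (simp add: core_tuples_def seq_space_simps)
    then show "(\<lambda>i. X True g ((p \<oplus>\<^bsub>seq_space M\<^esub> q) i)) \<in> D"
      using a g S.sub_add[OF D] by (simp add: core_tuples_def)
  qed
next
  note T = tup_subspace[OF E, of f]
  have c: "p i \<in> carrier M" if "p \<in> tup E f" for p i using S.sub_carrier[OF T that] by (simp add: seq_space_simps)
  fix k p assume k: "k \<in> carrier K" and a: "p \<in> core_tuples E f D"
  show "k \<odot>\<^bsub>seq_space M\<^esub> p \<in> core_tuples E f D"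
    unfolding core_tuples_def
  proof (intro CollectI conjI ballI)
    show "k \<odot>\<^bsub>seq_space M\<^esub> p \<in> tup E f" using a k S.sub_smult[OF T] by (simp add: core_tuples_def)
    fix g assume g: "g \<in> dual K M"
    have "(\<lambda>i. X True g ((k \<odot>\<^bsub>seq_space M\<^esub> p) i)) = k \<odot>\<^bsub>seq_space M\<^esub> (\<lambda>i. X True g (p i))"
      using a hom_smult[OF X_hom[OF g] k c] by (simp add: core_tuples_def seq_space_simps)
    then show "(\<lambda>i. X True g ((k \<odot>\<^bsub>seq_space M\<^esub> p) i)) \<in> D"
      using a g k S.sub_smult[OF D] by (simp add: core_tuples_def)
  qed
qed

lemma tup_lat:
  assumes "C \<in> lat"
  shows "tup C f \<in> lat_tuples f"
  unfolding lat_tuples_def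
proof (intro CollectI conjI allI ballI)
  show "S.fin (tup \<Omega> f) (tup C f)" by (rule tup_fin(1)[OF lat_sub(3)[OF assms]])
  show "tup C f \<subseteq> tup (carrier M) f" using sub_carrier[OF lat_sub(1)[OF assms]] by (intro tup_mono) auto
  show "(\<lambda>i. X b g (p i)) \<in> tup C f" if "g \<in> GS" "p \<in> tup C f" for b g p
    using that lat_X[OF assms that(1)] X_0[of g] GS_dual by (auto simp: tuples_def)
qed

lemma core_tup:
  assumes C: "subspace K C M"
  shows "core_tuples E f (tup C f) = tup (core E C) f"
  using X_0 by (auto simp: core_tuples_def core_def tuples_def)

text \<open>Cuts \<open>D\<close> along the last coordinate into a kernel of shorter tuples and an
  image in \<open>M\<close>; stability passes to both because the operators act entrywise.\<close>

lemma lat_step: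
  assumes D: "D \<in> lat_tuples (Suc f)"
  shows "{p \<in> D. p f = \<zero>} \<in> lat_tuples f" "(\<lambda>p. p f) ` D \<in> lat"
    "S.rdim (tup \<Omega> (Suc f)) D = S.rdim (tup \<Omega> f) {p \<in> D. p f = \<zero>} + rdim \<Omega> ((\<lambda>p. p f) ` D)"
proof -
  note s = lat_tuples_sub[OF D]
  have fin: "S.fin (tup \<Omega> (Suc f)) D" using D by (simp add: lat_tuples_def)
  note r = rdim_kernel_image[OF seq_proj S.vs_self vs_self tup_subspace[OF \<Omega>_sub] s, of f, unfolded tup_ker[OF \<Omega>_sub] tup_last[OF \<Omega>_sub]]
  show "S.rdim (tup \<Omega> (Suc f)) D = S.rdim (tup \<Omega> f) {p \<in> D. p f = \<zero>} + rdim \<Omega> ((\<lambda>p. p f) ` D)" by (rule r(2)[OF fin])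
  show "{p \<in> D. p f = \<zero>} \<in> lat_tuples f"
    unfolding lat_tuples_def
  proof (intro CollectI conjI allI ballI)
    show "S.fin (tup \<Omega> f) {p \<in> D. p f = \<zero>}" using r(1) fin by simp
    have "D \<subseteq> tup (carrier M) (Suc f)" using D by (simp add: lat_tuples_def)
    then show "{p \<in> D. p f = \<zero>} \<subseteq> tup (carrier M) f" using tup_ker[OF subspace_carrier, of f] by blast
    show "(\<lambda>i. X b g (p i)) \<in> D" if "g \<in> GS" "p \<in> {p \<in> D. p f = \<zero>}" for b g p
      using D that by (simp add: lat_tuples_def)
    show "X b g (p f) = \<zero>" if "g \<in> GS" "p \<in> {p \<in> D. p f = \<zero>}" for b g p
      using that X_0[of g b] GS_dual by auto
  qed
  show "(\<lambda>p. p f) ` D \<in> lat"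
    unfolding lat_def
  proof (intro CollectI conjI allI ballI)
    show "fin \<Omega> ((\<lambda>p. p f) ` D)" using r(1) fin by simp
    fix b g x assume g: "g \<in> GS" and "x \<in> (\<lambda>p. p f) ` D"
    then obtain p where p: "p \<in> D" "x = p f" by auto
    then have "(\<lambda>i. X b g (p i)) \<in> D" using D g by (simp add: lat_tuples_def)
    then have "(\<lambda>i. X b g (p i)) f \<in> (\<lambda>p. p f) ` D" by (rule imageI)
    then show "X b g x \<in> (\<lambda>p. p f) ` D" using p(2) by simp
  qed
qed

lemma core_fin:
  assumes E: "fin {\<zero>} E" and C: "subspace K C M"
  shows "fin {\<zero>} (core E C)" "rdim {\<zero>} (core E C) \<le> rdim {\<zero>} E"
proof -
  have S: "subspace K (core E C) M" by (rule core_subspace[OF fin_sub(2)[OF E] C])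
  have "{\<zero>} \<subseteq> core E C" "core E C \<subseteq> E" using sub_0[OF S] by (auto simp: core_def)
  then show "fin {\<zero>} (core E C)" "rdim {\<zero>} (core E C) \<le> rdim {\<zero>} E"
    using rdim_split[OF E S] by simp_all
qed

lemma core_tuples_fin:
  assumes E: "fin {\<zero>} E" and D: "subspace K D (seq_space M)"
  shows "S.fin Z (core_tuples E f D)"
proof -
  have S: "subspace K (core_tuples E f D) (seq_space M)" by (rule core_tuples_subspace[OF fin_sub(2)[OF E] D])
  have Z: "tup {\<zero>} f = Z" by (auto simp: tuples_def seq_space_simps fun_eq_iff) (metis not_le)
  have "Z \<subseteq> core_tuples E f D" "core_tuples E f D \<subseteq> tup E f" using S.sub_0[OF S] by (auto simp: core_tuples_def)
  then show ?thesis using S.rdim_split(1)[OF tup_fin(1)[OF E, of f, unfolded Z] S] by simp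
qed

lemma tup_fin_Z: "fin {\<zero>} E \<Longrightarrow> S.fin Z (tup E f)" "fin {\<zero>} E \<Longrightarrow> S.rdim Z (tup E f) = f * rdim {\<zero>} E"
proof -
  have Z: "tup {\<zero>} f = Z" by (auto simp: tuples_def seq_space_simps fun_eq_iff) (metis not_le)
  show "fin {\<zero>} E \<Longrightarrow> S.fin Z (tup E f)" "fin {\<zero>} E \<Longrightarrow> S.rdim Z (tup E f) = f * rdim {\<zero>} E"
    using tup_fin[of "{\<zero>}" E f] Z by simp_all
qed

text \<open>Dimensions over \<Omega> add up exactly, whereas for cores there are only inclusions:
  the kernel part of the core lies in the core of the kernel, and its image in the core of the
  image. Hence an inequality.\<close>

lemma val_step:
  assumes E: "fin {\<zero>} E" and D: "D \<in> lat_tuples (Suc f)"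
  shows "val_tuples m j E (Suc f) D \<le> val_tuples m j E f {u \<in> D. u f = \<zero>} + val m j E ((\<lambda>u. u f) ` D)"
proof -
  let ?D0 = "{u \<in> D. u f = \<zero>}" and ?p = "\<lambda>u::nat \<Rightarrow> 'm. u f" and ?W = "core_tuples E (Suc f) D"
  note s = lat_step[OF D] and Es = fin_sub(2)[OF E]
  have W: "S.fin Z ?W" "subspace K ?W (seq_space M)"
    using core_tuples_fin[OF E lat_tuples_sub(1)[OF D]] core_tuples_subspace[OF Es lat_tuples_sub(1)[OF D]] by simp_all
  have ZW: "Z \<subseteq> ?W" using S.sub_0[OF W(2)] by simp
  have z: "{u \<in> Z. ?p u = \<zero>} = Z" "?p ` Z = {\<zero>}" by (auto simp: seq_space_simps)
  note r = rdim_kernel_image[OF seq_proj S.vs_self vs_self S.subspace_zero W(2) ZW, of f, unfolded z]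
  have c0: "subspace K (core_tuples E f ?D0) (seq_space M)" "S.fin Z (core_tuples E f ?D0)"
    using core_tuples_subspace[OF Es lat_tuples_sub(1)[OF s(1)]] core_tuples_fin[OF E lat_tuples_sub(1)[OF s(1)]] by simp_all
  have W0: "subspace K {u \<in> ?W. ?p u = \<zero>} (seq_space M)"
    using subspace_inter_vimage[OF seq_proj S.vs_self vs_self W(2) subspace_zero, of f] by simp
  have "{u \<in> ?W. ?p u = \<zero>} \<subseteq> core_tuples E f ?D0"
    using tup_ker[OF Es, of f] X_0 by (auto simp: core_tuples_def)
  then have 1: "S.rdim Z {u \<in> ?W. ?p u = \<zero>} \<le> S.rdim Z (core_tuples E f ?D0)"
    using S.rdim_split(3)[OF c0(2) W0] S.sub_0[OF W0] by simp
  have pW: "subspace K (?p ` ?W) M" by (rule subspace_image[OF seq_proj S.vs_self vs_self W(2)])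
  have "?p ` ?W \<subseteq> core E (?p ` D)"
  proof
    fix x assume "x \<in> ?p ` ?W"
    then obtain u where u: "u \<in> ?W" "x = u f" by auto
    have "x \<in> E" using u by (simp add: core_tuples_def tuples_def)
    moreover have "X True g x \<in> ?p ` D" if "g \<in> dual K M" for g
    proof -
      have "(\<lambda>i. X True g (u i)) \<in> D" using u that by (simp add: core_tuples_def)
      from imageI[OF this, of ?p] show ?thesis using u(2) by simp
    qed
    ultimately show "x \<in> core E (?p ` D)" by (simp add: core_def)
  qed
  then have 2: "rdim {\<zero>} (?p ` ?W) \<le> rdim {\<zero>} (core E (?p ` D))"
    using rdim_split(3)[OF core_fin(1)[OF E lat_sub(1)[OF s(2)]] pW] sub_0[OF pW] by simp
  have "S.rdim Z ?W \<le> S.rdim Z (core_tuples E f ?D0) + rdim {\<zero>} (core E (?p ` D))"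
    using r(2)[OF W(1)] 1 2 by simp
  then have "int m * int (S.rdim Z ?W) \<le> int m * (int (S.rdim Z (core_tuples E f ?D0)) + int (rdim {\<zero>} (core E (?p ` D))))"
    by (intro mult_left_mono) simp_all
  then show ?thesis unfolding val_tuples_def val_def s(3) by (simp add: algebra_simps)
qed

lemma val_tuples_0:
  assumes E: "fin {\<zero>} E" and D: "D \<in> lat_tuples 0"
  shows "D = Z" "val_tuples m j E 0 D = 0"
proof -
  note s = lat_tuples_sub[OF D]
  show DZ: "D = Z" using s(2) D by (auto simp: tup_0 lat_tuples_def)
  have "core_tuples E 0 D = Z"
    using S.sub_0[OF core_tuples_subspace[OF fin_sub(2)[OF E] s(1), of 0]] by (auto simp: core_tuples_def tup_0)
  then show "val_tuples m j E 0 D = 0" using S.fin_self(2)[OF S.subspace_zero] DZ by (simp add: val_tuples_def tup_0)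
qed

lemma val_tuples_le:
  assumes E: "fin {\<zero>} E" and a: "\<And>C. C \<in> lat \<Longrightarrow> val m j E C \<le> a" and D: "D \<in> lat_tuples f"
  shows "val_tuples m j E f D \<le> int f * a"
  using D
proof (induct f arbitrary: D)
  case 0
  then show ?case using val_tuples_0(2)[OF E] by simp
next
  case (Suc f)
  note s = lat_step[OF Suc(2)]
  show ?case using val_step[OF E Suc(2), of m j] Suc(1)[OF s(1)] a[OF s(2)] by (simp add: algebra_simps)
qed

text \<open>Since neither slice of \<open>D\<close> can exceed its bound, both must attain it. The
  image contains \<open>C'\<close>, which has the largest dimension among optimal subspaces, so it
  equals \<open>C'\<close>; the kernel is treated by induction.\<close>

lemma val_tuples_eq:
  assumes E: "fin {\<zero>} E" and a: "\<And>C. C \<in> lat \<Longrightarrow> val m j E C \<le> a"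
    and C': "C' \<in> lat" "\<And>C. \<lbrakk>C \<in> lat; val m j E C = a\<rbrakk> \<Longrightarrow> rdim \<Omega> C \<le> rdim \<Omega> C'"
    and D: "D \<in> lat_tuples f" "tup C' f \<subseteq> D" "int f * a \<le> val_tuples m j E f D"
  shows "D = tup C' f"
  using D
proof (induct f arbitrary: D)
  case 0
  then show ?case using val_tuples_0(1)[OF E] by (simp add: tup_0)
next
  case (Suc f)
  note s = lat_step[OF Suc(2)] and C's = lat_sub(1)[OF C'(1)]
  let ?D0 = "{g \<in> D. g f = \<zero>}" and ?p = "\<lambda>g::nat \<Rightarrow> 'm. g f"
  have v: "val_tuples m j E f ?D0 \<le> int f * a" "val m j E (?p ` D) \<le> a"
    using val_tuples_le[OF E a s(1)] a[OF s(2)] by simp_all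
  have "int f * a + a \<le> val_tuples m j E f ?D0 + val m j E (?p ` D)"
    using val_step[OF E Suc(2), of m j] Suc(4) by (simp add: algebra_simps)
  then have eq: "int f * a \<le> val_tuples m j E f ?D0" "val m j E (?p ` D) = a" using v by simp_all
  have "tup C' f \<subseteq> ?D0" using tup_ker[OF C's, of f] Suc(3) by blast
  then have D0: "?D0 = tup C' f" by (rule Suc(1)[OF s(1) _ eq(1)])
  have sub: "C' \<subseteq> ?p ` D" using image_mono[OF Suc(3), of ?p] tup_last[OF C's, of f] by simp
  have "rdim \<Omega> (?p ` D) \<le> rdim \<Omega> C'" by (rule C'(2)[OF s(2) eq(2)])
  then have "rdim C' (?p ` D) = 0"
    using rdim_split(3)[OF lat_sub(3)[OF s(2)] C's lat_sub(2)[OF C'(1)] sub] by simp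
  then have pD: "?p ` D = C'"
    using rdim_0[OF rdim_split(2)[OF lat_sub(3)[OF s(2)] C's lat_sub(2)[OF C'(1)] sub]] by simp
  show ?case
  proof (rule equalityI[OF _ Suc(3)], rule subsetI)
    fix g assume g: "g \<in> D"
    then have xf: "g f \<in> C'" using pD by auto
    \<comment> \<open>Removing the last entry of \<open>g\<close>, which lies in \<open>C'\<close>,
      leaves an element of the kernel slice.\<close>
    let ?q = "\<lambda>l. if l = f then g f else \<zero>"
    have q: "?q \<in> tup C' (Suc f)" by (rule single_tup[OF C's xf]) simp
    note Ds = lat_tuples_sub(1)[OF Suc(2)]
    have c: "g \<in> carrier (seq_space M)" "?q \<in> carrier (seq_space M)"
      using S.sub_carrier[OF Ds g] S.sub_carrier[OF Ds subsetD[OF Suc(3) q]] by simp_all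
    have d: "g \<ominus>\<^bsub>seq_space M\<^esub> ?q \<in> D" by (rule S.sub_minus[OF Ds g subsetD[OF Suc(3) q]])
    have "(g \<ominus>\<^bsub>seq_space M\<^esub> ?q) f = \<zero>"
      using hom_minus[OF seq_proj S.vs_self vs_self c, of f] minus_self[of "g f"] c(1) by (simp add: seq_space_simps)
    then have "g \<ominus>\<^bsub>seq_space M\<^esub> ?q \<in> tup C' (Suc f)" using d D0 tup_ker[OF C's, of f] by blast
    then have "(g \<ominus>\<^bsub>seq_space M\<^esub> ?q) \<oplus>\<^bsub>seq_space M\<^esub> ?q \<in> tup C' (Suc f)"
      by (rule S.sub_add[OF tup_subspace[OF C's] _ q])
    then show "g \<in> tup C' (Suc f)" using S.minus_add_cancel[OF c] by simp
  qed
qed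

text \<open>
  \<open>u i j\<close> and \<open>s i j\<close> are the actions of the entries of a matrix \<open>h\<close> with
  \<open>\<Delta> h\<^sub>i\<^sub>j = \<Sigma>\<^sub>k h\<^sub>i\<^sub>k \<otimes> h\<^sub>k\<^sub>j\<close> and of the antipodes of these entries.
\<close>

definition comatrix_action ::
  "'m set \<Rightarrow> 'm set \<Rightarrow> nat \<Rightarrow> (nat \<Rightarrow> nat \<Rightarrow> 'm \<Rightarrow> 'm) \<Rightarrow> (nat \<Rightarrow> nat \<Rightarrow> 'm \<Rightarrow> 'm) \<Rightarrow> bool"
where
  "comatrix_action E E' f u s \<longleftrightarrow> (\<forall>i<f. \<forall>j<f. u i j \<in> module_hom K M M \<and> s i j \<in> module_hom K M M \<and>
    (\<forall>x\<in>\<Omega>. u i j x \<in> \<Omega>) \<and> (\<forall>x\<in>E. u i j x \<in> E') \<and>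
    (\<forall>g\<in>GS. (\<lambda>x. g (u i j x)) \<in> GS \<and> (\<lambda>x. g (s i j x)) \<in> GS) \<and>
    (\<forall>b. \<forall>g\<in>dual K M. \<forall>x\<in>carrier M.
      X b g (u i j x) = (\<Oplus> k\<in>{..<f}. u i k (X b (\<lambda>y. g (u k j y)) x)) \<and>
      u i j (X b g x) = (\<Oplus> k\<in>{..<f}. X b (\<lambda>y. g (s i k y)) (u k j x))))"

section \<open>Tuples moved by a comatrix\<close>

context
  fixes E E' f u s
  assumes E: "fin {\<zero>} E" and E': "fin {\<zero>} E'" and ca: "comatrix_action E E' f u s"
begin

lemma u_hom: "\<lbrakk>i < f; j < f\<rbrakk> \<Longrightarrow> u i j \<in> module_hom K M M" "\<lbrakk>i < f; j < f\<rbrakk> \<Longrightarrow> s i j \<in> module_hom K M M"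
  and u_\<Omega>: "\<lbrakk>i < f; j < f; x \<in> \<Omega>\<rbrakk> \<Longrightarrow> u i j x \<in> \<Omega>"
  and u_E: "\<lbrakk>i < f; j < f; x \<in> E\<rbrakk> \<Longrightarrow> u i j x \<in> E'"
  and u_GS: "\<lbrakk>i < f; j < f; g \<in> GS\<rbrakk> \<Longrightarrow> (\<lambda>x. g (u i j x)) \<in> GS" "\<lbrakk>i < f; j < f; g \<in> GS\<rbrakk> \<Longrightarrow> (\<lambda>x. g (s i j x)) \<in> GS"
  and X_u: "\<lbrakk>i < f; j < f; g \<in> dual K M; x \<in> carrier M\<rbrakk> \<Longrightarrow> X b g (u i j x) = (\<Oplus> k\<in>{..<f}. u i k (X b (\<lambda>y. g (u k j y)) x))"
  and u_X: "\<lbrakk>i < f; j < f; g \<in> dual K M; x \<in> carrier M\<rbrakk> \<Longrightarrow> u i j (X b g x) = (\<Oplus> k\<in>{..<f}. X b (\<lambda>y. g (s i k y)) (u k j x))"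
  using ca by (simp_all add: comatrix_action_def)

lemma u_closed: "\<lbrakk>i < f; j < f; x \<in> carrier M\<rbrakk> \<Longrightarrow> u i j x \<in> carrier M"
  by (rule hom_closed[OF u_hom(1)])

lemma u_dual: "\<lbrakk>i < f; j < f; g \<in> dual K M\<rbrakk> \<Longrightarrow> (\<lambda>x. g (u i j x)) \<in> dual K M"
  "\<lbrakk>i < f; j < f; g \<in> dual K M\<rbrakk> \<Longrightarrow> (\<lambda>x. g (s i j x)) \<in> dual K M"
  by (rule hom_comp[OF u_hom(1)] hom_comp[OF u_hom(2)], assumption+)+

text \<open>The matrix \<open>u\<close> acting on a tuple written as a column, cut off after
  \<open>f\<close> entries.\<close>

definition \<tau> :: "(nat \<Rightarrow> 'm) \<Rightarrow> nat \<Rightarrow> 'm" where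
  "\<tau> p j = (if j < f then \<Oplus> i\<in>{..<f}. u j i (p i) else \<zero>)"

lemma \<tau>_hom: "\<tau> \<in> module_hom K (seq_space M) (seq_space M)"
proof -
  have h: "(\<lambda>p. \<tau> p j) \<in> module_hom K (seq_space M) M" for j
  proof (cases "j < f")
    case True
    have "(\<lambda>p. \<Oplus> i\<in>{..<f}. u j i (p i)) \<in> module_hom K (seq_space M) M"
      by (rule hom_finsum_map) (rule hom_comp[OF seq_proj u_hom(1)[OF True]], simp)
    then show ?thesis using True by (simp add: \<tau>_def)
  next
    case False
    then show ?thesis using hom_zero_map by (simp add: \<tau>_def)
  qed
  show ?thesis
    by (rule homI) (use hom_closed[OF h] hom_add[OF h] hom_smult[OF h] in \<open>simp_all add: seq_space_simps fun_eq_iff\<close>)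
qed

lemma \<tau>_tup:
  assumes C: "subspace K C M" and D: "subspace K D M" and "\<And>i j x. \<lbrakk>i < f; j < f; x \<in> C\<rbrakk> \<Longrightarrow> u i j x \<in> D" and p: "p \<in> tup C f"
  shows "\<tau> p \<in> tup D f"
proof -
  have "(\<Oplus> i\<in>{..<f}. u j i (p i)) \<in> D" if "j < f" for j
    by (rule sub_finsum[OF D]) (use assms that in \<open>simp add: tuples_def\<close>)
  then show ?thesis by (simp add: tuples_def \<tau>_def)
qed

lemma \<tau>_single:
  assumes "i < f" "j < f" "x \<in> carrier M"
  shows "\<tau> (\<lambda>l. if l = i then x else \<zero>) j = u j i x"
proof -
  have "(\<Oplus> l\<in>{..<f}. u j l (if l = i then x else \<zero>)) = (\<Oplus> l\<in>{..<f}. if i = l then u j i x else \<zero>)"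
    using assms hom_0[OF u_hom(1)[OF assms(2)] vs_self vs_self] u_closed[OF assms(2,1,3)]
    by (intro M.finsum_cong') auto
  also have "\<dots> = u j i x" by (rule M.finsum_singleton) (use assms u_closed[OF assms(2,1,3)] in auto)
  finally show ?thesis using assms(2) by (simp add: \<tau>_def)
qed

lemma X_finsum: "\<lbrakk>g \<in> dual K M; \<And>i. i \<in> A \<Longrightarrow> x i \<in> carrier M\<rbrakk> \<Longrightarrow> X b g (\<Oplus> i\<in>A. x i) = (\<Oplus> i\<in>A. X b g (x i))"
  by (rule hom_finsum[OF X_hom vs_self vs_self])

text \<open>Coefficients of \<open>\<tau> p\<close> are again values of \<open>\<tau>\<close>, at
  coefficients of \<open>p\<close> by twisted functionals. This makes images under
  \<open>\<tau>\<close> stable.\<close>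

lemma X_\<tau>:
  assumes g: "g \<in> dual K M" and p: "p \<in> carrier (seq_space M)"
  shows "(\<lambda>j. X b g (\<tau> p j)) = \<tau> (\<lambda>k. \<Oplus> i\<in>{..<f}. X b (\<lambda>y. g (u k i y)) (p i))"
proof
  fix j
  have pc: "p i \<in> carrier M" for i using p by (simp add: seq_space_simps)
  show "X b g (\<tau> p j) = \<tau> (\<lambda>k. \<Oplus> i\<in>{..<f}. X b (\<lambda>y. g (u k i y)) (p i)) j"
  proof (cases "j < f")
    case True
    have Xc: "X b (\<lambda>y. g (u k i y)) (p i) \<in> carrier M" if "i < f" "k < f" for i k
      by (rule X_closed[OF u_dual(1)[OF that(2,1) g] pc])
    have "X b g (\<tau> p j) = (\<Oplus> i\<in>{..<f}. X b g (u j i (p i)))"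
      using True X_finsum[OF g, of "{..<f}" "\<lambda>i. u j i (p i)"] u_closed[OF True _ pc] by (simp add: \<tau>_def)
    also have "\<dots> = (\<Oplus> i\<in>{..<f}. \<Oplus> k\<in>{..<f}. u j k (X b (\<lambda>y. g (u k i y)) (p i)))"
      by (rule M.finsum_cong') (use X_u[OF True _ g pc] u_closed[OF True _ Xc] in auto)
    also have "\<dots> = (\<Oplus> k\<in>{..<f}. \<Oplus> i\<in>{..<f}. u j k (X b (\<lambda>y. g (u k i y)) (p i)))"
      by (rule finsum_swap) (rule u_closed[OF True _ Xc])
    also have "\<dots> = (\<Oplus> k\<in>{..<f}. u j k (\<Oplus> i\<in>{..<f}. X b (\<lambda>y. g (u k i y)) (p i)))"
    proof (rule M.finsum_cong')
      fix k assume "k \<in> {..<f}"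
      then have k: "k < f" by simp
      show "(\<Oplus> i\<in>{..<f}. u j k (X b (\<lambda>y. g (u k i y)) (p i))) = u j k (\<Oplus> i\<in>{..<f}. X b (\<lambda>y. g (u k i y)) (p i))"
        by (rule hom_finsum[OF u_hom(1)[OF True k] vs_self vs_self, symmetric]) (use Xc k in simp)
    qed (use u_closed[OF True] Xc in auto)
    finally show ?thesis using True by (simp add: \<tau>_def)
  next
    case False
    then show ?thesis using X_0[OF g] by (simp add: \<tau>_def)
  qed
qed

text \<open>The reverse passage, which expresses \<open>\<tau>\<close> of coefficients by
  coefficients of \<open>\<tau> p\<close>, twists the functional by the antipode entries
  \<open>s\<close>. This makes preimages under \<open>\<tau>\<close> stable.\<close>

lemma \<tau>_X:
  assumes g: "g \<in> dual K M" and p: "p \<in> carrier (seq_space M)" and j: "j < f"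
  shows "\<tau> (\<lambda>i. X b g (p i)) j = (\<Oplus> k\<in>{..<f}. X b (\<lambda>y. g (s j k y)) (\<tau> p k))"
proof -
  have pc: "p i \<in> carrier M" for i using p by (simp add: seq_space_simps)
  have Xc: "X b (\<lambda>y. g (s j k y)) (u k i (p i)) \<in> carrier M" if "i < f" "k < f" for i k
    by (rule X_closed[OF u_dual(2)[OF j that(2) g] u_closed[OF that(2,1) pc]])
  have "\<tau> (\<lambda>i. X b g (p i)) j = (\<Oplus> i\<in>{..<f}. \<Oplus> k\<in>{..<f}. X b (\<lambda>y. g (s j k y)) (u k i (p i)))"
    unfolding \<tau>_def using j u_X[OF j _ g pc] Xc by (auto intro!: M.finsum_cong')
  also have "\<dots> = (\<Oplus> k\<in>{..<f}. \<Oplus> i\<in>{..<f}. X b (\<lambda>y. g (s j k y)) (u k i (p i)))"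
    by (rule finsum_swap[OF Xc])
  also have "\<dots> = (\<Oplus> k\<in>{..<f}. X b (\<lambda>y. g (s j k y)) (\<tau> p k))"
  proof (rule M.finsum_cong')
    fix k assume "k \<in> {..<f}"
    then have k: "k < f" by simp
    show "(\<Oplus> i\<in>{..<f}. X b (\<lambda>y. g (s j k y)) (u k i (p i))) = X b (\<lambda>y. g (s j k y)) (\<tau> p k)"
      using X_finsum[OF u_dual(2)[OF j k g], of "{..<f}" "\<lambda>i. u k i (p i)"] u_closed[OF k _ pc] k by (simp add: \<tau>_def)
  qed (use X_closed[OF u_dual(2)[OF j _ g]] hom_closed[OF \<tau>_hom p] in \<open>auto simp: seq_space_simps\<close>)
  finally show ?thesis .
qed

text \<open>Let \<open>CF\<close> and \<open>Y\<close> be the tuples from \<open>C\<close> and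
  \<open>C'\<close>, let \<open>D = Y + \<tau> CF\<close>, and let \<open>B\<close> be the preimage
  of \<open>Y\<close> in \<open>CF\<close>. Over \<Omega> the dimensions of \<open>D\<close> and
  \<open>B\<close> add up to those of \<open>Y\<close> and \<open>CF\<close>, while the cores of
  \<open>D\<close> and \<open>B\<close> are together at least as large as those of \<open>Y\<close>
  and \<open>CF\<close>. So the values of \<open>D\<close> and \<open>B\<close> sum to at least
  \<open>f a' + f a\<close>. That of \<open>B\<close> is at most \<open>f a\<close>, so
  \<open>D\<close> is optimal for \<open>E'\<close>; as it contains \<open>Y\<close>, it equals
  \<open>Y\<close> by \<open>val_tuples_eq\<close>.\<close>

lemma comatrix_maps_optimum:
  assumes C: "C \<in> lat" "val m j E C = a" "\<And>D. D \<in> lat \<Longrightarrow> val m j E D \<le> a"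
    and C': "C' \<in> lat" "val m j E' C' = a'" "\<And>D. D \<in> lat \<Longrightarrow> val m j E' D \<le> a'"
      "\<And>D. \<lbrakk>D \<in> lat; val m j E' D = a'\<rbrakk> \<Longrightarrow> rdim \<Omega> D \<le> rdim \<Omega> C'"
    and il: "i < f" "l < f" and x: "x \<in> C"
  shows "u i l x \<in> C'"
proof -
  note Cs = lat_sub(1)[OF C(1)] and C's = lat_sub(1)[OF C'(1)]
  note Es = fin_sub(2)[OF E] and E's = fin_sub(2)[OF E']
  define Y where "Y = tup C' f"
  define CF where "CF = tup C f"
  define D where "D = Y <+>\<^bsub>seq_space M\<^esub> \<tau> ` CF"
  define B where "B = {p \<in> CF. \<tau> p \<in> Y}"
  have Ys: "subspace K Y (seq_space M)" and CFs: "subspace K CF (seq_space M)"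
    unfolding Y_def CF_def by (rule tup_subspace, rule C's Cs)+
  have \<Omega>Y: "tup \<Omega> f \<subseteq> Y" and \<Omega>C: "tup \<Omega> f \<subseteq> CF" unfolding Y_def CF_def by (rule tup_mono, rule lat_sub(2), rule C' C)+
  have Yl: "Y \<in> lat_tuples f" and Cl: "CF \<in> lat_tuples f" unfolding Y_def CF_def by (rule tup_lat, rule C' C)+
  note t\<Omega> = tup_subspace[OF \<Omega>_sub, of f]
  have tC: "subspace K (\<tau> ` CF) (seq_space M)" by (rule subspace_image[OF \<tau>_hom S.vs_self S.vs_self CFs])
  have Ds: "subspace K D (seq_space M)" unfolding D_def by (rule S.subspace_set_add[OF Ys tC])
  have YD: "Y \<subseteq> D" unfolding D_def by (rule S.set_add_upper1[OF Ys tC])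
  have tD: "\<tau> p \<in> D" if "p \<in> CF" for p using S.set_add_upper2[OF Ys tC] that by (auto simp: D_def)
  have Bs: "subspace K B (seq_space M)" unfolding B_def by (rule subspace_inter_vimage[OF \<tau>_hom S.vs_self S.vs_self CFs Ys])
  have BC: "B \<subseteq> CF" by (auto simp: B_def)
  have \<Omega>B: "tup \<Omega> f \<subseteq> B"
  proof
    fix p assume p: "p \<in> tup \<Omega> f"
    have "\<tau> p \<in> tup \<Omega> f" by (rule \<tau>_tup[OF \<Omega>_sub \<Omega>_sub u_\<Omega> p])
    then show "p \<in> B" using p \<Omega>C \<Omega>Y by (auto simp: B_def)
  qed
  have fC: "S.fin (tup \<Omega> f) CF" "S.rdim (tup \<Omega> f) CF = f * rdim \<Omega> C"
    and fY: "S.fin (tup \<Omega> f) Y" "S.rdim (tup \<Omega> f) Y = f * rdim \<Omega> C'"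
    unfolding CF_def Y_def using tup_fin[OF lat_sub(3)[OF C(1)]] tup_fin[OF lat_sub(3)[OF C'(1)]] by simp_all
  note sB = S.rdim_split[OF fC(1) Bs \<Omega>B BC]
  have iD: "S.fin Y D" "S.rdim Y D = S.rdim B CF"
    using fin_image[OF \<tau>_hom S.vs_self S.vs_self CFs Ys B_def] sB(2) by (simp_all add: D_def)
  have dD: "S.rdim (tup \<Omega> f) D = S.rdim (tup \<Omega> f) Y + S.rdim B CF" "S.fin (tup \<Omega> f) D"
    using S.fin_trans[OF fY(1) iD(1)] iD(2) by simp_all
  have carr: "CF \<subseteq> tup (carrier M) f" "Y \<subseteq> tup (carrier M) f" using Cl Yl by (simp_all add: lat_tuples_def)
  have clos: "(\<lambda>j. X b g (\<tau> p j)) \<in> \<tau> ` tup C0 f"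
    if g: "g \<in> dual K M" and p: "p \<in> carrier (seq_space M)" and C0: "subspace K C0 M"
      and m: "\<And>i k. \<lbrakk>i < f; k < f\<rbrakk> \<Longrightarrow> X b (\<lambda>y. g (u k i y)) (p i) \<in> C0" for b g p C0
  proof -
    let ?q = "\<lambda>k. \<Oplus> i\<in>{..<f}. X b (\<lambda>y. g (u k i y)) (p i)"
    \<comment> \<open>\<open>\<tau>\<close> reads only the first \<open>f\<close> entries, so
      truncation puts the tuple into \<open>tup C0 f\<close> without changing its image.\<close>
    define q where "q k = (if k < f then ?q k else \<zero>)" for k
    have e: "?q k \<in> C0" if "k < f" for k by (rule sub_finsum[OF C0]) (use m that in simp)
    have "\<tau> ?q = \<tau> q"
    proof
      fix j
      show "\<tau> ?q j = \<tau> q j"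
        unfolding \<tau>_def using u_closed[of j, OF _ _ sub_carrier[OF C0 e]] by (auto intro!: M.finsum_cong' simp: q_def)
    qed
    moreover have "q \<in> tup C0 f" using e by (simp add: tuples_def q_def)
    ultimately show ?thesis unfolding X_\<tau>[OF g p] by (rule image_eqI)
  qed
  have cc: "p \<in> carrier (seq_space M)" if "p \<in> CF \<or> p \<in> Y" for p using that S.sub_carrier[OF CFs] S.sub_carrier[OF Ys] by blast
  have CFi: "p i \<in> C" if "p \<in> CF" "i < f" for p i using that by (simp add: CF_def tuples_def)
  have Yi: "p i \<in> C'" if "p \<in> Y" "i < f" for p i using that by (simp add: Y_def tuples_def)
  have YI: "(\<lambda>j. \<tau> p j) \<in> Y" if "\<And>j. j < f \<Longrightarrow> \<tau> p j \<in> C'" for p using that by (simp add: Y_def tuples_def) (simp add: \<tau>_def)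
  \<comment> \<open>Twisting by \<open>u\<close> keeps functionals in \<open>GS\<close>, so
    \<open>X_\<tau>\<close> and the stability of \<open>C\<close> take care of the summand coming
    from \<open>\<tau>\<close>.\<close>
  have Dl: "D \<in> lat_tuples f"
    unfolding lat_tuples_def
  proof (intro CollectI conjI allI ballI)
    show "S.fin (tup \<Omega> f) D" by (rule dD(2))
    have "\<tau> ` CF \<subseteq> tup (carrier M) f"
      using \<tau>_tup[OF Cs subspace_carrier u_closed[OF _ _ sub_carrier[OF Cs]]] by (auto simp: CF_def)
    then show "D \<subseteq> tup (carrier M) f"
      unfolding D_def by (intro S.set_add_least[OF tup_subspace[OF subspace_carrier]] carr)
    fix b g p assume g: "g \<in> GS" and "p \<in> D"
    then obtain y \<zeta> where y: "y \<in> Y" "\<zeta> \<in> CF" "p = y \<oplus>\<^bsub>seq_space M\<^esub> \<tau> \<zeta>" by (auto simp: D_def S.set_add_iff)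
    have gd: "g \<in> dual K M" using g GS_dual by auto
    have "(\<lambda>j. X b g (\<tau> \<zeta> j)) \<in> \<tau> ` CF"
      unfolding CF_def by (rule clos[OF gd cc Cs lat_X[OF C(1) u_GS(1) CFi]]) (use y(2) g in simp_all)
    moreover have "(\<lambda>i. X b g (y i)) \<in> Y" using Yl g y(1) by (simp add: lat_tuples_def)
    ultimately have "(\<lambda>i. X b g (y i)) \<oplus>\<^bsub>seq_space M\<^esub> (\<lambda>j. X b g (\<tau> \<zeta> j)) \<in> D"
      unfolding D_def S.set_add_iff by blast
    moreover have "(\<lambda>i. X b g (p i)) = (\<lambda>i. X b g (y i)) \<oplus>\<^bsub>seq_space M\<^esub> (\<lambda>j. X b g (\<tau> \<zeta> j))"
      using hom_add[OF X_hom[OF gd]] cc[of y] y(1) hom_closed[OF \<tau>_hom cc[of \<zeta>]] y(2) unfolding y(3) by (simp add: seq_space_simps)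
    ultimately show "(\<lambda>i. X b g (p i)) \<in> D" by simp
  qed
  \<comment> \<open>Twisting by \<open>s\<close> also keeps functionals in \<open>GS\<close>, so by
    \<open>\<tau>_X\<close> the stability of \<open>C'\<close> controls what \<open>\<tau>\<close>
    does to coefficients of \<open>p\<close>.\<close>
  have Bl: "B \<in> lat_tuples f"
    unfolding lat_tuples_def
  proof (intro CollectI conjI allI ballI)
    show "S.fin (tup \<Omega> f) B" by (rule sB(1))
    show "B \<subseteq> tup (carrier M) f" using BC carr by blast
    fix b g p assume g: "g \<in> GS" and p: "p \<in> B"
    have gd: "g \<in> dual K M" using g GS_dual by auto
    have pC: "p \<in> CF" and pY: "\<tau> p \<in> Y" using p by (simp_all add: B_def)
    have "\<tau> (\<lambda>i. X b g (p i)) \<in> Y"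
    proof (rule YI)
      fix j assume j: "j < f"
      have e: "\<tau> (\<lambda>i. X b g (p i)) j = (\<Oplus> k\<in>{..<f}. X b (\<lambda>y. g (s j k y)) (\<tau> p k))" by (rule \<tau>_X[OF gd _ j]) (use cc pC in simp)
      show "\<tau> (\<lambda>i. X b g (p i)) j \<in> C'"
        unfolding e by (rule sub_finsum[OF C's]) (use lat_X[OF C'(1) u_GS(2)[OF j _ g] Yi[OF pY]] in simp)
    qed
    moreover have "(\<lambda>i. X b g (p i)) \<in> CF" using Cl g pC by (simp add: lat_tuples_def)
    ultimately show "(\<lambda>i. X b g (p i)) \<in> B" by (simp add: B_def)
  qed
  define XE where "XE = tup (core E C) f"
  define WY where "WY = core_tuples E' f Y"
  \<comment> \<open>The counterpart of \<open>B\<close> for cores: the tuples from the core of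
    \<open>E\<close> that \<open>\<tau>\<close> sends into the core of \<open>Y\<close>. It enters
    the same dimension count.\<close>
  define Q where "Q = {p \<in> XE. \<tau> p \<in> WY}"
  let ?W = "core_tuples E' f D"
  note cE = core_fin[OF E Cs] and cE' = core_fin[OF E' C's]
  have cEs: "subspace K (core E C) M" by (rule core_subspace[OF Es Cs])
  have XEs: "subspace K XE (seq_space M)" unfolding XE_def by (rule tup_subspace[OF cEs])
  have WYs: "subspace K WY (seq_space M)" unfolding WY_def by (rule core_tuples_subspace[OF E's Ys])
  have fXE: "S.fin Z XE" "S.rdim Z XE = f * rdim {\<zero>} (core E C)" unfolding XE_def by (rule tup_fin_Z[OF cE(1)])+
  have WYe: "WY = tup (core E' C') f" unfolding WY_def Y_def by (rule core_tup[OF C's])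
  have fWY: "S.fin Z WY" "S.rdim Z WY = f * rdim {\<zero>} (core E' C')" unfolding WYe by (rule tup_fin_Z[OF cE'(1)])+
  have XEc: "p \<in> carrier (seq_space M)" "i < f \<Longrightarrow> p i \<in> E" "\<lbrakk>i < f; g \<in> dual K M\<rbrakk> \<Longrightarrow> X True g (p i) \<in> C" if "p \<in> XE" for p i g
    using that S.sub_carrier[OF XEs that] by (simp_all add: XE_def tuples_def core_def)
  have fW: "S.fin Z ?W" by (rule core_tuples_fin[OF E' Ds])
  have Ws: "subspace K ?W (seq_space M)" by (rule core_tuples_subspace[OF E's Ds])
  \<comment> \<open>The entries of \<open>p\<close> have their coefficients in \<open>C\<close>, so
    by \<open>X_\<tau>\<close> the coefficients of \<open>\<tau> p\<close> lie in the image of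
    \<open>CF\<close>, for every functional.\<close>
  have "\<tau> p \<in> ?W" if p: "p \<in> XE" for p
    unfolding core_tuples_def
  proof (intro CollectI conjI ballI)
    show "\<tau> p \<in> tup E' f"
    proof (rule \<tau>_tup[OF Es E's u_E])
      show "p \<in> tup E f" using p by (auto simp: XE_def tuples_def core_def)
    qed
    fix g assume g: "g \<in> dual K M"
    have "(\<lambda>j. X True g (\<tau> p j)) \<in> \<tau> ` CF"
      unfolding CF_def by (rule clos[OF g XEc(1)[OF p] Cs XEc(3)[OF p _ u_dual(1)[OF _ _ g]]]) 
    then show "(\<lambda>j. X True g (\<tau> p j)) \<in> D" using tD by auto
  qed
  moreover have "WY \<subseteq> ?W" unfolding WY_def core_tuples_def using YD by auto
  ultimately have sub: "WY <+>\<^bsub>seq_space M\<^esub> \<tau> ` XE \<subseteq> ?W" by (intro S.set_add_least[OF Ws]) auto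
  have tX: "subspace K (\<tau> ` XE) (seq_space M)" by (rule subspace_image[OF \<tau>_hom S.vs_self S.vs_self XEs])
  have Ps: "subspace K (WY <+>\<^bsub>seq_space M\<^esub> \<tau> ` XE) (seq_space M)" by (rule S.subspace_set_add[OF WYs tX])
  have Qs: "subspace K Q (seq_space M)" unfolding Q_def by (rule subspace_inter_vimage[OF \<tau>_hom S.vs_self S.vs_self XEs WYs])
  have QX: "Q \<subseteq> XE" by (auto simp: Q_def)
  have ZQ: "Z \<subseteq> Q" using S.sub_0[OF Qs] by simp
  note sQ = S.rdim_split[OF fXE(1) Qs ZQ QX]
  have iP: "S.fin WY (WY <+>\<^bsub>seq_space M\<^esub> \<tau> ` XE)" "S.rdim WY (WY <+>\<^bsub>seq_space M\<^esub> \<tau> ` XE) = S.rdim Q XE"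
    using fin_image[OF \<tau>_hom S.vs_self S.vs_self XEs WYs Q_def] sQ(2) by simp_all
  have "S.rdim Z (WY <+>\<^bsub>seq_space M\<^esub> \<tau> ` XE) = S.rdim Z WY + S.rdim Q XE"
    using S.fin_trans(2)[OF fWY(1) iP(1)] iP(2) by simp
  moreover have "Z \<subseteq> WY <+>\<^bsub>seq_space M\<^esub> \<tau> ` XE" using S.sub_0[OF Ps] by simp
  ultimately have W1: "S.rdim Z WY + S.rdim Q XE \<le> S.rdim Z ?W"
    using S.rdim_split(3)[OF fW Ps _ sub] by simp
  let ?V = "core_tuples E f B"
  \<comment> \<open>By \<open>\<tau>_X\<close> the coefficients of \<open>p\<close> are sent by
    \<open>\<tau>\<close> to sums of coefficients of \<open>\<tau> p\<close> by other functionals.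
    These lie in \<open>C'\<close> because the core tests every functional.\<close>
  have "Q \<subseteq> ?V"
  proof
    fix p assume "p \<in> Q"
    then have p: "p \<in> XE" and t: "\<tau> p \<in> WY" by (simp_all add: Q_def)
    show "p \<in> ?V"
      unfolding core_tuples_def
    proof (intro CollectI conjI ballI)
      show "p \<in> tup E f" using p by (auto simp: XE_def tuples_def core_def)
      fix g assume g: "g \<in> dual K M"
      have "(\<lambda>i. X True g (p i)) \<in> CF"
        using XEc(3)[OF p _ g] p X_0[OF g] by (simp add: CF_def XE_def tuples_def)
      moreover have "\<tau> (\<lambda>i. X True g (p i)) \<in> Y"
      proof (rule YI)
        fix j assume j: "j < f"
        have e: "\<tau> (\<lambda>i. X True g (p i)) j = (\<Oplus> k\<in>{..<f}. X True (\<lambda>y. g (s j k y)) (\<tau> p k))" by (rule \<tau>_X[OF g XEc(1)[OF p] j])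
        have "X True (\<lambda>y. g (s j k y)) (\<tau> p k) \<in> C'" if k: "k < f" for k
        proof -
          have "(\<lambda>i. X True (\<lambda>y. g (s j k y)) (\<tau> p i)) \<in> Y"
            using t u_dual(2)[OF j k g] by (simp add: WY_def core_tuples_def)
          from Yi[OF this k] show ?thesis .
        qed
        then show "\<tau> (\<lambda>i. X True g (p i)) j \<in> C'"
          unfolding e by (intro sub_finsum[OF C's]) simp
      qed
      ultimately show "(\<lambda>i. X True g (p i)) \<in> B" by (simp add: B_def)
    qed
  qed
  then have V1: "S.rdim Z Q \<le> S.rdim Z ?V"
    using S.rdim_split(3)[OF core_tuples_fin[OF E Bs] Qs ZQ] by simp
  \<comment> \<open>An upper bound for \<open>B\<close> and a lower bound for the core of
    \<open>D\<close>; with the two exact values for \<open>CF\<close> and \<open>Y\<close> they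
    force \<open>D\<close> to reach \<open>f\<close> times \<open>a'\<close>.\<close>
  have "int m * int (S.rdim Z Q) - int j * int (S.rdim (tup \<Omega> f) B) \<le> int f * a"
    using val_tuples_le[OF E C(3) Bl] mult_left_mono[of "int (S.rdim Z Q)" "int (S.rdim Z ?V)" "int m"] V1
    by (simp add: val_tuples_def)
  moreover have "int m * (int (S.rdim Z WY) + int (S.rdim Q XE)) \<le> int m * int (S.rdim Z ?W)"
    using W1 by (intro mult_left_mono) simp_all
  moreover have "int f * a = int m * int (S.rdim Z XE) - int j * int (S.rdim (tup \<Omega> f) CF)"
    unfolding fXE fC C(2)[symmetric] val_def by (simp add: algebra_simps)
  moreover have "int f * a' = int m * int (S.rdim Z WY) - int j * int (S.rdim (tup \<Omega> f) Y)"
    unfolding fWY fY C'(2)[symmetric] val_def by (simp add: algebra_simps)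
  ultimately have "int f * a' \<le> val_tuples m j E' f D"
    unfolding val_tuples_def dD(1) sQ(3) sB(3) by (simp add: algebra_simps)
  then have DY: "D = Y"
    unfolding Y_def by (intro val_tuples_eq[OF E' C'(3) C'(1) C'(4) Dl]) (use YD in \<open>simp_all add: Y_def\<close>)
  \<comment> \<open>A tuple whose single nonzero entry is \<open>x\<close> in position
    \<open>l\<close> turns \<open>\<tau>\<close> back into the entries \<open>u i l\<close>.\<close>
  have "\<tau> (\<lambda>i. if i = l then x else \<zero>) \<in> Y"
    using tD[of "\<lambda>i. if i = l then x else \<zero>"] single_tup[OF Cs x il(2)] DY by (simp add: CF_def)
  from Yi[OF this il(1)] show ?thesis unfolding \<tau>_single[OF il(2,1) sub_carrier[OF Cs x]] .
qed

end

end

section \<open>Existence of optima and the comparison of dimensions\<close>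

context operator_family
begin

lemma \<Omega>_lat: "\<Omega> \<in> lat"
  using fin_self[OF \<Omega>_sub] X_\<Omega> by (simp add: lat_def)

lemma val_\<Omega>: "0 \<le> val m j E \<Omega>"
  using fin_self(2)[OF \<Omega>_sub] by (simp add: val_def)

lemma val_bound:
  assumes "fin {\<zero>} E" "C \<in> lat"
  shows "val m j E C \<le> int m * int (rdim {\<zero>} E) - int j * int (rdim \<Omega> C)"
  using core_fin(2)[OF assms(1) lat_sub(1)[OF assms(2)]] mult_left_mono[of _ _ "int m"] by (simp add: val_def)

lemma optimum_ex:
  assumes E: "fin {\<zero>} E"
  shows "\<exists>C. C \<in> lat \<and> (\<forall>D\<in>lat. val m j E D \<le> val m j E C) \<and>
    (0 < j \<longrightarrow> (\<forall>D\<in>lat. val m j E D = val m j E C \<longrightarrow> rdim \<Omega> D \<le> rdim \<Omega> C))"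
proof -
  have b: "nat (val m j E C) \<le> m * rdim {\<zero>} E" if "C \<in> lat" for C
  proof -
    have "val m j E C \<le> int (m * rdim {\<zero>} E)"
      by (rule order_trans[OF val_bound[OF E that]]) simp
    then show ?thesis by (simp only: nat_le_iff)
  qed
  \<comment> \<open>The maximum is taken over natural numbers, so only subspaces of nonnegative
    value compete; \<Omega> is one of them.\<close>
  have "\<exists>C. (C \<in> lat \<and> 0 \<le> val m j E C) \<and> (\<forall>D. D \<in> lat \<and> 0 \<le> val m j E D \<longrightarrow> nat (val m j E D) \<le> nat (val m j E C))"
    by (rule ex_has_greatest_nat[of _ \<Omega> _ "Suc (m * rdim {\<zero>} E)"]) (use \<Omega>_lat val_\<Omega> b in \<open>auto simp: less_Suc_eq_le\<close>)
  then obtain C where C: "C \<in> lat" "0 \<le> val m j E C"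
    and mx: "\<And>D. \<lbrakk>D \<in> lat; 0 \<le> val m j E D\<rbrakk> \<Longrightarrow> nat (val m j E D) \<le> nat (val m j E C)" by auto
  have le: "val m j E D \<le> val m j E C" if "D \<in> lat" for D
    using mx[OF that] C(2) by (cases "0 \<le> val m j E D") auto
  show ?thesis
  proof (cases "0 < j")
    case True
    have rb: "rdim \<Omega> D \<le> m * rdim {\<zero>} E" if "D \<in> lat" "val m j E D = val m j E C" for D
    proof -
      have "int j * int (rdim \<Omega> D) \<le> int (m * rdim {\<zero>} E)" using val_bound[OF E that(1), of m j] that(2) C(2) by simp
      moreover have "int 1 * int (rdim \<Omega> D) \<le> int j * int (rdim \<Omega> D)" using True by (intro mult_right_mono) simp_all
      ultimately have "int (rdim \<Omega> D) \<le> int (m * rdim {\<zero>} E)" by simp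
      then show ?thesis by (simp only: of_nat_le_iff)
    qed
    have "\<exists>C'. (C' \<in> lat \<and> val m j E C' = val m j E C) \<and> (\<forall>D. D \<in> lat \<and> val m j E D = val m j E C \<longrightarrow> rdim \<Omega> D \<le> rdim \<Omega> C')"
      by (rule ex_has_greatest_nat[of _ C _ "Suc (m * rdim {\<zero>} E)"]) (use C rb in \<open>auto simp: less_Suc_eq_le\<close>)
    then show ?thesis using le by metis
  next
    case False
    then show ?thesis using C(1) le by auto
  qed
qed

text \<open>Were the dimension of \<open>C' j\<close> at least \<open>1 + 2 * \<delta>\<close> times
  that of \<open>C j\<close> for every \<open>j > 0\<close>, summation over \<open>j\<close> would
  give \<open>(1 + 2 * \<delta>) (m - 1) dim E \<le> m dim E'\<close>. This contradicts
  \<open>dim E' < (1 + \<delta>) dim E\<close> once \<open>m\<close> is large.\<close>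

theorem optimal_pair:
  fixes \<delta> :: real
  assumes E: "fin {\<zero>} E" and E0: "0 < rdim {\<zero>} E"
    and ER: "\<And>g x. \<lbrakk>g \<in> dual K M; x \<in> E\<rbrakk> \<Longrightarrow> X True g x \<in> E" and EX: "\<And>b g x. \<lbrakk>g \<in> GS; x \<in> E\<rbrakk> \<Longrightarrow> X b g x \<in> E"
    and core_\<Omega>: "core E \<Omega> \<subseteq> {\<zero>}"
    and E': "fin {\<zero>} E'" and less: "real (rdim {\<zero>} E') < (1 + \<delta>) * real (rdim {\<zero>} E)" and \<delta>: "0 < \<delta>"
  shows "\<exists>C C'. C \<in> lat \<and> C' \<in> lat \<and> real (rdim \<Omega> C') < (1 + 2 * \<delta>) * real (rdim \<Omega> C) \<and>
    (\<forall>f u s. comatrix_action E E' f u s \<longrightarrow> (\<forall>i<f. \<forall>l<f. \<forall>x\<in>C. u i l x \<in> C'))"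
proof (rule ccontr)
  assume contra: "\<not> ?thesis"
  note Es = fin_sub(2)[OF E]
  \<comment> \<open>The last inequality of the proof reads
    \<open>m \<delta> < 1 + 2 \<delta>\<close> after division by the dimension of \<open>E\<close>;
    \<open>m\<close> is chosen to violate it.\<close>
  obtain m :: nat where m: "(1 + 2 * \<delta>) / \<delta> < real m" using reals_Archimedean2 by blast
  then have m\<delta>: "1 + 2 * \<delta> < real m * \<delta>" using \<delta> by (simp add: pos_divide_less_eq)
  have m1: "1 \<le> m" using m\<delta> \<delta> by (cases m) auto
  define C where "C j = (SOME C. C \<in> lat \<and> (\<forall>D\<in>lat. val m j E D \<le> val m j E C) \<and>
    (0 < j \<longrightarrow> (\<forall>D\<in>lat. val m j E D = val m j E C \<longrightarrow> rdim \<Omega> D \<le> rdim \<Omega> C)))" for j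
  define C' where "C' j = (SOME C. C \<in> lat \<and> (\<forall>D\<in>lat. val m j E' D \<le> val m j E' C) \<and>
    (0 < j \<longrightarrow> (\<forall>D\<in>lat. val m j E' D = val m j E' C \<longrightarrow> rdim \<Omega> D \<le> rdim \<Omega> C)))" for j
  have C: "C j \<in> lat" "D \<in> lat \<Longrightarrow> val m j E D \<le> val m j E (C j)" for j D
    using someI_ex[OF optimum_ex[OF E, of m j]] unfolding C_def by auto
  have C': "C' j \<in> lat" "D \<in> lat \<Longrightarrow> val m j E' D \<le> val m j E' (C' j)"
    "\<lbrakk>0 < j; D \<in> lat; val m j E' D = val m j E' (C' j)\<rbrakk> \<Longrightarrow> rdim \<Omega> D \<le> rdim \<Omega> (C' j)" for j D
    using someI_ex[OF optimum_ex[OF E', of m j]] unfolding C'_def by auto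
  define a where "a j = val m j E (C j)" for j
  define a' where "a' j = val m j E' (C' j)" for j
  have cc: "(1 + 2 * \<delta>) * real (rdim \<Omega> (C j)) \<le> real (rdim \<Omega> (C' j))" if "0 < j" for j
  proof (rule ccontr)
    assume "\<not> (1 + 2 * \<delta>) * real (rdim \<Omega> (C j)) \<le> real (rdim \<Omega> (C' j))"
    moreover have "u i l x \<in> C' j" if ca: "comatrix_action E E' f u s" and "i < f" "l < f" "x \<in> C j" for f u s i l x
      by (rule comatrix_maps_optimum[OF E E' ca C(1) refl C(2) C'(1) refl C'(2) C'(3)[OF \<open>0 < j\<close>] that(2-4)])
    ultimately show False using contra C(1)[of j] C'(1)[of j] by (meson not_le)
  qed
  \<comment> \<open>The optimum of one index competes at a neighbouring index: \<open>C j\<close> at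
    \<open>Suc j\<close>, and \<open>C' (Suc j)\<close> at \<open>j\<close>. Changing the index by
    one changes the value of a subspace by its dimension over \<Omega>.\<close>
  have step: "a j \<le> a (Suc j) + int (rdim \<Omega> (C j))" "a' (Suc j) + int (rdim \<Omega> (C' (Suc j))) \<le> a' j" for j
    using C(2)[OF C(1), of "Suc j" j] C'(2)[OF C'(1), of j "Suc j"] by (simp_all add: a_def a'_def val_def algebra_simps)
  have sums: "a 1 \<le> a (Suc n) + (\<Sum>i<n. int (rdim \<Omega> (C (Suc i))))" "a' n + (\<Sum>i<n. int (rdim \<Omega> (C' (Suc i)))) \<le> a' 0" for n
  proof (induct n)
    case (Suc n)
    {
      case 1
      show ?case using Suc(1) step(1)[of "Suc n"] by simp
    next
      case 2
      show ?case using Suc(2) step(2)[of n] by simp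
    }
  qed simp_all
  \<comment> \<open>At index \<open>Suc n\<close> a single dimension over \<Omega> already costs
    more than \<open>E\<close> can contribute, so the optimum there is at most 0.\<close>
  define n where "n = m * rdim {\<zero>} E"
  have an: "a (Suc n) \<le> 0"
  proof (cases "rdim \<Omega> (C (Suc n)) = 0")
    case True
    then have e: "C (Suc n) = \<Omega>" using rdim_0[OF lat_sub(3)[OF C(1)]] by simp
    have "core E \<Omega> = {\<zero>}" using core_\<Omega> sub_0[OF core_subspace[OF Es \<Omega>_sub]] by auto
    then have "rdim {\<zero>} (core E \<Omega>) = 0" using fin_self(2)[OF subspace_zero] by simp
    then show ?thesis by (simp add: a_def val_def e)
  next
    case False
    have "int (Suc n) * 1 \<le> int (Suc n) * int (rdim \<Omega> (C (Suc n)))" using False by (intro mult_left_mono) simp_all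
    then show ?thesis using val_bound[OF E C(1), of m "Suc n" "Suc n"] by (simp add: a_def n_def)
  qed
  have a'n: "0 \<le> a' n" using C'(2)[OF \<Omega>_lat, of n] val_\<Omega>[of m n E'] by (simp add: a'_def)
  have a'0: "a' 0 \<le> int m * int (rdim {\<zero>} E')" using val_bound[OF E' C'(1), of m 0 0] by (simp add: a'_def)
  \<comment> \<open>The competitor at \<open>j = 1\<close> is \<Omega> + E: its core is all of
    \<open>E\<close>, and its dimension over \<Omega> is at most that of \<open>E\<close>.\<close>
  have a1: "int m * int (rdim {\<zero>} E) - int (rdim {\<zero>} E) \<le> a 1"
  proof -
    let ?D = "\<Omega> <+>\<^bsub>M\<^esub> E" and ?Q = "{x \<in> E. x \<in> \<Omega>}"
    have Qs: "subspace K ?Q M" using subspace_Int[OF Es \<Omega>_sub] by (simp add: Int_def)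
    have "{\<zero>} \<subseteq> ?Q" "?Q \<subseteq> E" using sub_0[OF Qs] by auto
    note sp = rdim_split[OF E Qs this]
    have i: "fin \<Omega> ?D" "rdim \<Omega> ?D = rdim ?Q E"
      using fin_image[OF hom_id vs_self vs_self Es \<Omega>_sub refl] sp(2) by simp_all
    note u = set_add_upper1[OF \<Omega>_sub Es] set_add_upper2[OF \<Omega>_sub Es]
    have D: "?D \<in> lat"
      unfolding lat_def
    proof (intro CollectI conjI i(1) allI ballI)
      fix b g x assume g: "g \<in> GS" and "x \<in> ?D"
      then obtain y z where y: "y \<in> \<Omega>" "z \<in> E" "x = y \<oplus> z" by (auto simp: set_add_iff)
      have "X b g x = X b g y \<oplus> X b g z"
        unfolding y(3) by (rule hom_add[OF X_hom sub_carrier[OF \<Omega>_sub y(1)] sub_carrier[OF Es y(2)]]) (use g GS_dual in auto)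
      then show "X b g x \<in> ?D" using X_\<Omega>[OF g y(1), of b] EX[OF g y(2), of b] by (auto simp: set_add_iff)
    qed
    have "core E ?D = E" using ER u(2) by (auto simp: core_def)
    then have "val m 1 E ?D = int m * int (rdim {\<zero>} E) - int (rdim ?Q E)" using i(2) by (simp add: val_def)
    then show ?thesis using C(2)[OF D, of 1] sp(3) by (simp add: a_def)
  qed
  let ?e = "real (rdim {\<zero>} E)" and ?S = "real_of_int (\<Sum>i<n. int (rdim \<Omega> (C (Suc i))))" and ?S' = "real_of_int (\<Sum>i<n. int (rdim \<Omega> (C' (Suc i))))"
  have S1: "real m * ?e - ?e \<le> ?S"
  proof -
    have "int m * int (rdim {\<zero>} E) - int (rdim {\<zero>} E) \<le> (\<Sum>i<n. int (rdim \<Omega> (C (Suc i))))"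
      using a1 sums(1)[of n] an by simp
    then have "real_of_int (int m * int (rdim {\<zero>} E) - int (rdim {\<zero>} E)) \<le> ?S" by (simp only: of_int_le_iff)
    then show ?thesis by simp
  qed
  have S2: "?S' \<le> real m * real (rdim {\<zero>} E')"
  proof -
    have "(\<Sum>i<n. int (rdim \<Omega> (C' (Suc i)))) \<le> int m * int (rdim {\<zero>} E')"
      using a'0 sums(2)[of n] a'n by simp
    then have "?S' \<le> real_of_int (int m * int (rdim {\<zero>} E'))" by (simp only: of_int_le_iff)
    then show ?thesis by simp
  qed
  have S3: "(1 + 2 * \<delta>) * ?S \<le> ?S'"
    using cc by (simp add: sum_distrib_left) (intro sum_mono, simp)
  have "(1 + 2 * \<delta>) * (real m * ?e - ?e) \<le> (1 + 2 * \<delta>) * ?S" using S1 \<delta> by (intro mult_left_mono) simp_all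
  also have "\<dots> \<le> real m * real (rdim {\<zero>} E')" using S2 S3 by simp
  also have "\<dots> < real m * ((1 + \<delta>) * ?e)" using less m1 by (intro mult_strict_left_mono) simp_all
  finally have "(real m * \<delta>) * ?e < (1 + 2 * \<delta>) * ?e" by (simp add: algebra_simps)
  then show False using m\<delta> E0 by (simp add: mult_less_cancel_right)
qed

end

section \<open>Comatrices\<close>

context coalgebra
begin

text \<open>In Sweedler notation \<open>coef True g x\<close> is
  \<open>\<Sigma> g(x\<^sub>2) x\<^sub>1\<close> and \<open>coef False g x\<close> is
  \<open>\<Sigma> g(x\<^sub>1) x\<^sub>2\<close>. The Boolean lets both actions share one
  proof.\<close>

definition coef :: "bool \<Rightarrow> ('v \<Rightarrow> 'k) \<Rightarrow> 'v \<Rightarrow> 'v" where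
  "coef b g x = (if b then contr_right K C g (comult C x) else contr_left K C g (comult C x))"

definition cv :: "bool \<Rightarrow> ('v \<Rightarrow> 'k) \<Rightarrow> ('v \<Rightarrow> 'k) \<Rightarrow> 'v \<Rightarrow> 'k" where
  "cv b f g x = (if b then conv K C f g x else conv K C g f x)"

lemma coef_hom: "g \<in> dual K C \<Longrightarrow> coef b g \<in> module_hom K C C"
  using hom_comp[OF comult_hom CC.contr_right_hom] hom_comp[OF comult_hom CC.contr_left_hom]
  by (cases b) (simp_all add: coef_def[abs_def])

lemma coef_closed: "\<lbrakk>g \<in> dual K C; x \<in> carrier C\<rbrakk> \<Longrightarrow> coef b g x \<in> carrier C"
  by (rule hom_closed[OF coef_hom])

lemma functional_coef: "\<lbrakk>f \<in> dual K C; g \<in> dual K C; x \<in> carrier C\<rbrakk> \<Longrightarrow> f (coef b g x) = cv b f g x"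
  using CC.ev_contr_right[of f g "comult C x"] CC.ev_contr_left[of g f "comult C x"] comult_closed
  by (simp add: coef_def cv_def conv_def)

lemma functional_coef': "\<lbrakk>f \<in> dual K C; g \<in> dual K C; x \<in> carrier C\<rbrakk> \<Longrightarrow> g (coef (\<not> b) f x) = cv b f g x"
  using functional_coef[of g f x "\<not> b"] by (simp add: cv_def)

text \<open>The coefficient matrix of a finite-dimensional comodule in a basis, also called a
  multiplicative matrix.\<close>

definition comatrix :: "nat \<Rightarrow> (nat \<Rightarrow> nat \<Rightarrow> 'v) \<Rightarrow> bool" where
  "comatrix n c \<longleftrightarrow> (\<forall>i<n. \<forall>j<n. c i j \<in> carrier C \<and> counit C (c i j) = (if i = j then \<one>\<^bsub>K\<^esub> else \<zero>\<^bsub>K\<^esub>) \<and>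
    comult C (c i j) = (\<Oplus>\<^bsub>tensor K C C\<^esub> k\<in>{..<n}. pure_tensor K C C (c i k) (c k j)))"

text \<open>The space \<open>V\<close> spanned by all \<open>\<Sigma> f(h\<^sub>1) h\<^sub>2\<close>
  is finite-dimensional, contains \<open>h\<close>, and is a left coideal by coassociativity. Its
  coefficient matrix in a basis \<open>b\<close> is the comatrix, and applying the counit to the
  right factors of \<open>\<Delta> (b j) = \<Sigma> c j l \<otimes> b l\<close> puts
  \<open>V\<close>, hence \<open>h\<close>, into the span of the entries.\<close>

lemma comatrix_ex:
  assumes h: "h \<in> carrier C"
  shows "\<exists>n c. comatrix n c \<and> h \<in> span {c i j | i j. i < n \<and> j < n}"
proof -
  let ?L = "coef False" and ?R = "coef True"
  let ?g = "{?L f h | f. f \<in> dual K C}"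
  define V where "V = span ?g"
  have gc: "?g \<subseteq> carrier C" using coef_closed[OF _ h] by auto
  have V: "subspace K V C" unfolding V_def by (rule span_is_subspace[OF gc])
  have LV: "?L f v \<in> V" if f: "f \<in> dual K C" and v: "v \<in> V" for f v
  proof (rule hom_span_subset[OF coef_hom[OF f] vs_self vs_self V gc _ v[unfolded V_def]])
    fix y assume "y \<in> ?g"
    then obtain f' where f': "f' \<in> dual K C" "y = ?L f' h" by auto
    have "?L f y = ?L (conv K C f' f) h"
    proof (rule functional_eqI)
      show "?L f y \<in> carrier C" "?L (conv K C f' f) h \<in> carrier C"
        using f'(2) coef_closed[OF f coef_closed[OF f'(1) h]] coef_closed[OF conv_dual[OF f'(1) f] h] by simp_all
      fix \<phi> assume p: "\<phi> \<in> dual K C"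
      have "\<phi> (?L f y) = conv K C f \<phi> (?L f' h)"
        using functional_coef[OF p f coef_closed[OF f'(1) h], of False False] f'(2) by (simp add: cv_def)
      also have "\<dots> = conv K C f' (conv K C f \<phi>) h"
        using functional_coef[OF conv_dual[OF f p] f'(1) h, of False] by (simp add: cv_def)
      also have "\<dots> = conv K C (conv K C f' f) \<phi> h" by (rule conv_assoc[OF f'(1) f p h, symmetric])
      also have "\<dots> = \<phi> (?L (conv K C f' f) h)"
        using functional_coef[OF p conv_dual[OF f'(1) f] h, of False] by (simp add: cv_def)
      finally show "\<phi> (?L f y) = \<phi> (?L (conv K C f' f) h)" .
    qed
    then have "?L f y \<in> ?g" using conv_dual[OF f'(1) f] by auto
    then show "?L f y \<in> V" unfolding V_def by (rule span_incl[OF gc])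
  qed
  have hL: "?L (counit C) h = h" using counit_left[OF h] by (simp add: coef_def contr_left_def)
  have "?L (counit C) h \<in> ?g" using counit_hom by auto
  then have hV: "h \<in> V" unfolding V_def hL by (rule span_incl[OF gc])
  \<comment> \<open>Each generator of \<open>V\<close> is a combination of the right factors of one
    fixed expression of \<open>\<Delta> h\<close>.\<close>
  have "fin {\<zero>\<^bsub>C\<^esub>} V"
  proof -
    obtain L where L: "set L \<subseteq> carrier C \<times> carrier C" "comult C h = CC.T.lsum (map (\<lambda>(a, b). pure_tensor K C C a b) L)"
      by (rule CC.span_tens[OF subspace_carrier subspace_carrier CC.span_pure[OF comult_closed[OF h]]])
    let ?S = "span (snd ` set L)"
    have sc: "snd ` set L \<subseteq> carrier C" using L(1) by auto
    have S: "subspace K ?S C" by (rule span_is_subspace[OF sc])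
    have m: "CC.T.lsum (map (\<lambda>(a, b). pure_tensor K C C a b) L') \<in> CC.T.span {pure_tensor K C C a b | a b. a \<in> carrier C \<and> b \<in> ?S}"
      if "set L' \<subseteq> set L" for L'
      using that
    proof (induct L')
      case Nil
      show ?case using CC.T.sub_0[OF CC.sub_span_pure[OF subspace_carrier S]] by simp
    next
      case (Cons p L')
      obtain a b where p: "p = (a, b)" by (cases p)
      have ab: "a \<in> carrier C" "b \<in> ?S" using Cons(2) p L(1) span_incl[OF sc, of b] by force+
      show ?case
        using CC.T.sub_add[OF CC.sub_span_pure[OF subspace_carrier S] CC.pure_in_span[OF subspace_carrier S ab]] Cons p by simp
    qed
    have "?L f h \<in> ?S" if f: "f \<in> dual K C" for f
    proof -
      have "contr_left K C f (comult C h) \<in> ?S"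
      proof (rule hom_span_subset[OF CC.contr_left_hom[OF f] CC.tensor_vs vs_self S _ _ m[OF subset_refl, folded L(2)]])
        show "{pure_tensor K C C a b | a b. a \<in> carrier C \<and> b \<in> ?S} \<subseteq> carrier (tensor K C C)"
          using CC.tp_closed sub_carrier[OF S] by auto
        fix t assume "t \<in> {pure_tensor K C C a b | a b. a \<in> carrier C \<and> b \<in> ?S}"
        then obtain a b where ab: "t = pure_tensor K C C a b" "a \<in> carrier C" "b \<in> ?S" by auto
        show "contr_left K C f t \<in> ?S"
          unfolding ab(1) CC.contr_left_pure[OF f ab(2) sub_carrier[OF S ab(3)]]
          by (rule sub_smult[OF S _ ab(3)]) (use hom_closed[OF f ab(2)] in simp)
      qed
      then show ?thesis by (simp add: coef_def)
    qed
    then have "V \<subseteq> ?S" unfolding V_def by (intro span_least[OF S]) auto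
    moreover have "fin {\<zero>\<^bsub>C\<^esub>} ?S" by (rule fin_span[OF _ sc]) simp
    ultimately show ?thesis using rdim_split(1)[OF _ V] sub_0[OF V] by simp
  qed
  from dual_basis[OF this] obtain n :: nat and b \<beta> where B: "(\<forall>i<n. b i \<in> V \<and> \<beta> i \<in> module_hom K C (ground_space K)) \<and>
    (\<forall>i<n. \<forall>l<n. \<beta> i (b l) = (if i = l then \<one>\<^bsub>K\<^esub> else \<zero>\<^bsub>K\<^esub>)) \<and> (\<forall>v\<in>V. v = (\<Oplus>\<^bsub>C\<^esub> l\<in>{..<n}. \<beta> l v \<odot>\<^bsub>C\<^esub> b l))"
    by (elim exE)
  have b: "b i \<in> V" "\<beta> i \<in> dual K C" if "i < n" for i using B that by simp_all
  have d: "\<beta> i (b l) = (if i = l then \<one>\<^bsub>K\<^esub> else \<zero>\<^bsub>K\<^esub>)" if "i < n" "l < n" for i l using B that by simp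
  have e: "v = (\<Oplus>\<^bsub>C\<^esub> l\<in>{..<n}. \<beta> l v \<odot>\<^bsub>C\<^esub> b l)" if "v \<in> V" for v
    by (rule B[THEN conjunct2, THEN conjunct2, THEN bspec, OF that])
  have bc: "b i \<in> carrier C" if "i < n" for i by (rule sub_carrier[OF V b(1)[OF that]])
  define c where "c j k = ?R (\<beta> k) (b j)" for j k
  have cc: "c j k \<in> carrier C" if "j < n" "k < n" for j k
    unfolding c_def by (rule coef_closed[OF b(2)[OF that(2)] bc[OF that(1)]])
  have \<beta>c: "\<beta> l (?L f (b j)) = f (c j l)" if "f \<in> dual K C" "j < n" "l < n" for f j l
    using functional_coef[OF b(2)[OF that(3)] that(1) bc[OF that(2)], of False]
      functional_coef[OF that(1) b(2)[OF that(3)] bc[OF that(2)], of True] by (simp add: cv_def c_def)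
  have dc: "f x \<in> carrier K" if "f \<in> dual K C" "x \<in> carrier C" for f x using hom_closed[OF that] by simp
  \<comment> \<open>This is \<open>\<Delta> (b j) = \<Sigma> c j l \<otimes> b l\<close>, tested on
    two functionals.\<close>
  have key: "conv K C f \<phi> (b j) = (\<Oplus>\<^bsub>ground_space K\<^esub> l\<in>{..<n}. f (c j l) \<otimes>\<^bsub>K\<^esub> \<phi> (b l))"
    if f: "f \<in> dual K C" and p: "\<phi> \<in> dual K C" and j: "j < n" for f \<phi> j
  proof -
    interpret k: vectorspace K "ground_space K" by (rule ground_vs)
    have "conv K C f \<phi> (b j) = \<phi> (?L f (b j))" using functional_coef[OF p f bc[OF j], of False] by (simp add: cv_def)
    also have "\<dots> = \<phi> (\<Oplus>\<^bsub>C\<^esub> l\<in>{..<n}. \<beta> l (?L f (b j)) \<odot>\<^bsub>C\<^esub> b l)"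
      by (subst e[OF LV[OF f b(1)[OF j]]]) (rule refl)
    also have "\<dots> = (\<Oplus>\<^bsub>ground_space K\<^esub> l\<in>{..<n}. \<phi> (\<beta> l (?L f (b j)) \<odot>\<^bsub>C\<^esub> b l))"
      by (rule hom_finsum[OF p vs_self ground_vs]) (use smult_closed[OF dc[OF b(2) coef_closed[OF f bc[OF j]]] bc] in simp)
    also have "\<dots> = (\<Oplus>\<^bsub>ground_space K\<^esub> l\<in>{..<n}. f (c j l) \<otimes>\<^bsub>K\<^esub> \<phi> (b l))"
      by (rule k.M.finsum_cong') (use \<beta>c[OF f j] hom_smult[OF p dc[OF f cc[OF j]] bc] dc[OF f cc[OF j]] dc[OF p bc] in auto)
    finally show ?thesis .
  qed
  \<comment> \<open>Coassociativity at \<open>b i\<close>, with the dual vector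
    \<open>\<beta> j\<close> in the third place: one bracketing gives the comultiplication of
    \<open>c i j\<close>, the other the matrix product.\<close>
  have conv_c: "conv K C f g (c i j) = (\<Oplus>\<^bsub>ground_space K\<^esub> l\<in>{..<n}. f (c i l) \<otimes>\<^bsub>K\<^esub> g (c l j))"
    if f: "f \<in> dual K C" and g: "g \<in> dual K C" and ij: "i < n" "j < n" for f g i j
  proof -
    interpret k: vectorspace K "ground_space K" by (rule ground_vs)
    note \<beta>j = b(2)[OF ij(2)]
    have "conv K C f g (c i j) = conv K C (conv K C f g) (\<beta> j) (b i)"
      unfolding c_def using functional_coef[OF conv_dual[OF f g] \<beta>j bc[OF ij(1)], of True] by (simp add: cv_def)
    also have "\<dots> = conv K C f (conv K C g (\<beta> j)) (b i)" by (rule conv_assoc[OF f g \<beta>j bc[OF ij(1)]])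
    also have "\<dots> = (\<Oplus>\<^bsub>ground_space K\<^esub> l\<in>{..<n}. f (c i l) \<otimes>\<^bsub>K\<^esub> conv K C g (\<beta> j) (b l))" by (rule key[OF f conv_dual[OF g \<beta>j] ij(1)])
    also have "\<dots> = (\<Oplus>\<^bsub>ground_space K\<^esub> l\<in>{..<n}. f (c i l) \<otimes>\<^bsub>K\<^esub> g (c l j))"
    proof (rule k.M.finsum_cong')
      fix l assume "l \<in> {..<n}"
      then show "f (c i l) \<otimes>\<^bsub>K\<^esub> conv K C g (\<beta> j) (b l) = f (c i l) \<otimes>\<^bsub>K\<^esub> g (c l j)"
        using functional_coef[OF g \<beta>j bc[of l], of True] by (simp add: cv_def c_def)
    qed (use dc[OF f cc[OF ij(1)]] dc[OF g cc[OF _ ij(2)]] in auto)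
    finally show ?thesis .
  qed
  have pc: "pure_tensor K C C (c i k) (c k j) \<in> carrier (tensor K C C)" if "i < n" "j < n" "k < n" for i j k
    by (rule CC.tp_closed[OF cc[OF that(1,3)] cc[OF that(3,2)]])
  have comult_c: "comult C (c i j) = (\<Oplus>\<^bsub>tensor K C C\<^esub> k\<in>{..<n}. pure_tensor K C C (c i k) (c k j))" if ij: "i < n" "j < n" for i j
  proof (rule CC.tensor_eqI[OF comult_closed[OF cc[OF ij]] _ subset_refl subset_refl])
    show "(\<Oplus>\<^bsub>tensor K C C\<^esub> k\<in>{..<n}. pure_tensor K C C (c i k) (c k j)) \<in> carrier (tensor K C C)"
      by (rule CC.T.M.finsum_closed) (use pc[OF ij] in auto)
    fix f g assume f: "f \<in> dual K C" and g: "g \<in> dual K C"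
    interpret k: vectorspace K "ground_space K" by (rule ground_vs)
    have "ev K f g (\<Oplus>\<^bsub>tensor K C C\<^esub> k\<in>{..<n}. pure_tensor K C C (c i k) (c k j)) =
        (\<Oplus>\<^bsub>ground_space K\<^esub> k\<in>{..<n}. ev K f g (pure_tensor K C C (c i k) (c k j)))"
      by (rule hom_finsum[OF CC.ev_hom[OF f g] CC.tensor_vs ground_vs]) (use pc[OF ij] in simp)
    also have "\<dots> = (\<Oplus>\<^bsub>ground_space K\<^esub> l\<in>{..<n}. f (c i l) \<otimes>\<^bsub>K\<^esub> g (c l j))"
      by (rule k.M.finsum_cong') (use CC.ev_pure[OF f g cc[OF ij(1)] cc[OF _ ij(2)]] dc[OF f cc[OF ij(1)]] dc[OF g cc[OF _ ij(2)]] in auto)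
    also have "\<dots> = ev K f g (comult C (c i j))" using conv_c[OF f g ij] by (simp add: conv_def)
    finally show "ev K f g (comult C (c i j)) = ev K f g (\<Oplus>\<^bsub>tensor K C C\<^esub> k\<in>{..<n}. pure_tensor K C C (c i k) (c k j))" by (rule sym)
  qed (use functional_sep in auto)
  have counit_c: "counit C (c i j) = (if i = j then \<one>\<^bsub>K\<^esub> else \<zero>\<^bsub>K\<^esub>)" if ij: "i < n" "j < n" for i j
    using functional_coef[OF counit_hom b(2)[OF ij(2)] bc[OF ij(1)], of True] conv_counit(1)[OF b(2)[OF ij(2)] bc[OF ij(1)]] d[OF ij(2,1)]
    by (simp add: cv_def c_def)
  let ?s = "{c i j | i j. i < n \<and> j < n}"
  have sc: "?s \<subseteq> carrier C" using cc by auto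
  have Ss: "subspace K (span ?s) C" by (rule span_is_subspace[OF sc])
  have cs: "c i j \<in> span ?s" if "i < n" "j < n" for i j using span_incl[OF sc, of "c i j"] that by blast
  have ec: "counit C (b l) \<in> carrier K" if "l < n" for l by (rule dc[OF counit_hom bc[OF that]])
  have bs: "b j \<in> span ?s" if j: "j < n" for j
  proof -
    have "b j = (\<Oplus>\<^bsub>C\<^esub> l\<in>{..<n}. counit C (b l) \<odot>\<^bsub>C\<^esub> c j l)"
    proof (rule functional_eqI[OF bc[OF j]])
      show "(\<Oplus>\<^bsub>C\<^esub> l\<in>{..<n}. counit C (b l) \<odot>\<^bsub>C\<^esub> c j l) \<in> carrier C"
        by (rule M.finsum_closed) (use smult_closed[OF ec cc[OF j]] in auto)
      fix f assume f: "f \<in> dual K C"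
      interpret k: vectorspace K "ground_space K" by (rule ground_vs)
      have "f (\<Oplus>\<^bsub>C\<^esub> l\<in>{..<n}. counit C (b l) \<odot>\<^bsub>C\<^esub> c j l) = (\<Oplus>\<^bsub>ground_space K\<^esub> l\<in>{..<n}. f (counit C (b l) \<odot>\<^bsub>C\<^esub> c j l))"
        by (rule hom_finsum[OF f vs_self ground_vs]) (use smult_closed[OF ec cc[OF j]] in simp)
      also have "\<dots> = (\<Oplus>\<^bsub>ground_space K\<^esub> l\<in>{..<n}. f (c j l) \<otimes>\<^bsub>K\<^esub> counit C (b l))"
        by (rule k.M.finsum_cong') (use hom_smult[OF f ec cc[OF j]] dc[OF f cc[OF j]] ec m_comm in auto)
      also have "\<dots> = f (b j)" using key[OF f counit_hom j] conv_counit(2)[OF f bc[OF j]] by simp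
      finally show "f (b j) = f (\<Oplus>\<^bsub>C\<^esub> l\<in>{..<n}. counit C (b l) \<odot>\<^bsub>C\<^esub> c j l)" by (rule sym)
    qed
    also have "\<dots> \<in> span ?s" by (rule sub_finsum[OF Ss]) (use sub_smult[OF Ss ec cs[OF j]] in simp)
    finally show ?thesis .
  qed
  have "h = (\<Oplus>\<^bsub>C\<^esub> l\<in>{..<n}. \<beta> l h \<odot>\<^bsub>C\<^esub> b l)" by (rule e[OF hV])
  also have "\<dots> \<in> span ?s" by (rule sub_finsum[OF Ss]) (use sub_smult[OF Ss dc[OF b(2) h] bs] in simp)
  finally have "h \<in> span ?s" .
  then show ?thesis using cc counit_c comult_c by (intro exI[of _ n] exI[of _ c]) (simp add: comatrix_def)
qed

end

text \<open>\<open>tens_in_span\<close> controls right factors once the left factors lie in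
  \<open>A\<close>. So it is applied first to the swapped tensor, which brings the left factors into
  \<open>A\<close>, and then to \<open>t\<close> itself.\<close>

lemma (in tensor_pair) mem_span_by_contraction:
  assumes t: "t \<in> carrier T" and A: "subspace K A V" and B: "subspace K B W"
    and F: "\<Phi> \<subseteq> dual K V" "\<And>a. \<lbrakk>a \<in> carrier V; \<And>f. f \<in> \<Phi> \<Longrightarrow> f a = \<zero>\<^bsub>K\<^esub>\<rbrakk> \<Longrightarrow> a = \<zero>\<^bsub>V\<^esub>"
    and G: "\<Psi> \<subseteq> dual K W" "\<And>a. \<lbrakk>a \<in> carrier W; \<And>f. f \<in> \<Psi> \<Longrightarrow> f a = \<zero>\<^bsub>K\<^esub>\<rbrakk> \<Longrightarrow> a = \<zero>\<^bsub>W\<^esub>"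
    and l: "\<And>f. f \<in> \<Phi> \<Longrightarrow> contr_left K W f t \<in> B" and r: "\<And>g. g \<in> \<Psi> \<Longrightarrow> contr_right K V g t \<in> A"
  shows "t \<in> T.span {a \<star> b | a b. a \<in> A \<and> b \<in> B}"
proof -
  interpret W: tensor_pair K W V by (rule tensor_pairI[OF W.vs_self V.vs_self])
  let ?s = "tensor_swap K V W" and ?s' = "tensor_swap K W V"
  have P: "tensor_pair K V W" "tensor_pair K W V" by unfold_locales
  have st: "?s t \<in> carrier W.T" unfolding tensor_swap_def by (rule hom_closed[OF lift_hom[OF W.tensor_vs bilin_flip[OF W.tp_bilin]] t])
  have bl: "bilin K W V T (\<lambda>w v. v \<star> w)" by (rule bilin_flip[OF tp_bilin])
  have hs': "?s' \<in> module_hom K W.T T" unfolding tensor_swap_def by (rule W.lift_hom[OF tensor_vs bl])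
  have ps': "?s' (pure_tensor K W V w v) = v \<star> w" if "w \<in> carrier W" "v \<in> carrier V" for w v
    unfolding tensor_swap_def by (rule W.lift_pure[OF tensor_vs bl that])
  have "contr_left K V g (?s t) \<in> A" if g: "g \<in> \<Psi>" for g
  proof -
    have gd: "g \<in> dual K W" using g G(1) by auto
    have "contr_left K V g (?s t) = contr_right K V g t"
    proof (rule V.functional_eqI[OF hom_closed[OF W.contr_left_hom[OF gd] st] hom_closed[OF contr_right_hom[OF gd] t]])
      fix f assume f: "f \<in> dual K V"
      show "f (contr_left K V g (?s t)) = f (contr_right K V g t)"
        unfolding W.ev_contr_left[OF gd f st] ev_contr_right[OF f gd t] by (rule ev_swap(1)[OF P(1) f gd t])
    qed
    then show ?thesis using r[OF g] by simp
  qed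
  note cl = this
  obtain L where L: "set L \<subseteq> carrier W \<times> carrier V" "?s t = W.T.lsum (map (\<lambda>(a, b). pure_tensor K W V a b) L)"
    by (rule W.span_tens[OF W.subspace_carrier V.subspace_carrier W.span_pure[OF st]])
  have "?s t \<in> W.T.span {pure_tensor K W V w a | w a. w \<in> carrier W \<and> a \<in> A}"
    unfolding L(2) by (rule W.tens_in_span[OF W.subspace_carrier A G(1) G(2) L(1) cl[unfolded L(2)]])
  then have "?s' (?s t) \<in> T.span {a \<star> w | a w. a \<in> A \<and> w \<in> carrier W}"
  proof (rule hom_span_subset[OF hs' W.tensor_vs tensor_vs sub_span_pure[OF A W.subspace_carrier], rotated 2])
    show "{pure_tensor K W V w a | w a. w \<in> carrier W \<and> a \<in> A} \<subseteq> carrier W.T" using W.tp_closed V.sub_carrier[OF A] by auto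
    fix x assume "x \<in> {pure_tensor K W V w a | w a. w \<in> carrier W \<and> a \<in> A}"
    then obtain w a where x: "x = pure_tensor K W V w a" "w \<in> carrier W" "a \<in> A" by auto
    show "?s' x \<in> T.span {a \<star> w | a w. a \<in> A \<and> w \<in> carrier W}"
      unfolding x(1) ps'[OF x(2) V.sub_carrier[OF A x(3)]] by (rule pure_in_span[OF A W.subspace_carrier x(3,2)])
  qed
  moreover have "?s' (?s t) = t"
  proof (rule tensor_eqI[OF hom_closed[OF hs' st] t subset_refl subset_refl])
    fix f g assume f: "f \<in> dual K V" and g: "g \<in> dual K W"
    show "ev K f g (?s' (?s t)) = ev K f g t"
      using ev_swap(1)[OF P(2) g f st] ev_swap(1)[OF P(1) f g t] by simp
  qed (use V.functional_sep W.functional_sep in auto)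
  ultimately have "t \<in> T.span {a \<star> w | a w. a \<in> A \<and> w \<in> carrier W}" by simp
  then obtain L where L: "set L \<subseteq> A \<times> carrier W" "t = tens L" by (rule span_tens[OF A W.subspace_carrier])
  show ?thesis
    unfolding L(2)
  proof (rule tens_in_span[OF A B F(1) _ L(1)])
    show "a = \<zero>\<^bsub>V\<^esub>" if "a \<in> A" "\<And>f. f \<in> \<Phi> \<Longrightarrow> f a = \<zero>\<^bsub>K\<^esub>" for a by (rule F(2)[OF V.sub_carrier[OF A that(1)]]) (rule that(2))
    show "contr_left K W f (tens L) \<in> B" if "f \<in> \<Phi>" for f using l[OF that] L(2) by simp
  qed
qed

section \<open>The associated graded of a stable subspace\<close>

context filtered_coalgebra
begin

abbreviation (input) "Pinf \<equiv> (\<Inter>n. P n)"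

lemma Pinf_sub: "subspace K Pinf C"
  by (rule subspace_INT[OF P_sub])

text \<open>Dual to \<open>conv_kills\<close>: taking coefficients by a functional that kills
  \<open>P (Suc j)\<close> lowers the filtration degree by at most \<open>j\<close>.\<close>

lemma coef_P:
  assumes g: "g \<in> kills (Suc j)" and x: "x \<in> P (Suc (i + j))"
  shows "coef b g x \<in> P (Suc i)"
proof (rule functional_sub[OF P_sub coef_closed[OF killsD(1)[OF g] P_carrier[OF x]]])
  fix f assume "f \<in> dual K C" "\<And>y. y \<in> P (Suc i) \<Longrightarrow> f y = \<zero>\<^bsub>K\<^esub>"
  then have f: "f \<in> kills (Suc i)" by (simp add: kills_def)
  have "conv K C f g x = \<zero>\<^bsub>K\<^esub>" "conv K C g f x = \<zero>\<^bsub>K\<^esub>"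
    using killsD(2)[OF conv_kills[OF f g] order_refl x] killsD(2)[OF conv_kills[OF g f] order_refl, of x] x by (simp_all add: add.commute)
  then show "f (coef b g x) = \<zero>\<^bsub>K\<^esub>"
    using functional_coef[OF killsD(1)[OF f] killsD(1)[OF g] P_carrier[OF x]] by (simp add: cv_def)
qed

lemma kills_Suc: "g \<in> kills n \<Longrightarrow> g \<in> kills (Suc n)"
  using P_Suc by (auto simp: kills_def)

text \<open>For a fixed \<open>g\<close> that kills some \<open>P n\<close> the loss of degree is
  bounded, so elements of all \<open>P n\<close> keep that property.\<close>

lemma coef_Pinf:
  assumes g: "g \<in> (\<Union>n. kills n)" and x: "x \<in> Pinf"
  shows "coef b g x \<in> Pinf"
proof
  fix i
  obtain n where "g \<in> kills n" using g by auto
  then have "coef b g x \<in> P (Suc i)" using coef_P[OF kills_Suc] x by blast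
  then show "coef b g x \<in> P i" using P_Suc by blast
qed

sublocale stable: operator_family K C coef "\<Union>n. kills n" "Pinf"
proof (intro operator_family.intro operator_family_axioms.intro)
  show "coef b g \<in> module_hom K C C" if "g \<in> dual K C" for g b by (rule coef_hom[OF that])
  show "(\<Union>n. kills n) \<subseteq> dual K C" using killsD(1) by auto
  show "coef b g x \<in> Pinf" if "g \<in> (\<Union>n. kills n)" "x \<in> Pinf" for b g x by (rule coef_Pinf[OF that])
qed (rule vs_self Pinf_sub)+

text \<open>The sum over \<open>n\<close> of the images of \<open>D \<inter> P n\<close> in
  \<open>P n / P (Suc n)\<close>; a representative of \<open>p n\<close> lies in \<open>P n\<close>
  automatically.\<close>

definition gr_sub :: "'v set \<Rightarrow> (nat \<Rightarrow> 'v set) set" where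
  "gr_sub D = {p \<in> carrier G. \<forall>n. \<exists>x\<in>D. x \<in> p n}"

definition gr_sub_below :: "nat \<Rightarrow> 'v set \<Rightarrow> (nat \<Rightarrow> 'v set) set" where
  "gr_sub_below m D = {p \<in> gr_sub D. \<forall>k\<ge>m. p k = P (Suc k)}"

lemma gr_sub_subspace:
  assumes D: "subspace K D C"
  shows "subspace K (gr_sub D) G"
proof (rule G.subspaceI)
  show "gr_sub D \<subseteq> carrier G" by (auto simp: gr_sub_def)
  show "\<zero>\<^bsub>G\<^esub> \<in> gr_sub D"
    using sub_0[OF D] sub_0[OF P_sub] by (auto simp: gr_sub_def G_ops)
  show "p \<oplus>\<^bsub>G\<^esub> q \<in> gr_sub D" if a: "p \<in> gr_sub D" "q \<in> gr_sub D" for p q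
    unfolding gr_sub_def
  proof (intro CollectI conjI allI)
    show "p \<oplus>\<^bsub>G\<^esub> q \<in> carrier G" using a by (simp add: gr_sub_def)
    fix n
    obtain x y where x: "x \<in> D" "x \<in> p n" and y: "y \<in> D" "y \<in> q n" using a unfolding gr_sub_def by blast
    show "\<exists>x\<in>D. x \<in> (p \<oplus>\<^bsub>G\<^esub> q) n"
      using add_mem[of p q x n y] sub_add[OF D x(1) y(1)] a x y by (intro bexI[of _ "x \<oplus>\<^bsub>C\<^esub> y"]) (simp_all add: gr_sub_def)
  qed
  show "c \<odot>\<^bsub>G\<^esub> p \<in> gr_sub D" if c: "c \<in> carrier K" and a: "p \<in> gr_sub D" for c p
    unfolding gr_sub_def
  proof (intro CollectI conjI allI)
    show "c \<odot>\<^bsub>G\<^esub> p \<in> carrier G" using a c by (simp add: gr_sub_def)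
    fix n
    obtain x where x: "x \<in> D" "x \<in> p n" using a unfolding gr_sub_def by blast
    show "\<exists>x\<in>D. x \<in> (c \<odot>\<^bsub>G\<^esub> p) n"
      using smult_mem[of p c x n] sub_smult[OF D c x(1)] a x c by (intro bexI[of _ "c \<odot>\<^bsub>C\<^esub> x"]) (simp_all add: gr_sub_def)
  qed
qed

lemma gr_sub_below_subspace:
  assumes D: "subspace K D C"
  shows "subspace K (gr_sub_below m D) G"
proof (rule G.subspaceI)
  note S = gr_sub_subspace[OF D]
  show "gr_sub_below m D \<subseteq> carrier G" using G.sub_carrier[OF S] by (auto simp: gr_sub_below_def)
  show "\<zero>\<^bsub>G\<^esub> \<in> gr_sub_below m D" using G.sub_0[OF S] by (simp add: gr_sub_below_def G_ops)
  show "p \<oplus>\<^bsub>G\<^esub> q \<in> gr_sub_below m D" if a: "p \<in> gr_sub_below m D" "q \<in> gr_sub_below m D" for p q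
    using a G.sub_add[OF S] zero_add_P(1) by (simp add: gr_sub_below_def G_ops)
  show "c \<odot>\<^bsub>G\<^esub> p \<in> gr_sub_below m D" if c: "c \<in> carrier K" and a: "p \<in> gr_sub_below m D" for c p
    using a c G.sub_smult[OF S] zero_add_P(2) by (simp add: gr_sub_below_def G_ops)
qed

lemma cls_gr_sub:
  assumes D: "subspace K D C" and x: "x \<in> D" "x \<in> P n"
  shows "cls n x \<in> gr_sub_below (Suc n) D"
proof -
  have "\<exists>y\<in>D. y \<in> cls n x k" for k
    using cls_mem(1)[OF x(2)] cls_mem(3)[of k n x] x(1) sub_0[OF D] by (cases "k = n") auto
  then show ?thesis using cls_closed[OF x(2)] by (simp add: gr_sub_below_def gr_sub_def cls_at)
qed

lemma gr_sub_below_Suc: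
  assumes D: "subspace K D C"
  shows "gr_sub_below (Suc n) D = gr_sub_below n D <+>\<^bsub>G\<^esub> cls n ` (D \<inter> P n)"
proof
  note S = gr_sub_below_subspace[OF D]
  show "gr_sub_below n D <+>\<^bsub>G\<^esub> cls n ` (D \<inter> P n) \<subseteq> gr_sub_below (Suc n) D"
  proof (rule G.set_add_least[OF S])
    show "gr_sub_below n D \<subseteq> gr_sub_below (Suc n) D" by (auto simp: gr_sub_below_def)
    show "cls n ` (D \<inter> P n) \<subseteq> gr_sub_below (Suc n) D" using cls_gr_sub[OF D] by auto
  qed
  show "gr_sub_below (Suc n) D \<subseteq> gr_sub_below n D <+>\<^bsub>G\<^esub> cls n ` (D \<inter> P n)"
  proof
    fix p assume p: "p \<in> gr_sub_below (Suc n) D"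
    then have pG: "p \<in> carrier G" by (simp add: gr_sub_below_def gr_sub_def)
    obtain x where x: "x \<in> D" "x \<in> p n" using p unfolding gr_sub_below_def gr_sub_def by blast
    note xP = G_memD[OF pG x(2)]
    define q where "q = p \<ominus>\<^bsub>G\<^esub> cls n x"
    have Sc: "cls n x \<in> gr_sub_below (Suc n) D" by (rule cls_gr_sub[OF D x(1) xP(1)])
    have q: "q \<in> gr_sub_below (Suc n) D" unfolding q_def by (rule G.sub_minus[OF S p Sc])
    then have qG: "q \<in> carrier G" by (simp add: gr_sub_below_def gr_sub_def)
    have e: "q \<oplus>\<^bsub>G\<^esub> cls n x = p" unfolding q_def by (rule G.minus_add_cancel[OF pG cls_closed[OF xP(1)]])
    obtain y where y: "y \<in> D" "y \<in> q n" using q unfolding gr_sub_below_def gr_sub_def by blast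
    note yP = G_memD[OF qG y(2)]
    have "y \<oplus>\<^bsub>C\<^esub> x \<in> p n" using add_mem[OF qG cls_closed[OF xP(1)] y(2) cls_mem(1)[OF xP(1)]] e by simp
    from mem_diff[OF pG this x(2)] have "(y \<oplus>\<^bsub>C\<^esub> x) \<ominus>\<^bsub>C\<^esub> x \<in> P (Suc n)" .
    then have "y \<in> P (Suc n)" using yP(2) xP(2) by (simp add: a_minus_def M.a_assoc M.r_neg)
    then have "q n = P (Suc n)" using yP(3) P_coset_zero[OF yP(2)] by simp
    then have "q k = P (Suc k)" if "n \<le> k" for k using q that by (cases "k = n") (simp_all add: gr_sub_below_def)
    then have "q \<in> gr_sub_below n D" using q by (simp add: gr_sub_below_def)
    then show "p \<in> gr_sub_below n D <+>\<^bsub>G\<^esub> cls n ` (D \<inter> P n)"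
      using e x(1) xP(1) by (auto simp: G.set_add_iff)
  qed
qed

text \<open>The graded pieces measure the steps of the descending chain of the
  \<open>D \<inter> P n\<close>. As \<open>D\<close> is finite over the intersection of all
  \<open>P n\<close>, the chain becomes constant, and its constant value is that
  intersection.\<close>

lemma fin_gr_sub:
  assumes D: "fin Pinf D"
  shows "G.fin {\<zero>\<^bsub>G\<^esub>} (gr_sub D)" "G.rdim {\<zero>\<^bsub>G\<^esub>} (gr_sub D) = rdim Pinf D"
proof -
  note Ds = fin_sub(2)[OF D] and PD = fin_sub(3)[OF D]
  have DP: "subspace K (D \<inter> P n) C" "Pinf \<subseteq> D \<inter> P n" for n
    using subspace_Int[OF Ds P_sub] PD by auto
  have fDP: "fin Pinf (D \<inter> P n)" for n by (rule rdim_split(1)[OF D DP]) simp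
  have step: "fin (D \<inter> P (Suc n)) (D \<inter> P n)" "rdim Pinf (D \<inter> P n) = rdim Pinf (D \<inter> P (Suc n)) + rdim (D \<inter> P (Suc n)) (D \<inter> P n)" for n
  proof -
    have "D \<inter> P (Suc n) \<subseteq> D \<inter> P n" using P_Suc[of n] by auto
    from rdim_split(2,3)[OF fDP DP this] show "fin (D \<inter> P (Suc n)) (D \<inter> P n)"
      "rdim Pinf (D \<inter> P n) = rdim Pinf (D \<inter> P (Suc n)) + rdim (D \<inter> P (Suc n)) (D \<inter> P n)" by simp_all
  qed
  \<comment> \<open>Both steps are the quotient of \<open>D \<inter> P n\<close> by
    \<open>D \<inter> P (Suc n)\<close>: \<open>fin_image\<close> is used for the class map, and for
    the inclusion to change the ambient space.\<close>
  have gstep: "G.fin (gr_sub_below n D) (gr_sub_below (Suc n) D)"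
    "G.rdim (gr_sub_below n D) (gr_sub_below (Suc n) D) = rdim (D \<inter> P (Suc n)) (D \<inter> P n)" for n
  proof -
    interpret Pn: vectorspace K "C\<lparr>carrier := P n\<rparr>" by (rule Pn_vs)
    have Xs: "subspace K (D \<inter> P n) (C\<lparr>carrier := P n\<rparr>)"
      by (rule Pn.subspaceI) (use sub_0[OF DP(1)] sub_add[OF DP(1)] sub_smult[OF DP(1)] in auto)
    have inc: "(\<lambda>x. x) \<in> module_hom K (C\<lparr>carrier := P n\<rparr>) C" by (rule incl_hom)
    have e1: "D \<inter> P (Suc n) = {x \<in> D \<inter> P n. x \<in> D \<inter> P (Suc n)}" using P_Suc[of n] by auto
    have "D \<inter> P (Suc n) <+>\<^bsub>C\<^esub> (\<lambda>x. x) ` (D \<inter> P n) = D \<inter> P n"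
      using set_add_absorb[OF DP(1)[of n] DP(1)[of "Suc n"]] P_Suc[of n] by (simp add: le_infI2)
    then have i1: "Pn.fin (D \<inter> P (Suc n)) (D \<inter> P n)" "Pn.rdim (D \<inter> P (Suc n)) (D \<inter> P n) = rdim (D \<inter> P (Suc n)) (D \<inter> P n)"
      using fin_image[OF inc Pn.vs_self vs_self Xs DP(1) e1] step(1)[of n] by simp_all
    have e2: "D \<inter> P (Suc n) = {x \<in> D \<inter> P n. cls n x \<in> gr_sub_below n D}"
    proof
      show "D \<inter> P (Suc n) \<subseteq> {x \<in> D \<inter> P n. cls n x \<in> gr_sub_below n D}"
      proof
        fix x assume x: "x \<in> D \<inter> P (Suc n)"
        then have xP: "x \<in> P n" using P_Suc[of n] by auto
        then have "cls n x = \<zero>\<^bsub>G\<^esub>" using cls_zero_iff[OF xP] x by simp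
        then show "x \<in> {x \<in> D \<inter> P n. cls n x \<in> gr_sub_below n D}"
          using x xP G.sub_0[OF gr_sub_below_subspace[OF Ds], of n] by simp
      qed
      show "{x \<in> D \<inter> P n. cls n x \<in> gr_sub_below n D} \<subseteq> D \<inter> P (Suc n)"
      proof
        fix x assume x: "x \<in> {x \<in> D \<inter> P n. cls n x \<in> gr_sub_below n D}"
        then have "cls n x n = P (Suc n)" by (simp add: gr_sub_below_def)
        then show "x \<in> D \<inter> P (Suc n)" using x cls_mem(1)[of x n] by auto
      qed
    qed
    show "G.fin (gr_sub_below n D) (gr_sub_below (Suc n) D)"
      "G.rdim (gr_sub_below n D) (gr_sub_below (Suc n) D) = rdim (D \<inter> P (Suc n)) (D \<inter> P n)"
      using fin_image[OF cls_hom Pn.vs_self G.vs_self Xs gr_sub_below_subspace[OF Ds] e2] i1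
      unfolding gr_sub_below_Suc[OF Ds] by simp_all
  qed
  have b0: "gr_sub_below 0 D = {\<zero>\<^bsub>G\<^esub>}"
    using G.sub_0[OF gr_sub_below_subspace[OF Ds, of 0]] by (auto simp: gr_sub_below_def fun_eq_iff G_ops)
  have ind: "G.fin {\<zero>\<^bsub>G\<^esub>} (gr_sub_below n D) \<and> G.rdim {\<zero>\<^bsub>G\<^esub>} (gr_sub_below n D) + rdim Pinf (D \<inter> P n) = rdim Pinf D" for n
  proof (induct n)
    case 0
    have "D \<inter> P 0 = D" using sub_carrier[OF Ds] by (auto simp: P_0)
    then show ?case using G.fin_self[OF G.subspace_zero] by (simp add: b0)
  next
    case (Suc n)
    then show ?case using G.fin_trans[OF _ gstep(1), of "{\<zero>\<^bsub>G\<^esub>}" n] gstep(2)[of n] step(2)[of n] by simp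
  qed
  \<comment> \<open>At a minimum of the dimension no later step can be strict, so
    \<open>D \<inter> P N\<close> already lies in every \<open>P n\<close>.\<close>
  obtain N where N: "\<And>n. rdim Pinf (D \<inter> P N) \<le> rdim Pinf (D \<inter> P n)"
    using ex_has_least_nat[of "\<lambda>_. True" 0 "\<lambda>n. rdim Pinf (D \<inter> P n)"] by auto
  have mono: "D \<inter> P N \<subseteq> P n" for n
  proof (cases "N \<le> n")
    case True
    have sub: "D \<inter> P n \<subseteq> D \<inter> P N" using P_antimono[OF True] by auto
    note sp = rdim_split(2,3)[OF fDP DP sub]
    have "rdim (D \<inter> P n) (D \<inter> P N) = 0" using sp(2) N[of n] by simp
    from rdim_0[OF sp(1) this] show ?thesis by auto
  qed (use P_antimono[of n N] in auto)
  have DN: "D \<inter> P N = Pinf" using mono DP(2)[of N] by auto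
  have "gr_sub D = gr_sub_below N D"
  proof
    show "gr_sub D \<subseteq> gr_sub_below N D"
    proof
      fix p assume p: "p \<in> gr_sub D"
      have pG: "p \<in> carrier G" using p by (simp add: gr_sub_def)
      have "p k = P (Suc k)" if k: "N \<le> k" for k
      proof -
        obtain x where x: "x \<in> D" "x \<in> p k" using p unfolding gr_sub_def by blast
        note xP = G_memD[OF pG x(2)]
        have "x \<in> P (Suc k)" using mono x(1) P_mem_antimono[OF xP(1) k] by blast
        then show ?thesis using xP(3) P_coset_zero[OF xP(2)] by simp
      qed
      then show "p \<in> gr_sub_below N D" using p by (simp add: gr_sub_below_def)
    qed
  qed (auto simp: gr_sub_below_def)
  then show "G.fin {\<zero>\<^bsub>G\<^esub>} (gr_sub D)" "G.rdim {\<zero>\<^bsub>G\<^esub>} (gr_sub D) = rdim Pinf D"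
    using ind[of N] DN fin_self(2)[OF Pinf_sub] by simp_all
qed

text \<open>By \<open>mem_span_by_contraction\<close> it is enough to contract with homogeneous
  functionals. In degree \<open>n\<close> the contraction by \<open>hf j g\<close> is represented by
  \<open>coef b g x\<close>, where \<open>x\<close> in \<open>D\<close> represents degree
  \<open>n + j\<close> of \<open>p\<close>; this coefficient stays in \<open>D\<close> because
  \<open>g\<close> belongs to some \<open>kills\<close>.\<close>

lemma gr_sub_comult:
  assumes D: "D \<in> stable.lat" and p: "p \<in> gr_sub D"
  shows "gr_comult K C P p \<in> GG.T.span {pure_tensor K G G a b | a b. a \<in> gr_sub D \<and> b \<in> gr_sub D}"
proof -
  note Ds = stable.lat_sub(1)[OF D] and S = gr_sub_subspace[OF stable.lat_sub(1)[OF D]]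
  have pG: "p \<in> carrier G" using p by (simp add: gr_sub_def)
  note t = gr_comult_closed[OF pG]
  have mem: "\<zeta> \<in> gr_sub D" if \<zeta>: "\<zeta> \<in> carrier G" and g: "g \<in> kills (Suc j)"
    and eq: "\<And>i f. f \<in> kills (Suc i) \<Longrightarrow> hf i f \<zeta> = hf (i + j) (cv b f g) p" for \<zeta> g j b
    unfolding gr_sub_def
  proof (intro CollectI conjI \<zeta> allI)
    fix n
    obtain x where x: "x \<in> D" "x \<in> p (n + j)" using p unfolding gr_sub_def by blast
    note xP = G_memD[OF pG x(2)] and gd = killsD(1)[OF g]
    note rc = coef_closed[OF gd xP(2), of b] and rP = rep_P[OF \<zeta>, of n]
    have "coef b g x \<ominus>\<^bsub>C\<^esub> rep \<zeta> n \<in> P (Suc n)"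
    proof (rule functional_sub[OF P_sub M.minus_closed[OF rc P_carrier[OF rP]]])
      fix f assume "f \<in> dual K C" "\<And>y. y \<in> P (Suc n) \<Longrightarrow> f y = \<zero>\<^bsub>K\<^esub>"
      then have f: "f \<in> kills (Suc n)" by (simp add: kills_def)
      interpret k: vectorspace K "ground_space K" by (rule ground_vs)
      have cvk: "cv b f g \<in> kills (Suc (n + j))"
        using conv_kills[OF f g] conv_kills[OF g f] by (cases b) (simp_all add: cv_def[abs_def] add.commute)
      have "f (rep \<zeta> n) = hf n f \<zeta>" by (rule hf_mem[OF f \<zeta> rep_in[OF \<zeta>], symmetric])
      also have "\<dots> = cv b f g x" unfolding eq[OF f] by (rule hf_mem[OF cvk pG x(2)])
      also have "\<dots> = f (coef b g x)" by (rule functional_coef[OF killsD(1)[OF f] gd xP(2), symmetric])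
      finally show "f (coef b g x \<ominus>\<^bsub>C\<^esub> rep \<zeta> n) = \<zero>\<^bsub>K\<^esub>"
        using hom_minus[OF killsD(1)[OF f] vs_self ground_vs rc P_carrier[OF rP]] k.minus_self[of "f (coef b g x)"]
          hom_closed[OF killsD(1)[OF f] rc] by simp
    qed
    then have "coef b g x \<in> \<zeta> n" using rep_coset[OF \<zeta>, of n] P_mem_coset[OF P_carrier[OF rP]] rc by simp
    moreover have "coef b g x \<in> D" by (rule stable.lat_X[OF D _ x(1)]) (use g in blast)
    ultimately show "\<exists>x\<in>D. x \<in> \<zeta> n" by blast
  qed
  show ?thesis
  proof (rule GG.mem_span_by_contraction[OF t S S hfs_dual hfs_sep hfs_dual hfs_sep])
    fix e assume "e \<in> hfs"
    then obtain j g where e: "e = hf j g" and g: "g \<in> kills (Suc j)" by (auto simp: hfs_def)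
    note gd = hf_dual[OF g]
    show "contr_left K G e (gr_comult K C P p) \<in> gr_sub D"
      unfolding e
    proof (rule mem[OF hom_closed[OF GG.contr_left_hom[OF gd] t] g, of False])
      fix i f assume f: "f \<in> kills (Suc i)"
      show "hf i f (contr_left K G (hf j g) (gr_comult K C P p)) = hf (i + j) (cv False f g) p"
        using GG.ev_contr_left[OF gd hf_dual[OF f] t] ev_gr_comult[OF g f pG] by (simp add: cv_def[abs_def] add.commute)
    qed
    show "contr_right K G e (gr_comult K C P p) \<in> gr_sub D"
      unfolding e
    proof (rule mem[OF hom_closed[OF GG.contr_right_hom[OF gd] t] g, of True])
      fix i f assume f: "f \<in> kills (Suc i)"
      show "hf i f (contr_right K G (hf j g) (gr_comult K C P p)) = hf (i + j) (cv True f g) p"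
        using GG.ev_contr_right[OF hf_dual[OF f] gd t] ev_gr_comult[OF f g pG] by (simp add: cv_def[abs_def])
    qed
  qed
qed

end

section \<open>Amenability of the associated graded module coalgebra\<close>

lemma (in tensor_pair) lift_swap:
  assumes U: "vectorspace K U" and b: "bilin K W V U b" and t: "t \<in> carrier T"
  shows "tensor_lift K U b (tensor_swap K V W t) = tensor_lift K U (\<lambda>v w. b w v) t"
proof -
  interpret W: tensor_pair K W V by (rule tensor_pairI[OF W.vs_self V.vs_self])
  note h = W.lift_hom[OF U b] and f = bilin_flip[OF W.tp_bilin]
  have "tensor_lift K U b (tensor_swap K V W t) = tensor_lift K U (\<lambda>v w. tensor_lift K U b (pure_tensor K W V w v)) t"
    unfolding tensor_swap_def by (rule hom_lift[OF W.tensor_vs f U h t])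
  also have "\<dots> = tensor_lift K U (\<lambda>v w. b w v) t"
    by (rule lift_cong[OF U bilin_comp[OF f h] t]) (rule W.lift_pure[OF U b])
  finally show ?thesis .
qed

section \<open>Comatrices of a cocommutative Hopf algebra acting on \<open>M\<close>\<close>

context module_coalgebra
begin

context
  fixes n :: nat and c :: "nat \<Rightarrow> nat \<Rightarrow> 'h"
  assumes coc: "cocommutative K H"
    and c: "H.comatrix n c"
begin

lemma cc: "\<lbrakk>i < n; j < n\<rbrakk> \<Longrightarrow> c i j \<in> carrier H"
  and counit_c: "\<lbrakk>i < n; j < n\<rbrakk> \<Longrightarrow> counit H (c i j) = (if i = j then \<one>\<^bsub>K\<^esub> else \<zero>\<^bsub>K\<^esub>)"
  and comult_c: "\<lbrakk>i < n; j < n\<rbrakk> \<Longrightarrow> comult H (c i j) = (\<Oplus>\<^bsub>tensor K H H\<^esub> k\<in>{..<n}. pure_tensor K H H (c i k) (c k j))"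
  using c by (simp_all add: H.comatrix_def)

lemma lift_comatrix:
  assumes U: "vectorspace K U" and b: "bilin K H H U \<beta>" and ij: "i < n" "j < n"
  shows "tensor_lift K U \<beta> (comult H (c i j)) = (\<Oplus>\<^bsub>U\<^esub> k\<in>{..<n}. \<beta> (c i k) (c k j))"
proof -
  interpret U: vectorspace K U by (rule U)
  have "tensor_lift K U \<beta> (comult H (c i j)) = (\<Oplus>\<^bsub>U\<^esub> k\<in>{..<n}. tensor_lift K U \<beta> (pure_tensor K H H (c i k) (c k j)))"
    unfolding comult_c[OF ij]
    by (rule hom_finsum[OF H.CC.lift_hom[OF U b] H.CC.tensor_vs U]) (use H.CC.tp_closed[OF cc[OF ij(1)] cc[OF _ ij(2)]] in simp)
  also have "\<dots> = (\<Oplus>\<^bsub>U\<^esub> k\<in>{..<n}. \<beta> (c i k) (c k j))"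
    by (rule U.M.finsum_cong')
      (use H.CC.lift_pure[OF U b cc[OF ij(1)] cc[OF _ ij(2)]] bilin_closed[OF b cc[OF ij(1)] cc[OF _ ij(2)]] in auto)
  finally show ?thesis .
qed

text \<open>The comultiplication of \<open>c i j\<close> acting on \<open>m\<close>, written along
  the comatrix. Cocommutativity allows either order of the two tensor factors of
  \<open>\<Delta> (c i j)\<close>, so left and right coefficients obey the same formulas.\<close>

lemma comatrix_cv:
  assumes f: "f \<in> dual K M" and g: "g \<in> dual K M" and m: "m \<in> carrier M" and ij: "i < n" "j < n"
  shows "M.cv b f g (act M (c i j) m) =
      (\<Oplus>\<^bsub>ground_space K\<^esub> k\<in>{..<n}. M.cv b (\<lambda>y. f (act M (c i k) y)) (\<lambda>y. g (act M (c k j) y)) m)"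
    and "M.cv b f g (act M (c i j) m) =
      (\<Oplus>\<^bsub>ground_space K\<^esub> k\<in>{..<n}. M.cv b (\<lambda>y. f (act M (c k j) y)) (\<lambda>y. g (act M (c i k) y)) m)"
proof -
  let ?\<beta> = "\<lambda>f g a b. conv K M (\<lambda>y. f (act M a y)) (\<lambda>y. g (act M b y)) m"
  have bl: "bilin K H H (ground_space K) (?\<beta> f g)" if f: "f \<in> dual K M" and g: "g \<in> dual K M" for f g
    unfolding conv_def ev_def
    by (rule quad_inner_bilin[OF H.vs_self H.vs_self M.vs_self M.vs_self H.ground_vs action.conv2_q(1)[OF f g] action.conv2_q(2)[OF f g] M.comult_closed[OF m]])
  have 1: "conv K M f g (act M (c i j) m) = form_lift K (?\<beta> f g) (comult H (c i j))"
    if f: "f \<in> dual K M" and g: "g \<in> dual K M" for f g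
    using action.coalgebra_homD(1)[OF act_coalgebra_hom cc[OF ij] m f g] action.conv2_comult[OF f g H.comult_closed[OF cc[OF ij]] m] by simp
  have A: "conv K M f g (act M (c i j) m) = (\<Oplus>\<^bsub>ground_space K\<^esub> k\<in>{..<n}. ?\<beta> f g (c i k) (c k j))"
    if f: "f \<in> dual K M" and g: "g \<in> dual K M" for f g
    unfolding 1[OF f g] by (rule lift_comatrix[OF H.ground_vs bl[OF f g] ij])
  have B: "conv K M f g (act M (c i j) m) = (\<Oplus>\<^bsub>ground_space K\<^esub> k\<in>{..<n}. ?\<beta> f g (c k j) (c i k))"
    if f: "f \<in> dual K M" and g: "g \<in> dual K M" for f g
  proof -
    have sw: "tensor_swap K H H (comult H (c i j)) = comult H (c i j)" using coc cc[OF ij] by (simp add: cocommutative_def)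
    have "form_lift K (?\<beta> f g) (comult H (c i j)) = form_lift K (\<lambda>a b. ?\<beta> f g b a) (comult H (c i j))"
      using H.CC.lift_swap[OF H.ground_vs bl[OF f g] H.comult_closed[OF cc[OF ij]]] sw by simp
    also have "\<dots> = (\<Oplus>\<^bsub>ground_space K\<^esub> k\<in>{..<n}. ?\<beta> f g (c k j) (c i k))"
      by (rule lift_comatrix[OF H.ground_vs bilin_flip[OF bl[OF f g]] ij])
    finally show ?thesis using 1[OF f g] by simp
  qed
  show "M.cv b f g (act M (c i j) m) = (\<Oplus>\<^bsub>ground_space K\<^esub> k\<in>{..<n}. M.cv b (\<lambda>y. f (act M (c i k) y)) (\<lambda>y. g (act M (c k j) y)) m)"
    using A[OF f g] B[OF g f] by (cases b) (simp_all add: M.cv_def)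
  show "M.cv b f g (act M (c i j) m) = (\<Oplus>\<^bsub>ground_space K\<^esub> k\<in>{..<n}. M.cv b (\<lambda>y. f (act M (c k j) y)) (\<lambda>y. g (act M (c i k) y)) m)"
    using B[OF f g] A[OF g f] by (cases b) (simp_all add: M.cv_def)
qed

text \<open>The antipode turns a comatrix into its inverse matrix.\<close>

lemma comatrix_antipode:
  assumes il: "i < n" "l < n" and y: "y \<in> carrier M"
  shows "(\<Oplus>\<^bsub>M\<^esub> k\<in>{..<n}. act M (antipode H (c i k)) (act M (c k l) y)) = (if i = l then y else \<zero>\<^bsub>M\<^esub>)"
proof -
  have S: "antipode H x \<in> carrier H" if "x \<in> carrier H" for x by (rule hom_closed[OF H.antipode_linear that])
  have b: "bilin K H H H (\<lambda>a b. antipode H a \<otimes>\<^bsub>H\<^esub> b)" by (rule bilin_subst[OF H.mult_bilin H.antipode_linear hom_id])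
  have "(\<Oplus>\<^bsub>M\<^esub> k\<in>{..<n}. act M (antipode H (c i k)) (act M (c k l) y)) = (\<Oplus>\<^bsub>M\<^esub> k\<in>{..<n}. act M (antipode H (c i k) \<otimes>\<^bsub>H\<^esub> c k l) y)"
    by (rule M.M.finsum_cong') (use act_mult[OF S[OF cc[OF il(1)]] cc[OF _ il(2)] y] act_closed S cc il y in auto)
  also have "\<dots> = act M (\<Oplus>\<^bsub>H\<^esub> k\<in>{..<n}. antipode H (c i k) \<otimes>\<^bsub>H\<^esub> c k l) y"
    by (rule hom_finsum[OF bilin_hom1[OF act_bilin y] H.vs_self M.vs_self, symmetric]) (use S cc il in simp)
  also have "(\<Oplus>\<^bsub>H\<^esub> k\<in>{..<n}. antipode H (c i k) \<otimes>\<^bsub>H\<^esub> c k l) = counit H (c i l) \<odot>\<^bsub>H\<^esub> \<one>\<^bsub>H\<^esub>"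
    using lift_comatrix[OF H.vs_self b il] H.antipode_left[OF cc[OF il]] by simp
  also have "act M (counit H (c i l) \<odot>\<^bsub>H\<^esub> \<one>\<^bsub>H\<^esub>) y = (if i = l then y else \<zero>\<^bsub>M\<^esub>)"
    unfolding counit_c[OF il] using act_one[OF y] hom_0[OF bilin_hom1[OF act_bilin y] H.vs_self M.vs_self]
      act_smult_left[OF _ H.one_closed y] M.smult_one[OF y] M.lmult_0[OF y] by simp
  finally show ?thesis .
qed

text \<open>Tested on functionals, the first identity is \<open>comatrix_cv\<close>. In the second,
  the right-hand side is expanded along the comatrix and then collapses by
  \<open>comatrix_antipode\<close>. Translating a functional that kills \<open>M\<^sub>n\<close>
  gives another one, since \<open>H\<close> preserves \<open>M\<^sub>n\<close>.\<close>

lemma comatrix_is_action: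
  assumes uE: "\<And>i j x. \<lbrakk>i < n; j < n; x \<in> E\<rbrakk> \<Longrightarrow> act M (c i j) x \<in> E'"
  shows "gr.MF.stable.comatrix_action E E' n (\<lambda>i j. act M (c i j)) (\<lambda>i j. act M (antipode H (c i j)))"
  unfolding gr.MF.stable.comatrix_action_def
proof (intro allI impI conjI ballI)
  have S: "antipode H x \<in> carrier H" if "x \<in> carrier H" for x by (rule hom_closed[OF H.antipode_linear that])
  note ah = bilin_hom2[OF act_bilin]
  have H0: "h \<in> carrier H \<Longrightarrow> h \<in> Hp 0" for h by simp
  have aP: "act M h x \<in> Mp k" if "h \<in> carrier H" "x \<in> Mp k" for h x k
    using act_Hp_Mp[OF H0[OF that(1)] that(2)] by simp
  have kills: "(\<lambda>x. g (act M h x)) \<in> (\<Union>n. gr.MF.kills n)" if h: "h \<in> carrier H" and g: "g \<in> (\<Union>n. gr.MF.kills n)" for h g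
  proof -
    obtain k where k: "g \<in> gr.MF.kills k" using g by auto
    have "(\<lambda>x. g (act M h x)) \<in> gr.MF.kills k"
      using k hom_comp[OF ah[OF h] gr.MF.killsD(1)[OF k]] aP[OF h] by (simp add: gr.MF.kills_def)
    then show ?thesis by auto
  qed
  fix i j assume i: "i < n" and j: "j < n"
  show "act M (c i j) \<in> module_hom K M M" by (rule ah[OF cc[OF i j]])
  show "act M (antipode H (c i j)) \<in> module_hom K M M" by (rule ah[OF S[OF cc[OF i j]]])
  show "act M (c i j) x \<in> E'" if "x \<in> E" for x by (rule uE[OF i j that])
  show "act M (c i j) x \<in> (\<Inter>n. Mp n)" if "x \<in> (\<Inter>n. Mp n)" for x using aP[OF cc[OF i j]] that by blast
  show "(\<lambda>x. g (act M (c i j) x)) \<in> (\<Union>n. gr.MF.kills n)" "(\<lambda>x. g (act M (antipode H (c i j)) x)) \<in> (\<Union>n. gr.MF.kills n)"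
    if "g \<in> (\<Union>n. gr.MF.kills n)" for g by (rule kills[OF _ that], rule cc[OF i j] S[OF cc[OF i j]])+
  fix b g x assume g: "g \<in> dual K M" and x: "x \<in> carrier M"
  interpret k: vectorspace K "ground_space K" by (rule H.ground_vs)
  have du: "(\<lambda>y. f (act M h y)) \<in> dual K M" if "f \<in> dual K M" "h \<in> carrier H" for f h by (rule hom_comp[OF ah[OF that(2)] that(1)])
  note ac = act_closed[OF cc]
  show "M.coef b g (act M (c i j) x) = (\<Oplus>\<^bsub>M\<^esub> k\<in>{..<n}. act M (c i k) (M.coef b (\<lambda>y. g (act M (c k j) y)) x))"
  proof (rule M.functional_eqI)
    have xc: "act M (c i k) (M.coef b (\<lambda>y. g (act M (c k j) y)) x) \<in> carrier M" if "k < n" for k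
      by (rule ac[OF i that M.coef_closed[OF du[OF g cc[OF that j]] x]])
    show "M.coef b g (act M (c i j) x) \<in> carrier M" by (rule M.coef_closed[OF g ac[OF i j x]])
    show "(\<Oplus>\<^bsub>M\<^esub> k\<in>{..<n}. act M (c i k) (M.coef b (\<lambda>y. g (act M (c k j) y)) x)) \<in> carrier M"
      by (rule M.M.finsum_closed) (use xc in auto)
    fix f assume f: "f \<in> dual K M"
    have "f (\<Oplus>\<^bsub>M\<^esub> k\<in>{..<n}. act M (c i k) (M.coef b (\<lambda>y. g (act M (c k j) y)) x)) =
        (\<Oplus>\<^bsub>ground_space K\<^esub> k\<in>{..<n}. f (act M (c i k) (M.coef b (\<lambda>y. g (act M (c k j) y)) x)))"
      by (rule hom_finsum[OF f M.vs_self H.ground_vs]) (use xc in simp)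
    also have "\<dots> = (\<Oplus>\<^bsub>ground_space K\<^esub> k\<in>{..<n}. M.cv b (\<lambda>y. f (act M (c i k) y)) (\<lambda>y. g (act M (c k j) y)) x)"
    proof (rule k.M.finsum_cong')
      have eq: "M.cv b (\<lambda>y. f (act M (c i k) y)) (\<lambda>y. g (act M (c k j) y)) x = f (act M (c i k) (M.coef b (\<lambda>y. g (act M (c k j) y)) x))" if k: "k < n" for k
        by (rule M.functional_coef[OF du[OF f cc[OF i k]] du[OF g cc[OF k j]] x, symmetric])
      show "(\<lambda>k. M.cv b (\<lambda>y. f (act M (c i k) y)) (\<lambda>y. g (act M (c k j) y)) x) \<in> {..<n} \<rightarrow> carrier (ground_space K)"
        using hom_closed[OF f xc] by (simp add: eq)
      show "f (act M (c i k) (M.coef b (\<lambda>y. g (act M (c k j) y)) x)) = M.cv b (\<lambda>y. f (act M (c i k) y)) (\<lambda>y. g (act M (c k j) y)) x"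
        if "k \<in> {..<n}" for k using eq[of k] that by simp
    qed simp
    also have "\<dots> = f (M.coef b g (act M (c i j) x))"
      using comatrix_cv(1)[OF f g x i j, of b] M.functional_coef[OF f g ac[OF i j x], of b] by simp
    finally show "f (M.coef b g (act M (c i j) x)) = f (\<Oplus>\<^bsub>M\<^esub> k\<in>{..<n}. act M (c i k) (M.coef b (\<lambda>y. g (act M (c k j) y)) x))" by (rule sym)
  qed
  let ?s = "\<lambda>i k. antipode H (c i k)"
  show "act M (c i j) (M.coef b g x) = (\<Oplus>\<^bsub>M\<^esub> k\<in>{..<n}. M.coef b (\<lambda>y. g (act M (?s i k) y)) (act M (c k j) x))"
  proof (rule M.functional_eqI)
    have sc: "?s i k \<in> carrier H" if "k < n" for k by (rule S[OF cc[OF i that]])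
    have xc: "M.coef b (\<lambda>y. g (act M (?s i k) y)) (act M (c k j) x) \<in> carrier M" if "k < n" for k
      by (rule M.coef_closed[OF du[OF g sc[OF that]] ac[OF that j x]])
    show "act M (c i j) (M.coef b g x) \<in> carrier M" by (rule ac[OF i j M.coef_closed[OF g x]])
    show "(\<Oplus>\<^bsub>M\<^esub> k\<in>{..<n}. M.coef b (\<lambda>y. g (act M (?s i k) y)) (act M (c k j) x)) \<in> carrier M"
      by (rule M.M.finsum_closed) (use xc in auto)
    fix f assume f: "f \<in> dual K M"
    \<comment> \<open>Moving the translated \<open>f\<close> into a coefficient on the other side
      turns each convolution into \<open>g\<close> at a translate of one vector \<open>y l\<close>,
      so that the antipode identity can be used inside \<open>g\<close>.\<close>
    define y where "y l = M.coef (\<not> b) (\<lambda>z. f (act M (c l j) z)) x" for l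
    have yc: "y l \<in> carrier M" if "l < n" for l unfolding y_def by (rule M.coef_closed[OF du[OF f cc[OF that j]] x])
    have gy: "q (y l) = M.cv b (\<lambda>z. f (act M (c l j) z)) q x" if "l < n" "q \<in> dual K M" for l q
      unfolding y_def by (rule M.functional_coef'[OF du[OF f cc[OF that(1) j]] that(2) x])
    have zc: "act M (?s i k) (act M (c k l) (y l)) \<in> carrier M" if "k < n" "l < n" for k l
      by (rule act_closed[OF sc[OF that(1)] ac[OF that yc[OF that(2)]]])
    have gc: "g z \<in> carrier K" if "z \<in> carrier M" for z using hom_closed[OF g that] by simp
    have "f (\<Oplus>\<^bsub>M\<^esub> k\<in>{..<n}. M.coef b (\<lambda>y. g (act M (?s i k) y)) (act M (c k j) x)) =
        (\<Oplus>\<^bsub>ground_space K\<^esub> k\<in>{..<n}. f (M.coef b (\<lambda>y. g (act M (?s i k) y)) (act M (c k j) x)))"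
      by (rule hom_finsum[OF f M.vs_self H.ground_vs]) (use xc in simp)
    also have "\<dots> = (\<Oplus>\<^bsub>ground_space K\<^esub> k\<in>{..<n}. \<Oplus>\<^bsub>ground_space K\<^esub> l\<in>{..<n}. g (act M (?s i k) (act M (c k l) (y l))))"
    proof (rule k.M.finsum_cong')
      fix k assume "k \<in> {..<n}"
      then have k: "k < n" by simp
      have "f (M.coef b (\<lambda>y. g (act M (?s i k) y)) (act M (c k j) x)) = M.cv b f (\<lambda>y. g (act M (?s i k) y)) (act M (c k j) x)"
        by (rule M.functional_coef[OF f du[OF g sc[OF k]] ac[OF k j x]])
      also have "\<dots> = (\<Oplus>\<^bsub>ground_space K\<^esub> l\<in>{..<n}. M.cv b (\<lambda>y. f (act M (c l j) y)) (\<lambda>y. g (act M (?s i k) (act M (c k l) y))) x)"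
        by (rule comatrix_cv(2)[OF f du[OF g sc[OF k]] x k j])
      also have "\<dots> = (\<Oplus>\<^bsub>ground_space K\<^esub> l\<in>{..<n}. g (act M (?s i k) (act M (c k l) (y l))))"
        by (rule k.M.finsum_cong') (use gy[OF _ du[OF du[OF g sc[OF k]] cc[OF k]]] gc zc[OF k] in auto)
      finally show "f (M.coef b (\<lambda>y. g (act M (?s i k) y)) (act M (c k j) x)) = (\<Oplus>\<^bsub>ground_space K\<^esub> l\<in>{..<n}. g (act M (?s i k) (act M (c k l) (y l))))" .
    qed (use gc zc in \<open>auto intro!: k.M.finsum_closed[simplified]\<close>)
    \<comment> \<open>Summing over \<open>k\<close> first lets \<open>comatrix_antipode\<close> act
      on \<open>y l\<close>.\<close>
    also have "\<dots> = (\<Oplus>\<^bsub>ground_space K\<^esub> l\<in>{..<n}. \<Oplus>\<^bsub>ground_space K\<^esub> k\<in>{..<n}. g (act M (?s i k) (act M (c k l) (y l))))"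
      by (rule k.finsum_swap) (use gc zc in simp)
    also have "\<dots> = (\<Oplus>\<^bsub>ground_space K\<^esub> l\<in>{..<n}. if i = l then g (y i) else \<zero>\<^bsub>ground_space K\<^esub>)"
    proof (rule k.M.finsum_cong')
      fix l assume "l \<in> {..<n}"
      then have l: "l < n" by simp
      have "(\<Oplus>\<^bsub>ground_space K\<^esub> k\<in>{..<n}. g (act M (?s i k) (act M (c k l) (y l)))) = g (\<Oplus>\<^bsub>M\<^esub> k\<in>{..<n}. act M (?s i k) (act M (c k l) (y l)))"
        by (rule hom_finsum[OF g M.vs_self H.ground_vs, symmetric]) (use zc l in simp)
      then show "(\<Oplus>\<^bsub>ground_space K\<^esub> k\<in>{..<n}. g (act M (?s i k) (act M (c k l) (y l)))) = (if i = l then g (y i) else \<zero>\<^bsub>ground_space K\<^esub>)"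
        unfolding comatrix_antipode[OF i l yc[OF l]] using hom_0[OF g M.vs_self H.ground_vs] by simp
    qed (use gc yc[OF i] k.M.zero_closed in auto)
    also have "\<dots> = g (y i)"
      by (rule k.M.finsum_singleton) (use i gc yc in auto)
    also have "\<dots> = f (act M (c i j) (M.coef b g x))"
      unfolding gy[OF i g] by (rule M.functional_coef[OF du[OF f cc[OF i j]] g x, symmetric])
    finally show "f (act M (c i j) (M.coef b g x)) = f (\<Oplus>\<^bsub>M\<^esub> k\<in>{..<n}. M.coef b (\<lambda>y. g (act M (?s i k) y)) (act M (c k j) x))" by (rule sym)
  qed
qed

end

text \<open>The counit of the right coefficient of \<open>e\<close> by \<open>g\<close> is
  \<open>g e\<close>, and the counit vanishes on \<open>M\<^sub>1\<close>, which contains the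
  intersection.\<close>

lemma core_Pinf:
  assumes E: "E \<subseteq> carrier M"
  shows "gr.MF.stable.core E (\<Inter>n. Mp n) \<subseteq> {\<zero>\<^bsub>M\<^esub>}"
proof
  fix e assume e: "e \<in> gr.MF.stable.core E (\<Inter>n. Mp n)"
  then have ec: "e \<in> carrier M" using E by (auto simp: gr.MF.stable.core_def)
  have "g e = \<zero>\<^bsub>K\<^esub>" if g: "g \<in> dual K M" for g
  proof -
    have "M.coef True g e \<in> Mp 1" using e g unfolding gr.MF.stable.core_def by blast
    then have "counit M (M.coef True g e) = \<zero>\<^bsub>K\<^esub>" by (rule counit_Mp)
    then show ?thesis
      using M.functional_coef[OF M.counit_hom g ec, of True] M.conv_counit(1)[OF g ec] by (simp add: M.cv_def)
  qed
  then show "e \<in> {\<zero>\<^bsub>M\<^esub>}" using M.functional_sep[OF ec] by simp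
qed

lemma subcoalgebra_coef:
  assumes E: "subcoalgebra K E M" and g: "g \<in> dual K M" and x: "x \<in> E"
  shows "M.coef b g x \<in> E"
proof -
  have Es: "subspace K E M" and m: "comult M x \<in> M.CC.T.span {pure_tensor K M M a b | a b. a \<in> E \<and> b \<in> E}"
    using E x unfolding subcoalgebra_def by auto
  note Ec = M.sub_carrier[OF Es]
  have gk: "g a \<in> carrier K" if "a \<in> E" for a using hom_closed[OF g Ec[OF that]] by simp
  have pc: "{pure_tensor K M M a b | a b. a \<in> E \<and> b \<in> E} \<subseteq> carrier (tensor K M M)" using M.CC.tp_closed Ec by auto
  have "contr_right K M g (comult M x) \<in> E"
    by (rule hom_span_subset[OF M.CC.contr_right_hom[OF g] M.CC.tensor_vs M.vs_self Es pc _ m])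
      (use M.CC.contr_right_pure[OF g] M.sub_smult[OF Es gk] Ec in auto)
  moreover have "contr_left K M g (comult M x) \<in> E"
    by (rule hom_span_subset[OF M.CC.contr_left_hom[OF g] M.CC.tensor_vs M.vs_self Es pc _ m])
      (use M.CC.contr_left_pure[OF g] M.sub_smult[OF Es gk] Ec in auto)
  ultimately show ?thesis by (simp add: M.coef_def)
qed

end

section \<open>From amenability of \<open>M\<close> to amenability of its associated graded module
  coalgebra\<close>

context module_coalgebra
begin

text \<open>The sum is spanned by a basis of \<open>E\<close> together with its finitely many
  products with elements of \<open>A\<close>.\<close>

lemma fin_span_act:
  assumes A: "finite A" "A \<subseteq> carrier H" and E: "M.fin {\<zero>\<^bsub>M\<^esub>} E"
  shows "subspace K (E <+>\<^bsub>M\<^esub> span_act K M (H.span A) E) M" "M.fin {\<zero>\<^bsub>M\<^esub>} (E <+>\<^bsub>M\<^esub> span_act K M (H.span A) E)"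
    "\<lbrakk>h \<in> H.span A; x \<in> E\<rbrakk> \<Longrightarrow> act M h x \<in> E <+>\<^bsub>M\<^esub> span_act K M (H.span A) E"
proof -
  obtain m where m: "M.rel {\<zero>\<^bsub>M\<^esub>} E m" using E unfolding M.fin_def by (rule exE)
  from M.rel_basis[OF m refl] obtain B where B: "finite B" "B \<subseteq> carrier M" "M.span B = E" by (elim exE conjE)
  have T: "subspace K (H.span A) H" by (rule H.span_is_subspace[OF A(2)])
  have Es: "subspace K E M" by (rule M.fin_sub(2)[OF E])
  have gen: "{act M f e | f e. f \<in> H.span A \<and> e \<in> E} \<subseteq> carrier M" using act_closed H.sub_carrier[OF T] M.sub_carrier[OF Es] by auto
  have TE: "subspace K (span_act K M (H.span A) E) M" unfolding span_act_def by (rule M.span_is_subspace[OF gen])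
  show S: "subspace K (E <+>\<^bsub>M\<^esub> span_act K M (H.span A) E) M" by (rule M.subspace_set_add[OF Es TE])
  show "act M h x \<in> E <+>\<^bsub>M\<^esub> span_act K M (H.span A) E" if "h \<in> H.span A" "x \<in> E"
  proof -
    have "act M h x \<in> span_act K M (H.span A) E" unfolding span_act_def by (rule M.span_incl[OF gen]) (use that in blast)
    then show ?thesis using M.set_add_upper2[OF Es TE] by auto
  qed
  let ?D = "B \<union> (\<lambda>(a, b). act M a b) ` (A \<times> B)"
  have D: "finite ?D" "?D \<subseteq> carrier M" using A B(1,2) act_closed by auto
  have Ds: "subspace K (M.span ?D) M" by (rule M.span_is_subspace[OF D(2)])
  have "E \<subseteq> M.span ?D" unfolding B(3)[symmetric] by (rule M.span_least[OF Ds]) (use M.span_incl[OF D(2)] in auto)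
  moreover have "span_act K M (H.span A) E \<subseteq> M.span ?D"
    unfolding span_act_def
  proof (rule M.span_least[OF Ds], rule subsetI)
    fix y assume "y \<in> {act M f e | f e. f \<in> H.span A \<and> e \<in> E}"
    then obtain f e where y: "y = act M f e" "f \<in> H.span A" "e \<in> E" by auto
    have "act M a e \<in> M.span ?D" if a: "a \<in> A" for a
    proof (rule hom_span_subset[OF bilin_hom2[OF act_bilin] M.vs_self M.vs_self Ds B(2) _ y(3)[folded B(3)]])
      show "a \<in> carrier H" using a A(2) by auto
      show "act M a b \<in> M.span ?D" if "b \<in> B" for b by (rule M.span_incl[OF D(2)]) (use a that in auto)
    qed
    then have "act M f e \<in> M.span ?D"
      by (intro hom_span_subset[OF bilin_hom1[OF act_bilin M.sub_carrier[OF Es y(3)]] H.vs_self M.vs_self Ds A(2) _ y(2)])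
    then show "y \<in> M.span ?D" using y(1) by simp
  qed
  ultimately have sub: "E <+>\<^bsub>M\<^esub> span_act K M (H.span A) E \<subseteq> M.span ?D" by (rule M.set_add_least[OF Ds])
  show "M.fin {\<zero>\<^bsub>M\<^esub>} (E <+>\<^bsub>M\<^esub> span_act K M (H.span A) E)"
    using M.rdim_split(1)[OF M.fin_span[OF D] S _ sub] M.sub_0[OF S] by simp
qed

text \<open>Amenability is applied to the span of all entries of comatrices whose spans contain the
  elements of \<open>X\<close>, not to the span of \<open>X\<close>: optimal subspaces are compared
  by whole comatrices.\<close>

lemma amenable_pair:
  assumes coc: "cocommutative K H" and am: "amenable K H M"
    and X: "finite X" "X \<subseteq> carrier H" and \<delta>: "(0::real) < \<delta>"
  shows "\<exists>C C'. C \<in> gr.MF.stable.lat \<and> C' \<in> gr.MF.stable.lat \<and>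
    real (M.rdim (\<Inter>n. Mp n) C') < (1 + 2 * \<delta>) * real (M.rdim (\<Inter>n. Mp n) C) \<and> (\<forall>h\<in>X. \<forall>x\<in>C. act M h x \<in> C')"
proof -
  have "\<forall>h\<in>carrier H. \<exists>p. H.comatrix (fst p) (snd p) \<and> h \<in> H.span {snd p i j | i j. i < fst p \<and> j < fst p}"
    using H.comatrix_ex by (simp add: split_paired_Ex)
  from bchoice[OF this] obtain p where p: "\<forall>h\<in>carrier H. H.comatrix (fst (p h)) (snd (p h)) \<and>
    h \<in> H.span {snd (p h) i j | i j. i < fst (p h) \<and> j < fst (p h)}" by (rule exE)
  define N where "N h = fst (p h)" for h
  define c where "c h = snd (p h)" for h
  have cm: "H.comatrix (N h) (c h)" and span_c: "h \<in> H.span {c h i j | i j. i < N h \<and> j < N h}" if "h \<in> carrier H" for h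
    using p that by (simp_all add: N_def c_def)
  have cc: "c h i j \<in> carrier H" if "h \<in> carrier H" "i < N h" "j < N h" for h i j
    using cm[OF that(1)] that(2,3) by (simp add: H.comatrix_def)
  define A where "A = (\<Union>h\<in>X. (\<lambda>(i, j). c h i j) ` ({..<N h} \<times> {..<N h}))"
  have A: "finite A" unfolding A_def by (rule finite_UN_I[OF X(1)]) simp
  have A': "A \<subseteq> carrier H" using X(2) cc by (auto simp: A_def)
  note A = A A'
  have T: "subspace K (H.span A) H" by (rule H.span_is_subspace[OF A(2)])
  have Tf: "vectorspace.fin_dim K (H\<lparr>carrier := H.span A\<rparr>)" using H.fin_dim_subspace(1)[OF T] H.fin_span[OF A] by simp
  from am[unfolded amenable_def, rule_format, OF conjI[OF T conjI[OF Tf \<delta>]]]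
  obtain E where E: "subcoalgebra K E M" and Ef: "vectorspace.fin_dim K (M\<lparr>carrier := E\<rparr>)"
    and Ed: "real (vectorspace.dim K (quotient_space (M\<lparr>carrier := E <+>\<^bsub>M\<^esub> span_act K M (H.span A) E\<rparr>) E)) < \<delta> * real (vectorspace.dim K (M\<lparr>carrier := E\<rparr>))"
    by (elim exE conjE)
  have Es: "subspace K E M" using E by (simp add: subcoalgebra_def)
  have Efin: "M.fin {\<zero>\<^bsub>M\<^esub>} E" using M.fin_dim_subspace(1)[OF Es] Ef by simp
  let ?E' = "E <+>\<^bsub>M\<^esub> span_act K M (H.span A) E"
  note E' = fin_span_act[OF A Efin]
  have gen: "{act M f e | f e. f \<in> H.span A \<and> e \<in> E} \<subseteq> carrier M" using act_closed H.sub_carrier[OF T] M.sub_carrier[OF Es] by auto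
  have EE': "E \<subseteq> ?E'"
    by (rule M.set_add_upper1[OF Es]) (unfold span_act_def, rule M.span_is_subspace[OF gen])
  have "{\<zero>\<^bsub>M\<^esub>} \<subseteq> E" using M.sub_0[OF Es] by simp
  note sp = M.rdim_split[OF E'(2) Es this EE']
  have "real (M.rdim E ?E') < \<delta> * real (M.rdim {\<zero>\<^bsub>M\<^esub>} E)"
    using Ed M.dim_quotient[OF E'(1) Es EE' sp(2)] M.fin_dim_subspace(2)[OF Es Efin] by simp
  \<comment> \<open>The strict inequality excludes \<open>E = 0\<close>.\<close>
  moreover from this have "0 < M.rdim {\<zero>\<^bsub>M\<^esub>} E" by (cases "M.rdim {\<zero>\<^bsub>M\<^esub>} E") auto
  ultimately have l: "0 < M.rdim {\<zero>\<^bsub>M\<^esub>} E" "real (M.rdim {\<zero>\<^bsub>M\<^esub>} ?E') < (1 + \<delta>) * real (M.rdim {\<zero>\<^bsub>M\<^esub>} E)"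
    using sp(3) by (simp_all add: algebra_simps)
  have "\<exists>C C'. C \<in> gr.MF.stable.lat \<and> C' \<in> gr.MF.stable.lat \<and> real (M.rdim (\<Inter>n. Mp n) C') < (1 + 2 * \<delta>) * real (M.rdim (\<Inter>n. Mp n) C) \<and>
    (\<forall>f u s. gr.MF.stable.comatrix_action E ?E' f u s \<longrightarrow> (\<forall>i<f. \<forall>l<f. \<forall>x\<in>C. u i l x \<in> C'))"
  proof (rule gr.MF.stable.optimal_pair[OF Efin l(1) _ _ core_Pinf E'(2) l(2) \<delta>])
    show "M.coef True g x \<in> E" if "g \<in> dual K M" "x \<in> E" for g x by (rule subcoalgebra_coef[OF E that])
    show "M.coef b g x \<in> E" if "g \<in> (\<Union>n. gr.MF.kills n)" "x \<in> E" for b g x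
      by (rule subcoalgebra_coef[OF E _ that(2)]) (use that(1) gr.MF.killsD(1) in auto)
    show "E \<subseteq> carrier M" using M.sub_carrier[OF Es] by auto
  qed
  then obtain C C' where C: "C \<in> gr.MF.stable.lat" "C' \<in> gr.MF.stable.lat" "real (M.rdim (\<Inter>n. Mp n) C') < (1 + 2 * \<delta>) * real (M.rdim (\<Inter>n. Mp n) C)"
    and act_C: "\<forall>f u s. gr.MF.stable.comatrix_action E ?E' f u s \<longrightarrow> (\<forall>i<f. \<forall>l<f. \<forall>x\<in>C. u i l x \<in> C')" by (elim exE conjE)
  note Cs = gr.MF.stable.lat_sub(1)[OF C(1)] and C's = gr.MF.stable.lat_sub(1)[OF C(2)]
  have "act M h x \<in> C'" if h: "h \<in> X" and x: "x \<in> C" for h x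
  proof -
    have hc: "h \<in> carrier H" using h X(2) by auto
    have ca: "gr.MF.stable.comatrix_action E ?E' (N h) (\<lambda>i j. act M (c h i j)) (\<lambda>i j. act M (antipode H (c h i j)))"
    proof (rule comatrix_is_action[OF coc cm[OF hc]])
      fix i j y assume ij: "i < N h" "j < N h" and y: "y \<in> E"
      have "c h i j \<in> H.span A" by (rule H.span_incl[OF A(2)]) (use h ij in \<open>auto simp: A_def\<close>)
      then show "act M (c h i j) y \<in> ?E'" by (rule E'(3)[OF _ y])
    qed
    have sub: "{c h i j | i j. i < N h \<and> j < N h} \<subseteq> carrier H" using cc[OF hc] by auto
    show "act M h x \<in> C'"
      by (rule hom_span_subset[OF bilin_hom1[OF act_bilin M.sub_carrier[OF Cs x]] H.vs_self M.vs_self C's sub _ span_c[OF hc]])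
        (use act_C[rule_format, OF ca _ _ x] in auto)
  qed
  then show ?thesis using C by (intro exI[of _ C] exI[of _ C']) simp
qed

text \<open>The subcoalgebra is \<open>gr_sub C\<close>. Elements of \<open>F\<close> have
  representatives built from the finite set \<open>X\<close>, which sends \<open>C\<close> into
  \<open>C'\<close>, so products of \<open>F\<close> with \<open>gr_sub C\<close> stay in
  \<open>gr_sub C'\<close>. Taking \<open>\<epsilon> / 2\<close> for \<open>\<delta>\<close> turns
  the factor \<open>1 + 2 * \<delta>\<close> into \<open>1 + \<epsilon>\<close>.\<close>

lemma gr_amenable:
  assumes coc: "cocommutative K H" and am: "amenable K H M"
  shows "amenable K (gr_hopf K H) (gr_modcoalg K H M)"
  unfolding amenable_def
proof (intro allI impI, elim conjE)
  let ?D = "gr_hopf K H" and ?N = "gr_modcoalg K H M" and ?a = "gr_bilinear M Mp (act M)"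
  note s = H.gr_hopf_simps and n = gr_modcoalg_simps
  interpret D: hopf_algebra K ?D by (rule H.gr_hopf_algebra)
  interpret N: coalgebra K ?N by (rule gr.MF.gr_coalgebra) (simp_all add: n)
  have bl: "bilin K ?D ?N ?N ?a"
    using gr.act_gr_bilin bilin_record_cong[of ?D gr.GH ?N gr.GM ?N gr.GM K] by (simp add: s n)
  have tN: "tensor K ?N ?N = tensor K gr.GM gr.GM" "pure_tensor K ?N ?N = pure_tensor K gr.GM gr.GM" by (rule tensor_cong, simp_all add: n)+
  have subN: "subspace K W ?N \<longleftrightarrow> subspace K W gr.GM" for W
    unfolding N.subspace_iff gr.MF.G.subspace_iff by (simp add: n)
  have idN: "(\<lambda>x. x) \<in> module_hom K ?N gr.GM" by (rule homI) (simp_all add: n)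
  have finN: "N.fin {\<zero>\<^bsub>?N\<^esub>} W \<longleftrightarrow> gr.MF.G.fin {\<zero>\<^bsub>gr.GM\<^esub>} W" "N.fin {\<zero>\<^bsub>?N\<^esub>} W \<Longrightarrow> N.rdim {\<zero>\<^bsub>?N\<^esub>} W = gr.MF.G.rdim {\<zero>\<^bsub>gr.GM\<^esub>} W"
    if W: "subspace K W ?N" for W
  proof -
    have e: "{\<zero>\<^bsub>?N\<^esub>} = {x \<in> W. x \<in> {\<zero>\<^bsub>gr.GM\<^esub>}}" using N.sub_0[OF W] by (auto simp: n)
    have z: "{\<zero>\<^bsub>gr.GM\<^esub>} <+>\<^bsub>gr.GM\<^esub> (\<lambda>x. x) ` W = W" using gr.MF.G.set_add_0 W subN by simp
    show "N.fin {\<zero>\<^bsub>?N\<^esub>} W \<longleftrightarrow> gr.MF.G.fin {\<zero>\<^bsub>gr.GM\<^esub>} W" "N.fin {\<zero>\<^bsub>?N\<^esub>} W \<Longrightarrow> N.rdim {\<zero>\<^bsub>?N\<^esub>} W = gr.MF.G.rdim {\<zero>\<^bsub>gr.GM\<^esub>} W"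
      using fin_image[OF idN N.vs_self gr.MF.G.vs_self W gr.MF.G.subspace_zero e] z by simp_all
  qed
  fix F and \<epsilon> :: real assume F: "subspace K F ?D" and Ff: "vectorspace.fin_dim K (?D\<lparr>carrier := F\<rparr>)" and \<epsilon>: "0 < \<epsilon>"
  have "D.fin {\<zero>\<^bsub>?D\<^esub>} F" using D.fin_dim_subspace(1)[OF F] Ff by simp
  then obtain m where m: "D.rel {\<zero>\<^bsub>?D\<^esub>} F m" unfolding D.fin_def by (rule exE)
  from D.rel_basis[OF m refl] obtain B where B: "finite B" "B \<subseteq> carrier ?D" "D.span B = F" by (elim exE conjE)
  have BG: "p \<in> carrier gr.GH" if "p \<in> B" for p using B(2) that s(1) by auto
  let ?supp = "\<lambda>p. {k. p k \<noteq> Hp (Suc k)}"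
  \<comment> \<open>The unit is included to force \<open>C \<subseteq> C'\<close>.\<close>
  define X where "X = insert \<one>\<^bsub>H\<^esub> (\<Union>p\<in>B. gr.HF.rep p ` ?supp p)"
  have X: "finite X" "X \<subseteq> carrier H"
    using B(1) BG gr.HF.G_carrier gr.HF.P_carrier[OF gr.HF.rep_P] by (auto simp: X_def)
  have \<delta>: "0 < \<epsilon> / 2" using \<epsilon> by simp
  from amenable_pair[OF coc am X \<delta>] obtain C C' where C: "C \<in> gr.MF.stable.lat" "C' \<in> gr.MF.stable.lat"
    and less: "real (M.rdim (\<Inter>n. Mp n) C') < (1 + 2 * (\<epsilon> / 2)) * real (M.rdim (\<Inter>n. Mp n) C)"
    and act_C': "\<forall>h\<in>X. \<forall>x\<in>C. act M h x \<in> C'" by (elim exE conjE)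
  have act_C: "act M h x \<in> C'" if "h \<in> X" "x \<in> C" for h x using act_C' that by simp
  note Cs = gr.MF.stable.lat_sub[OF C(1)] and C's = gr.MF.stable.lat_sub[OF C(2)]
  let ?E = "gr.MF.gr_sub C" and ?E' = "gr.MF.gr_sub C'"
  have Es: "subspace K ?E ?N" and E's: "subspace K ?E' ?N"
    unfolding subN by (rule gr.MF.gr_sub_subspace, rule Cs(1) C's(1))+
  have EG: "p \<in> carrier gr.GM" if "p \<in> ?E" for p using that by (simp add: gr.MF.gr_sub_def)
  note fE = gr.MF.fin_gr_sub[OF Cs(3)] and fE' = gr.MF.fin_gr_sub[OF C's(3)]
  have fN: "N.fin {\<zero>\<^bsub>?N\<^esub>} ?E" "N.rdim {\<zero>\<^bsub>?N\<^esub>} ?E = M.rdim (\<Inter>n. Mp n) C"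
    and fN': "N.fin {\<zero>\<^bsub>?N\<^esub>} ?E'" "N.rdim {\<zero>\<^bsub>?N\<^esub>} ?E' = M.rdim (\<Inter>n. Mp n) C'"
    using finN[OF Es] finN[OF E's] fE fE' by simp_all
  have CC': "C \<subseteq> C'"
  proof
    fix x assume x: "x \<in> C"
    have "act M \<one>\<^bsub>H\<^esub> x \<in> C'" by (rule act_C[OF _ x]) (simp add: X_def)
    then show "x \<in> C'" using act_one[OF M.sub_carrier[OF Cs(1) x]] by simp
  qed
  then have EE': "?E \<subseteq> ?E'" unfolding gr.MF.gr_sub_def by blast
  have gen: "?a p q \<in> ?E'" if p: "p \<in> B" and q: "q \<in> ?E" for p q
    unfolding gr.MF.gr_sub_def
  proof (intro CollectI conjI allI)
    note pG = BG[OF p] and qG = EG[OF q]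
    show "?a p q \<in> carrier gr.GM" by (rule gr.act_gr_closed[OF pG qG])
    fix k
    \<comment> \<open>Outside the support the representative is taken to be zero, since
      \<open>X\<close> collects \<open>rep p i\<close> over the finite support only.\<close>
    define x where "x i = (if i \<in> ?supp p then gr.HF.rep p i else \<zero>\<^bsub>H\<^esub>)" for i
    have xx: "x i \<in> p i" for i using gr.HF.rep_in[OF pG] H.sub_0[OF H.Hp_subspace, of "Suc i"] by (auto simp: x_def simp del: aug_power.simps)
    have "\<exists>y\<in>C. y \<in> q i" for i using q by (simp add: gr.MF.gr_sub_def)
    then obtain y where y: "\<And>i. y i \<in> C" "\<And>i. y i \<in> q i" by metis
    note v = gr.act_gr_val[OF pG qG xx y(2), of k]
    have "act M (x i) (y j) \<in> C'" for i j
    proof (cases "i \<in> ?supp p")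
      case True
      then have "x i \<in> X" using p by (auto simp: x_def X_def)
      then show ?thesis by (rule act_C[OF _ y(1)])
    next
      case False
      then show ?thesis
        using hom_0[OF bilin_hom1[OF act_bilin M.sub_carrier[OF Cs(1) y(1)]] H.vs_self M.vs_self] M.sub_0[OF C's(1)] by (simp add: x_def)
    qed
    then have "(\<Oplus>\<^bsub>M\<^esub> i\<in>{..k}. act M (x i) (y (k - i))) \<in> C'" by (intro M.sub_finsum[OF C's(1)])
    moreover have "(\<Oplus>\<^bsub>M\<^esub> i\<in>{..k}. act M (x i) (y (k - i))) \<in> ?a p q k"
      unfolding v(1) by (rule gr.MF.P_coset_self[OF Mp_carrier[OF v(2)]])
    ultimately show "\<exists>z\<in>C'. z \<in> ?a p q k" by blast
  qed
  have FE: "span_act K ?N F ?E \<subseteq> ?E'"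
    unfolding span_act_def
  proof (rule N.span_least[OF E's], rule subsetI)
    fix y assume "y \<in> {act ?N f e | f e. f \<in> F \<and> e \<in> ?E}"
    then obtain p q where y: "y = ?a p q" "p \<in> F" "q \<in> ?E" by (auto simp: n)
    show "y \<in> ?E'"
      unfolding y(1)
      by (rule hom_span_subset[OF bilin_hom1[OF bl N.sub_carrier[OF Es y(3)]] D.vs_self N.vs_self E's B(2) _ y(2)[folded B(3)]])
        (rule gen[OF _ y(3)])
  qed
  have gc: "{act ?N f e | f e. f \<in> F \<and> e \<in> ?E} \<subseteq> carrier ?N"
    using bilin_closed[OF bl D.sub_carrier[OF F] N.sub_carrier[OF Es]] by (auto simp: n)
  have FEs: "subspace K (span_act K ?N F ?E) ?N" unfolding span_act_def by (rule N.span_is_subspace[OF gc])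
  let ?W = "?E <+>\<^bsub>?N\<^esub> span_act K ?N F ?E"
  have W: "subspace K ?W ?N" "?E \<subseteq> ?W" "?W \<subseteq> ?E'"
    using N.subspace_set_add[OF Es FEs] N.set_add_upper1[OF Es FEs] N.set_add_least[OF E's EE' FE] by simp_all
  have zE: "{\<zero>\<^bsub>?N\<^esub>} \<subseteq> ?E" using N.sub_0[OF Es] by simp
  note s1 = N.rdim_split[OF fN'(1) Es zE EE']
  note s2 = N.rdim_split[OF s1(2) W]
  have "real (N.rdim ?E ?W) < \<epsilon> * real (N.rdim {\<zero>\<^bsub>?N\<^esub>} ?E)"
    using less s1(3) s2(3) unfolding fN(2)[symmetric] fN'(2)[symmetric] by (simp add: algebra_simps)
  then have dim: "real (vectorspace.dim K (quotient_space (?N\<lparr>carrier := ?W\<rparr>) ?E)) < \<epsilon> * real (vectorspace.dim K (?N\<lparr>carrier := ?E\<rparr>))"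
    using N.dim_quotient[OF W(1) Es W(2) s2(1)] N.fin_dim_subspace(2)[OF Es fN(1)] by simp
  have sc: "subcoalgebra K ?E ?N"
    unfolding subcoalgebra_def tN n(5) using Es gr.MF.gr_sub_comult[OF C(1)] by auto
  show "\<exists>E. subcoalgebra K E ?N \<and> vectorspace.fin_dim K (?N\<lparr>carrier := E\<rparr>) \<and>
      real (vectorspace.dim K (quotient_space (?N\<lparr>carrier := E <+>\<^bsub>?N\<^esub> span_act K ?N F E\<rparr>) E)) < \<epsilon> * real (vectorspace.dim K (?N\<lparr>carrier := E\<rparr>))"
    using sc dim N.fin_dim_subspace(1)[OF Es] fN(1) by blast
qed

end

theorem theorem10:
  fixes K :: "('k, 'y) ring_scheme"
    and H :: "('k, 'h) hopf"
    and M :: "('k, 'h, 'm) modcoalg"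
  assumes "field K"
    and "hopf_algebra K H"
    and "cocommutative K H"
    and "module_coalgebra K H M"
    and "amenable K H M"
  shows "module_coalgebra K (gr_hopf K H) (gr_modcoalg K H M) \<and>
    amenable K (gr_hopf K H) (gr_modcoalg K H M)"
proof -
  interpret module_coalgebra K H M by (rule assms(4))
  show ?thesis using gr_module_coalgebra gr_amenable[OF assms(3,5)] by blast
qed

end
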